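(* Let $f\in L^2(\Omega)$ and $F(\boldsymbol v):=(f,v)$ for $\boldsymbol v=(v,\boldsymbol Q)\in V$. Let $U_h\subset U$, $V_h\subset V$ be finite-dimensional subspaces such that a Fortin operator exists, i.e., there is a linear operator $\Pi_F:V\to V_h$ and a constant $C_F>0$ with $$\|\Pi_F\boldsymbol v\|_V\le C_F\|\boldsymbol v\|_V\quad\text{and}\quad b(\boldsymbol u_h,\Pi_F\boldsymbol v)=b(\boldsymbol u_h,\boldsymbol v)\qquad\forall\,\boldsymbol u_h\in U_h,\ \boldsymbol v\in V.$$ Then the problem: find $\boldsymbol u_h\in U_h$ such that $$b(\boldsymbol u_h,\Theta_h\boldsymbol w_h)=F(\Theta_h\boldsymbol w_h)\qquad\forall\,\boldsymbol w_h\in U_h$$ admits a unique solution. Moreover, let $\boldsymbol u\in U$ denote the solution of $b(\boldsymbol u,\boldsymbol v)=F(\boldsymbol v)$ for all $\boldsymbol v\in V$ and let $\boldsymbol u_h\in U_h$ be the solution of the discrete problem. Then $$\|\boldsymbol u-\boldsymbol u_h\|_U\le C_{\rm qopt}\,C_F\min_{\boldsymbol w_h\in U_h}\|\boldsymbol u-\boldsymbol w_h\|_U,$$ where $C_{\rm qopt}>0$ depends only on $\Omega$ and $A$.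
   Context: Setting. Let $d\in\{2,3\}$, let $\Omega\subset\mathbb R^d$ be a bounded convex polytopal domain, and let $A:\Omega\to\mathbb R^{d\times d}_{\rm sym}$ be measurable with $0<\operatorname{ess\,inf}_{\Omega}\lambda_{\min}(A(x))\le\operatorname{ess\,sup}_\Omega\lambda_{\max}(A(x))<\infty$, satisfying the Cordes condition: there is $0<\varepsilon\le1$ with $\big(\sum_{j,k}A_{jk}^2\big)/\big(\sum_jA_{jj}\big)^2\le\frac1{d-1+\varepsilon}$ a.e. in $\Omega$. Notation. $(\cdot,\cdot)_\omega$, $\|\cdot\|_\omega$ are the $L^2(\omega)$ inner product and norm (also for matrix-valued functions, with the Frobenius product $:$); the index is dropped for $\omega=\Omega$. $\boldsymbol L^2_{\rm sym}(\omega)$ is the space of symmetric $d\times d$ matrix functions with $L^2(\omega)$ entries. $\|v\|_{H^k(\omega)}^2=\|v\|_\omega^2+\|D^kv\|_\omega^2$. $X:=H^2(\Omega)\cap H^1_0(\Omega)$. $\mathrm{div}\,\mathbf{Div}$ is the iterated divergence (row-wise divergence followed by divergence), the formal adjoint of the Hessian $D^2$. $\boldsymbol H(\mathrm{div}\,\mathbf{Div};\omega)$ is the completion of smooth (up to the boundary) symmetric matrix functions on $\overline\omega$ in the norm $(\|\cdot\|_\omega^2+\|\mathrm{div}\,\mathbf{Div}(\cdot)\|_\omega^2)^{1/2}$. Let $\mathcal T$ be a finite partition of $\Omega$ into disjoint open Lipschitz subdomains $T$ of positive measure with $\bigcup_{T\in\mathcal T}\overline T=\overline\Omega$. $\boldsymbol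 H(\mathrm{div}\,\mathbf{Div};\mathcal T):=\prod_{T\in\mathcal T}\boldsymbol H(\mathrm{div}\,\mathbf{Div};T)$ with the product norm, identified with a subspace of $\boldsymbol L^2_{\rm sym}(\Omega)$; $(u,\mathrm{div}\,\mathbf{Div}\,\boldsymbol Q)_{\mathcal T}:=\sum_{T}(u,\mathrm{div}\,\mathbf{Div}\,\boldsymbol Q)_T$. Traces. For $u\in H^2(\Omega)$, the functional $\mathrm{tr}^2_{\mathcal T}u\in\boldsymbol H(\mathrm{div}\,\mathbf{Div};\mathcal T)'$ is $\langle\mathrm{tr}^2_{\mathcal T}u,\boldsymbol Q\rangle_{\mathcal S}:=\sum_{T\in\mathcal T}\big[(\mathrm{div}\,\mathbf{Div}\,\boldsymbol Q,u)_T-(\boldsymbol Q,D^2u)_T\big]$. Set $\widehat U:=\mathrm{tr}^2_{\mathcal T}(X)$ with norm $\|\widehat{\boldsymbol u}\|_{3/2,1/2,\mathcal S}:=\inf\{\|u\|_{H^2(\Omega)}:\mathrm{tr}^2_{\mathcal T}u=\widehat{\boldsymbol u}\}$. Spaces and form. $U:=L^2(\Omega)\times\boldsymbol L^2_{\rm sym}(\Omega)\times\widehat U$ with $\|(u,\boldsymbol M,\widehat{\boldsymbol u})\|_U^2:=\|u\|^2+\|\boldsymbol M\|^2+\|\widehat{\boldsymbol u}\|_{3/2,1/2,\mathcal S}^2$; $V:=L^2(\Omega)\times\boldsymbol H(\mathrm{div}\,\mathbf{Div};\mathcal T)$ with $\|(v,\boldsymbol Q)\|_V^2:=\|v\|^2+\|\boldsymbol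 Q\|_{\boldsymbol H(\mathrm{div}\,\mathbf{Div};\mathcal T)}^2$ and the inner product $(\cdot,\cdot)_V$ inducing this norm. For $\boldsymbol u=(u,\boldsymbol M,\widehat{\boldsymbol u})\in U$ and $\boldsymbol v=(v,\boldsymbol Q)\in V$, $$b(\boldsymbol u,\boldsymbol v):=-(u,\mathrm{div}\,\mathbf{Div}\,\boldsymbol Q)_{\mathcal T}+(\boldsymbol M,Av+\boldsymbol Q)+\langle\widehat{\boldsymbol u},\boldsymbol Q\rangle_{\mathcal S}.$$ The discrete trial-to-test operator $\Theta_h:U_h\to V_h$ is defined by $(\Theta_h\boldsymbol u_h,\boldsymbol v_h)_V=b(\boldsymbol u_h,\boldsymbol v_h)$ for all $\boldsymbol v_h\in V_h$. For every $f\in L^2(\Omega)$ the problem $b(\boldsymbol u,\boldsymbol v)=(f,v)$ for all $\boldsymbol v=(v,\boldsymbol Q)\in V$ has a unique solution $\boldsymbol u\in U$.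
   Formalization: The error estimate is stated only for U_h ≠ {0}: for U_h = {0}, Π_F = 0 is a Fortin operator with every C_F > 0, so the estimate fails for f ≠ 0 and small C_F; unique solvability of the discrete problem is stated for all U_h. *)

theory Defs
  imports
    "HOL-Analysis.Analysis"
    "HOL-Probability.Essential_Supremum"
    "HOL-Library.Function_Algebras"
begin

section \<open>The Hilbert space of square integrable functions\<close>

definition sqint :: "('a::euclidean_space \<Rightarrow> 'b::euclidean_space) \<Rightarrow> bool" where
  "sqint f \<longleftrightarrow> f \<in> borel_measurable lebesgue \<and> integrable lebesgue (\<lambda>x. (norm (f x))\<^sup>2)"

lemma sqint_zero: "sqint (\<lambda>x. 0)"
  by (simp add: sqint_def)

lemma sqint_scaleR: "sqint f \<Longrightarrow> sqint (\<lambda>x. c *\<^sub>R f x)"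
  by (auto simp: sqint_def power_mult_distrib)

lemma sqint_uminus: "sqint f \<Longrightarrow> sqint (\<lambda>x. - f x)"
  using sqint_scaleR[of f "-1"] by simp

lemma sqint_add:
  fixes f g :: "'a::euclidean_space \<Rightarrow> 'b::euclidean_space"
  assumes "sqint f" "sqint g" shows "sqint (\<lambda>x. f x + g x)"
proof -
  have m: "(\<lambda>x. f x + g x) \<in> borel_measurable lebesgue"
    using assms by (auto simp: sqint_def)
  have i: "integrable lebesgue (\<lambda>x. 2 * (norm (f x))\<^sup>2 + 2 * (norm (g x))\<^sup>2)"
    using assms by (auto simp: sqint_def)
  have b: "(norm (a + b))\<^sup>2 \<le> 2 * (norm a)\<^sup>2 + 2 * (norm b)\<^sup>2" for a b :: 'b
  proof -
    have "(norm (a + b))\<^sup>2 \<le> (norm a + norm b)\<^sup>2"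
      by (simp add: norm_triangle_ineq power_mono)
    also have "\<dots> \<le> 2 * (norm a)\<^sup>2 + 2 * (norm b)\<^sup>2"
      using sum_squares_bound[of "norm a" "norm b"] by (simp add: power2_sum)
    finally show ?thesis .
  qed
  have "integrable lebesgue (\<lambda>x. (norm (f x + g x))\<^sup>2)"
    by (rule Bochner_Integration.integrable_bound[OF i]) (use m b in auto)
  then show ?thesis using m by (simp add: sqint_def)
qed

lemma sqint_inner:
  fixes f g :: "'a::euclidean_space \<Rightarrow> 'b::euclidean_space"
  assumes "sqint f" "sqint g" shows "integrable lebesgue (\<lambda>x. f x \<bullet> g x)"
proof -
  have m: "(\<lambda>x. f x \<bullet> g x) \<in> borel_measurable lebesgue"
    using assms by (auto simp: sqint_def)
  have i: "integrable lebesgue (\<lambda>x. (norm (f x))\<^sup>2 + (norm (g x))\<^sup>2)"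
    using assms by (auto simp: sqint_def)
  have b: "\<bar>a \<bullet> b\<bar> \<le> (norm a)\<^sup>2 + (norm b)\<^sup>2" for a b :: 'b
  proof -
    have "\<bar>a \<bullet> b\<bar> \<le> norm a * norm b" by (rule Cauchy_Schwarz_ineq2)
    moreover have "2 * norm a * norm b \<le> (norm a)\<^sup>2 + (norm b)\<^sup>2"
      by (rule sum_squares_bound)
    moreover have "0 \<le> norm a * norm b" by simp
    ultimately show ?thesis by linarith
  qed
  show ?thesis
    by (rule Bochner_Integration.integrable_bound[OF i]) (use m b in auto)
qed

definition l2rel :: "('a::euclidean_space \<Rightarrow> 'b::euclidean_space) \<Rightarrow> ('a \<Rightarrow> 'b) \<Rightarrow> bool" where
  "l2rel f g \<longleftrightarrow> sqint f \<and> sqint g \<and> (AE x in lebesgue. f x = g x)"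

lemma part_equivp_l2rel: "part_equivp l2rel"
proof (rule part_equivpI)
  show "\<exists>f. l2rel f f" by (rule exI[of _ "\<lambda>x. 0"]) (simp add: l2rel_def sqint_zero)
  show "symp l2rel" by (rule sympI) (auto simp: l2rel_def elim: eventually_mono)
  show "transp l2rel"
    by (rule transpI) (auto simp: l2rel_def elim: eventually_elim2)
qed

quotient_type (overloaded) ('a, 'b) l2 = "'a::euclidean_space \<Rightarrow> 'b::euclidean_space" / partial: l2rel
  by (rule part_equivp_l2rel)

instantiation l2 :: (euclidean_space, euclidean_space) real_vector
begin

lift_definition zero_l2 :: "('a, 'b) l2" is "\<lambda>x. 0"
  by (simp add: l2rel_def sqint_zero)

lift_definition plus_l2 :: "('a, 'b) l2 \<Rightarrow> ('a, 'b) l2 \<Rightarrow> ('a, 'b) l2" is "\<lambda>f g x. f x + g x"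
  by (auto simp: l2rel_def intro: sqint_add elim: eventually_elim2)

lift_definition uminus_l2 :: "('a, 'b) l2 \<Rightarrow> ('a, 'b) l2" is "\<lambda>f x. - f x"
  by (auto simp: l2rel_def intro: sqint_uminus)

definition minus_l2 :: "('a, 'b) l2 \<Rightarrow> ('a, 'b) l2 \<Rightarrow> ('a, 'b) l2" where
  "minus_l2 f g = f + (- g)"

lift_definition scaleR_l2 :: "real \<Rightarrow> ('a, 'b) l2 \<Rightarrow> ('a, 'b) l2" is "\<lambda>c f x. c *\<^sub>R f x"
  by (auto simp: l2rel_def intro: sqint_scaleR)

instance
proof
  fix f g h :: "('a, 'b) l2" and a b :: real
  show "f + g + h = f + (g + h)"
    by transfer (auto simp: l2rel_def add.assoc intro!: sqint_add)
  show "f + g = g + f"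
    by transfer (auto simp: l2rel_def add.commute intro!: sqint_add)
  show "0 + f = f"
    by transfer (auto simp: l2rel_def)
  show "- f + f = 0"
    by transfer (auto simp: l2rel_def sqint_zero)
  show "f - g = f + - g"
    by (simp add: minus_l2_def)
  show "a *\<^sub>R (f + g) = a *\<^sub>R f + a *\<^sub>R g"
    by transfer (auto simp: l2rel_def scaleR_add_right intro!: sqint_add sqint_scaleR)
  show "(a + b) *\<^sub>R f = a *\<^sub>R f + b *\<^sub>R f"
    by transfer (auto simp: l2rel_def scaleR_add_left intro!: sqint_add sqint_scaleR)
  show "a *\<^sub>R b *\<^sub>R f = (a * b) *\<^sub>R f"
    by transfer (auto simp: l2rel_def intro!: sqint_scaleR)
  show "1 *\<^sub>R f = f"
    by transfer (auto simp: l2rel_def)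
qed

end

instantiation l2 :: (euclidean_space, euclidean_space) real_inner
begin

lift_definition inner_l2 :: "('a, 'b) l2 \<Rightarrow> ('a, 'b) l2 \<Rightarrow> real"
  is "\<lambda>f g. \<integral>x. f x \<bullet> g x \<partial>lebesgue"
proof -
  fix f f' g g' :: "'a \<Rightarrow> 'b"
  assume "l2rel f f'" "l2rel g g'"
  then have s: "sqint f" "sqint f'" "sqint g" "sqint g'"
    and e: "AE x in lebesgue. f x = f' x" "AE x in lebesgue. g x = g' x"
    by (auto simp: l2rel_def)
  have "AE x in lebesgue. f x \<bullet> g x = f' x \<bullet> g' x"
    using e by eventually_elim simp
  then show "(\<integral>x. f x \<bullet> g x \<partial>lebesgue) = (\<integral>x. f' x \<bullet> g' x \<partial>lebesgue)"
    using sqint_inner[OF s(1,3)] sqint_inner[OF s(2,4)]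
    by (intro integral_cong_AE) (auto dest: borel_measurable_integrable)
qed

definition norm_l2 :: "('a, 'b) l2 \<Rightarrow> real" where
  "norm_l2 f = sqrt (f \<bullet> f)"

definition sgn_l2 :: "('a, 'b) l2 \<Rightarrow> ('a, 'b) l2" where
  "sgn_l2 f = inverse (norm f) *\<^sub>R f"

definition dist_l2 :: "('a, 'b) l2 \<Rightarrow> ('a, 'b) l2 \<Rightarrow> real" where
  "dist_l2 f g = norm (f - g)"

definition uniformity_l2 :: "(('a, 'b) l2 \<times> ('a, 'b) l2) filter" where
  "uniformity_l2 = (INF e\<in>{0<..}. principal {(x, y). dist x y < e})"

definition open_l2 :: "('a, 'b) l2 set \<Rightarrow> bool" where
  "open_l2 S = (\<forall>x\<in>S. \<forall>\<^sub>F (x', y) in uniformity. x' = x \<longrightarrow> y \<in> S)"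

instance
proof
  fix f g h :: "('a, 'b) l2" and a :: real
  show "dist f g = norm (f - g)"
    by (rule dist_l2_def)
  show "sgn f = f /\<^sub>R norm f"
    by (rule sgn_l2_def)
  show "uniformity = (INF e\<in>{0<..}. principal {(x :: ('a, 'b) l2, y). dist x y < e})"
    by (rule uniformity_l2_def)
  show "open S = (\<forall>x\<in>S. \<forall>\<^sub>F (x', y) in uniformity. x' = x \<longrightarrow> y \<in> S)" for S :: "('a, 'b) l2 set"
    by (rule open_l2_def)
  show "f \<bullet> g = g \<bullet> f"
    by transfer (simp add: inner_commute)
  show "(f + g) \<bullet> h = f \<bullet> h + g \<bullet> h"
    by transfer (auto simp: l2rel_def inner_add_left sqint_inner)
  show "(a *\<^sub>R f) \<bullet> g = a * (f \<bullet> g)"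
    by transfer auto
  show "0 \<le> f \<bullet> f"
    by transfer (auto intro: integral_nonneg_AE)
  show "f \<bullet> f = 0 \<longleftrightarrow> f = 0"
  proof transfer
    fix f :: "'a \<Rightarrow> 'b"
    assume "l2rel f f"
    then have s: "sqint f" by (simp add: l2rel_def)
    show "((\<integral>x. f x \<bullet> f x \<partial>lebesgue) = 0) = l2rel f (\<lambda>x. 0)"
      using integral_nonneg_eq_0_iff_AE[OF sqint_inner[OF s s]] s
      by (simp add: l2rel_def sqint_zero)
  qed
  show "norm f = sqrt (f \<bullet> f)"
    by (rule norm_l2_def)
qed

end

text \<open>For \<open>f\<close> square integrable on \<open>\<omega>\<close>, \<open>L2_of \<omega> f\<close> is the class of the extension of \<open>f\<close> by zero.
  Throughout, \<open>L\<^sup>2(\<omega>)\<close> is identified with the classes that vanish outside \<open>\<omega>\<close>, so the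
  \<open>L\<^sup>2(\<omega>)\<close> norm and inner product are \<open>norm\<close> and \<open>\<bullet>\<close> of the type. On matrices, \<open>\<bullet>\<close> is the
  Frobenius product.\<close>

definition L2_of :: "'a::euclidean_space set \<Rightarrow> ('a \<Rightarrow> 'b::euclidean_space) \<Rightarrow> ('a, 'b) l2" where
  "L2_of \<omega> f = abs_l2 (\<lambda>x. if x \<in> \<omega> then f x else 0)"

definition L2 :: "'a::euclidean_space set \<Rightarrow> ('a, 'b::euclidean_space) l2 set" where
  "L2 \<omega> = {f. AE x in lebesgue. x \<notin> \<omega> \<longrightarrow> rep_l2 f x = 0}"

definition restr :: "'a::euclidean_space set \<Rightarrow> ('a, 'b::euclidean_space) l2 \<Rightarrow> ('a, 'b) l2" where
  "restr \<omega> f = L2_of \<omega> (rep_l2 f)"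

type_synonym 'n sfun = "(real^'n, real) l2"
type_synonym 'n vfun = "(real^'n, real^'n) l2"
type_synonym 'n mfun = "(real^'n, real^'n^'n) l2"

definition L2sym :: "(real^'n) set \<Rightarrow> 'n mfun set" where
  "L2sym \<omega> = {Q \<in> L2 \<omega>. AE x in lebesgue. transpose (rep_l2 Q x) = rep_l2 Q x}"


section \<open>Smooth functions and classical differential operators\<close>

definition pd :: "'n \<Rightarrow> (real^'n \<Rightarrow> real) \<Rightarrow> real^'n \<Rightarrow> real" where
  "pd i f x = frechet_derivative f (at x) (axis i 1)"

fun Ck :: "nat \<Rightarrow> (real^'n \<Rightarrow> real) \<Rightarrow> bool" where
  "Ck 0 f \<longleftrightarrow> continuous_on UNIV f"
| "Ck (Suc k) f \<longleftrightarrow> (\<forall>x. f differentiable at x) \<and> (\<forall>i. Ck k (pd i f))"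

definition smooth :: "(real^'n \<Rightarrow> real) \<Rightarrow> bool" where
  "smooth f \<longleftrightarrow> (\<forall>k. Ck k f)"

definition grad :: "(real^'n \<Rightarrow> real) \<Rightarrow> real^'n \<Rightarrow> real^'n" where
  "grad f x = (\<chi> i. pd i f x)"

definition hess :: "(real^'n \<Rightarrow> real) \<Rightarrow> real^'n \<Rightarrow> real^'n^'n" where
  "hess f x = (\<chi> i j. pd i (pd j f) x)"

definition divergence :: "(real^'n \<Rightarrow> real^'n) \<Rightarrow> real^'n \<Rightarrow> real" where
  "divergence q x = (\<Sum>j\<in>UNIV. pd j (\<lambda>y. q y $ j) x)"

definition row_Div :: "(real^'n \<Rightarrow> real^'n^'n) \<Rightarrow> real^'n \<Rightarrow> real^'n" where
  "row_Div \<Phi> x = (\<chi> i. divergence (\<lambda>y. \<Phi> y $ i) x)"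

definition div_Div :: "(real^'n \<Rightarrow> real^'n^'n) \<Rightarrow> real^'n \<Rightarrow> real" where
  "div_Div \<Phi> = divergence (row_Div \<Phi>)"

definition test_fun :: "(real^'n) set \<Rightarrow> (real^'n \<Rightarrow> real) set" where
  "test_fun \<omega> = {\<phi>. smooth \<phi> \<and> compact (closure {x. \<phi> x \<noteq> 0}) \<and> closure {x. \<phi> x \<noteq> 0} \<subseteq> \<omega>}"

text \<open>On a bounded Lipschitz domain, the functions smooth up to the boundary are the restrictions
  of smooth functions on the whole space.\<close>

definition smooth_sym :: "(real^'n \<Rightarrow> real^'n^'n) set" where
  "smooth_sym = {\<Phi>. (\<forall>i j. smooth (\<lambda>x. \<Phi> x $ i $ j)) \<and> (\<forall>x. transpose (\<Phi> x) = \<Phi> x)}"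


section \<open>Sobolev spaces\<close>

definition is_weak_grad :: "(real^'n) set \<Rightarrow> 'n sfun \<Rightarrow> 'n vfun \<Rightarrow> bool" where
  "is_weak_grad \<Omega> u G \<longleftrightarrow> G \<in> L2 \<Omega> \<and>
     (\<forall>\<phi>\<in>test_fun \<Omega>. \<forall>i. u \<bullet> L2_of \<Omega> (pd i \<phi>) = - (G \<bullet> L2_of \<Omega> (\<lambda>x. axis i (\<phi> x))))"

definition is_weak_hess :: "(real^'n) set \<Rightarrow> 'n sfun \<Rightarrow> 'n mfun \<Rightarrow> bool" where
  "is_weak_hess \<Omega> u H \<longleftrightarrow> H \<in> L2 \<Omega> \<and>
     (\<forall>\<phi>\<in>test_fun \<Omega>. \<forall>i j. u \<bullet> L2_of \<Omega> (pd i (pd j \<phi>)) = H \<bullet> L2_of \<Omega> (\<lambda>x. axis i (axis j (\<phi> x))))"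

definition weak_grad :: "(real^'n) set \<Rightarrow> 'n sfun \<Rightarrow> 'n vfun" where
  "weak_grad \<Omega> u = (THE G. is_weak_grad \<Omega> u G)"

definition weak_hess :: "(real^'n) set \<Rightarrow> 'n sfun \<Rightarrow> 'n mfun" where
  "weak_hess \<Omega> u = (THE H. is_weak_hess \<Omega> u H)"

definition H2 :: "(real^'n) set \<Rightarrow> 'n sfun set" where
  "H2 \<Omega> = {u \<in> L2 \<Omega>. (\<exists>G. is_weak_grad \<Omega> u G) \<and> (\<exists>H. is_weak_hess \<Omega> u H)}"

definition H10 :: "(real^'n) set \<Rightarrow> 'n sfun set" where
  "H10 \<Omega> = {u \<in> L2 \<Omega>. (\<exists>G. is_weak_grad \<Omega> u G) \<and>
     (\<exists>\<phi> :: nat \<Rightarrow> real^'n \<Rightarrow> real. (\<forall>k. \<phi> k \<in> test_fun \<Omega>) \<and>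
        (\<lambda>k. L2_of \<Omega> (\<phi> k)) \<longlonglongrightarrow> u \<and> (\<lambda>k. L2_of \<Omega> (grad (\<phi> k))) \<longlonglongrightarrow> weak_grad \<Omega> u)}"

definition H2_norm :: "(real^'n) set \<Rightarrow> 'n sfun \<Rightarrow> real" where
  "H2_norm \<Omega> u = sqrt ((norm u)\<^sup>2 + (norm (weak_hess \<Omega> u))\<^sup>2)"

definition X_space :: "(real^'n) set \<Rightarrow> 'n sfun set" where
  "X_space \<Omega> = H2 \<Omega> \<inter> H10 \<Omega>"

text \<open>The completion of the symmetric matrix functions smooth up to the boundary is realized
  inside \<open>L\<^sup>2\<close> as the domain of the closure of \<open>div_Div\<close>.\<close>

definition is_divDiv :: "(real^'n) set \<Rightarrow> 'n mfun \<Rightarrow> 'n sfun \<Rightarrow> bool" where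
  "is_divDiv \<omega> Q q \<longleftrightarrow> (\<exists>\<Phi> :: nat \<Rightarrow> real^'n \<Rightarrow> real^'n^'n. (\<forall>k. \<Phi> k \<in> smooth_sym) \<and>
     (\<lambda>k. L2_of \<omega> (\<Phi> k)) \<longlonglongrightarrow> Q \<and> (\<lambda>k. L2_of \<omega> (div_Div (\<Phi> k))) \<longlonglongrightarrow> q)"

definition HdivDiv :: "(real^'n) set \<Rightarrow> 'n mfun set" where
  "HdivDiv \<omega> = {Q. \<exists>q. is_divDiv \<omega> Q q}"

definition divDiv :: "(real^'n) set \<Rightarrow> 'n mfun \<Rightarrow> 'n sfun" where
  "divDiv \<omega> Q = (THE q. is_divDiv \<omega> Q q)"


section \<open>Domains, partitions and coefficients\<close>

definition convex_polytopal_domain :: "(real^'n) set \<Rightarrow> bool" where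
  "convex_polytopal_domain \<Omega> \<longleftrightarrow>
     open \<Omega> \<and> \<Omega> \<noteq> {} \<and> bounded \<Omega> \<and> convex \<Omega> \<and> polytope (closure \<Omega>)"

text \<open>Locally, in a coordinate system with vertical direction \<open>e\<close>, the set is the strict epigraph of a
  Lipschitz function of the horizontal variable \<open>x - (x \<bullet> e) *\<^sub>R e\<close>.\<close>

definition lipschitz_domain :: "(real^'n) set \<Rightarrow> bool" where
  "lipschitz_domain T \<longleftrightarrow> open T \<and> T \<noteq> {} \<and> connected T \<and> bounded T \<and>
     (\<forall>p\<in>frontier T. \<exists>r>0. \<exists>e. norm e = 1 \<and>
        (\<exists>L. \<exists>\<gamma> :: real^'n \<Rightarrow> real. L-lipschitz_on {y. y \<bullet> e = 0} \<gamma> \<and>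
           T \<inter> ball p r = {x \<in> ball p r. \<gamma> (x - (x \<bullet> e) *\<^sub>R e) < x \<bullet> e}))"

definition lipschitz_partition :: "(real^'n) set \<Rightarrow> (real^'n) set set \<Rightarrow> bool" where
  "lipschitz_partition \<Omega> \<T> \<longleftrightarrow> finite \<T> \<and> disjoint \<T> \<and>
     (\<forall>T\<in>\<T>. lipschitz_domain T \<and> T \<subseteq> \<Omega> \<and> 0 < emeasure lebesgue T) \<and>
     (\<Union>T\<in>\<T>. closure T) = closure \<Omega>"

definition eigenvalues :: "real^'n^'n \<Rightarrow> real set" where
  "eigenvalues B = {\<kappa>. \<exists>v. v \<noteq> 0 \<and> B *v v = \<kappa> *\<^sub>R v}"

definition lambda_min :: "real^'n^'n \<Rightarrow> real" where
  "lambda_min B = Min (eigenvalues B)"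

definition lambda_max :: "real^'n^'n \<Rightarrow> real" where
  "lambda_max B = Max (eigenvalues B)"

definition essinf :: "'a measure \<Rightarrow> ('a \<Rightarrow> ereal) \<Rightarrow> ereal" where
  "essinf M f = - esssup M (\<lambda>x. - f x)"

definition elliptic_coefficient :: "(real^'n) set \<Rightarrow> (real^'n \<Rightarrow> real^'n^'n) \<Rightarrow> bool" where
  "elliptic_coefficient \<Omega> A \<longleftrightarrow>
     (\<forall>x\<in>\<Omega>. transpose (A x) = A x) \<and> A \<in> borel_measurable (lebesgue_on \<Omega>) \<and>
     0 < essinf (lebesgue_on \<Omega>) (\<lambda>x. ereal (lambda_min (A x))) \<and>
     essinf (lebesgue_on \<Omega>) (\<lambda>x. ereal (lambda_min (A x)))
       \<le> esssup (lebesgue_on \<Omega>) (\<lambda>x. ereal (lambda_max (A x))) \<and>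
     esssup (lebesgue_on \<Omega>) (\<lambda>x. ereal (lambda_max (A x))) < \<infinity>"

definition cordes :: "(real^'n) set \<Rightarrow> (real^'n \<Rightarrow> real^'n^'n) \<Rightarrow> bool" where
  "cordes \<Omega> A \<longleftrightarrow> (\<exists>\<epsilon>. 0 < \<epsilon> \<and> \<epsilon> \<le> 1 \<and>
     (AE x in lebesgue_on \<Omega>.
        (\<Sum>j\<in>UNIV. \<Sum>k\<in>UNIV. (A x $ j $ k)\<^sup>2) / (\<Sum>j\<in>UNIV. A x $ j $ j)\<^sup>2
          \<le> 1 / (real CARD('n) - 1 + \<epsilon>)))"


section \<open>Broken spaces and traces\<close>

definition HdivDiv_mesh :: "(real^'n) set \<Rightarrow> (real^'n) set set \<Rightarrow> 'n mfun set" where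
  "HdivDiv_mesh \<Omega> \<T> = {Q \<in> L2sym \<Omega>. \<forall>T\<in>\<T>. restr T Q \<in> HdivDiv T}"

definition HdivDiv_mesh_inner :: "(real^'n) set set \<Rightarrow> 'n mfun \<Rightarrow> 'n mfun \<Rightarrow> real" where
  "HdivDiv_mesh_inner \<T> Q R =
     (\<Sum>T\<in>\<T>. restr T Q \<bullet> restr T R + divDiv T (restr T Q) \<bullet> divDiv T (restr T R))"

text \<open>Functionals on the broken space are extended by zero to the whole type, so that two of them
  are equal iff they agree on the broken space.\<close>

type_synonym 'n trace = "'n mfun \<Rightarrow> real"

definition tr2 :: "(real^'n) set \<Rightarrow> (real^'n) set set \<Rightarrow> 'n sfun \<Rightarrow> 'n trace" where
  "tr2 \<Omega> \<T> u = (\<lambda>Q. if Q \<in> HdivDiv_mesh \<Omega> \<T>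
     then \<Sum>T\<in>\<T>. divDiv T (restr T Q) \<bullet> restr T u - restr T Q \<bullet> restr T (weak_hess \<Omega> u)
     else 0)"

definition U_hat :: "(real^'n) set \<Rightarrow> (real^'n) set set \<Rightarrow> 'n trace set" where
  "U_hat \<Omega> \<T> = tr2 \<Omega> \<T> ` X_space \<Omega>"

definition trace_norm :: "(real^'n) set \<Rightarrow> (real^'n) set set \<Rightarrow> 'n trace \<Rightarrow> real" where
  "trace_norm \<Omega> \<T> \<mu> = Inf {H2_norm \<Omega> u | u. u \<in> H2 \<Omega> \<and> tr2 \<Omega> \<T> u = \<mu>}"

instantiation "fun" :: (type, real_vector) real_vector
begin

definition scaleR_fun :: "real \<Rightarrow> ('a \<Rightarrow> 'b) \<Rightarrow> 'a \<Rightarrow> 'b" where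
  "scaleR_fun c f = (\<lambda>x. c *\<^sub>R f x)"

instance
  by standard (auto simp: scaleR_fun_def fun_eq_iff scaleR_add_left scaleR_add_right)

end


section \<open>The variational formulation and its discretization\<close>

type_synonym 'n trial = "'n sfun \<times> 'n mfun \<times> 'n trace"
type_synonym 'n test = "'n sfun \<times> 'n mfun"

definition U_space :: "(real^'n) set \<Rightarrow> (real^'n) set set \<Rightarrow> 'n trial set" where
  "U_space \<Omega> \<T> = L2 \<Omega> \<times> L2sym \<Omega> \<times> U_hat \<Omega> \<T>"

definition U_norm :: "(real^'n) set \<Rightarrow> (real^'n) set set \<Rightarrow> 'n trial \<Rightarrow> real" where
  "U_norm \<Omega> \<T> = (\<lambda>(u, M, \<mu>). sqrt ((norm u)\<^sup>2 + (norm M)\<^sup>2 + (trace_norm \<Omega> \<T> \<mu>)\<^sup>2))"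

definition V_space :: "(real^'n) set \<Rightarrow> (real^'n) set set \<Rightarrow> 'n test set" where
  "V_space \<Omega> \<T> = L2 \<Omega> \<times> HdivDiv_mesh \<Omega> \<T>"

definition V_inner :: "(real^'n) set set \<Rightarrow> 'n test \<Rightarrow> 'n test \<Rightarrow> real" where
  "V_inner \<T> = (\<lambda>(v, Q) (w, R). v \<bullet> w + HdivDiv_mesh_inner \<T> Q R)"

definition V_norm :: "(real^'n) set set \<Rightarrow> 'n test \<Rightarrow> real" where
  "V_norm \<T> x = sqrt (V_inner \<T> x x)"

definition b_form :: "(real^'n) set \<Rightarrow> (real^'n \<Rightarrow> real^'n^'n) \<Rightarrow> (real^'n) set set \<Rightarrow>
    'n trial \<Rightarrow> 'n test \<Rightarrow> real" where
  "b_form \<Omega> A \<T> = (\<lambda>(u, M, \<mu>) (v, Q).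
     - (\<Sum>T\<in>\<T>. restr T u \<bullet> divDiv T (restr T Q))
     + M \<bullet> (L2_of \<Omega> (\<lambda>x. rep_l2 v x *\<^sub>R A x) + Q) + \<mu> Q)"

definition F_form :: "'n::finite sfun \<Rightarrow> 'n test \<Rightarrow> real" where
  "F_form f = (\<lambda>(v, Q). f \<bullet> v)"

definition is_solution :: "(real^'n) set \<Rightarrow> (real^'n \<Rightarrow> real^'n^'n) \<Rightarrow> (real^'n) set set \<Rightarrow>
    'n sfun \<Rightarrow> 'n trial \<Rightarrow> bool" where
  "is_solution \<Omega> A \<T> f u \<longleftrightarrow>
     u \<in> U_space \<Omega> \<T> \<and> (\<forall>v\<in>V_space \<Omega> \<T>. b_form \<Omega> A \<T> u v = F_form f v)"

definition fin_dim_subspace_of :: "'v::real_vector set \<Rightarrow> 'v set \<Rightarrow> bool" where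
  "fin_dim_subspace_of S W \<longleftrightarrow> S \<subseteq> W \<and> subspace S \<and> (\<exists>B. finite B \<and> S = span B)"

definition trial_to_test :: "(real^'n) set \<Rightarrow> (real^'n \<Rightarrow> real^'n^'n) \<Rightarrow> (real^'n) set set \<Rightarrow>
    'n test set \<Rightarrow> 'n trial \<Rightarrow> 'n test" where
  "trial_to_test \<Omega> A \<T> Vh u =
     (THE t. t \<in> Vh \<and> (\<forall>v\<in>Vh. V_inner \<T> t v = b_form \<Omega> A \<T> u v))"

definition is_discrete_solution :: "(real^'n) set \<Rightarrow> (real^'n \<Rightarrow> real^'n^'n) \<Rightarrow> (real^'n) set set \<Rightarrow>
    'n trial set \<Rightarrow> 'n test set \<Rightarrow> 'n sfun \<Rightarrow> 'n trial \<Rightarrow> bool" where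
  "is_discrete_solution \<Omega> A \<T> Uh Vh f uh \<longleftrightarrow> uh \<in> Uh \<and>
     (\<forall>w\<in>Uh. b_form \<Omega> A \<T> uh (trial_to_test \<Omega> A \<T> Vh w) = F_form f (trial_to_test \<Omega> A \<T> Vh w))"

definition is_fortin :: "(real^'n) set \<Rightarrow> (real^'n \<Rightarrow> real^'n^'n) \<Rightarrow> (real^'n) set set \<Rightarrow>
    'n trial set \<Rightarrow> 'n test set \<Rightarrow> ('n test \<Rightarrow> 'n test) \<Rightarrow> real \<Rightarrow> bool" where
  "is_fortin \<Omega> A \<T> Uh Vh PiF C \<longleftrightarrow>
     (\<forall>v\<in>V_space \<Omega> \<T>. PiF v \<in> Vh) \<and>
     (\<forall>v\<in>V_space \<Omega> \<T>. \<forall>w\<in>V_space \<Omega> \<T>. PiF (v + w) = PiF v + PiF w) \<and>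
     (\<forall>c. \<forall>v\<in>V_space \<Omega> \<T>. PiF (c *\<^sub>R v) = c *\<^sub>R PiF v) \<and>
     (\<forall>v\<in>V_space \<Omega> \<T>. V_norm \<T> (PiF v) \<le> C * V_norm \<T> v) \<and>
     (\<forall>uh\<in>Uh. \<forall>v\<in>V_space \<Omega> \<T>. b_form \<Omega> A \<T> uh (PiF v) = b_form \<Omega> A \<T> uh v)"

end

(* Writing a trace as tr2 w with w in X, the form becomes
     b(u,(v,Q)) = (w - u, divDiv Q) + (M - D^2 w, Q) + (A : M, v).
   Stability: split (M - D^2 w, w - u) orthogonally along the closed graph of the broken divDiv. A pair
   (Z, z) orthogonal to that graph is in particular orthogonal to all (Phi, divDiv Phi) with Phi smooth up
   to the boundary, so the extension of z by zero has square integrable Hessian -Z on the whole space; hence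
   z lies in X, and w may be replaced by w - z without changing its trace. Testing with the projection
   and with (A : M, 0) then bounds A : D^2 w, and the Cordes condition together with the Miranda-Talenti
   inequality |D^2 w| <= |trace D^2 w| bounds the H^2 norm of w, with a constant not depending on the mesh.

   Miranda-Talenti is proved without boundary regularity: the 2x2 minors of D^2 w are integrated against
   the concave weight 1 / (1 + d * sum_i 1 / l_i), l_i being the distances to the faces; concavity gives a
   sign to the term containing second derivatives of the weight, a Hardy inequality for the tangential
   derivatives of w makes the error terms of the cutoff vanish, and then d tends to 0.

   The discrete problem is symmetric positive definite in the form V_inner (Theta u) (Theta w). In the
   quasi-optimality estimate the summand 1 of the constant is absorbed by C_F >= 1. *)

theory Submission
  imports Defs
begin

text \<open>The projection onto the graph keeps the constant free of the mesh: no estimate on single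
  elements enters, only the closedness of the graph and the fact that it contains every globally
  smooth field. The regularity of \<open>z\<close> must then come from orthogonality alone. As
  \<open>smooth_sym\<close> carries no boundary condition, the complement satisfies the weak Hessian
  identity against test functions of the whole space; this encodes vanishing value and vanishing
  normal derivative at once, and dilation about an interior point turns mollifications of
  \<open>z\<close> into test functions of the domain.

  For Miranda-Talenti the obstacle is that members of \<open>X_space\<close> are approximated by
  test functions in first derivatives only, so boundary integrals are out of reach and interior
  cutoffs are forced. Their second derivatives are singular at the faces; a cutoff that depends on
  the face distances alone pairs them only with tangential derivatives, which a Hardy argument
  controls.

  The quasi-optimality estimate excludes \<open>Uh = {0}\<close> because the zero map is then a
  Fortin operator for arbitrarily small \<open>C_F\<close>, so a bound proportional to
  \<open>C_F\<close> fails for every nonzero solution.\<close>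

abbreviation lebesgue_integral :: "('a::euclidean_space \<Rightarrow> 'b::{banach,second_countable_topology}) \<Rightarrow> 'b" (binder "\<integral>" 10)
  where "lebesgue_integral \<equiv> integral\<^sup>L lebesgue"

section \<open>The space of square integrable functions\<close>

lemma l2rel_self: "l2rel f f \<longleftrightarrow> sqint f"
  by (simp add: l2rel_def)

lemma sqint_rep [simp]: "sqint (rep_l2 F)"
  using Quotient3_rep_reflp[OF Quotient3_l2] by (simp add: l2rel_def)

lemma abs_rep [simp]: "abs_l2 (rep_l2 F) = F"
  by (rule Quotient3_abs_rep[OF Quotient3_l2])

lemma abs_l2_eq_iff:
  assumes "sqint f" "sqint g"
  shows "abs_l2 f = abs_l2 g \<longleftrightarrow> (AE x in lebesgue. f x = g x)"
  using Quotient3_rel[OF Quotient3_l2, of f g] assms by (simp add: l2rel_def)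

lemma rep_abs_AE:
  assumes "sqint f" shows "AE x in lebesgue. rep_l2 (abs_l2 f) x = f x"
  using abs_l2_eq_iff[of "rep_l2 (abs_l2 f)" f] assms by simp

lemma l2_eq_iff: "F = G \<longleftrightarrow> (AE x in lebesgue. rep_l2 F x = rep_l2 G x)"
  using abs_l2_eq_iff[of "rep_l2 F" "rep_l2 G"] by simp

lemma sqint_measurable: "sqint f \<Longrightarrow> f \<in> borel_measurable lebesgue"
  by (simp add: sqint_def)

lemma sqint_integrable: "sqint f \<Longrightarrow> integrable lebesgue (\<lambda>x. (norm (f x))\<^sup>2)"
  by (simp add: sqint_def)

lemma rep_measurable [measurable]: "rep_l2 F \<in> borel_measurable lebesgue"
  by (rule sqint_measurable) simp

lemma sqint_diff: "sqint f \<Longrightarrow> sqint g \<Longrightarrow> sqint (\<lambda>x. f x - g x)"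
  using sqint_add[OF _ sqint_uminus[of g], of f] by simp

lemma sqint_bound:
  assumes "sqint f" "g \<in> borel_measurable lebesgue" "AE x in lebesgue. norm (g x) \<le> B * norm (f x)"
  shows "sqint g"
proof -
  have "integrable lebesgue (\<lambda>x. B\<^sup>2 * (norm (f x))\<^sup>2)"
    using assms(1) by (auto simp: sqint_def)
  moreover have "AE x in lebesgue. norm ((norm (g x))\<^sup>2) \<le> norm (B\<^sup>2 * (norm (f x))\<^sup>2)"
    using assms(3) by eventually_elim (simp flip: power_mult_distrib add: power_mono)
  moreover have "(\<lambda>x. (norm (g x))\<^sup>2) \<in> borel_measurable lebesgue"
    using assms(2) by measurable
  ultimately show ?thesis
    unfolding sqint_def using assms(2) Bochner_Integration.integrable_bound by blast
qed

lemma abs_l2_zero: "abs_l2 (\<lambda>x. 0) = 0"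
  by (simp add: zero_l2_def)

lemma abs_l2_add: "sqint f \<Longrightarrow> sqint g \<Longrightarrow> abs_l2 f + abs_l2 g = abs_l2 (\<lambda>x. f x + g x)"
  by (rule plus_l2.abs_eq) (auto simp: l2rel_self)

lemma abs_l2_scaleR: "sqint f \<Longrightarrow> c *\<^sub>R abs_l2 f = abs_l2 (\<lambda>x. c *\<^sub>R f x)"
  by (rule scaleR_l2.abs_eq) (auto simp: l2rel_self)

lemma abs_l2_uminus: "sqint f \<Longrightarrow> - abs_l2 f = abs_l2 (\<lambda>x. - f x)"
  by (rule uminus_l2.abs_eq) (auto simp: l2rel_self)

lemma abs_l2_diff: "sqint f \<Longrightarrow> sqint g \<Longrightarrow> abs_l2 f - abs_l2 g = abs_l2 (\<lambda>x. f x - g x)"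
  by (simp add: minus_l2_def abs_l2_uminus abs_l2_add sqint_uminus)

lemma abs_l2_inner: "sqint f \<Longrightarrow> sqint g \<Longrightarrow> abs_l2 f \<bullet> abs_l2 g = (\<integral>x. f x \<bullet> g x)"
  by (rule inner_l2.abs_eq) (auto simp: l2rel_self)

lemma rep_add_AE: "AE x in lebesgue. rep_l2 (F + G) x = rep_l2 F x + rep_l2 G x"
  using rep_abs_AE[OF sqint_add[of "rep_l2 F" "rep_l2 G"]] abs_l2_add[of "rep_l2 F" "rep_l2 G"] by simp

lemma rep_diff_AE: "AE x in lebesgue. rep_l2 (F - G) x = rep_l2 F x - rep_l2 G x"
  using rep_abs_AE[OF sqint_diff[of "rep_l2 F" "rep_l2 G"]] abs_l2_diff[of "rep_l2 F" "rep_l2 G"] by simp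

lemma rep_scaleR_AE: "AE x in lebesgue. rep_l2 (c *\<^sub>R F) x = c *\<^sub>R rep_l2 F x"
  using rep_abs_AE[OF sqint_scaleR[of "rep_l2 F" c]] abs_l2_scaleR[of "rep_l2 F" c] by simp

lemma rep_zero_AE: "AE x in lebesgue. rep_l2 0 x = 0"
  using rep_abs_AE[OF sqint_zero] by (simp add: abs_l2_zero)

lemma norm_abs_l2:
  "sqint f \<Longrightarrow> (norm (abs_l2 f))\<^sup>2 = (\<integral>x. (norm (f x))\<^sup>2)"
  by (simp add: power2_norm_eq_inner abs_l2_inner)

lemma nn_integral_norm_l2:
  "(\<integral>\<^sup>+x. ennreal ((norm (rep_l2 F x))\<^sup>2) \<partial>lebesgue) = ennreal ((norm F)\<^sup>2)"
proof -
  have "(\<integral>\<^sup>+x. ennreal ((norm (rep_l2 F x))\<^sup>2) \<partial>lebesgue) = ennreal (\<integral>x. (norm (rep_l2 F x))\<^sup>2)"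
    using sqint_rep[of F] by (intro nn_integral_eq_integral) (auto simp: sqint_def)
  then show ?thesis using norm_abs_l2[of "rep_l2 F"] by simp
qed

lemma nn_integral_norm_diff_l2:
  "(\<integral>\<^sup>+x. ennreal ((norm (rep_l2 F x - rep_l2 G x))\<^sup>2) \<partial>lebesgue) = ennreal ((norm (F - G))\<^sup>2)"
proof -
  have "(\<integral>\<^sup>+x. ennreal ((norm (rep_l2 F x - rep_l2 G x))\<^sup>2) \<partial>lebesgue)
      = (\<integral>\<^sup>+x. ennreal ((norm (rep_l2 (F - G) x))\<^sup>2) \<partial>lebesgue)"
    by (intro nn_integral_cong_AE) (use rep_diff_AE[of F G] in \<open>eventually_elim, simp\<close>)
  then show ?thesis by (simp add: nn_integral_norm_l2)
qed

text \<open>The Riesz-Fischer argument with weights: the integral of the sum of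
  \<open>2^n * (d n x)\<^sup>2\<close> is at most the sum of \<open>(1/2)^n\<close>. At every point
  where that sum is a finite \<open>S\<close>, the increments are bounded by
  \<open>sqrt S * (sqrt (1/2))^n\<close> and are therefore summable.\<close>

lemma fast_Cauchy_pointwise:
  fixes X :: "nat \<Rightarrow> ('a::euclidean_space, 'b::euclidean_space) l2"
  assumes fast: "\<And>n. norm (X (Suc n) - X n) \<le> (1/2)^n"
  shows "AE x in lebesgue. convergent (\<lambda>n. rep_l2 (X n) x)"
proof -
  define d where "d n x = norm (rep_l2 (X (Suc n)) x - rep_l2 (X n) x)" for n x
  have [measurable]: "d n \<in> borel_measurable lebesgue" for n
    unfolding d_def by measurable
  have "(\<integral>\<^sup>+x. (\<Sum>n. ennreal (2^n * (d n x)\<^sup>2)) \<partial>lebesgue) = (\<Sum>n. \<integral>\<^sup>+x. ennreal (2^n * (d n x)\<^sup>2) \<partial>lebesgue)"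
    by (intro nn_integral_suminf) measurable
  also have "\<dots> \<le> (\<Sum>n. ennreal ((1/2)^n))"
  proof (intro suminf_le allI)
    fix n
    have "(\<integral>\<^sup>+x. ennreal (2^n * (d n x)\<^sup>2) \<partial>lebesgue) = ennreal (2^n) * ennreal ((norm (X (Suc n) - X n))\<^sup>2)"
      by (simp add: ennreal_mult nn_integral_cmult d_def nn_integral_norm_diff_l2[symmetric])
    also have "\<dots> \<le> ennreal (2^n) * ennreal (((1/2)^n)\<^sup>2)"
      by (intro mult_left_mono ennreal_leI power_mono fast) auto
    also have "\<dots> = ennreal ((1/2)^n)"
      by (simp flip: ennreal_mult add: power2_eq_square power_divide)
    finally show "(\<integral>\<^sup>+x. ennreal (2^n * (d n x)\<^sup>2) \<partial>lebesgue) \<le> ennreal ((1/2)^n)" .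
  qed auto
  also have "\<dots> = ennreal (\<Sum>n. (1/2)^n)"
    by (intro suminf_ennreal2 summable_geometric) simp_all
  also have "\<dots> < \<infinity>" by simp
  finally have "(\<integral>\<^sup>+x. (\<Sum>n. ennreal (2^n * (d n x)\<^sup>2)) \<partial>lebesgue) < \<infinity>" .
  then have "AE x in lebesgue. (\<Sum>n. ennreal (2^n * (d n x)\<^sup>2)) \<noteq> \<infinity>"
    by (intro nn_integral_PInf_AE) auto
  then show ?thesis
  proof eventually_elim
    fix x assume fin: "(\<Sum>n. ennreal (2^n * (d n x)\<^sup>2)) \<noteq> \<infinity>"
    define S where "S = enn2real (\<Sum>n. ennreal (2^n * (d n x)\<^sup>2))"
    have S: "0 \<le> S" "(\<Sum>n. ennreal (2^n * (d n x)\<^sup>2)) = ennreal S"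
      using fin by (simp_all add: S_def less_top)
    have "d n x \<le> sqrt S * (sqrt (1/2))^n" for n
    proof -
      have "e n \<le> suminf e" for e :: "nat \<Rightarrow> ennreal"
        using sum_le_suminf[of e "{n}"] by (simp add: summableI)
      from this[of "\<lambda>n. ennreal (2^n * (d n x)\<^sup>2)"] have "2^n * (d n x)\<^sup>2 \<le> S"
        unfolding S(2) using ennreal_le_iff[OF S(1)] by blast
      then have "(d n x)\<^sup>2 \<le> S * (1/2)^n" by (simp add: field_simps power_divide)
      then have "d n x \<le> sqrt (S * (1/2)^n)" by (rule real_le_rsqrt)
      also have "\<dots> = sqrt S * (sqrt (1/2))^n" by (simp add: real_sqrt_mult real_sqrt_power)
      finally show ?thesis .
    qed
    note d_le = this
    have "summable (\<lambda>n. sqrt S * (sqrt (1/2))^n)"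
      by (intro summable_mult summable_geometric) (simp add: real_sqrt_lt_1_iff)
    then have "summable (\<lambda>n. rep_l2 (X (Suc n)) x - rep_l2 (X n) x)"
      by (rule summable_comparison_test'[where N=0]) (use d_le in \<open>simp add: d_def\<close>)
    then have "convergent (\<lambda>n. \<Sum>k<n. rep_l2 (X (Suc k)) x - rep_l2 (X k) x)"
      by (simp add: summable_iff_convergent)
    then have "convergent (\<lambda>n. rep_l2 (X n) x - rep_l2 (X 0) x)"
      by (simp only: sum_lessThan_telescope[of "\<lambda>n. rep_l2 (X n) x"])
    then have "convergent (\<lambda>n. (rep_l2 (X n) x - rep_l2 (X 0) x) + rep_l2 (X 0) x)"
      by (rule convergent_add[OF _ convergent_const])
    then show "convergent (\<lambda>n. rep_l2 (X n) x)" by simp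
  qed
qed

text \<open>Fatou's lemma, applied to the differences with a fixed \<open>X n\<close>, shows at once
  that the pointwise limit differs from \<open>X n\<close> by a square integrable function and that
  the distance is at most \<open>2 * (1/2)^n\<close>.\<close>

lemma fast_Cauchy_convergent:
  fixes X :: "nat \<Rightarrow> ('a::euclidean_space, 'b::euclidean_space) l2"
  assumes fast: "\<And>n. norm (X (Suc n) - X n) \<le> (1/2)^n"
  shows "convergent X"
proof -
  define F where "F x = lim (\<lambda>n. rep_l2 (X n) x)" for x
  have [measurable]: "F \<in> borel_measurable lebesgue"
    unfolding F_def by measurable
  have lim: "AE x in lebesgue. (\<lambda>n. rep_l2 (X n) x) \<longlonglongrightarrow> F x"
    using fast_Cauchy_pointwise[OF fast] by eventually_elim (simp add: F_def convergent_LIMSEQ_iff)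
  have dist: "norm (X m - X n) \<le> 2 * (1/2)^n" if "n \<le> m" for m n
  proof -
    have "norm (X m - X n) = norm (\<Sum>k=n..<m. X (Suc k) - X k)"
      using that by (simp add: sum_Suc_diff')
    also have "\<dots> \<le> (\<Sum>k=n..<m. (1/2)^k)"
      by (intro sum_norm_le fast)
    also have "\<dots> = 2 * (1/2)^n - 2 * (1/2)^m"
      using that by (induction m rule: dec_induct) auto
    also have "\<dots> \<le> 2 * (1/2)^n" by simp
    finally show ?thesis .
  qed
  have est: "(\<integral>\<^sup>+x. ennreal ((norm (F x - rep_l2 (X n) x))\<^sup>2) \<partial>lebesgue) \<le> ennreal ((2 * (1/2)^n)\<^sup>2)" for n
  proof -
    have "(\<integral>\<^sup>+x. ennreal ((norm (F x - rep_l2 (X n) x))\<^sup>2) \<partial>lebesgue)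
       = (\<integral>\<^sup>+x. liminf (\<lambda>m. ennreal ((norm (rep_l2 (X m) x - rep_l2 (X n) x))\<^sup>2)) \<partial>lebesgue)"
    proof (intro nn_integral_cong_AE, use lim in eventually_elim)
      fix x assume "(\<lambda>n. rep_l2 (X n) x) \<longlonglongrightarrow> F x"
      then have "(\<lambda>m. ennreal ((norm (rep_l2 (X m) x - rep_l2 (X n) x))\<^sup>2)) \<longlonglongrightarrow> ennreal ((norm (F x - rep_l2 (X n) x))\<^sup>2)"
        by (intro tendsto_intros tendsto_ennrealI)
      then show "ennreal ((norm (F x - rep_l2 (X n) x))\<^sup>2) = liminf (\<lambda>m. ennreal ((norm (rep_l2 (X m) x - rep_l2 (X n) x))\<^sup>2))"
        by (intro lim_imp_Liminf[symmetric]) simp_all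
    qed
    also have "\<dots> \<le> liminf (\<lambda>m. \<integral>\<^sup>+x. ennreal ((norm (rep_l2 (X m) x - rep_l2 (X n) x))\<^sup>2) \<partial>lebesgue)"
      by (intro nn_integral_liminf) measurable
    also have "\<dots> \<le> ennreal ((2 * (1/2)^n)\<^sup>2)"
    proof (rule Liminf_le)
      show "\<forall>\<^sub>F m in sequentially. (\<integral>\<^sup>+x. ennreal ((norm (rep_l2 (X m) x - rep_l2 (X n) x))\<^sup>2) \<partial>lebesgue) \<le> ennreal ((2 * (1/2)^n)\<^sup>2)"
        unfolding nn_integral_norm_diff_l2
        by (rule eventually_sequentiallyI[of n]) (intro ennreal_leI power_mono dist; simp)
    qed simp
    finally show ?thesis .
  qed
  have sqd: "sqint (\<lambda>x. F x - rep_l2 (X n) x)" for n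
  proof -
    have "(\<integral>\<^sup>+x. ennreal (norm ((norm (F x - rep_l2 (X n) x))\<^sup>2)) \<partial>lebesgue) < \<infinity>"
      using est[of n] by (simp add: le_less_trans)
    then have "integrable lebesgue (\<lambda>x. (norm (F x - rep_l2 (X n) x))\<^sup>2)"
      by (intro integrableI_bounded) auto
    then show ?thesis by (simp add: sqint_def)
  qed
  have sqF: "sqint F"
    using sqint_add[OF sqd[of 0] sqint_rep[of "X 0"]] by simp
  have "norm (abs_l2 F - X n) \<le> 2 * (1/2)^n" for n
  proof -
    have "abs_l2 F - X n = abs_l2 (\<lambda>x. F x - rep_l2 (X n) x)"
      using abs_l2_diff[OF sqF sqint_rep[of "X n"]] by simp
    then have "ennreal ((norm (abs_l2 F - X n))\<^sup>2) = (\<integral>\<^sup>+x. ennreal ((norm (F x - rep_l2 (X n) x))\<^sup>2) \<partial>lebesgue)"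
      using nn_integral_eq_integral[of lebesgue "\<lambda>x. (norm (F x - rep_l2 (X n) x))\<^sup>2"] sqd[of n]
      by (simp add: norm_abs_l2 sqint_def)
    then have "(norm (abs_l2 F - X n))\<^sup>2 \<le> (2 * (1/2)^n)\<^sup>2"
      using est[of n] ennreal_le_iff[OF zero_le_power2] by metis
    then show ?thesis by (rule power2_le_imp_le) simp
  qed
  then have "norm (X n - abs_l2 F) \<le> 2 * (1/2)^n" for n by (simp add: norm_minus_commute)
  moreover have "(\<lambda>n. 2 * (1/2::real)^n) \<longlonglongrightarrow> 0"
    by (intro tendsto_mult_right_zero LIMSEQ_power_zero) simp
  ultimately have "(\<lambda>n. X n - abs_l2 F) \<longlonglongrightarrow> 0"
    by (intro Lim_null_comparison[of "\<lambda>n. X n - abs_l2 F"] always_eventually allI)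
  then show ?thesis
    using LIM_zero_cancel convergentI by blast
qed

instance l2 :: (euclidean_space, euclidean_space) complete_space
proof
  fix X :: "nat \<Rightarrow> ('a, 'b) l2" assume X: "Cauchy X"
  have "\<exists>N. \<forall>m\<ge>N. \<forall>n\<ge>N. norm (X m - X n) < (1/2)^k" for k
    using X by (auto simp: Cauchy_def dist_norm)
  then obtain N where N: "\<And>k m n. N k \<le> m \<Longrightarrow> N k \<le> n \<Longrightarrow> norm (X m - X n) < (1/2)^k"
    by metis
  \<comment> \<open>The maximum with \<open>Suc p\<close> keeps the indices strictly increasing, the
    one with \<open>N (Suc k)\<close> moves them into the range where \<open>X\<close> varies by
    less than the required power of 1/2.\<close>
  define r where "r = rec_nat (N 0) (\<lambda>k p. max (Suc p) (N (Suc k)))"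
  have r: "r (Suc k) = max (Suc (r k)) (N (Suc k))" "r 0 = N 0" for k
    by (auto simp: r_def)
  have "strict_mono r" by (rule strict_monoI_Suc) (simp add: r)
  moreover have "N k \<le> r k" for k by (cases k) (auto simp: r)
  moreover have "r k \<le> r (Suc k)" for k by (simp add: r)
  ultimately have "norm ((X \<circ> r) (Suc k) - (X \<circ> r) k) \<le> (1/2)^k" for k
    using N[of k "r (Suc k)" "r k"] order_trans[of "N k" "r k" "r (Suc k)"] by (simp add: less_imp_le)
  then have "convergent (X \<circ> r)" by (rule fast_Cauchy_convergent)
  then obtain L where "(X \<circ> r) \<longlonglongrightarrow> L" by (auto simp: convergent_def)
  then have "X \<longlonglongrightarrow> L" using X \<open>strict_mono r\<close> by (rule Cauchy_converges_subseq[rotated 2])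
  then show "convergent X" by (rule convergentI)
qed

section \<open>Pointwise linear operators\<close>

text \<open>Measurable families of linear maps with a bound valid at every point. Restriction to a
  set, matrix entries, transposition and contraction with the coefficient are all of this kind, so
  continuity and adjoints are proved once, for \<open>pop\<close>.\<close>

definition pfield :: "('a::euclidean_space \<Rightarrow> 'b::euclidean_space \<Rightarrow> 'c::euclidean_space) \<Rightarrow> real \<Rightarrow> bool" where
  "pfield L B \<longleftrightarrow> 0 \<le> B \<and> (\<forall>x. linear (L x)) \<and> (\<forall>x v. norm (L x v) \<le> B * norm v) \<and>
     (\<forall>v. (\<lambda>x. L x v) \<in> borel_measurable lebesgue)"

definition pop :: "('a::euclidean_space \<Rightarrow> 'b::euclidean_space \<Rightarrow> 'c::euclidean_space) \<Rightarrow> ('a, 'b) l2 \<Rightarrow> ('a, 'c) l2" where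
  "pop L F = abs_l2 (\<lambda>x. L x (rep_l2 F x))"

text \<open>Expanding the argument in the standard basis leaves only the functions
  \<open>L x b\<close> for fixed basis vectors \<open>b\<close>, whose measurability is part of
  \<open>pfield\<close>.\<close>

lemma pfield_measurable:
  assumes "pfield L B" "f \<in> borel_measurable lebesgue"
  shows "(\<lambda>x. L x (f x)) \<in> borel_measurable lebesgue"
proof -
  have "L x (f x) = (\<Sum>b\<in>Basis. (f x \<bullet> b) *\<^sub>R L x b)" for x
  proof -
    have "L x (f x) = L x (\<Sum>b\<in>Basis. (f x \<bullet> b) *\<^sub>R b)" by (simp add: euclidean_representation)
    also have "\<dots> = (\<Sum>b\<in>Basis. (f x \<bullet> b) *\<^sub>R L x b)"
      using assms(1) by (simp add: pfield_def linear_sum linear_scale)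
    finally show ?thesis .
  qed
  moreover have "(\<lambda>x. \<Sum>b\<in>Basis. (f x \<bullet> b) *\<^sub>R L x b) \<in> borel_measurable lebesgue"
    using assms by (intro borel_measurable_sum borel_measurable_scaleR borel_measurable_inner borel_measurable_const)
      (simp_all add: pfield_def)
  ultimately show ?thesis by simp
qed

lemma pfield_sqint:
  assumes L: "pfield L B" and f: "sqint f" shows "sqint (\<lambda>x. L x (f x))"
proof (rule sqint_bound[OF f])
  show "(\<lambda>x. L x (f x)) \<in> borel_measurable lebesgue"
    by (rule pfield_measurable[OF L sqint_measurable[OF f]])
  show "AE x in lebesgue. norm (L x (f x)) \<le> B * norm (f x)"
    using L by (simp add: pfield_def)
qed

lemma rep_pop_AE: "pfield L B \<Longrightarrow> AE x in lebesgue. rep_l2 (pop L F) x = L x (rep_l2 F x)"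
  unfolding pop_def by (rule rep_abs_AE) (simp add: pfield_sqint)

lemma pop_abs:
  assumes "pfield L B" "sqint f" shows "pop L (abs_l2 f) = abs_l2 (\<lambda>x. L x (f x))"
  unfolding pop_def using rep_abs_AE[OF assms(2)]
  by (subst abs_l2_eq_iff) (auto simp: pfield_sqint[OF assms(1)] assms elim: eventually_mono)

lemma pop_add: "pfield L B \<Longrightarrow> pop L (F + G) = pop L F + pop L G"
proof -
  assume L: "pfield L B"
  have lin: "linear (L x)" for x using L by (simp add: pfield_def)
  show ?thesis
    unfolding l2_eq_iff
    using rep_pop_AE[OF L, of "F + G"] rep_pop_AE[OF L, of F] rep_pop_AE[OF L, of G]
      rep_add_AE[of F G] rep_add_AE[of "pop L F" "pop L G"]
    by eventually_elim (simp add: linear_add[OF lin])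
qed

lemma pop_scaleR: "pfield L B \<Longrightarrow> pop L (c *\<^sub>R F) = c *\<^sub>R pop L F"
proof -
  assume L: "pfield L B"
  have lin: "linear (L x)" for x using L by (simp add: pfield_def)
  show ?thesis
    unfolding l2_eq_iff
    using rep_pop_AE[OF L, of "c *\<^sub>R F"] rep_pop_AE[OF L, of F]
      rep_scaleR_AE[of c F] rep_scaleR_AE[of c "pop L F"]
    by eventually_elim (simp add: linear_scale[OF lin])
qed

lemma norm_pop_le:
  assumes L: "pfield L B" shows "norm (pop L F) \<le> B * norm F"
proof -
  have B: "0 \<le> B" using L by (simp add: pfield_def)
  have "(norm (pop L F))\<^sup>2 = (\<integral>x. (norm (L x (rep_l2 F x)))\<^sup>2)"
    unfolding pop_def by (rule norm_abs_l2) (simp add: pfield_sqint[OF L])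
  also have "\<dots> \<le> (\<integral>x. B\<^sup>2 * (norm (rep_l2 F x))\<^sup>2)"
  proof (intro integral_mono)
    show "integrable lebesgue (\<lambda>x. (norm (L x (rep_l2 F x)))\<^sup>2)"
      by (rule sqint_integrable[OF pfield_sqint[OF L sqint_rep]])
    show "integrable lebesgue (\<lambda>x. B\<^sup>2 * (norm (rep_l2 F x))\<^sup>2)"
      using sqint_rep[of F] by (auto simp: sqint_def)
    show "(norm (L x (rep_l2 F x)))\<^sup>2 \<le> B\<^sup>2 * (norm (rep_l2 F x))\<^sup>2" for x
      using L by (simp flip: power_mult_distrib add: power_mono pfield_def)
  qed
  also have "\<dots> = (B * norm F)\<^sup>2"
    using norm_abs_l2[of "rep_l2 F"] by (simp add: power_mult_distrib)
  finally show ?thesis by (rule power2_le_imp_le) (simp add: B)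
qed

lemma bounded_linear_pop: "pfield L B \<Longrightarrow> bounded_linear (pop L)"
  using norm_pop_le[of L B]
  by (intro bounded_linear_intro[where K=B] pop_add[of L B] pop_scaleR[of L B]) (simp_all add: mult.commute)

lemma pop_adjoint:
  assumes "pfield L B" "pfield L' B'" "\<And>x v w. L x v \<bullet> w = v \<bullet> L' x w"
  shows "pop L F \<bullet> G = F \<bullet> pop L' G"
proof -
  have "pop L F \<bullet> G = (\<integral>x. L x (rep_l2 F x) \<bullet> rep_l2 G x)"
    unfolding pop_def using abs_l2_inner[OF pfield_sqint[OF assms(1) sqint_rep[of F]] sqint_rep[of G]] by simp
  also have "\<dots> = (\<integral>x. rep_l2 F x \<bullet> L' x (rep_l2 G x))"
    by (simp add: assms(3))
  also have "\<dots> = F \<bullet> pop L' G"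
    unfolding pop_def using abs_l2_inner[OF sqint_rep[of F] pfield_sqint[OF assms(2) sqint_rep[of G]]] by simp
  finally show ?thesis .
qed

lemma pfield_const:
  assumes "bounded_linear h" obtains B where "pfield (\<lambda>x. h) B"
proof -
  obtain K where "\<forall>x. norm (h x) \<le> norm x * K" "0 < K" using bounded_linear.pos_bounded[OF assms] by auto
  then show thesis
    using assms by (intro that[of K]) (auto simp: pfield_def mult.commute bounded_linear.linear)
qed

section \<open>Smooth functions\<close>

lemma pd_eq: "(f has_derivative f') (at x) \<Longrightarrow> pd i f x = f' (axis i 1)"
  unfolding pd_def using frechet_derivative_at by metis

lemma has_derivative_cong_open:
  assumes "open S" "x \<in> S" "\<And>y. y \<in> S \<Longrightarrow> f y = g y"
  shows "(f has_derivative f') (at x) \<longleftrightarrow> (g has_derivative f') (at x)"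
  using has_derivative_transform_within_open[OF _ assms(1,2)] assms(3) by metis

lemma pd_cong:
  assumes "open S" "x \<in> S" "\<And>y. y \<in> S \<Longrightarrow> f y = g y"
  shows "pd i f x = pd i g x"
  unfolding pd_def frechet_derivative_def using has_derivative_cong_open[OF assms] by simp

lemma differentiable_cong_open:
  assumes "open S" "x \<in> S" "\<And>y. y \<in> S \<Longrightarrow> f y = g y"
  shows "f differentiable at x \<longleftrightarrow> g differentiable at x"
  unfolding differentiable_def using has_derivative_cong_open[OF assms] by simp

lemma has_derivative_pd:
  fixes f :: "real^'n \<Rightarrow> real"
  assumes "f differentiable at x"
  shows "(f has_derivative (\<lambda>h. \<Sum>i\<in>UNIV. h $ i * pd i f x)) (at x)"
proof -
  obtain f' where f': "(f has_derivative f') (at x)" using assms by (auto simp: differentiable_def)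
  have lin: "linear f'" using f' by (rule has_derivative_linear)
  have "f' h = (\<Sum>i\<in>UNIV. h $ i * pd i f x)" for h
  proof -
    have "f' h = f' (\<Sum>i\<in>UNIV. (h $ i) *\<^sub>R axis i 1)"
      by (simp add: scalar_mult_eq_scaleR[symmetric] basis_expansion)
    also have "\<dots> = (\<Sum>i\<in>UNIV. h $ i * f' (axis i 1))"
      by (simp add: linear_sum[OF lin] linear_scale[OF lin])
    finally show ?thesis by (simp add: pd_eq[OF f'])
  qed
  then have "f' = (\<lambda>h. \<Sum>i\<in>UNIV. h $ i * pd i f x)" by blast
  then show ?thesis using f' by simp
qed

lemma pd_const [simp]: "pd i (\<lambda>x. c) x = 0"
  using pd_eq[OF has_derivative_const[of c "at x"]] by simp

lemma pd_add:
  fixes f g :: "real^'n \<Rightarrow> real"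
  assumes "f differentiable at x" "g differentiable at x"
  shows "pd i (\<lambda>y. f y + g y) x = pd i f x + pd i g x"
proof -
  obtain f' g' where "(f has_derivative f') (at x)" "(g has_derivative g') (at x)"
    using assms by (auto simp: differentiable_def)
  then show ?thesis
    using pd_eq[OF has_derivative_add, of f f' x g g'] pd_eq[of f f' x] pd_eq[of g g' x] by simp
qed

lemma pd_mult:
  fixes f g :: "real^'n \<Rightarrow> real"
  assumes "f differentiable at x" "g differentiable at x"
  shows "pd i (\<lambda>y. f y * g y) x = f x * pd i g x + pd i f x * g x"
proof -
  obtain f' g' where "(f has_derivative f') (at x)" "(g has_derivative g') (at x)"
    using assms by (auto simp: differentiable_def)
  then show ?thesis
    using pd_eq[OF has_derivative_mult, of f f' x g g'] pd_eq[of f f' x] pd_eq[of g g' x] by simp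
qed

lemma pd_cmult:
  fixes f :: "real^'n \<Rightarrow> real"
  shows "f differentiable at x \<Longrightarrow> pd i (\<lambda>y. c * f y) x = c * pd i f x"
  using pd_mult[of "\<lambda>y. c" x f i] by simp

lemma pd_sum:
  fixes f :: "'k \<Rightarrow> real^'n \<Rightarrow> real"
  assumes "finite K" "\<And>k. k \<in> K \<Longrightarrow> f k differentiable at x"
  shows "pd i (\<lambda>y. \<Sum>k\<in>K. f k y) x = (\<Sum>k\<in>K. pd i (f k) x)"
  using assms
proof (induction rule: finite_induct)
  case (insert k K)
  then show ?case by (simp add: pd_add differentiable_sum)
qed simp

lemma pd_chain:
  fixes f :: "real^'n \<Rightarrow> real"
  assumes "f differentiable at x" "(g has_real_derivative g') (at (f x))"
  shows "pd i (\<lambda>y. g (f y)) x = g' * pd i f x" "(\<lambda>y. g (f y)) differentiable at x"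
proof -
  obtain f' where f': "(f has_derivative f') (at x)" using assms by (auto simp: differentiable_def)
  have "((\<lambda>y. g (f y)) has_derivative (\<lambda>h. g' * f' h)) (at x)"
    using has_derivative_compose[OF f', of g "(*) g'"] assms(2) by (simp add: has_field_derivative_def)
  then show "pd i (\<lambda>y. g (f y)) x = g' * pd i f x" "(\<lambda>y. g (f y)) differentiable at x"
    using pd_eq[OF f'] pd_eq by (auto simp: differentiable_def)
qed

lemma pd_affine:
  fixes f :: "real^'n \<Rightarrow> real"
  assumes "f differentiable at (c + l *\<^sub>R x)"
  shows "pd i (\<lambda>y. f (c + l *\<^sub>R y)) x = l * pd i f (c + l *\<^sub>R x)" "(\<lambda>y. f (c + l *\<^sub>R y)) differentiable at x"
proof -
  obtain f' where f': "(f has_derivative f') (at (c + l *\<^sub>R x))" using assms by (auto simp: differentiable_def)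
  have "((\<lambda>y. c + l *\<^sub>R y) has_derivative (\<lambda>h. l *\<^sub>R h)) (at x)"
    by (auto intro!: derivative_eq_intros)
  from has_derivative_compose[OF this f']
  have D: "((\<lambda>y. f (c + l *\<^sub>R y)) has_derivative (\<lambda>h. f' (l *\<^sub>R h))) (at x)" .
  then show "pd i (\<lambda>y. f (c + l *\<^sub>R y)) x = l * pd i f (c + l *\<^sub>R x)" "(\<lambda>y. f (c + l *\<^sub>R y)) differentiable at x"
    using pd_eq[OF f'] pd_eq[OF D] linear_scale[OF has_derivative_linear[OF f']] by (auto simp: differentiable_def)
qed

text \<open>Local versions of \<open>Ck\<close> and \<open>smooth\<close>: the weights built from
  reciprocal distances to the faces are smooth inside the domain only. Derivatives are those of the
  whole space, so the notion is used on open sets.\<close>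

fun Ckon :: "nat \<Rightarrow> (real^'n) set \<Rightarrow> (real^'n \<Rightarrow> real) \<Rightarrow> bool" where
  "Ckon 0 S f \<longleftrightarrow> continuous_on S f"
| "Ckon (Suc k) S f \<longleftrightarrow> (\<forall>x\<in>S. f differentiable at x) \<and> (\<forall>i. Ckon k S (pd i f))"

definition smooth_on :: "(real^'n) set \<Rightarrow> (real^'n \<Rightarrow> real) \<Rightarrow> bool" where
  "smooth_on S f \<longleftrightarrow> (\<forall>k. Ckon k S f)"

lemma Ckon_UNIV: "Ckon k UNIV f \<longleftrightarrow> Ck k f"
  by (induction k arbitrary: f) auto

lemma smooth_on_UNIV: "smooth_on UNIV f \<longleftrightarrow> smooth f"
  by (simp add: smooth_on_def smooth_def Ckon_UNIV)

lemma Ckon_cong: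
  assumes "open S" shows "(\<And>x. x \<in> S \<Longrightarrow> f x = g x) \<Longrightarrow> Ckon k S f \<longleftrightarrow> Ckon k S g"
proof (induction k arbitrary: f g)
  case 0 then show ?case by (simp cong: continuous_on_cong)
next
  case (Suc k)
  have "Ckon k S (pd i f) \<longleftrightarrow> Ckon k S (pd i g)" for i
    by (rule Suc.IH) (rule pd_cong[OF assms _ Suc.prems])
  moreover have "(\<forall>x\<in>S. f differentiable at x) \<longleftrightarrow> (\<forall>x\<in>S. g differentiable at x)"
    using differentiable_cong_open[of S _ f g] assms Suc.prems by auto
  ultimately show ?case by simp
qed

lemma Ckon_subset: "Ckon k S f \<Longrightarrow> T \<subseteq> S \<Longrightarrow> Ckon k T f"
  by (induction k arbitrary: f) (auto intro: continuous_on_subset)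

text \<open>Makes smoothness a local matter. It serves to glue a formula valid in an open set to the
  zero function on the complement of a compact subset.\<close>

lemma Ckon_local:
  "(\<And>x. x \<in> S \<Longrightarrow> \<exists>T. open T \<and> x \<in> T \<and> Ckon k T f) \<Longrightarrow> Ckon k S f"
proof (induction k arbitrary: f)
  case 0
  have "isCont f x" if "x \<in> S" for x
    using 0[OF that] continuous_on_eq_continuous_at by force
  then show ?case by (simp add: continuous_at_imp_continuous_on)
next
  case (Suc k)
  have "f differentiable at x" if "x \<in> S" for x using Suc.prems[OF that] by auto
  moreover have "Ckon k S (pd i f)" for i
    by (rule Suc.IH) (use Suc.prems in force)
  ultimately show ?case by simp
qed

lemma Ckon_lower: "Ckon (Suc k) S f \<Longrightarrow> Ckon k S f"
proof (induction k arbitrary: f)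
  case 0
  then show ?case
    by (auto intro!: continuous_at_imp_continuous_on differentiable_imp_continuous_within)
next
  case (Suc k)
  then show ?case by (metis Ckon.simps(2))
qed

lemma Ckon_const: "Ckon k (S :: (real^'a) set) (\<lambda>x. c)"
proof (induction k arbitrary: c)
  case (Suc k)
  have "pd i (\<lambda>x::real^'a. c) = (\<lambda>x. 0)" for i by (simp add: fun_eq_iff)
  then show ?case using Suc by simp
qed simp

lemma Ckon_add:
  assumes "open S" shows "Ckon k S f \<Longrightarrow> Ckon k S g \<Longrightarrow> Ckon k S (\<lambda>x. f x + g x)"
proof (induction k arbitrary: f g)
  case 0 then show ?case by (simp add: continuous_on_add)
next
  case (Suc k)
  have "Ckon k S (pd i (\<lambda>x. f x + g x)) \<longleftrightarrow> Ckon k S (\<lambda>x. pd i f x + pd i g x)" for i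
    using Suc.prems by (intro Ckon_cong[OF assms]) (simp add: pd_add)
  then show ?case using Suc by simp
qed

lemma Ckon_mult:
  assumes "open S" shows "Ckon k S f \<Longrightarrow> Ckon k S g \<Longrightarrow> Ckon k S (\<lambda>x. f x * g x)"
proof (induction k arbitrary: f g)
  case 0 then show ?case by (simp add: continuous_on_mult)
next
  case (Suc k)
  have "Ckon k S (pd i (\<lambda>x. f x * g x)) \<longleftrightarrow> Ckon k S (\<lambda>x. f x * pd i g x + pd i f x * g x)" for i
    using Suc.prems by (intro Ckon_cong[OF assms]) (simp add: pd_mult)
  moreover have "Ckon k S (\<lambda>x. f x * pd i g x + pd i f x * g x)" for i
    using Suc.prems by (intro Ckon_add[OF assms] Suc.IH) (use Ckon_lower in auto)
  moreover have "\<forall>x\<in>S. (\<lambda>x. f x * g x) differentiable at x"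
    using Suc.prems by (auto intro!: differentiable_mult)
  ultimately show ?case by simp
qed

lemma Ckon_linear: "Ckon k S (\<lambda>x. a \<bullet> x)"
proof (cases k)
  case (Suc j)
  have D: "((\<lambda>x. a \<bullet> x) has_derivative (\<lambda>h. a \<bullet> h)) (at x)" for x
    by (auto intro!: derivative_eq_intros)
  then have "pd i (\<lambda>x. a \<bullet> x) = (\<lambda>x. a \<bullet> axis i 1)" for i by (intro ext pd_eq)
  then show ?thesis using Suc D by (auto simp: Ckon_const differentiable_def)
qed (simp add: continuous_on_inner)

lemma Ckon_affine:
  "Ckon k S f \<Longrightarrow> (\<And>x. x \<in> T \<Longrightarrow> c + l *\<^sub>R x \<in> S) \<Longrightarrow> open T \<Longrightarrow> Ckon k T (\<lambda>x. f (c + l *\<^sub>R x))"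
proof (induction k arbitrary: f)
  case 0
  then show ?case by (auto intro!: continuous_on_compose2[of S f] continuous_intros)
next
  case (Suc k)
  have "Ckon k T (pd i (\<lambda>x. f (c + l *\<^sub>R x))) \<longleftrightarrow> Ckon k T (\<lambda>x. l * pd i f (c + l *\<^sub>R x))" for i
    using Suc.prems by (intro Ckon_cong pd_affine) auto
  moreover have "Ckon k T (\<lambda>x. l * pd i f (c + l *\<^sub>R x))" for i
    using Suc by (intro Ckon_mult Ckon_const) auto
  ultimately show ?case using Suc.prems by (auto intro!: pd_affine)
qed

text \<open>The one-variable counterpart of \<open>Ckon\<close>, for outer functions of
  compositions. The derivative is existentially quantified so that an explicit formula can be
  supplied at each order.\<close>

fun Dk :: "nat \<Rightarrow> real set \<Rightarrow> (real \<Rightarrow> real) \<Rightarrow> bool" where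
  "Dk 0 I g \<longleftrightarrow> continuous_on I g"
| "Dk (Suc k) I g \<longleftrightarrow> (\<exists>g'. (\<forall>t\<in>I. (g has_real_derivative g' t) (at t)) \<and> Dk k I g')"

lemma Ckon_chain:
  assumes "open S"
  shows "Dk k I g \<Longrightarrow> Ckon k S f \<Longrightarrow> f ` S \<subseteq> I \<Longrightarrow> Ckon k S (\<lambda>x. g (f x))"
proof (induction k arbitrary: f g)
  case 0 then show ?case by (auto intro: continuous_on_compose2)
next
  case (Suc k)
  from Suc.prems(1) obtain g' where "\<forall>t\<in>I. (g has_real_derivative g' t) (at t)" "Dk k I g'"
    unfolding Dk.simps by blast
  then have g': "\<And>t. t \<in> I \<Longrightarrow> (g has_real_derivative g' t) (at t)" "Dk k I g'" by auto
  have gf: "(g has_real_derivative g' (f x)) (at (f x))" if "x \<in> S" for x using g' that Suc.prems by auto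
  have fd: "f differentiable at x" if "x \<in> S" for x using Suc.prems that by auto
  have "Ckon k S (pd i (\<lambda>x. g (f x))) \<longleftrightarrow> Ckon k S (\<lambda>x. g' (f x) * pd i f x)" for i
    by (intro Ckon_cong[OF assms] pd_chain(1) gf fd)
  moreover have "Ckon k S (\<lambda>x. g' (f x) * pd i f x)" for i
    using Suc.prems(2) Suc.IH[OF g'(2) Ckon_lower[OF Suc.prems(2)] Suc.prems(3)]
    by (intro Ckon_mult[OF assms]) auto
  moreover have "\<forall>x\<in>S. (\<lambda>x. g (f x)) differentiable at x"
    using pd_chain(2)[OF fd gf] by blast
  ultimately show ?case by simp
qed

lemma smooth_on_subset: "smooth_on S f \<Longrightarrow> T \<subseteq> S \<Longrightarrow> smooth_on T f"
  unfolding smooth_on_def using Ckon_subset by blast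

lemma smooth_on_const: "smooth_on S (\<lambda>x. c)"
  by (simp add: smooth_on_def Ckon_const)

lemma smooth_on_linear: "smooth_on S (\<lambda>x. a \<bullet> x)"
  by (simp add: smooth_on_def Ckon_linear)

lemma smooth_on_add: "open S \<Longrightarrow> smooth_on S f \<Longrightarrow> smooth_on S g \<Longrightarrow> smooth_on S (\<lambda>x. f x + g x)"
  by (simp add: smooth_on_def Ckon_add)

lemma smooth_on_mult: "open S \<Longrightarrow> smooth_on S f \<Longrightarrow> smooth_on S g \<Longrightarrow> smooth_on S (\<lambda>x. f x * g x)"
  by (simp add: smooth_on_def Ckon_mult)

lemma smooth_on_diff: "open S \<Longrightarrow> smooth_on S f \<Longrightarrow> smooth_on S g \<Longrightarrow> smooth_on S (\<lambda>x. f x - g x)"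
  using smooth_on_add[of S f "\<lambda>x. (-1) * g x"] smooth_on_mult[OF _ smooth_on_const[of S "-1"], of g] by simp

lemma smooth_on_sum:
  assumes "open S" "finite K" "\<And>k. k \<in> K \<Longrightarrow> smooth_on S (f k)"
  shows "smooth_on S (\<lambda>x. \<Sum>k\<in>K. f k x)"
  using assms(2,3)
  by (induction K rule: finite_induct) (simp_all add: smooth_on_const smooth_on_add assms(1))

lemma smooth_on_prod:
  assumes "open S" "finite K" "\<And>k. k \<in> K \<Longrightarrow> smooth_on S (f k)"
  shows "smooth_on S (\<lambda>x. \<Prod>k\<in>K. f k x)"
  using assms(2,3)
  by (induction K rule: finite_induct) (simp_all add: smooth_on_const smooth_on_mult assms(1))

lemma smooth_on_chain:
  "open S \<Longrightarrow> (\<And>k. Dk k I g) \<Longrightarrow> smooth_on S f \<Longrightarrow> f ` S \<subseteq> I \<Longrightarrow> smooth_on S (\<lambda>x. g (f x))"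
  unfolding smooth_on_def using Ckon_chain by blast

lemma smooth_on_affine: "smooth f \<Longrightarrow> smooth (\<lambda>x. f (c + l *\<^sub>R x))"
  unfolding smooth_on_UNIV[symmetric] smooth_on_def using Ckon_affine[of _ UNIV f UNIV] by simp

lemma smooth_on_cong:
  "open S \<Longrightarrow> (\<And>x. x \<in> S \<Longrightarrow> f x = g x) \<Longrightarrow> smooth_on S f \<longleftrightarrow> smooth_on S g"
  unfolding smooth_on_def using Ckon_cong by blast

lemma smooth_on_local:
  "(\<And>x. x \<in> S \<Longrightarrow> \<exists>T. open T \<and> x \<in> T \<and> smooth_on T f) \<Longrightarrow> smooth_on S f"
  unfolding smooth_on_def using Ckon_local by metis

lemma smooth_on_pd: "smooth_on S f \<Longrightarrow> smooth_on S (pd i f)"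
  unfolding smooth_on_def by (metis Ckon.simps(2))

lemma smooth_on_differentiable: "smooth_on S f \<Longrightarrow> x \<in> S \<Longrightarrow> f differentiable at x"
  unfolding smooth_on_def by (metis Ckon.simps(2))

lemma smooth_on_continuous: "smooth_on S f \<Longrightarrow> continuous_on S f"
  unfolding smooth_on_def by (metis Ckon.simps(1))

lemma smooth_pd: "smooth f \<Longrightarrow> smooth (pd i f)"
  using smooth_on_pd[of UNIV] by (simp add: smooth_on_UNIV)

lemma smooth_differentiable: "smooth f \<Longrightarrow> f differentiable at x"
  using smooth_on_differentiable[of UNIV] by (simp add: smooth_on_UNIV)

lemma smooth_continuous: "smooth f \<Longrightarrow> continuous_on S f"
  using smooth_on_continuous[of UNIV f] continuous_on_subset[of UNIV f S] by (simp add: smooth_on_UNIV)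

lemmas smooth_intros = smooth_on_const[of UNIV, unfolded smooth_on_UNIV] smooth_on_linear[of UNIV, unfolded smooth_on_UNIV]
  smooth_on_add[OF open_UNIV, unfolded smooth_on_UNIV] smooth_on_mult[OF open_UNIV, unfolded smooth_on_UNIV]
  smooth_on_diff[OF open_UNIV, unfolded smooth_on_UNIV] smooth_on_sum[OF open_UNIV, unfolded smooth_on_UNIV]
  smooth_on_prod[OF open_UNIV, unfolded smooth_on_UNIV]

section \<open>One-variable profiles: flat functions, reciprocals and the convex cutoff\<close>

lemma Dk_add: "Dk k I f \<Longrightarrow> Dk k I g \<Longrightarrow> Dk k I (\<lambda>t. f t + g t)"
proof (induction k arbitrary: f g)
  case 0 then show ?case by (simp add: continuous_on_add)
next
  case (Suc k)
  then obtain f' g' where "\<forall>t\<in>I. (f has_real_derivative f' t) (at t)" "Dk k I f'"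
    "\<forall>t\<in>I. (g has_real_derivative g' t) (at t)" "Dk k I g'" by auto
  then show ?case using Suc.IH[of f' g'] by (auto intro!: exI[of _ "\<lambda>t. f' t + g' t"] DERIV_add)
qed

lemma Dk_cmult: "Dk k I f \<Longrightarrow> Dk k I (\<lambda>t. c * f t)"
proof (induction k arbitrary: f)
  case 0 then show ?case by (simp add: continuous_on_mult)
next
  case (Suc k)
  then obtain f' where "\<forall>t\<in>I. (f has_real_derivative f' t) (at t)" "Dk k I f'" by auto
  then show ?case using Suc.IH[of f'] by (auto intro!: exI[of _ "\<lambda>t. c * f' t"] DERIV_cmult)
qed

text \<open>For \<open>m = 0\<close> this is the classical flat function exp(-1/t). The powers of
  \<open>1/t\<close> are carried along because the linear span of the family is then closed under
  differentiation.\<close>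

definition gexp :: "nat \<Rightarrow> real \<Rightarrow> real" where
  "gexp m t = (if t \<le> 0 then 0 else (1/t)^m * exp (-1/t))"

lemma gexp_nonneg: "0 \<le> gexp m t"
  by (simp add: gexp_def)

lemma exp_ge_partial_sum:
  assumes "0 \<le> (x::real)" "finite K" shows "(\<Sum>n\<in>K. x^n /\<^sub>R fact n) \<le> exp x"
proof -
  have "(\<Sum>n\<in>K. x^n /\<^sub>R fact n) \<le> (\<Sum>n. x^n /\<^sub>R fact n)"
    using assms by (intro sum_le_suminf summable_exp_generic) auto
  then show ?thesis by (simp add: exp_def)
qed

lemma power_exp_le: "(x::real)^k * exp (-x) \<le> fact k" if "0 \<le> x"
proof -
  have "(\<Sum>n\<in>{k}. x^n /\<^sub>R fact n) \<le> exp x"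
    by (rule exp_ge_partial_sum) (use that in auto)
  then show ?thesis by (simp add: exp_minus field_simps)
qed

text \<open>The bound x^k exp(-x) \<le> k! at x = 1/t with k = m + 2. Being quadratic in
  \<open>t\<close>, it makes the difference quotient at 0 tend to 0.\<close>

lemma gexp_le: "gexp m t \<le> fact (m + 2) * t\<^sup>2"
proof (cases "t \<le> 0")
  case False
  then have "(1/t)^(m+2) * exp (-(1/t)) \<le> fact (m+2)"
    by (intro power_exp_le) simp
  then show ?thesis using False by (simp add: gexp_def field_simps power_add power2_eq_square)
qed (simp add: gexp_def)

lemma gexp_has_derivative:
  "(gexp m has_real_derivative (gexp (m+2) t - real m * gexp (m+1) t)) (at t)"
proof -
  consider "t < 0" | "t = 0" | "t > 0" by linarith
  then show ?thesis
  proof cases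
    case 1
    have "((\<lambda>t. 0) has_real_derivative 0) (at t)" by simp
    then have "(gexp m has_real_derivative 0) (at t)"
      by (rule DERIV_cong_ev[THEN iffD1, OF refl _ refl, rotated])
        (use 1 in \<open>auto simp: gexp_def eventually_nhds intro!: exI[of _ "{..<0}"]\<close>)
    then show ?thesis using 1 by (simp add: gexp_def)
  next
    case 2
    have "((\<lambda>h. gexp m h / h) \<longlongrightarrow> 0) (at 0)"
    proof (rule Lim_null_comparison)
      show "\<forall>\<^sub>F h in at 0. norm (gexp m h / h) \<le> fact (m + 2) * \<bar>h\<bar>"
      proof (rule always_eventually, rule allI)
        fix h :: real
        show "norm (gexp m h / h) \<le> fact (m + 2) * \<bar>h\<bar>"
        proof (cases "h = 0")
          case False
          have "norm (gexp m h / h) = gexp m h / \<bar>h\<bar>"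
            using gexp_nonneg[of m h] by simp
          also have "\<dots> \<le> (fact (m + 2) * h\<^sup>2) / \<bar>h\<bar>"
            by (intro divide_right_mono gexp_le) simp
          also have "c * h\<^sup>2 / \<bar>h\<bar> = c * \<bar>h\<bar>" for c
            using False by (cases "h \<ge> 0") (simp_all add: power2_eq_square)
          finally show ?thesis .
        qed simp
      qed
      show "((\<lambda>h. fact (m + 2) * \<bar>h\<bar>) \<longlongrightarrow> 0) (at (0::real))"
        by (intro tendsto_mult_right_zero tendsto_rabs_zero tendsto_ident_at)
    qed
    then show ?thesis using 2 by (simp add: DERIV_def gexp_def)
  next
    case 3
    have "((\<lambda>t. (1/t)^m * exp (-1/t)) has_real_derivative
        (gexp (m+2) t - real m * gexp (m+1) t)) (at t)"
    proof -
      have i: "((\<lambda>t. 1/t) has_real_derivative - (1/t)\<^sup>2) (at t)"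
        using 3 by (auto intro!: derivative_eq_intros simp: power2_eq_square divide_simps)
      have "((\<lambda>t. -1/t) has_real_derivative (1/t)\<^sup>2) (at t)"
        using DERIV_minus[OF i] by simp
      from DERIV_mult[OF DERIV_power[OF i, of m] DERIV_fun_exp[OF this]] show ?thesis
        by (rule DERIV_cong) (cases m; use 3 in \<open>simp add: gexp_def power2_eq_square algebra_simps\<close>)
    qed
    then show ?thesis
      by (rule DERIV_cong_ev[THEN iffD1, OF refl _ refl, rotated])
        (use 3 in \<open>auto simp: gexp_def eventually_nhds intro!: exI[of _ "{0<..}"]\<close>)
  qed
qed

lemma Dk_gexp: "Dk k UNIV (gexp m)"
proof (induction k arbitrary: m)
  case 0
  show ?case
    using DERIV_isCont[OF gexp_has_derivative] by (simp add: continuous_at_imp_continuous_on)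
next
  case (Suc k)
  have "Dk k UNIV (\<lambda>t. gexp (m+2) t + (- real m) * gexp (m+1) t)"
    by (intro Dk_add Dk_cmult Suc)
  then have "Dk k UNIV (\<lambda>t. gexp (m+2) t - real m * gexp (m+1) t)" by simp
  then show ?case
    unfolding Dk.simps by (intro exI[of _ "\<lambda>t. gexp (m+2) t - real m * gexp (m+1) t"] conjI ballI gexp_has_derivative)
qed

lemma Dk_inverse: "Dk k {0<..} (\<lambda>t. c * (1/t)^m)"
proof (induction k arbitrary: m c)
  case 0 show ?case by (auto intro!: continuous_intros)
next
  case (Suc k)
  have "((\<lambda>t. c * (1/t)^m) has_real_derivative (- c * real m) * (1/t)^(m+1)) (at t)" if "t > 0" for t :: real
  proof -
    have "((\<lambda>t. 1/t) has_real_derivative - (1/t)\<^sup>2) (at t)"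
      using that by (auto intro!: derivative_eq_intros simp: power2_eq_square divide_simps)
    from DERIV_cmult[OF DERIV_power[OF this, of m], of c] show ?thesis
      by (rule DERIV_cong) (cases m; simp add: power2_eq_square)
  qed
  then show ?case
    unfolding Dk.simps using Suc[of "- c * real m" "m+1"]
    by (intro exI[of _ "\<lambda>t. (- c * real m) * (1/t)^(m+1)"] conjI ballI) auto
qed

text \<open>A smooth convex substitute for the positive part: zero on the negative axis, of linear
  growth, with first derivative \<open>gexp 0 + gexp 1\<close> and second derivative
  \<open>gexp 3\<close>, both nonnegative. Composed with a concave function it keeps the sign of the
  concave contribution, and the only error comes from \<open>gexp 3\<close>.\<close>

definition hfun :: "real \<Rightarrow> real" where
  "hfun t = t * gexp 0 t"

lemma hfun_has_derivative: "(hfun has_real_derivative (gexp 0 t + gexp 1 t)) (at t)"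
proof -
  have "t * gexp 2 t = gexp 1 t" by (simp add: gexp_def power2_eq_square)
  then show ?thesis
    unfolding hfun_def using gexp_has_derivative[of 0 t]
    by (auto intro!: derivative_eq_intros simp: numeral_2_eq_2 mult.commute)
qed

lemma hfun_has_derivative2: "((\<lambda>t. gexp 0 t + gexp 1 t) has_real_derivative gexp 3 t) (at t)"
  using gexp_has_derivative[of 0 t] gexp_has_derivative[of 1 t]
  by (auto intro!: derivative_eq_intros simp: numeral_2_eq_2 numeral_3_eq_3)

lemma Dk_hfun: "Dk k UNIV hfun"
proof (cases k)
  case 0
  then show ?thesis using DERIV_isCont[OF hfun_has_derivative] by (simp add: continuous_at_imp_continuous_on)
next
  case (Suc j)
  then show ?thesis using hfun_has_derivative Dk_add[OF Dk_gexp Dk_gexp, of j 0 1]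
    by (auto intro!: exI[of _ "\<lambda>t. gexp 0 t + gexp 1 t"])
qed

text \<open>The cubic Taylor polynomial of exp(1/t) is a lower bound, which gives an upper bound for
  exp(-1/t) by a rational function. The first estimate supplies the dominating constant for the
  cutoff error, the second its decay when the argument tends to infinity.\<close>

lemma gexp3_bound: "gexp 3 t * (1 + t) \<le> 6" "t > 0 \<Longrightarrow> gexp 3 t * (1 + t) \<le> 1 / t\<^sup>2"
proof -
  have *: "exp (-(1/t)) \<le> 6 * t^3 / (6 * t^3 + 6 * t\<^sup>2 + 3 * t + 1)" if "t > 0"
  proof -
    have "(\<Sum>n\<in>{..<4}. (1/t)^n /\<^sub>R fact n) \<le> exp (1/t)"
      by (rule exp_ge_partial_sum) (use that in auto)
    then have "(6 * t^3 + 6 * t\<^sup>2 + 3 * t + 1) / (6 * t^3) \<le> exp (1/t)"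
      using that by (simp add: eval_nat_numeral field_simps)
    then have "exp (-(1/t)) * ((6 * t^3 + 6 * t\<^sup>2 + 3 * t + 1) / (6 * t^3)) \<le> exp (-(1/t)) * exp (1/t)"
      by (intro mult_left_mono) simp_all
    then have "exp (-(1/t)) * (6 * t^3 + 6 * t\<^sup>2 + 3 * t + 1) \<le> 6 * t^3"
      using that by (simp add: mult_exp_exp pos_divide_le_eq)
    moreover have "0 < 6 * t^3 + 6 * t\<^sup>2 + 3 * t + 1"
      using that by (simp add: add_pos_pos)
    ultimately show ?thesis
      by (simp add: pos_le_divide_eq)
  qed
  have **: "gexp 3 t * (1 + t) \<le> (1/t)^3 * (6 * t^3 / (6 * t^3 + 6 * t\<^sup>2 + 3 * t + 1)) * (1 + t)" if "t > 0"
  proof -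
    have "(1/t)^3 * exp (-(1/t)) * (1 + t) \<le> (1/t)^3 * (6 * t^3 / (6 * t^3 + 6 * t\<^sup>2 + 3 * t + 1)) * (1 + t)"
      using that * by (intro mult_right_mono mult_left_mono) auto
    then show ?thesis using that by (simp add: gexp_def)
  qed
  show "gexp 3 t * (1 + t) \<le> 6"
  proof (cases "t \<le> 0")
    case False
    then have "gexp 3 t * (1 + t) \<le> (1/t)^3 * (6 * t^3 / (6 * t^3 + 6 * t\<^sup>2 + 3 * t + 1)) * (1 + t)"
      using ** by simp
    also have "\<dots> = 6 * (1 + t) / (6 * t^3 + 6 * t\<^sup>2 + 3 * t + 1)"
      using False by (simp add: field_simps)
    also have "\<dots> \<le> 6"
      using False by (simp add: divide_le_eq add_pos_nonneg)
    finally show ?thesis .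
  qed (simp add: gexp_def)
  assume t: "t > 0"
  have "gexp 3 t * (1 + t) \<le> (1/t)^3 * (6 * t^3 / (6 * t^3 + 6 * t\<^sup>2 + 3 * t + 1)) * (1 + t)"
    using ** t by simp
  also have "\<dots> = 6 * (1 + t) / (6 * t^3 + 6 * t\<^sup>2 + 3 * t + 1)"
    using t by (simp add: field_simps)
  also have "\<dots> \<le> 1 / t\<^sup>2"
  proof -
    have "6 * (1 + t) * t\<^sup>2 \<le> 6 * t^3 + 6 * t\<^sup>2 + 3 * t + 1"
      using t by (simp add: algebra_simps power2_eq_square power3_eq_cube)
    then show ?thesis using t by (simp add: divide_simps add_pos_pos)
  qed
  finally show "gexp 3 t * (1 + t) \<le> 1 / t\<^sup>2" .
qed

section \<open>Projections and best approximation\<close>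

text \<open>The first variation argument: at \<open>t = - a / k\<close>, with \<open>k\<close>
  positive and at least \<open>c\<close>, the quadratic is at most -a^2/k. Used for orthogonality of
  best approximations and for minimizers of the Rayleigh quotient.\<close>

lemma quadratic_nonneg_imp_zero:
  fixes a c :: real
  assumes "\<And>t. 0 \<le> 2 * t * a + t\<^sup>2 * c" shows "a = 0"
proof -
  define k where "k = \<bar>c\<bar> + 1"
  have k: "k > 0" "c \<le> k" by (auto simp: k_def)
  have "0 \<le> 2 * (-a / k) * a + (-a / k)\<^sup>2 * c" by (rule assms)
  also have "\<dots> \<le> 2 * (-a / k) * a + (-a / k)\<^sup>2 * k"
    using k by (intro add_left_mono mult_left_mono) auto
  also have "\<dots> = - a\<^sup>2 / k" using k by (simp add: field_simps power2_eq_square)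
  finally have "a\<^sup>2 \<le> 0" using k by (simp add: field_simps)
  then show ?thesis by simp
qed

lemma closed_subspace_projection:
  fixes S :: "'a::{real_inner,complete_space} set"
  assumes "closed S" and S: "subspace S"
  obtains p where "p \<in> S" "\<And>y. y \<in> S \<Longrightarrow> (x - p) \<bullet> y = 0"
proof -
  define D where "D = Inf ((\<lambda>y. (norm (x - y))\<^sup>2) ` S)"
  have ne: "(\<lambda>y. (norm (x - y))\<^sup>2) ` S \<noteq> {}" using subspace_0[OF S] by auto
  have bdd: "bdd_below ((\<lambda>y. (norm (x - y))\<^sup>2) ` S)" by (rule bdd_belowI2[of _ 0]) simp
  have D: "D \<le> (norm (x - y))\<^sup>2" if "y \<in> S" for y
    unfolding D_def by (rule cINF_lower[OF bdd that])
  have "\<exists>y\<in>S. (norm (x - y))\<^sup>2 < D + 1 / real (Suc n)" for n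
    using cInf_lessD[OF ne, of "D + 1 / real (Suc n)"] by (auto simp: D_def)
  then obtain y where y: "\<And>n. y n \<in> S" "\<And>n. (norm (x - y n))\<^sup>2 < D + 1 / real (Suc n)" by metis
  \<comment> \<open>Parallelogram identity. The midpoint lies in \<open>S\<close>, so its squared
    distance to \<open>x\<close> is at least \<open>D\<close>; a minimizing sequence is therefore
    Cauchy.\<close>
  have par: "(norm (y n - y m))\<^sup>2 \<le> 2 / real (Suc n) + 2 / real (Suc m)" for n m
  proof -
    have mid: "(1/2) *\<^sub>R (y n + y m) \<in> S" using y(1) by (intro subspace_scale subspace_add S)
    have "(norm (y n - y m))\<^sup>2 = 2 * (norm (x - y n))\<^sup>2 + 2 * (norm (x - y m))\<^sup>2 - 4 * (norm (x - (1/2) *\<^sub>R (y n + y m)))\<^sup>2"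
      by (simp add: power2_norm_eq_inner inner_simps algebra_simps inner_commute)
    then show ?thesis using y(2)[of n] y(2)[of m] D[OF mid] by linarith
  qed
  have "Cauchy y"
  proof (rule metric_CauchyI)
    fix e :: real assume e: "0 < e"
    obtain N where N: "1 / real (Suc N) < e\<^sup>2 / 4" using e nat_approx_posE[of "e\<^sup>2 / 4"] by auto
    have "dist (y m) (y n) < e" if "m \<ge> N" "n \<ge> N" for m n
    proof -
      have "1 / real (Suc m) \<le> 1 / real (Suc N)" "1 / real (Suc n) \<le> 1 / real (Suc N)"
        using that by (simp_all add: frac_le)
      then have "(norm (y m - y n))\<^sup>2 < e\<^sup>2" using par[of m n] N by simp
      then show ?thesis using e by (simp add: dist_norm power_less_imp_less_base)
    qed
    then show "\<exists>M. \<forall>m\<ge>M. \<forall>n\<ge>M. dist (y m) (y n) < e" by blast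
  qed
  then obtain p where p: "y \<longlonglongrightarrow> p" using Cauchy_convergent_iff convergent_def by blast
  have pS: "p \<in> S" using closed_sequentially[OF assms(1) _ p] y(1) by blast
  have "(\<lambda>n. (norm (x - y n))\<^sup>2) \<longlonglongrightarrow> (norm (x - p))\<^sup>2" by (intro tendsto_intros p)
  moreover have "(\<lambda>n. D + 1 / real (Suc n)) \<longlonglongrightarrow> D + 0"
    by (intro tendsto_intros LIMSEQ_Suc[OF lim_1_over_n])
  ultimately have pD: "(norm (x - p))\<^sup>2 \<le> D"
    using y(2) by (intro LIMSEQ_le[of "\<lambda>n. (norm (x - y n))\<^sup>2" _ "\<lambda>n. D + 1 / real (Suc n)"]) (auto intro: less_imp_le)
  have "(x - p) \<bullet> z = 0" if z: "z \<in> S" for z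
  proof -
    have "0 \<le> 2 * t * ((x - p) \<bullet> z) + t\<^sup>2 * (z \<bullet> z)" for t
    proof -
      have "p - t *\<^sub>R z \<in> S" using pS z by (intro subspace_diff subspace_scale S)
      then have "(norm (x - p))\<^sup>2 \<le> (norm (x - (p - t *\<^sub>R z)))\<^sup>2" by (rule order_trans[OF pD D])
      also have "\<dots> = (norm (x - p))\<^sup>2 + 2 * t * ((x - p) \<bullet> z) + t\<^sup>2 * (z \<bullet> z)"
      proof -
        have "(norm (r + t *\<^sub>R z))\<^sup>2 = (norm r)\<^sup>2 + 2 * t * (r \<bullet> z) + t\<^sup>2 * (z \<bullet> z)" for r
          unfolding power2_norm_eq_inner
          by (simp add: inner_simps algebra_simps inner_commute[of z r] power2_eq_square)
        from this[of "x - p"] show ?thesis by (simp add: algebra_simps)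
      qed
      finally show ?thesis by simp
    qed
    then show ?thesis by (rule quadratic_nonneg_imp_zero)
  qed
  with pS show thesis by (rule that)
qed

text \<open>The residual of the projection of \<open>x\<close> lies in \<open>W\<close> and is
  orthogonal to \<open>S\<close>, hence it is zero. Applied to a closure, this is the usual density
  criterion.\<close>

lemma closed_subspace_eqI:
  fixes S :: "'a::{real_inner,complete_space} set"
  assumes "closed S" "subspace S" "x \<in> W" "subspace W" "S \<subseteq> W"
    and orth: "\<And>v. v \<in> W \<Longrightarrow> (\<And>y. y \<in> S \<Longrightarrow> v \<bullet> y = 0) \<Longrightarrow> v = 0"
  shows "x \<in> S"
proof -
  obtain p where p: "p \<in> S" "\<And>y. y \<in> S \<Longrightarrow> (x - p) \<bullet> y = 0"
    using closed_subspace_projection[OF assms(1,2)] by blast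
  have "x - p = 0" using p assms by (intro orth subspace_diff) auto
  then show ?thesis using p by simp
qed

text \<open>The trial norm is a mere function on a subset of a vector space, so compactness of balls
  cannot be invoked. Instead the spanning set grows by one vector \<open>b\<close> at a time: the
  distance to \<open>span B\<close> after subtracting \<open>t *\<^sub>R b\<close> is a Lipschitz
  function of the real number \<open>t\<close>, and it remains to minimize it.\<close>

lemma best_approximation_seminorm:
  fixes p :: "'a::real_vector \<Rightarrow> real"
  assumes W: "subspace W"
    and add: "\<And>x y. x \<in> W \<Longrightarrow> y \<in> W \<Longrightarrow> p (x + y) \<le> p x + p y"
    and scale: "\<And>c x. x \<in> W \<Longrightarrow> p (c *\<^sub>R x) = \<bar>c\<bar> * p x"
    and "finite B" "B \<subseteq> W" "x \<in> W"
  shows "\<exists>w\<in>span B. \<forall>z\<in>span B. p (x - w) \<le> p (x - z)"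
  using assms(4-)
proof (induction B arbitrary: x rule: finite_induct)
  case (insert b B)
  have bW: "b \<in> W" and BW: "span B \<subseteq> W" using insert.prems span_minimal[OF _ W, of B] by auto
  have nonneg: "0 \<le> p y" if "y \<in> W" for y
    using add[OF that subspace_neg[OF W that]] scale[OF that, of 0] scale[OF that, of "-1"] by simp
  have "\<exists>w\<in>span B. \<forall>z\<in>span B. p (x - t *\<^sub>R b - w) \<le> p (x - t *\<^sub>R b - z)" for t
    using insert.prems bW by (intro insert.IH subspace_diff subspace_scale W) auto
  then obtain w where w: "\<And>t. w t \<in> span B" "\<And>t z. z \<in> span B \<Longrightarrow> p (x - t *\<^sub>R b - w t) \<le> p (x - t *\<^sub>R b - z)"
    by metis
  obtain wb where wb: "wb \<in> span B" "\<And>z. z \<in> span B \<Longrightarrow> p (b - wb) \<le> p (b - z)"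
    using insert.IH[of b] insert.prems bW by auto
  define f where "f t = p (x - t *\<^sub>R b - w t)" for t
  have mem: "x - t *\<^sub>R b - z \<in> W" if "z \<in> span B" for t z
    using that BW insert.prems bW by (intro subspace_diff subspace_scale W) auto
  have lip: "f t \<le> f s + \<bar>t - s\<bar> * p b" for s t
  proof -
    have "f t \<le> p (x - t *\<^sub>R b - w s)" unfolding f_def by (rule w(2)[OF w(1)])
    also have "x - t *\<^sub>R b - w s = (x - s *\<^sub>R b - w s) + (s - t) *\<^sub>R b" by (simp add: algebra_simps)
    also have "p \<dots> \<le> f s + \<bar>s - t\<bar> * p b"
      unfolding f_def scale[OF bW, symmetric] by (intro add mem w(1) subspace_scale W bW)
    finally show ?thesis by (simp add: abs_minus_commute)
  qed
  have "\<exists>t. \<forall>s. f t \<le> f s"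
  \<comment> \<open>If \<open>b\<close> is at distance zero from \<open>span B\<close>, it can be
    traded for \<open>wb\<close> at no cost and the coefficient 0 is optimal. Otherwise
    \<open>f\<close> grows linearly and a compact interval contains a minimum.\<close>
  proof (cases "p (b - wb) = 0")
    case True
    have "f 0 \<le> f s" for s
    proof -
      have "f 0 \<le> p (x - 0 *\<^sub>R b - (w s + s *\<^sub>R wb))"
        unfolding f_def by (rule w(2)) (intro span_add span_scale w(1) wb(1))
      also have "x - 0 *\<^sub>R b - (w s + s *\<^sub>R wb) = (x - s *\<^sub>R b - w s) + s *\<^sub>R (b - wb)" by (simp add: algebra_simps)
      also have "p \<dots> \<le> f s + p (s *\<^sub>R (b - wb))"
        unfolding f_def using wb(1) BW by (intro add mem w(1) subspace_scale subspace_diff W bW) auto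
      also have "p (s *\<^sub>R (b - wb)) = 0"
        using True wb(1) BW by (subst scale) (auto intro!: subspace_diff W bW)
      finally show ?thesis by simp
    qed
    then show ?thesis by blast
  next
    case False
    define \<beta> where "\<beta> = p (b - wb)"
    have \<beta>: "\<beta> > 0" using False nonneg[of "b - wb"] wb(1) BW bW W by (force simp: \<beta>_def subspace_diff)
    \<comment> \<open>Since \<open>\<bar>s\<bar> * \<beta> \<le> p x + f s\<close>, any
      \<open>s\<close> of modulus above \<open>R\<close> has
      \<open>f s \<ge> p x \<ge> f 0\<close>.\<close>
    define R where "R = 2 * p x / \<beta>"
    have R: "R \<ge> 0" using \<beta> nonneg insert.prems by (simp add: R_def)
    have far: "f 0 \<le> f s" if "\<bar>s\<bar> > R" for s
    proof -
      have s: "s \<noteq> 0" using that R by auto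
      have z: "(- 1 / s) *\<^sub>R w s \<in> span B" by (intro span_scale w(1))
      have "\<bar>s\<bar> * \<beta> \<le> \<bar>s\<bar> * p (b - (- 1 / s) *\<^sub>R w s)"
        unfolding \<beta>_def by (intro mult_left_mono wb(2) z) simp
      also have "\<dots> = p (s *\<^sub>R (b - (- 1 / s) *\<^sub>R w s))"
        using z BW by (intro scale[symmetric] subspace_diff W bW) auto
      also have "s *\<^sub>R (b - (- 1 / s) *\<^sub>R w s) = x + (-1) *\<^sub>R (x - s *\<^sub>R b - w s)"
        using s by (simp add: algebra_simps)
      also have "p \<dots> \<le> p x + p ((-1) *\<^sub>R (x - s *\<^sub>R b - w s))"
        using insert.prems by (intro add mem w(1) subspace_scale W) auto
      also have "p ((-1) *\<^sub>R (x - s *\<^sub>R b - w s)) = f s"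
        unfolding f_def by (subst scale[OF mem[OF w(1)]]) simp
      finally have "\<bar>s\<bar> * \<beta> \<le> p x + f s" .
      moreover have "2 * p x \<le> \<bar>s\<bar> * \<beta>"
        using that \<beta> by (simp add: R_def pos_divide_less_eq less_imp_le)
      moreover have "f 0 \<le> p x"
        using w(2)[of 0 0] by (simp add: f_def span_zero)
      ultimately show ?thesis by simp
    qed
    have pb: "0 \<le> p b" by (rule nonneg[OF bW])
    have "continuous_on {-R..R} f"
    proof (rule continuous_on_iff[THEN iffD2], intro ballI allI impI)
      fix t e :: real assume "0 < e"
      have "dist (f s) (f t) < e" if "dist s t < e / (p b + 1)" for s
      proof -
        have "\<bar>f s - f t\<bar> \<le> \<bar>s - t\<bar> * p b"
          using lip[of s t] lip[of t s] by (simp add: abs_le_iff abs_minus_commute)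
        also have "\<dots> \<le> \<bar>s - t\<bar> * (p b + 1)" by (intro mult_left_mono) auto
        also have "\<dots> < e" using that pb by (simp add: dist_real_def pos_less_divide_eq)
        finally show ?thesis by (simp add: dist_real_def)
      qed
      then show "\<exists>d>0. \<forall>s\<in>{-R..R}. dist s t < d \<longrightarrow> dist (f s) (f t) < e"
        using \<open>0 < e\<close> pb by (intro exI[of _ "e / (p b + 1)"]) auto
    qed
    then obtain t where t: "t \<in> {-R..R}" "\<And>s. s \<in> {-R..R} \<Longrightarrow> f t \<le> f s"
      using continuous_attains_inf[of "{-R..R}" f] R by auto
    have "f t \<le> f s" for s
    proof (cases "\<bar>s\<bar> \<le> R")
      case True then show ?thesis using t(2)[of s] by (simp add: abs_le_iff)
    next
      case False then show ?thesis using far[of s] t(2)[of 0] R by auto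
    qed
    then show ?thesis by blast
  qed
  then obtain t where t: "\<And>s. f t \<le> f s" by blast
  show ?case
  proof (intro bexI ballI)
    have sub: "span B \<subseteq> span (insert b B)" by (rule span_mono) auto
    show "t *\<^sub>R b + w t \<in> span (insert b B)"
      using w(1) sub by (intro span_add[OF span_scale[OF span_base]]) auto
    fix z assume "z \<in> span (insert b B)"
    then obtain k where k: "z - k *\<^sub>R b \<in> span B" using span_breakdown_eq by blast
    have "p (x - (t *\<^sub>R b + w t)) = f t" by (simp add: f_def algebra_simps)
    also have "\<dots> \<le> f k" by (rule t)
    also have "\<dots> \<le> p (x - k *\<^sub>R b - (z - k *\<^sub>R b))" unfolding f_def by (rule w(2)[OF k])
    finally show "p (x - (t *\<^sub>R b + w t)) \<le> p (x - z)" by simp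
  qed
qed (auto intro!: bexI[of _ 0])

text \<open>Gram-Schmidt inside the induction: \<open>p\<close> represents \<open>s b\<close> on
  \<open>span B\<close>, so \<open>c = b - p\<close> is orthogonal to \<open>span B\<close>, and the
  representative \<open>t\<close> found there only needs a multiple of \<open>c\<close>. It yields
  the trial-to-test operator on the test side and the discrete solution on the trial side.\<close>

lemma Riesz_finite_span:
  fixes s :: "'a::real_vector \<Rightarrow> 'a \<Rightarrow> real" and l :: "'a \<Rightarrow> real"
  assumes W: "subspace W"
    and add: "\<And>x y z. x \<in> W \<Longrightarrow> y \<in> W \<Longrightarrow> z \<in> W \<Longrightarrow> s (x + y) z = s x z + s y z"
    and scale: "\<And>c x z. x \<in> W \<Longrightarrow> z \<in> W \<Longrightarrow> s (c *\<^sub>R x) z = c * s x z"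
    and sym: "\<And>x y. x \<in> W \<Longrightarrow> y \<in> W \<Longrightarrow> s x y = s y x"
    and definite: "\<And>x. x \<in> W \<Longrightarrow> s x x = 0 \<Longrightarrow> x = 0"
    and l: "\<And>x y. x \<in> W \<Longrightarrow> y \<in> W \<Longrightarrow> l (x + y) = l x + l y" "\<And>c x. x \<in> W \<Longrightarrow> l (c *\<^sub>R x) = c * l x"
    and B: "finite B" "B \<subseteq> W"
  shows "\<exists>t\<in>span B. \<forall>y\<in>span B. s t y = l y"
  using B l
proof (induction B arbitrary: l rule: finite_induct)
  case empty
  have "s 0 0 = 0" "l 0 = 0"
    using scale[OF subspace_0[OF W] subspace_0[OF W], of 0] empty.prems(3)[OF subspace_0[OF W], of 0] by simp_all
  then show ?case by simp
next
  case (insert b B)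
  note W' = subspace_add[OF W] subspace_scale[OF W] subspace_diff[OF W]
  have b: "b \<in> W" and BW: "span B \<subseteq> W" using insert.prems(1) span_minimal[OF _ W] by auto
  have IH: "\<exists>t\<in>span B. \<forall>y\<in>span B. s t y = m y"
    if "\<And>x y. x \<in> W \<Longrightarrow> y \<in> W \<Longrightarrow> m (x + y) = m x + m y" "\<And>c x. x \<in> W \<Longrightarrow> m (c *\<^sub>R x) = c * m x" for m
    by (rule insert.IH) (use insert.prems(1) that in auto)
  have "s b (x + y) = s b x + s b y" "s b (c *\<^sub>R x) = c * s b x" if "x \<in> W" "y \<in> W" for x y c
    using that add[OF that b] scale[OF that(1) b] by (simp_all add: sym[OF b] W')
  then obtain p where p: "p \<in> span B" "\<And>y. y \<in> span B \<Longrightarrow> s p y = s b y" using IH[of "s b"] by blast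
  obtain t where t: "t \<in> span B" "\<And>y. y \<in> span B \<Longrightarrow> s t y = l y" using IH[of l] insert.prems(2,3) by blast
  define c where "c = b - p"
  have pW: "p \<in> W" "t \<in> W" using p t BW by auto
  have cW: "c \<in> W" using W'(3)[OF b pW(1)] by (simp add: c_def)
  have orth: "s c y = 0" if "y \<in> span B" for y
    using add[OF cW pW(1), of y] p(2)[OF that] that BW by (auto simp: c_def)
  have dec: "\<exists>k z. y = k *\<^sub>R c + z \<and> z \<in> span B" if yS: "y \<in> span (insert b B)" for y
  proof -
    obtain k where "y - k *\<^sub>R b \<in> span B" using yS unfolding span_breakdown_eq by blast
    then have "(y - k *\<^sub>R b) + k *\<^sub>R p \<in> span B" using p(1) by (intro span_add span_scale)
    moreover have "y = k *\<^sub>R c + ((y - k *\<^sub>R b) + k *\<^sub>R p)" by (simp add: c_def algebra_simps)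
    ultimately show ?thesis by blast
  qed
  have sub: "span B \<subseteq> span (insert b B)" by (rule span_mono) auto
  have cS: "c \<in> span (insert b B)"
    unfolding c_def by (rule span_diff) (use p(1) sub span_base[of b "insert b B"] in auto)
  \<comment> \<open>For \<open>c = 0\<close> the new vector already lies in \<open>span B\<close>
    and nothing has to be corrected; definiteness provides the denominator in the other
    case.\<close>
  define a where "a = (if c = 0 then 0 else (l c - s t c) / s c c)"
  have ac: "s (t + a *\<^sub>R c) c = l c"
  proof (cases "c = 0")
    case True
    have "s x 0 = 0" if "x \<in> W" for x
      using scale[OF subspace_0[OF W] that, of 0] sym[OF that subspace_0[OF W]] by simp
    then show ?thesis
      using True insert.prems(3)[OF subspace_0[OF W], of 0] pW by (simp add: a_def)
  next
    case False
    then have "s c c \<noteq> 0" using definite[OF cW] by blast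
    then show ?thesis using False add[OF pW(2) W'(2)[OF cW] cW] scale[OF cW cW] by (simp add: a_def)
  qed
  have "s (t + a *\<^sub>R c) y = l y" if y: "y \<in> span (insert b B)" for y
  proof -
    obtain k z where e: "y = k *\<^sub>R c + z" "z \<in> span B" using dec[OF y] by blast
    have z: "z \<in> W" using e(2) BW by blast
    have T: "t + a *\<^sub>R c \<in> W" by (intro W' pW cW)
    have "s (t + a *\<^sub>R c) z = l z"
      using add[OF pW(2) W'(2)[OF cW] z] scale[OF cW z] orth[OF e(2)] t(2)[OF e(2)] by simp
    moreover have "s (t + a *\<^sub>R c) y = k * s (t + a *\<^sub>R c) c + s (t + a *\<^sub>R c) z"
      using add[OF W'(2)[OF cW] z T] scale[OF cW T] by (simp add: e(1) sym[OF T] W' cW z)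
    moreover have "l y = k * l c + l z" using insert.prems(2)[OF W'(2)[OF cW] z] insert.prems(3)[OF cW] by (simp add: e(1))
    ultimately show ?thesis using ac by simp
  qed
  moreover have "t + a *\<^sub>R c \<in> span (insert b B)" using t(1) sub cS by (intro span_add span_scale) auto
  ultimately show ?case by blast
qed

section \<open>Ellipticity and the Cordes condition\<close>

lemma symmetric_inner:
  fixes B :: "real^'n^'n"
  assumes "transpose B = B" shows "(B *v v) \<bullet> w = v \<bullet> (B *v w)"
  by (metis assms dot_lmul_matrix inner_commute vector_transpose_matrix)

text \<open>\<open>m\<close> is the minimum of the Rayleigh quotient on the unit sphere, attained at
  \<open>v0\<close>. Varying \<open>v0\<close> in the direction of the residual
  \<open>r = B *v v0 - m *\<^sub>R v0\<close> makes the linear coefficient equal to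
  \<open>r \<bullet> r\<close>, which must vanish.\<close>

lemma exists_minimal_eigenvalue:
  fixes B :: "real^'n^'n"
  assumes B: "transpose B = B"
  obtains m where "m \<in> eigenvalues B" "\<And>v. m * (v \<bullet> v) \<le> v \<bullet> (B *v v)"
proof -
  have "continuous_on (sphere 0 1) (\<lambda>v. v \<bullet> (B *v v))"
    by (intro continuous_intros matrix_vector_mult_linear_continuous_on)
  moreover have "sphere (0::real^'n) 1 \<noteq> {}" by simp
  ultimately obtain v0 where v0: "norm v0 = 1" "\<And>v. norm v = 1 \<Longrightarrow> v0 \<bullet> (B *v v0) \<le> v \<bullet> (B *v v)"
    using continuous_attains_inf[of "sphere (0::real^'n) 1" "\<lambda>v. v \<bullet> (B *v v)"] by auto
  define m where "m = v0 \<bullet> (B *v v0)"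
  have m: "m * (v \<bullet> v) \<le> v \<bullet> (B *v v)" for v
  proof (cases "v = 0")
    case False
    have "m \<le> (v /\<^sub>R norm v) \<bullet> (B *v (v /\<^sub>R norm v))"
      unfolding m_def by (rule v0(2)) (simp add: False)
    also have "\<dots> = (v \<bullet> (B *v v)) / (v \<bullet> v)"
      using False by (simp add: matrix_vector_mult_scaleR dot_square_norm power2_eq_square divide_inverse)
    finally show ?thesis using False by (simp add: pos_le_divide_eq)
  qed simp
  define r where "r = B *v v0 - m *\<^sub>R v0"
  have v00: "v0 \<bullet> v0 = 1" using v0(1) by (simp add: dot_square_norm)
  have "0 \<le> 2 * t * (r \<bullet> r) + t\<^sup>2 * (r \<bullet> (B *v r) - m * (r \<bullet> r))" for t
  proof -
    have "0 \<le> (v0 + t *\<^sub>R r) \<bullet> (B *v (v0 + t *\<^sub>R r)) - m * ((v0 + t *\<^sub>R r) \<bullet> (v0 + t *\<^sub>R r))"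
      using m by simp
    also have "\<dots> = (m - m) + 2 * t * (r \<bullet> (B *v v0) - m * (r \<bullet> v0)) + t\<^sup>2 * (r \<bullet> (B *v r) - m * (r \<bullet> r))"
      using symmetric_inner[OF B, of r v0] v00 m_def
      by (simp add: matrix_vector_right_distrib matrix_vector_mult_scaleR inner_simps
          algebra_simps power2_eq_square inner_commute)
    also have "r \<bullet> (B *v v0) - m * (r \<bullet> v0) = r \<bullet> r"
      by (simp add: r_def inner_diff_right inner_diff_left)
    finally show ?thesis by simp
  qed
  then have "r \<bullet> r = 0" by (rule quadratic_nonneg_imp_zero)
  then have "B *v v0 = m *\<^sub>R v0" by (simp add: r_def)
  moreover have "v0 \<noteq> 0" using v0(1) by auto
  ultimately have "m \<in> eigenvalues B" by (auto simp: eigenvalues_def)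
  with m show thesis by (rule that[rotated])
qed

text \<open>Eigenvectors for different eigenvalues are orthogonal, and orthogonal families are
  finite. Without finiteness, \<open>Min\<close> and \<open>Max\<close> in \<open>lambda_min\<close>
  and \<open>lambda_max\<close> would carry no information.\<close>

lemma finite_eigenvalues:
  fixes B :: "real^'n^'n"
  assumes B: "transpose B = B" shows "finite (eigenvalues B)"
proof -
  define f where "f k = (SOME v. v \<noteq> 0 \<and> B *v v = k *\<^sub>R v)" for k
  have f: "f k \<noteq> 0 \<and> B *v f k = k *\<^sub>R f k" if "k \<in> eigenvalues B" for k
    unfolding f_def by (rule someI_ex) (use that in \<open>simp add: eigenvalues_def\<close>)
  have orth: "f k \<bullet> f l = 0" if "k \<in> eigenvalues B" "l \<in> eigenvalues B" "k \<noteq> l" for k l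
    using symmetric_inner[OF B, of "f k" "f l"] f[OF that(1)] f[OF that(2)] that(3) by auto
  have "inj_on f (eigenvalues B)"
    by (rule inj_onI) (metis f orth inner_eq_zero_iff)
  moreover have "pairwise orthogonal (f ` eigenvalues B)"
    by (auto simp: pairwise_def orthogonal_def intro!: orth)
  ultimately show ?thesis
    using pairwise_orthogonal_imp_finite finite_imageD by blast
qed

lemma lambda_bounds:
  fixes B :: "real^'n^'n"
  assumes B: "transpose B = B"
  shows "lambda_min B * (v \<bullet> v) \<le> v \<bullet> (B *v v)" "v \<bullet> (B *v v) \<le> lambda_max B * (v \<bullet> v)"
proof -
  obtain m where m: "m \<in> eigenvalues B" "\<And>v. m * (v \<bullet> v) \<le> v \<bullet> (B *v v)"
    using exists_minimal_eigenvalue[OF B] by blast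
  have "lambda_min B \<le> m"
    unfolding lambda_min_def by (rule Min_le[OF finite_eigenvalues[OF B] m(1)])
  then show "lambda_min B * (v \<bullet> v) \<le> v \<bullet> (B *v v)"
    using m(2)[of v] mult_right_mono[of "lambda_min B" m "v \<bullet> v"] by simp
  have neg: "(- B) *v v = - (B *v v)" for v
    by (simp add: matrix_vector_mult_def vec_eq_iff sum_negf)
  have "transpose (- B) = - B"
    using B by (simp add: transpose_def vec_eq_iff)
  then obtain l where l: "l \<in> eigenvalues (- B)" "\<And>v. l * (v \<bullet> v) \<le> v \<bullet> ((- B) *v v)"
    using exists_minimal_eigenvalue by blast
  have "- l \<in> eigenvalues B"
    using l(1) by (auto simp: eigenvalues_def neg) (metis minus_equation_iff)
  then have "- l \<le> lambda_max B"
    unfolding lambda_max_def by (rule Max_ge[OF finite_eigenvalues[OF B]])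
  then show "v \<bullet> (B *v v) \<le> lambda_max B * (v \<bullet> v)"
    using l(2)[of v] mult_right_mono[of "- l" "lambda_max B" "v \<bullet> v"] by (simp add: neg)
qed

lemma diagonal_bounds:
  fixes B :: "real^'n^'n"
  assumes "transpose B = B" shows "lambda_min B \<le> B $ i $ i" "B $ i $ i \<le> lambda_max B"
proof -
  have "axis i 1 \<bullet> (B *v axis i 1) = B $ i $ i" "axis i 1 \<bullet> axis i (1::real) = 1"
    by (simp_all add: inner_axis' matrix_vector_mult_basis column_def inner_axis_axis)
  then show "lambda_min B \<le> B $ i $ i" "B $ i $ i \<le> lambda_max B"
    using lambda_bounds[OF assms, of "axis i 1"] by simp_all
qed

lemma inner_matrix: "(B::real^'n^'m) \<bullet> D = (\<Sum>i\<in>UNIV. \<Sum>j\<in>UNIV. B $ i $ j * D $ i $ j)"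
  by (simp add: inner_vec_def)

lemma mat_1_inner: "(mat 1 :: real^'n^'n) \<bullet> D = trace D"
  by (simp add: inner_matrix mat_def trace_def if_distrib[of "\<lambda>x. x * _"] cong: if_cong)

lemma trace_square_le:
  fixes B :: "real^'n^'n"
  shows "(trace B)\<^sup>2 \<le> real CARD('n) * (B \<bullet> B)"
proof -
  have "(mat 1 :: real^'n^'n) \<bullet> mat 1 = real CARD('n)"
    unfolding mat_1_inner by (simp add: trace_def mat_def)
  then show ?thesis
    using Cauchy_Schwarz_ineq[of "mat 1 :: real^'n^'n" B] by (simp add: mat_1_inner)
qed

lemma young_square:
  fixes a b t :: real
  assumes "t > 0" shows "(a + b)\<^sup>2 \<le> (1 + t) * a\<^sup>2 + (1 + 1/t) * b\<^sup>2"
proof -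
  have "0 \<le> (t * a - b)\<^sup>2 / t" using assms by simp
  also have "\<dots> = t * a\<^sup>2 - 2 * a * b + b\<^sup>2 / t"
    using assms by (simp add: power2_diff field_simps power2_eq_square)
  finally show ?thesis by (simp add: power2_sum algebra_simps)
qed

text \<open>Rescaling by S/N, with S the trace and N the squared norm of \<open>B\<close>, brings
  \<open>B\<close> as close to the identity as possible:
  \<open>R = mat 1 - (S / N) *\<^sub>R B\<close> has squared norm d - S^2/N, which the Cordes
  condition bounds by 1 - e. Then trace D = R:D + (S/N) B:D is squared with Young's inequality for
  the parameter e/2, using (1 + e/2)(1 - e) \<le> 1 - e/2. The factor S/N is at most 1/c because S^2
  \<le> d N and S \<ge> d c.\<close>

lemma cordes_pointwise:
  fixes B D :: "real^'n^'n"
  assumes e: "0 < e" "e \<le> 1" and c: "0 < c" and S: "real CARD('n) * c \<le> trace B"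
    and cor: "(B \<bullet> B) / (trace B)\<^sup>2 \<le> 1 / (real CARD('n) - 1 + e)"
  shows "(trace D)\<^sup>2 \<le> (1 - e/2) * (D \<bullet> D) + (1 + 2/e) / c\<^sup>2 * (B \<bullet> D)\<^sup>2"
proof -
  define d where "d = real CARD('n)"
  define S where "S = trace B"
  define N where "N = B \<bullet> B"
  have d: "d \<ge> 1" by (simp add: d_def Suc_leI)
  have "0 < d * c" using c d by simp
  then have S0: "S > 0" "d * c \<le> S" using S by (simp_all add: S_def d_def)
  have SN: "S\<^sup>2 \<le> d * N" using trace_square_le[of B] by (simp add: S_def N_def d_def)
  have N0: "N > 0"
  proof -
    have "0 < d * N" using SN S0(1) by (meson less_le_trans zero_less_power)
    then show ?thesis using d by (simp add: zero_less_mult_iff)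
  qed
  have g: "S / N \<le> 1 / c"
  proof -
    have "S / N \<le> d / S" using SN N0 S0 by (simp add: field_simps power2_eq_square)
    also have "\<dots> \<le> 1 / c" using S0 c by (simp add: field_simps)
    finally show ?thesis .
  qed
  have cor': "d - 1 + e \<le> S\<^sup>2 / N"
    using cor N0 S0 d e unfolding S_def[symmetric] N_def[symmetric] d_def[symmetric] by (simp add: field_simps)
  define R where "R = mat 1 - (S / N) *\<^sub>R B"
  have m1: "(mat 1 :: real^'n^'n) \<bullet> mat 1 = d"
    unfolding mat_1_inner d_def by (simp add: trace_def mat_def)
  have "R \<bullet> R = d - 2 * (S / N) * S + (S / N)\<^sup>2 * N"
    unfolding R_def using m1 mat_1_inner[of B]
    by (simp add: inner_diff_left inner_diff_right inner_commute[of B "mat 1"] S_def N_def power2_eq_square)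
  also have "\<dots> = d - S\<^sup>2 / N" using N0 by (simp add: field_simps power2_eq_square)
  also have "\<dots> \<le> 1 - e" using cor' by simp
  finally have R: "R \<bullet> R \<le> 1 - e" .
  have "trace D = R \<bullet> D + (S / N) * (B \<bullet> D)"
    by (simp add: R_def inner_diff_left mat_1_inner)
  then have "(trace D)\<^sup>2 \<le> (1 + e/2) * (R \<bullet> D)\<^sup>2 + (1 + 1/(e/2)) * ((S / N) * (B \<bullet> D))\<^sup>2"
    using young_square[of "e/2"] e by simp
  also have "\<dots> \<le> (1 + e/2) * ((1 - e) * (D \<bullet> D)) + (1 + 1/(e/2)) * ((1/c)\<^sup>2 * (B \<bullet> D)\<^sup>2)"
  proof (intro add_mono mult_left_mono)
    have "(R \<bullet> D)\<^sup>2 \<le> (R \<bullet> R) * (D \<bullet> D)" by (rule Cauchy_Schwarz_ineq)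
    also have "\<dots> \<le> (1 - e) * (D \<bullet> D)" using R by (intro mult_right_mono) auto
    finally show "(R \<bullet> D)\<^sup>2 \<le> (1 - e) * (D \<bullet> D)" .
    have "(S / N)\<^sup>2 \<le> (1/c)\<^sup>2" using g S0 N0 by (intro power_mono) auto
    then show "((S / N) * (B \<bullet> D))\<^sup>2 \<le> (1/c)\<^sup>2 * (B \<bullet> D)\<^sup>2"
      unfolding power_mult_distrib by (rule mult_right_mono) simp
  qed (use e in auto)
  also have "\<dots> \<le> (1 - e/2) * (D \<bullet> D) + (1 + 2/e) / c\<^sup>2 * (B \<bullet> D)\<^sup>2"
  proof -
    have "(1 + e/2) * (1 - e) \<le> 1 - e/2" using e by (simp add: algebra_simps)
    then have "(1 + e/2) * (1 - e) * (D \<bullet> D) \<le> (1 - e/2) * (D \<bullet> D)" by (rule mult_right_mono) simp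
    then show ?thesis by (simp add: power_divide mult.assoc)
  qed
  finally show ?thesis .
qed

lemma elliptic_cordes_bounds:
  fixes U :: "(real^'n) set"
  assumes ell: "elliptic_coefficient U A" and cor: "cordes U A" and U: "U \<in> sets lebesgue"
  obtains K \<theta> C where "0 < K" "0 < \<theta>" "\<theta> < 1" "0 < C"
    "AE x in lebesgue. x \<in> U \<longrightarrow> norm (A x) \<le> K \<and> (\<forall>D. (trace D)\<^sup>2 \<le> (1 - \<theta>) * (D \<bullet> D) + C * (A x \<bullet> D)\<^sup>2)"
proof -
  obtain e where e: "0 < e" "e \<le> 1" and corA: "AE x in lebesgue_on U.
        (\<Sum>j\<in>UNIV. \<Sum>k\<in>UNIV. (A x $ j $ k)\<^sup>2) / (\<Sum>j\<in>UNIV. A x $ j $ j)\<^sup>2 \<le> 1 / (real CARD('n) - 1 + e)"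
    using cor by (auto simp: cordes_def)
  have sym: "transpose (A x) = A x" if "x \<in> U" for x
    using ell that by (auto simp: elliptic_coefficient_def)
  define m where "m = essinf (lebesgue_on U) (\<lambda>x. ereal (lambda_min (A x)))"
  define M where "M = esssup (lebesgue_on U) (\<lambda>x. ereal (lambda_max (A x)))"
  have mM: "0 < m" "M < \<infinity>"
    using ell unfolding elliptic_coefficient_def m_def M_def by simp_all
  obtain c where c: "0 < c" "ereal c < m"
    using ereal_dense2[OF mM(1)] by auto
  obtain L where L: "0 < L" "M \<le> ereal L"
  proof (cases M)
    case (real r)
    then show thesis using that[of "max r 1"] by (simp add: less_max_iff_disj)
  qed (use mM that[of 1] in auto)
  have min: "AE x in lebesgue_on U. c \<le> lambda_min (A x)"
    using esssup_AE[of "\<lambda>x. - ereal (lambda_min (A x))" "lebesgue_on U"]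
  proof eventually_elim
    case (elim x)
    then have "m \<le> ereal (lambda_min (A x))"
      unfolding m_def essinf_def by (simp add: ereal_uminus_le_reorder)
    then have "ereal c < ereal (lambda_min (A x))" using c(2) by (rule less_le_trans[rotated])
    then show ?case by simp
  qed
  have max: "AE x in lebesgue_on U. lambda_max (A x) \<le> L"
    using esssup_AE[of "\<lambda>x. ereal (lambda_max (A x))" "lebesgue_on U"]
  proof eventually_elim
    case (elim x)
    then have "ereal (lambda_max (A x)) \<le> ereal L"
      using L(2) unfolding M_def by (rule order_trans)
    then show ?case by simp
  qed
  define d where "d = real CARD('n)"
  have d: "d \<ge> 1" by (simp add: d_def Suc_leI)
  \<comment> \<open>The Cordes condition also bounds the Frobenius norm from above: |A|^2 \<le>
    (trace A)^2 / (d - 1 + e), where the trace is at most d L and d - 1 + e is at least e.\<close>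
  define K where "K = d * L / sqrt e"
  have "AE x in lebesgue_on U. x \<in> U \<longrightarrow> norm (A x) \<le> K \<and>
     (\<forall>D. (trace D)\<^sup>2 \<le> (1 - e/2) * (D \<bullet> D) + (1 + 2/e) / c\<^sup>2 * (A x \<bullet> D)\<^sup>2)"
    using min max corA
  proof eventually_elim
    case (elim x)
    show ?case
    proof
      assume x: "x \<in> U"
      have S: "d * c \<le> trace (A x)"
        using sum_mono[of UNIV "\<lambda>i::'n. c" "\<lambda>i. A x $ i $ i"] diagonal_bounds(1)[OF sym[OF x]] elim(1)
        by (simp add: trace_def d_def) (meson order_trans)
      have S2: "trace (A x) \<le> d * L"
        using sum_mono[of UNIV "\<lambda>i. A x $ i $ i" "\<lambda>i::'n. L"] diagonal_bounds(2)[OF sym[OF x]] elim(2)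
        by (simp add: trace_def d_def) (meson order_trans)
      have cor: "(A x \<bullet> A x) / (trace (A x))\<^sup>2 \<le> 1 / (d - 1 + e)"
        using elim(3) by (simp add: inner_matrix trace_def d_def power2_eq_square)
      have S0: "trace (A x) > 0" using S c(1) d by (meson less_le_trans mult_pos_pos zero_less_one)
      have "A x \<bullet> A x \<le> (trace (A x))\<^sup>2 / (d - 1 + e)"
        using cor S0 d e by (simp add: field_simps)
      also have "\<dots> \<le> (d * L)\<^sup>2 / e"
        using S0 S2 d e by (intro frac_le power_mono) auto
      also have "\<dots> = K\<^sup>2" using e by (simp add: K_def power_divide)
      finally have "(norm (A x))\<^sup>2 \<le> K\<^sup>2" by (simp add: dot_square_norm)
      then have "norm (A x) \<le> K"
        by (rule power2_le_imp_le) (use d L e in \<open>simp add: K_def\<close>)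
      then show "norm (A x) \<le> K \<and>
        (\<forall>D. (trace D)\<^sup>2 \<le> (1 - e/2) * (D \<bullet> D) + (1 + 2/e) / c\<^sup>2 * (A x \<bullet> D)\<^sup>2)"
        using cordes_pointwise[OF e c(1)] S cor unfolding d_def by blast
    qed
  qed
  then have "AE x in lebesgue. x \<in> U \<longrightarrow> norm (A x) \<le> K \<and>
     (\<forall>D. (trace D)\<^sup>2 \<le> (1 - e/2) * (D \<bullet> D) + (1 + 2/e) / c\<^sup>2 * (A x \<bullet> D)\<^sup>2)"
    using U by (subst (asm) AE_restrict_space_iff) (auto elim: eventually_mono)
  then show thesis
    by (rule that[of K "e/2" "(1 + 2/e) / c\<^sup>2", rotated -1]) (use d L e c in \<open>auto simp: K_def add_pos_pos\<close>)
qed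

section \<open>Test functions\<close>

lemma test_fun_smooth: "\<phi> \<in> test_fun U \<Longrightarrow> smooth \<phi>"
  by (simp add: test_fun_def)

lemma test_funI:
  assumes "smooth \<phi>" "compact K" "K \<subseteq> U" "\<And>x. x \<notin> K \<Longrightarrow> \<phi> x = 0"
  shows "\<phi> \<in> test_fun U"
proof -
  have "closure {x. \<phi> x \<noteq> 0} \<subseteq> K"
    using assms(2,4) by (intro closure_minimal compact_imp_closed) auto
  moreover from this have "compact (closure {x. \<phi> x \<noteq> 0})"
    using assms(2) by (metis compact_Int_closed closed_closure inf.absorb_iff2)
  ultimately show ?thesis using assms(1,3) by (auto simp: test_fun_def)
qed

lemma test_funE:
  assumes "\<phi> \<in> test_fun U"
  obtains K where "compact K" "K \<subseteq> U" "\<And>x. x \<notin> K \<Longrightarrow> \<phi> x = 0" "\<And>x i. x \<notin> K \<Longrightarrow> pd i \<phi> x = 0"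
proof -
  define K where "K = closure {x. \<phi> x \<noteq> 0}"
  have K: "compact K" "K \<subseteq> U" using assms by (auto simp: test_fun_def K_def)
  have z: "\<phi> x = 0" if "x \<notin> K" for x
    using that closure_subset[of "{x. \<phi> x \<noteq> 0}"] by (auto simp: K_def)
  have "pd i \<phi> x = 0" if "x \<notin> K" for x i
  proof -
    have "pd i \<phi> x = pd i (\<lambda>x. 0) x"
      using that z compact_imp_closed[OF K(1)] by (intro pd_cong[of "- K"]) auto
    then show ?thesis by simp
  qed
  then show thesis using K z that by blast
qed

lemma test_fun_outside: "\<phi> \<in> test_fun U \<Longrightarrow> x \<notin> U \<Longrightarrow> \<phi> x = 0"
  by (erule test_funE) auto

lemma test_fun_mono: "\<phi> \<in> test_fun U \<Longrightarrow> U \<subseteq> U' \<Longrightarrow> \<phi> \<in> test_fun U'"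
  by (auto simp: test_fun_def)

lemma test_fun_pd:
  assumes "\<phi> \<in> test_fun U" shows "pd i \<phi> \<in> test_fun U"
proof -
  obtain K where "compact K" "K \<subseteq> U" "\<And>x. x \<notin> K \<Longrightarrow> pd i \<phi> x = 0"
    using test_funE[OF assms] by metis
  then show ?thesis by (rule test_funI[OF smooth_pd[OF test_fun_smooth[OF assms]]])
qed

lemma test_fun_zero: "(\<lambda>x. 0) \<in> test_fun U"
  by (rule test_funI[of _ "{}"]) (auto intro: smooth_intros)

lemma test_fun_add:
  assumes "\<phi> \<in> test_fun U" "\<psi> \<in> test_fun U" shows "(\<lambda>x. \<phi> x + \<psi> x) \<in> test_fun U"
proof -
  obtain K L where "compact K" "K \<subseteq> U" "\<And>x. x \<notin> K \<Longrightarrow> \<phi> x = 0"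
    "compact L" "L \<subseteq> U" "\<And>x. x \<notin> L \<Longrightarrow> \<psi> x = 0"
    using test_funE[OF assms(1)] test_funE[OF assms(2)] by metis
  then show ?thesis
    using assms[THEN test_fun_smooth] by (intro test_funI[of _ "K \<union> L"] smooth_intros) auto
qed

text \<open>The factor \<open>m\<close> may be singular at the boundary of \<open>U\<close>. The
  product is smooth nevertheless, as it vanishes identically on the open complement of a compact
  subset of \<open>U\<close>.\<close>

lemma test_fun_mult_smooth_on:
  assumes \<phi>: "\<phi> \<in> test_fun U" and m: "smooth_on U m" and U: "open U"
  shows "(\<lambda>x. m x * \<phi> x) \<in> test_fun U"
proof -
  obtain K where K: "compact K" "K \<subseteq> U" "\<And>x. x \<notin> K \<Longrightarrow> \<phi> x = 0"
    using test_funE[OF \<phi>] by metis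
  have "smooth_on UNIV (\<lambda>x. m x * \<phi> x)"
  proof (rule smooth_on_local)
    fix x :: "real^'a"
    show "\<exists>T. open T \<and> x \<in> T \<and> smooth_on T (\<lambda>x. m x * \<phi> x)"
    proof (cases "x \<in> U")
      case True
      have "smooth_on U \<phi>"
        using test_fun_smooth[OF \<phi>] smooth_on_subset[of UNIV \<phi> U] by (simp add: smooth_on_UNIV)
      then show ?thesis using True U m by (intro exI[of _ U]) (simp add: smooth_on_mult)
    next
      case False
      have op: "open (- K)" using compact_imp_closed[OF K(1)] by auto
      have "smooth_on (- K) (\<lambda>x. m x * \<phi> x) \<longleftrightarrow> smooth_on (- K) (\<lambda>x. 0)"
        by (rule smooth_on_cong[OF op]) (simp add: K)
      then show ?thesis using False K op by (intro exI[of _ "- K"]) (auto simp: smooth_on_const)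
    qed
  qed
  then show ?thesis
    using K by (intro test_funI[of _ K]) (auto simp: smooth_on_UNIV)
qed

lemma test_fun_mult_smooth:
  assumes "\<phi> \<in> test_fun U" "smooth m" shows "(\<lambda>x. m x * \<phi> x) \<in> test_fun U"
proof -
  obtain K where "compact K" "K \<subseteq> U" "\<And>x. x \<notin> K \<Longrightarrow> \<phi> x = 0"
    using test_funE[OF assms(1)] by metis
  then show ?thesis
    by (intro test_funI[of _ K] smooth_intros(4) test_fun_smooth[OF assms(1)] assms(2)) auto
qed

lemma test_fun_cmult: "\<phi> \<in> test_fun U \<Longrightarrow> (\<lambda>x. c * \<phi> x) \<in> test_fun U"
  by (rule test_fun_mult_smooth) (auto intro: smooth_intros)

lemma test_fun_affine:
  assumes \<phi>: "\<phi> \<in> test_fun UNIV" and l: "l \<noteq> 0"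
  shows "(\<lambda>x. \<phi> (c + l *\<^sub>R x)) \<in> test_fun UNIV"
proof -
  obtain K where K: "compact K" "\<And>x. x \<notin> K \<Longrightarrow> \<phi> x = 0"
    using test_funE[OF \<phi>] by metis
  have "compact ((\<lambda>y. (1/l) *\<^sub>R (y - c)) ` K)"
    by (intro compact_continuous_image K continuous_intros)
  moreover have "\<phi> (c + l *\<^sub>R x) = 0" if "x \<notin> (\<lambda>y. (1/l) *\<^sub>R (y - c)) ` K" for x
  proof (rule K(2), rule notI)
    assume "c + l *\<^sub>R x \<in> K"
    then have "(1/l) *\<^sub>R (c + l *\<^sub>R x - c) \<in> (\<lambda>y. (1/l) *\<^sub>R (y - c)) ` K" by (rule imageI)
    then show False using that l by simp
  qed
  ultimately show ?thesis
    by (intro test_funI smooth_on_affine test_fun_smooth[OF \<phi>]) auto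
qed

lemma test_fun_continuous: "\<phi> \<in> test_fun U \<Longrightarrow> continuous_on S \<phi>"
  by (intro smooth_continuous test_fun_smooth)

lemma test_fun_borel: "\<phi> \<in> test_fun U \<Longrightarrow> \<phi> \<in> borel_measurable borel"
  by (intro borel_measurable_continuous_onI test_fun_continuous)

lemma borel_measurable_lebesgueI:
  fixes f :: "'a::euclidean_space \<Rightarrow> 'b::euclidean_space"
  assumes "f \<in> borel_measurable borel" shows "f \<in> borel_measurable lebesgue"
  by (rule measurable_completion) (use assms in measurable)

lemma test_fun_measurable: "\<phi> \<in> test_fun U \<Longrightarrow> \<phi> \<in> borel_measurable lebesgue"
  by (intro borel_measurable_lebesgueI test_fun_borel)

lemma test_fun_bounded:
  assumes "\<phi> \<in> test_fun U" obtains B where "0 \<le> B" "\<And>x. \<bar>\<phi> x\<bar> \<le> B"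
proof -
  obtain K where K: "compact K" "\<And>x. x \<notin> K \<Longrightarrow> \<phi> x = 0" using test_funE[OF assms] by metis
  have "compact (\<phi> ` K)" by (intro compact_continuous_image K test_fun_continuous[OF assms])
  then have "\<exists>B. \<forall>x\<in>K. \<bar>\<phi> x\<bar> \<le> B" by (auto dest!: compact_imp_bounded simp: bounded_iff)
  then obtain B where B: "\<And>x. x \<in> K \<Longrightarrow> \<bar>\<phi> x\<bar> \<le> B" by blast
  have "\<bar>\<phi> x\<bar> \<le> \<bar>B\<bar>" for x using B[of x] K(2)[of x] by (cases "x \<in> K") auto
  then show thesis using that[of "\<bar>B\<bar>"] by simp
qed

lemma integrable_indicator_cball: "integrable lebesgue (\<lambda>x. c * indicator (cball a r) x :: real)"
proof -
  have "integrable lebesgue (indicator (cball a r) :: _ \<Rightarrow> real)"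
    using lmeasurable_cball[of a r] unfolding fmeasurable_def by (intro integrable_real_indicator) (simp_all add: top.not_eq_extremum)
  then show ?thesis by (rule integrable_mult_right)
qed

lemma integrable_bounded_support:
  fixes f :: "'a::euclidean_space \<Rightarrow> 'b::euclidean_space"
  assumes "f \<in> borel_measurable lebesgue" "\<And>x. norm (f x) \<le> B" "bounded S" "\<And>x. x \<notin> S \<Longrightarrow> f x = 0"
  shows "integrable lebesgue f"
proof -
  obtain R where R: "S \<subseteq> cball 0 R" using assms(3) by (auto simp: bounded_iff subset_iff)
  have "integrable lebesgue (\<lambda>x::'a. B * indicator (cball 0 R) x :: real)"
    by (rule integrable_indicator_cball[of B 0 R])
  then show ?thesis
  proof (rule Bochner_Integration.integrable_bound)
    show "AE x in lebesgue. norm (f x) \<le> norm (B * indicator (cball 0 R) x :: real)"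
    proof (intro AE_I2)
      fix x show "norm (f x) \<le> norm (B * indicator (cball 0 R) x :: real)"
      proof (cases "x \<in> cball 0 R")
        case True
        have "norm (f x) \<le> \<bar>B\<bar>" using assms(2)[of x] by linarith
        then show ?thesis using True by (simp add: indicator_def)
      next
        case False
        then have "f x = 0" using R assms(4) by blast
        then show ?thesis by simp
      qed
    qed
  qed (rule assms(1))
qed

lemma sqint_bounded_support:
  fixes f :: "'a::euclidean_space \<Rightarrow> 'b::euclidean_space"
  assumes "f \<in> borel_measurable lebesgue" "\<And>x. norm (f x) \<le> B" "bounded S" "\<And>x. x \<notin> S \<Longrightarrow> f x = 0"
  shows "sqint f"
proof -
  have "integrable lebesgue (\<lambda>x. (norm (f x))\<^sup>2)"
    by (rule integrable_bounded_support[where B = "B\<^sup>2" and S = S])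
      (use assms in \<open>auto intro!: power_mono\<close>)
  then show ?thesis using assms(1) by (simp add: sqint_def)
qed

lemma test_fun_sqint: assumes "\<phi> \<in> test_fun U" shows "sqint \<phi>"
proof -
  obtain K where K: "compact K" "\<And>x. x \<notin> K \<Longrightarrow> \<phi> x = 0" using test_funE[OF assms] by metis
  obtain B where "\<And>x. \<bar>\<phi> x\<bar> \<le> B" using test_fun_bounded[OF assms] by metis
  then show ?thesis
    by (intro sqint_bounded_support[OF test_fun_measurable[OF assms], of B K] compact_imp_bounded K) auto
qed

lemma test_fun_integrable: assumes "\<phi> \<in> test_fun U" shows "integrable lebesgue \<phi>"
proof -
  obtain K where K: "compact K" "\<And>x. x \<notin> K \<Longrightarrow> \<phi> x = 0" using test_funE[OF assms] by metis
  obtain B where "\<And>x. \<bar>\<phi> x\<bar> \<le> B" using test_fun_bounded[OF assms] by metis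
  then show ?thesis
    by (intro integrable_bounded_support[OF test_fun_measurable[OF assms], of B K] compact_imp_bounded K) auto
qed

lemma sqint_times_test: "sqint f \<Longrightarrow> \<phi> \<in> test_fun U \<Longrightarrow> integrable lebesgue (\<lambda>x. f x * \<phi> x :: real)"
  using sqint_inner[of f \<phi>] by (simp add: test_fun_sqint)

lemma abs_sum_component_le: "\<bar>\<Sum>i\<in>UNIV. h $ i * c i\<bar> \<le> (\<Sum>i\<in>UNIV. \<bar>c i\<bar>) * norm (h :: real^'n)"
proof -
  have "\<bar>\<Sum>i\<in>UNIV. h $ i * c i\<bar> \<le> (\<Sum>i\<in>UNIV. \<bar>h $ i * c i\<bar>)" by (rule sum_abs)
  also have "\<dots> \<le> (\<Sum>i\<in>UNIV. \<bar>c i\<bar> * norm h)"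
    by (intro sum_mono) (simp add: abs_mult mult.commute[of "\<bar>h $ _\<bar>"] mult_left_mono component_le_norm_cart)
  finally show ?thesis by (simp add: sum_distrib_right)
qed

lemma test_fun_Lipschitz:
  assumes "\<phi> \<in> test_fun U" obtains K where "0 \<le> K" "\<And>x y. \<bar>\<phi> x - \<phi> y\<bar> \<le> K * norm (x - y)"
proof -
  have "\<exists>B. \<forall>x. \<bar>pd i \<phi> x\<bar> \<le> B" for i
    using test_fun_bounded[OF test_fun_pd[OF assms, of i]] by metis
  then obtain B where B: "\<And>i x. \<bar>pd i \<phi> x\<bar> \<le> B i" by metis
  define K where "K = (\<Sum>i\<in>UNIV. B i)"
  have "norm (\<phi> x - \<phi> y) \<le> K * norm (x - y)" for x y
  proof (rule differentiable_bound[OF convex_UNIV])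
    fix z assume "z \<in> (UNIV :: (real^'a) set)"
    show "(\<phi> has_derivative (\<lambda>h. \<Sum>i\<in>UNIV. h $ i * pd i \<phi> z)) (at z within UNIV)"
      using has_derivative_pd[OF smooth_differentiable[OF test_fun_smooth[OF assms]]] by simp
    show "onorm (\<lambda>h. \<Sum>i\<in>UNIV. h $ i * pd i \<phi> z) \<le> K"
    proof (rule onorm_le)
      fix h :: "real^'a"
      have "norm (\<Sum>i\<in>UNIV. h $ i * pd i \<phi> z) \<le> (\<Sum>i\<in>UNIV. \<bar>pd i \<phi> z\<bar>) * norm h"
        using abs_sum_component_le by simp
      also have "\<dots> \<le> K * norm h" unfolding K_def by (intro mult_right_mono sum_mono B) simp
      finally show "norm (\<Sum>i\<in>UNIV. h $ i * pd i \<phi> z) \<le> K * norm h" .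
    qed
  qed auto
  moreover have "0 \<le> K" unfolding K_def using B by (intro sum_nonneg) (meson abs_ge_zero order_trans)
  ultimately show thesis using that by (simp add: real_norm_def)
qed

lemma test_fun_Taylor:
  assumes "\<phi> \<in> test_fun U"
  obtains K where "0 \<le> K" "\<And>x h. \<bar>\<phi> (x + h) - \<phi> x - (\<Sum>i\<in>UNIV. h $ i * pd i \<phi> x)\<bar> \<le> K * (norm h)\<^sup>2"
proof -
  have "\<exists>K. 0 \<le> K \<and> (\<forall>x y. \<bar>pd i \<phi> x - pd i \<phi> y\<bar> \<le> K * norm (x - y))" for i
    using test_fun_Lipschitz[OF test_fun_pd[OF assms, of i]] by metis
  then obtain B where B: "\<And>i. 0 \<le> B i" "\<And>i x y. \<bar>pd i \<phi> x - pd i \<phi> y\<bar> \<le> B i * norm (x - y)" by metis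
  define K where "K = (\<Sum>i\<in>UNIV. B i)"
  have "\<bar>\<phi> (x + h) - \<phi> x - (\<Sum>i\<in>UNIV. h $ i * pd i \<phi> x)\<bar> \<le> K * (norm h)\<^sup>2" for x h
  proof -
    define g where "g y = \<phi> y - (\<Sum>i\<in>UNIV. y $ i * pd i \<phi> x)" for y
    have "norm (g (x + h) - g x) \<le> (K * norm h) * norm (x + h - x)"
    proof (rule differentiable_bound[OF convex_closed_segment[of x "x + h"]])
      fix z assume z: "z \<in> closed_segment x (x + h)"
      have "(\<phi> has_derivative (\<lambda>h. \<Sum>i\<in>UNIV. h $ i * pd i \<phi> z)) (at z within closed_segment x (x + h))"
        by (rule has_derivative_at_withinI[OF has_derivative_pd[OF smooth_differentiable[OF test_fun_smooth[OF assms]]]])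
      moreover have "((\<lambda>y. \<Sum>i\<in>UNIV. y $ i * pd i \<phi> x) has_derivative (\<lambda>h. \<Sum>i\<in>UNIV. h $ i * pd i \<phi> x)) (at z within closed_segment x (x + h))"
        by (intro bounded_linear_imp_has_derivative bounded_linear_sum bounded_linear_mult_left bounded_linear_compose[OF bounded_linear_mult_left] bounded_linear_vec_nth)
      ultimately show "(g has_derivative (\<lambda>h. (\<Sum>i\<in>UNIV. h $ i * pd i \<phi> z) - (\<Sum>i\<in>UNIV. h $ i * pd i \<phi> x))) (at z within closed_segment x (x + h))"
        unfolding g_def by (rule has_derivative_diff)
      show "onorm (\<lambda>h. (\<Sum>i\<in>UNIV. h $ i * pd i \<phi> z) - (\<Sum>i\<in>UNIV. h $ i * pd i \<phi> x)) \<le> K * norm h"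
      proof (rule onorm_le)
        fix k :: "real^'a"
        have "norm ((\<Sum>i\<in>UNIV. k $ i * pd i \<phi> z) - (\<Sum>i\<in>UNIV. k $ i * pd i \<phi> x))
            = \<bar>\<Sum>i\<in>UNIV. k $ i * (pd i \<phi> z - pd i \<phi> x)\<bar>"
          by (simp add: sum_subtractf right_diff_distrib)
        also have "\<dots> \<le> (\<Sum>i\<in>UNIV. \<bar>pd i \<phi> z - pd i \<phi> x\<bar>) * norm k" by (rule abs_sum_component_le)
        also have "\<dots> \<le> (\<Sum>i\<in>UNIV. B i * norm h) * norm k"
        proof (intro mult_right_mono sum_mono)
          fix i
          have "norm (z - x) \<le> norm h"
            using segment_bound(1)[OF z] by (simp add: norm_minus_commute)
          then have "B i * norm (z - x) \<le> B i * norm h" using B(1) by (rule mult_left_mono)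
          then show "\<bar>pd i \<phi> z - pd i \<phi> x\<bar> \<le> B i * norm h" using B(2)[of i z x] by simp
        qed simp
        finally show "norm ((\<Sum>i\<in>UNIV. k $ i * pd i \<phi> z) - (\<Sum>i\<in>UNIV. k $ i * pd i \<phi> x)) \<le> K * norm h * norm k"
          by (simp add: K_def sum_distrib_right)
      qed
    qed auto
    moreover have "g (x + h) - g x = \<phi> (x + h) - \<phi> x - (\<Sum>i\<in>UNIV. h $ i * pd i \<phi> x)"
      by (simp add: g_def algebra_simps sum.distrib)
    ultimately show ?thesis by (simp add: power2_eq_square)
  qed
  moreover have "0 \<le> K" unfolding K_def by (intro sum_nonneg B)
  ultimately show thesis using that by blast
qed

section \<open>Integration by parts and symmetry of second derivatives\<close>

lemma lebesgue_integral_shift: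
  fixes f :: "'a::euclidean_space \<Rightarrow> real"
  assumes "f \<in> borel_measurable borel"
  shows "(\<integral>x. f (c + x)) = (\<integral>x. f x)"
proof -
  have "(\<integral>x. f x \<partial>lborel) = (\<integral>x. f x \<partial>(distr lborel borel ((+) c)))" by (simp add: lborel_distr_plus)
  also have "\<dots> = (\<integral>x. f (c + x) \<partial>lborel)" by (rule integral_distr) (use assms in auto)
  finally show ?thesis using assms by (simp add: integral_completion)
qed

text \<open>By translation invariance the difference quotients of \<open>\<phi>\<close> have
  integral zero. They approximate the partial derivative with error at most \<open>C * t\<close>,
  uniformly on a fixed ball that contains the support of \<open>\<phi>\<close> and of all its
  translates by at most 1.\<close>

lemma integral_pd_test_fun:
  assumes \<phi>: "\<phi> \<in> test_fun U" shows "(\<integral>x. pd i \<phi> x) = 0"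
proof -
  obtain K where K: "compact K" "\<And>x. x \<notin> K \<Longrightarrow> \<phi> x = 0" "\<And>x i. x \<notin> K \<Longrightarrow> pd i \<phi> x = 0"
    using test_funE[OF \<phi>] by metis
  obtain R where R: "K \<subseteq> cball 0 R" using compact_imp_bounded[OF K(1)] by (auto simp: bounded_iff subset_iff)
  obtain C where C: "0 \<le> C" "\<And>x h. \<bar>\<phi> (x + h) - \<phi> x - (\<Sum>i\<in>UNIV. h $ i * pd i \<phi> x)\<bar> \<le> C * (norm h)\<^sup>2"
    using test_fun_Taylor[OF \<phi>] by blast
  define S where "S = cball (0::real^'a) (R + 1)"
  define I where "I = (\<integral>x. pd i \<phi> x)"
  define V where "V = measure lebesgue S"
  have bound: "\<bar>I\<bar> \<le> C * V * t" if t: "0 < t" "t \<le> 1" for t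
  proof -
    define e where "e = t *\<^sub>R (axis i 1 :: real^'a)"
    have ne: "norm e = t" using t by (simp add: e_def)
    have se: "(\<Sum>j\<in>UNIV. e $ j * pd j \<phi> x) = t * pd i \<phi> x" for x
      by (simp add: e_def axis_def if_distrib[of "\<lambda>x. _ * x"] if_distrib[of "\<lambda>x. x * _"] cong: if_cong)
    have shift: "(\<lambda>x. \<phi> (e + x)) \<in> test_fun UNIV"
      using test_fun_affine[OF test_fun_mono[OF \<phi>], of 1 e] by simp
    have int: "integrable lebesgue (\<lambda>x. \<phi> (e + x))" "integrable lebesgue \<phi>" "integrable lebesgue (pd i \<phi>)"
      using test_fun_integrable shift \<phi> test_fun_pd[OF \<phi>] by blast+
    have "t * I = - (\<integral>x. (\<phi> (e + x) - \<phi> x - t * pd i \<phi> x))"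
      using int lebesgue_integral_shift[OF test_fun_borel[OF \<phi>], of e] by (simp add: I_def)
    then have "\<bar>t * I\<bar> = \<bar>\<integral>x. (\<phi> (e + x) - \<phi> x - t * pd i \<phi> x) \<partial>lebesgue\<bar>" by simp
    also have "\<dots> \<le> (\<integral>x. (C * t\<^sup>2) * indicator S x)"
    proof (rule integral_abs_bound_integral)
      show "integrable lebesgue (\<lambda>x. \<phi> (e + x) - \<phi> x - t * pd i \<phi> x)" using int by simp
      show "integrable lebesgue (\<lambda>x. (C * t\<^sup>2) * indicator S x :: real)"
        unfolding S_def by (rule integrable_indicator_cball)
      fix x :: "real^'a"
      show "\<bar>\<phi> (e + x) - \<phi> x - t * pd i \<phi> x\<bar> \<le> (C * t\<^sup>2) * indicator S x"
      proof (cases "x \<in> S")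
        case True then show ?thesis using C(2)[of x e] ne by (simp add: se add.commute)
      next
        case False
        then have "norm x > R + 1" by (simp add: S_def)
        moreover have "norm x \<le> norm (e + x) + norm e" using norm_triangle_ineq4[of "e + x" e] by simp
        ultimately have "x \<notin> K" "e + x \<notin> K" using R ne t by (auto simp: subset_iff)
        then show ?thesis using K False by simp
      qed
    qed
    also have "\<dots> = C * t\<^sup>2 * V" by (simp add: V_def S_def)
    finally have "t * \<bar>I\<bar> \<le> t * (C * V * t)" using t by (simp add: abs_mult power2_eq_square mult_ac)
    then show ?thesis using t by simp
  qed
  have "\<bar>I\<bar> \<le> e" if "e > 0" for e
  proof -
    have V: "0 \<le> V" by (simp add: V_def)
    define t where "t = min 1 (e / (C * V + 1))"
    have t: "0 < t" "t \<le> 1" using that C(1) V by (auto simp: t_def add_nonneg_pos)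
    have "\<bar>I\<bar> \<le> C * V * t" by (rule bound[OF t])
    also have "\<dots> \<le> (C * V + 1) * t" using t by simp
    also have "\<dots> \<le> (C * V + 1) * (e / (C * V + 1))" using C(1) V by (intro mult_left_mono) (auto simp: t_def)
    also have "\<dots> = e" using C(1) V by (simp add: add_nonneg_eq_0_iff)
    finally show ?thesis .
  qed
  then have "\<bar>I\<bar> \<le> 0" by (rule field_le_epsilon[where y=0, simplified])
  then show ?thesis by (simp add: I_def)
qed

lemma test_fun_integral_by_parts:
  assumes \<phi>: "\<phi> \<in> test_fun U" and m: "smooth_on U m" and U: "open U"
  shows "(\<integral>x. m x * pd i \<phi> x) = - (\<integral>x. pd i m x * \<phi> x)"
proof -
  have t: "(\<lambda>x. m x * \<phi> x) \<in> test_fun U" "(\<lambda>x. m x * pd i \<phi> x) \<in> test_fun U" "(\<lambda>x. pd i m x * \<phi> x) \<in> test_fun U"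
    using \<phi> m U by (auto intro!: test_fun_mult_smooth_on test_fun_pd smooth_on_pd)
  have "pd i (\<lambda>x. m x * \<phi> x) x = m x * pd i \<phi> x + pd i m x * \<phi> x" for x
  proof (cases "x \<in> U")
    case True
    then show ?thesis
      using smooth_on_differentiable[OF m] smooth_differentiable[OF test_fun_smooth[OF \<phi>]] by (simp add: pd_mult)
  next
    case False
    then show ?thesis
      using test_fun_outside[OF \<phi>] test_fun_outside[OF test_fun_pd[OF \<phi>]] test_fun_outside[OF test_fun_pd[OF t(1)]]
      by simp
  qed
  then have "0 = (\<integral>x. m x * pd i \<phi> x + pd i m x * \<phi> x)"
    using integral_pd_test_fun[OF t(1), of i] by simp
  then show ?thesis using t(2,3)[THEN test_fun_integrable] by simp
qed

lemma pd_line_derivative: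
  fixes f :: "real^'n \<Rightarrow> real"
  assumes "smooth f"
  shows "((\<lambda>s. f (a + s *\<^sub>R axis i 1)) has_real_derivative pd i f (a + s *\<^sub>R axis i 1)) (at s)"
proof -
  have "((\<lambda>s. a + s *\<^sub>R axis i 1) has_derivative (\<lambda>h. h *\<^sub>R (axis i 1 :: real^'n))) (at s)"
    by (auto intro!: derivative_eq_intros)
  from has_derivative_compose[OF this has_derivative_pd[OF smooth_differentiable[OF assms]]]
  have "((\<lambda>s. f (a + s *\<^sub>R axis i 1)) has_derivative (\<lambda>h. \<Sum>j\<in>UNIV. (h *\<^sub>R (axis i 1 :: real^'n)) $ j * pd j f (a + s *\<^sub>R axis i 1))) (at s)" .
  moreover have "(\<Sum>j\<in>UNIV. (h *\<^sub>R (axis i 1 :: real^'n)) $ j * pd j f x) = pd i f x * h" for h x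
    by (simp add: axis_def if_distrib[of "\<lambda>x. _ * x"] if_distrib[of "\<lambda>x. x * _"] mult.commute cong: if_cong)
  ultimately show ?thesis by (simp add: has_field_derivative_def mult_commute_abs)
qed

text \<open>The mean value theorem is applied first along \<open>i\<close> to the increment in
  direction \<open>j\<close>, then along \<open>j\<close>. As the left-hand side is symmetric in
  \<open>i\<close> and \<open>j\<close>, letting \<open>t\<close> tend to 0 gives the equality of
  the mixed derivatives.\<close>

lemma second_difference:
  fixes f :: "real^'n \<Rightarrow> real"
  assumes f: "smooth f" and t: "0 < t"
  shows "\<exists>p. norm (p - x) \<le> 2 * t \<and>
     f (x + t *\<^sub>R axis i 1 + t *\<^sub>R axis j 1) - f (x + t *\<^sub>R axis i 1) - f (x + t *\<^sub>R axis j 1) + f x = t\<^sup>2 * pd j (pd i f) p"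
proof -
  define g where "g s = f ((x + t *\<^sub>R axis j 1) + s *\<^sub>R axis i 1) - f (x + s *\<^sub>R axis i 1)" for s
  have "(g has_real_derivative (pd i f ((x + t *\<^sub>R axis j 1) + s *\<^sub>R axis i 1) - pd i f (x + s *\<^sub>R axis i 1))) (at s)" for s
    unfolding g_def by (intro DERIV_diff pd_line_derivative f)
  then obtain z where z: "0 < z" "z < t"
    "g t - g 0 = (t - 0) * (pd i f ((x + t *\<^sub>R axis j 1) + z *\<^sub>R axis i 1) - pd i f (x + z *\<^sub>R axis i 1))"
    using MVT2[OF t, of g "\<lambda>s. pd i f ((x + t *\<^sub>R axis j 1) + s *\<^sub>R axis i 1) - pd i f (x + s *\<^sub>R axis i 1)"] by blast
  obtain r where r: "0 < r" "r < t"
    "pd i f ((x + z *\<^sub>R axis i 1) + t *\<^sub>R axis j 1) - pd i f ((x + z *\<^sub>R axis i 1) + 0 *\<^sub>R axis j 1)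
       = (t - 0) * pd j (pd i f) ((x + z *\<^sub>R axis i 1) + r *\<^sub>R axis j 1)"
    using MVT2[OF t, of "\<lambda>r. pd i f ((x + z *\<^sub>R axis i 1) + r *\<^sub>R axis j 1)"
        "\<lambda>r. pd j (pd i f) ((x + z *\<^sub>R axis i 1) + r *\<^sub>R axis j 1)"] pd_line_derivative[OF smooth_pd[OF f]] by blast
  define p where "p = (x + z *\<^sub>R axis i 1) + r *\<^sub>R (axis j 1 :: real^'n)"
  have "norm (p - x) \<le> norm (z *\<^sub>R (axis i 1 :: real^'n)) + norm (r *\<^sub>R (axis j 1 :: real^'n))"
    using norm_triangle_ineq[of "z *\<^sub>R (axis i 1 :: real^'n)" "r *\<^sub>R (axis j 1 :: real^'n)"] by (simp add: p_def)
  then have "norm (p - x) \<le> 2 * t" using z r by simp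
  moreover have "g t - g 0 = t\<^sup>2 * pd j (pd i f) p"
    using z(3) r(3) by (simp add: p_def power2_eq_square add_ac)
  ultimately show ?thesis
    by (intro exI[of _ p]) (simp add: g_def add_ac)
qed

lemma pd_commute:
  fixes f :: "real^'n \<Rightarrow> real"
  assumes f: "smooth f" shows "pd i (pd j f) x = pd j (pd i f) x"
proof -
  define t where "t n = 1 / real (Suc n)" for n
  have t: "0 < t n" for n by (simp add: t_def)
  have t0: "t \<longlonglongrightarrow> 0" unfolding t_def by (rule LIMSEQ_Suc[OF lim_1_over_n])
  obtain p where p: "\<And>n. norm (p n - x) \<le> 2 * t n" "\<And>n. f (x + t n *\<^sub>R axis i 1 + t n *\<^sub>R axis j 1) - f (x + t n *\<^sub>R axis i 1) - f (x + t n *\<^sub>R axis j 1) + f x = (t n)\<^sup>2 * pd j (pd i f) (p n)"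
    using second_difference[OF f t, where x=x and i=i and j=j] by metis
  obtain q where q: "\<And>n. norm (q n - x) \<le> 2 * t n" "\<And>n. f (x + t n *\<^sub>R axis j 1 + t n *\<^sub>R axis i 1) - f (x + t n *\<^sub>R axis j 1) - f (x + t n *\<^sub>R axis i 1) + f x = (t n)\<^sup>2 * pd i (pd j f) (q n)"
    using second_difference[OF f t, where x=x and i=j and j=i] by metis
  have eq: "pd j (pd i f) (p n) = pd i (pd j f) (q n)" for n
  proof -
    have "(t n)\<^sup>2 * pd j (pd i f) (p n) = (t n)\<^sup>2 * pd i (pd j f) (q n)"
      unfolding p(2)[symmetric] q(2)[symmetric] by (simp add: add_ac)
    then show ?thesis using t[of n] by simp
  qed
  have lim: "r \<longlonglongrightarrow> x" if "\<And>n. norm (r n - x) \<le> 2 * t n" for r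
  proof -
    have "(\<lambda>n. r n - x) \<longlonglongrightarrow> 0"
      by (rule Lim_null_comparison[of _ "\<lambda>n. 2 * t n"]) (use that t0 in \<open>auto intro: tendsto_mult_right_zero\<close>)
    then show ?thesis by (rule LIM_zero_cancel)
  qed
  have "(\<lambda>n. pd j (pd i f) (p n)) \<longlonglongrightarrow> pd j (pd i f) x" "(\<lambda>n. pd i (pd j f) (q n)) \<longlonglongrightarrow> pd i (pd j f) x"
    using continuous_on_tendsto_compose[OF smooth_continuous[of _ UNIV] lim] p(1) q(1) smooth_pd[OF smooth_pd[OF f]] by auto
  then show ?thesis unfolding eq using LIMSEQ_unique by blast
qed

section \<open>Density of test functions\<close>

text \<open>A Dynkin argument: the Borel sets over which the integral vanishes are closed under
  disjoint unions and, thanks to the assumption on \<open>UNIV\<close>, under complements; boxes are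
  stable under intersection and generate the Borel sets.\<close>

lemma integrable_zero_on_boxes:
  fixes f :: "'a::euclidean_space \<Rightarrow> real"
  assumes f: "integrable lborel f" and box: "\<And>a b. set_lebesgue_integral lborel (box a b) f = 0"
    and UNIV: "set_lebesgue_integral lborel UNIV f = 0"
  shows "AE x in lborel. f x = 0"
proof (rule sigma_finite_measure.density_zero[OF lborel.sigma_finite_measure_axioms f])
  fix A :: "'a set" assume A: "A \<in> sets lborel"
  have si: "set_integrable lborel S f" if "S \<in> sets borel" for S
    using f that unfolding set_integrable_def by (intro integrable_mult_indicator) auto
  have "Int_stable (range (\<lambda>(a, b). box a b :: 'a set))"
    by (auto simp: Int_stable_def box_Int_box)
  moreover have "(range (\<lambda>(a, b). box a b :: 'a set)) \<subseteq> Pow UNIV"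
    by auto
  moreover have "A \<in> sigma_sets UNIV (range (\<lambda>(a, b). box a b))"
    using A unfolding sets_lborel borel_eq_box by simp
  ultimately show "set_lebesgue_integral lborel A f = 0"
  proof (induction rule: sigma_sets_induct_disjoint)
    case (basic A) then show ?case using box by auto
  next
    case empty then show ?case by (simp add: set_lebesgue_integral_def)
  next
    case (compl A)
    then have "A \<in> sets borel" by (simp add: borel_eq_box)
    then have A: "A \<in> sets borel" "UNIV - A \<in> sets borel" by (auto simp: Compl_eq_Diff_UNIV[symmetric])
    have "set_lebesgue_integral lborel (A \<union> (UNIV - A)) f = set_lebesgue_integral lborel A f + set_lebesgue_integral lborel (UNIV - A) f"
      by (rule set_integral_Un) (use A si in auto)
    then show ?case using UNIV compl by simp
  next
    case (union F)
    then have F: "\<And>i. F i \<in> sets lborel" by (simp add: borel_eq_box subset_eq)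
    have "set_lebesgue_integral lborel (\<Union>i. F i) f = (\<Sum>i. set_lebesgue_integral lborel (F i) f)"
      using F union(1) by (intro lebesgue_integral_countable_add si) (auto simp: disjoint_family_on_def)
    then show ?case using union(3) by simp
  qed
qed

text \<open>Each factor is a smoothed Heaviside function: \<open>gexp 0 (real n * s)\<close> is zero
  for \<open>s \<le> 0\<close> and tends to 1 for \<open>s > 0\<close>. The products approximate the
  indicator of the open box from below, with supports in the closed box for all
  \<open>n\<close>.\<close>

definition box_bump :: "real^'n \<Rightarrow> real^'n \<Rightarrow> nat \<Rightarrow> real^'n \<Rightarrow> real" where
  "box_bump a b n x = (\<Prod>i\<in>UNIV. gexp 0 (real n * (x $ i - a $ i)) * gexp 0 (real n * (b $ i - x $ i)))"

lemma box_bump_test_fun: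
  assumes "cbox a b \<subseteq> U" shows "box_bump a b n \<in> test_fun U"
proof (rule test_funI[of _ "cbox a b"])
  have c: "smooth (\<lambda>x::real^'a. x $ i)" for i
  proof -
    have "(\<lambda>x::real^'a. axis i 1 \<bullet> x) = (\<lambda>x. x $ i)" by (simp add: inner_axis' fun_eq_iff)
    then show ?thesis using smooth_intros(2)[of "axis i (1::real)"] by simp
  qed
  have g: "smooth (\<lambda>x. gexp 0 (f x))" if "smooth f" for f :: "real^'a \<Rightarrow> real"
    using smooth_on_chain[OF open_UNIV Dk_gexp, of f 0] that by (simp add: smooth_on_UNIV)
  show "smooth (box_bump a b n)"
    unfolding box_bump_def by (intro smooth_intros g c finite)
  show "box_bump a b n x = 0" if "x \<notin> cbox a b" for x
  proof -
    have "\<exists>i. x $ i < a $ i \<or> b $ i < x $ i" using that by (force simp: mem_box_cart not_le[symmetric])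
    then obtain i where "x $ i < a $ i \<or> b $ i < x $ i" by blast
    then have "real n * (x $ i - a $ i) \<le> 0 \<or> real n * (b $ i - x $ i) \<le> 0" by (auto simp: mult_le_0_iff)
    then have "gexp 0 (real n * (x $ i - a $ i)) * gexp 0 (real n * (b $ i - x $ i)) = 0" by (auto simp: gexp_def)
    then show ?thesis unfolding box_bump_def by (intro prod_zero) auto
  qed
qed (use assms in auto)

lemma gexp_0_le_1: "gexp 0 t \<le> 1"
  by (simp add: gexp_def)

lemma gexp_scaled_tendsto: "(\<lambda>n. gexp 0 (real n * s)) \<longlonglongrightarrow> (if s > 0 then 1 else 0)"
proof (cases "s > 0")
  case True
  have "(\<lambda>n. exp (- (1 / s) * (1 / real n))) \<longlonglongrightarrow> exp (- (1 / s) * 0)"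
    by (intro tendsto_intros lim_1_over_n)
  moreover have "\<forall>\<^sub>F n in sequentially. exp (- (1 / s) * (1 / real n)) = gexp 0 (real n * s)"
    by (rule eventually_sequentiallyI[of 1]) (use True in \<open>auto simp: gexp_def mult_le_0_iff field_simps\<close>)
  ultimately show ?thesis using True by (auto intro: Lim_transform_eventually)
next
  case False
  then have "gexp 0 (real n * s) = 0" for n by (simp add: gexp_def mult_nonneg_nonpos)
  then show ?thesis using False by simp
qed

lemma box_bump_tendsto: "(\<lambda>n. box_bump a b n x) \<longlonglongrightarrow> indicator (box a b) x"
proof -
  have "(\<lambda>n. box_bump a b n x) \<longlonglongrightarrow> (\<Prod>i\<in>UNIV. (if x $ i - a $ i > 0 then 1 else 0) * (if b $ i - x $ i > 0 then 1 else 0))"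
    unfolding box_bump_def by (intro tendsto_prod tendsto_mult gexp_scaled_tendsto)
  also have "(\<Prod>i\<in>UNIV. (if x $ i - a $ i > 0 then 1 else 0) * (if b $ i - x $ i > 0 then 1 else 0 :: real)) = indicator (box a b) x"
  proof (cases "x \<in> box a b")
    case False
    then obtain i where "\<not> (x $ i - a $ i > 0 \<and> b $ i - x $ i > 0)" by (auto simp: mem_box_cart)
    then show ?thesis using False by (auto intro!: prod_zero exI[of _ i])
  qed (auto simp: mem_box_cart)
  finally show ?thesis .
qed

lemma box_bump_bounds: "0 \<le> box_bump a b n x" "box_bump a b n x \<le> 1"
  unfolding box_bump_def
  by (auto intro!: prod_nonneg prod_le_1 mult_nonneg_nonneg mult_le_one gexp_nonneg gexp_0_le_1)

lemma box_bump_outside: "x \<notin> box a b \<Longrightarrow> box_bump a b n x = 0"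
proof -
  assume "x \<notin> box a b"
  then obtain i where "x $ i \<le> a $ i \<or> b $ i \<le> x $ i" by (auto simp: mem_box_cart not_less)
  then have "real n * (x $ i - a $ i) \<le> 0 \<or> real n * (b $ i - x $ i) \<le> 0" by (auto simp: mult_le_0_iff)
  then have "gexp 0 (real n * (x $ i - a $ i)) * gexp 0 (real n * (b $ i - x $ i)) = 0" by (auto simp: gexp_def)
  then show ?thesis unfolding box_bump_def by (intro prod_zero) auto
qed

lemma open_countable_Union_box_aux:
  fixes U :: "'a::euclidean_space set"
  assumes "open U"
  shows "\<exists>\<D>. countable \<D> \<and> \<Union>\<D> = U \<and> (\<forall>X\<in>\<D>. \<exists>a b. X = box a b \<and> cbox a b \<subseteq> U)"
proof -
  define \<F> where "\<F> = {box a b | a b. cbox a b \<subseteq> U}"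
  have op: "\<And>S. S \<in> \<F> \<Longrightarrow> open S" by (auto simp: \<F>_def open_box)
  obtain \<D> where D: "\<D> \<subseteq> \<F>" "countable \<D>" "\<Union>\<D> = \<Union>\<F>"
    using Lindelof[OF op] by blast
  have "\<Union>\<F> = U"
  proof
    show "\<Union>\<F> \<subseteq> U" using box_subset_cbox by (fastforce simp: \<F>_def)
    show "U \<subseteq> \<Union>\<F>"
    proof
      fix x assume "x \<in> U"
      then obtain a b where "x \<in> box a b" "cbox a b \<subseteq> U"
        using assms open_contains_cbox[of U] by blast
      then show "x \<in> \<Union>\<F>" by (auto simp: \<F>_def)
    qed
  qed
  then show ?thesis using D by (intro exI[of _ \<D>]) (auto simp: \<F>_def)
qed

text \<open>The fundamental lemma of the calculus of variations. Bumps show that the integrals over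
  all boxes with closure in \<open>U\<close> vanish. After multiplication by the indicator of one
  such box, the integrals over arbitrary boxes vanish too, because intersections of boxes are boxes;
  and \<open>U\<close> is a countable union of them.\<close>

lemma test_fun_fundamental:
  assumes U: "open U" and v: "sqint (v :: real^'n \<Rightarrow> real)"
    and z: "\<And>\<phi>. \<phi> \<in> test_fun U \<Longrightarrow> (\<integral>x. v x * \<phi> x) = 0"
  shows "AE x in lebesgue. x \<in> U \<longrightarrow> v x = 0"
proof -
  \<comment> \<open>A Borel representative, since the box argument is carried out for
    \<open>lborel\<close> and not for its completion.\<close>
  obtain v' where v'[measurable]: "v' \<in> borel_measurable lborel" and vv': "AE x in lborel. v x = v' x"
    using completion_ex_borel_measurable_real[of v lborel] sqint_measurable[OF v] by auto
  have vv'L: "AE x in lebesgue. v x = v' x" by (rule AE_completion[OF vv'])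
  have v'm: "v' \<in> borel_measurable lebesgue" by (rule measurable_completion) (rule v')
  have sq': "sqint v'"
  proof (rule sqint_bound[OF v v'm])
    show "AE x in lebesgue. norm (v' x) \<le> 1 * norm (v x)" using vv'L by eventually_elim simp
  qed
  have int_box: "integrable lborel (\<lambda>x. indicator (box a b) x * v' x)" for a b
  proof -
    have "integrable lebesgue (\<lambda>x. indicator (box a b) x * v' x)"
    proof -
      have "sqint (indicator (box a b) :: real^'n \<Rightarrow> real)"
        by (rule sqint_bounded_support[where B=1 and S="box a b"])
          (simp_all add: bounded_box borel_measurable_lebesgueI[OF borel_measurable_indicator])
      from sqint_inner[OF this sq'] show ?thesis by simp
    qed
    then show ?thesis by (subst (asm) integrable_completion) auto
  qed
  have box0: "(\<integral>x. indicator (box a b) x * v' x \<partial>lborel) = 0" if ab: "cbox a b \<subseteq> U" for a b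
  proof -
    have "(\<lambda>n. \<integral>x. box_bump a b n x * v' x \<partial>lborel) \<longlonglongrightarrow> (\<integral>x. indicator (box a b) x * v' x \<partial>lborel)"
    proof (rule integral_dominated_convergence[where w="\<lambda>x. \<bar>indicator (box a b) x * v' x\<bar>"])
      show "(\<lambda>x. box_bump a b n x * v' x) \<in> borel_measurable lborel" for n
        using test_fun_borel[OF box_bump_test_fun[OF ab, of n]] v' by auto
      show "integrable lborel (\<lambda>x. \<bar>indicator (box a b) x * v' x\<bar>)" by (rule integrable_abs[OF int_box])
      show "AE x in lborel. (\<lambda>n. box_bump a b n x * v' x) \<longlonglongrightarrow> indicator (box a b) x * v' x"
        by (intro AE_I2 tendsto_mult box_bump_tendsto tendsto_const)
      show "AE x in lborel. norm (box_bump a b n x * v' x) \<le> \<bar>indicator (box a b) x * v' x\<bar>" for n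
      proof (intro AE_I2)
        fix x show "norm (box_bump a b n x * v' x) \<le> \<bar>indicator (box a b) x * v' x\<bar>"
          using box_bump_bounds[of a b n x] box_bump_outside[of x a b n]
          by (cases "x \<in> box a b") (auto simp: abs_mult mult_left_le_one_le)
      qed
    qed auto
    moreover have "(\<integral>x. box_bump a b n x * v' x \<partial>lborel) = 0" for n
    proof -
      have t: "box_bump a b n \<in> test_fun U" by (rule box_bump_test_fun[OF ab])
      have "(\<integral>x. box_bump a b n x * v' x \<partial>lborel) = (\<integral>x. box_bump a b n x * v' x)"
        by (rule integral_completion[symmetric]) (use test_fun_borel[OF t] in auto)
      also have "\<dots> = (\<integral>x. v x * box_bump a b n x)"
      proof (rule integral_cong_AE)
        show "AE x in lebesgue. box_bump a b n x * v' x = v x * box_bump a b n x"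
          using vv'L by eventually_elim simp
      qed (use test_fun_measurable[OF t] sqint_measurable[OF v] sqint_measurable[OF sq'] in auto)
      also have "\<dots> = 0" by (rule z[OF t])
      finally show ?thesis .
    qed
    ultimately show ?thesis using LIMSEQ_unique[OF tendsto_const[of 0]] by auto
  qed
  have AE_box: "AE x in lborel. indicator (box c d) x * v' x = 0" if cd: "cbox c d \<subseteq> U" for c d
  proof (rule integrable_zero_on_boxes[OF int_box])
    show "set_lebesgue_integral lborel UNIV (\<lambda>x. indicator (box c d) x * v' x) = 0"
      using box0[OF cd] by (simp add: set_lebesgue_integral_def)
    fix a b :: "real^'n"
    obtain e f where ef: "box a b \<inter> box c d = box e f" "cbox e f \<subseteq> cbox c d \<or> box e f = {}"
    proof -
      define e f where "e = (\<Sum>i\<in>Basis. max (a \<bullet> i) (c \<bullet> i) *\<^sub>R i)" "f = (\<Sum>i\<in>Basis. min (b \<bullet> i) (d \<bullet> i) *\<^sub>R i)"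
      have "box a b \<inter> box c d = box e f" unfolding e_f_def by (rule box_Int_box)
      moreover have "cbox e f \<subseteq> cbox c d" by (auto simp: mem_box e_f_def)
      ultimately show thesis using that by blast
    qed
    have "(\<integral>x. indicator (box e f) x * v' x \<partial>lborel) = 0"
      using ef(2) box0[of e f] cd by (auto simp: subset_trans)
    moreover have "(\<lambda>x. indicator (box a b) x *\<^sub>R (indicator (box c d) x * v' x)) = (\<lambda>x. indicator (box e f) x * v' x)"
      unfolding ef(1)[symmetric] by (simp add: indicator_inter_arith fun_eq_iff)
    ultimately show "set_lebesgue_integral lborel (box a b) (\<lambda>x. indicator (box c d) x * v' x) = 0"
      unfolding set_lebesgue_integral_def by simp
  qed
  obtain \<D> :: "(real^'n) set set" where D: "countable \<D>" "\<Union>\<D> = U" "\<And>X. X \<in> \<D> \<Longrightarrow> \<exists>a b. X = box a b \<and> cbox a b \<subseteq> U"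
    using open_countable_Union_box_aux[OF U] by metis
  have "AE x in lborel. \<forall>X\<in>\<D>. indicator X x * v' x = 0"
    by (subst AE_ball_countable[OF D(1)]) (use AE_box D(3) in blast)
  then have "AE x in lebesgue. \<forall>X\<in>\<D>. indicator X x * v' x = 0" by (rule AE_completion)
  with vv'L show ?thesis
  proof eventually_elim
    case (elim x)
    show ?case
    proof
      assume "x \<in> U"
      then obtain X where "X \<in> \<D>" "x \<in> X" using D(2) by auto
      then show "v x = 0" using elim by auto
    qed
  qed
qed

section \<open>Mollification\<close>

lemma AE_eq_integral_cong_mult:
  assumes "AE x in lebesgue. f x = g x" "f \<in> borel_measurable lebesgue" "g \<in> borel_measurable lebesgue" "h \<in> borel_measurable lebesgue"
  shows "(\<integral>x. f x * h x) = (\<integral>x. g x * h x \<partial>lebesgue :: real)"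
proof (rule integral_cong_AE)
  show "AE x in lebesgue. f x * h x = g x * h x" using assms(1) by eventually_elim simp
qed (intro borel_measurable_times assms)+

lemma sqint_mult_bounded:
  fixes f m :: "'a::euclidean_space \<Rightarrow> real"
  assumes "sqint f" "m \<in> borel_measurable lebesgue" "\<And>x. \<bar>m x\<bar> \<le> B"
  shows "sqint (\<lambda>x. m x * f x)"
proof (rule sqint_bound[OF assms(1)])
  show "(\<lambda>x. m x * f x) \<in> borel_measurable lebesgue"
    by (intro borel_measurable_times assms sqint_measurable)
  show "AE x in lebesgue. norm (m x * f x) \<le> B * norm (f x)"
    by (intro AE_I2) (simp add: abs_mult mult_right_mono assms(3))
qed

lemma sqint_mult_test:
  assumes "sqint f" "\<phi> \<in> test_fun U" shows "sqint (\<lambda>x. \<phi> x * f x)"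
proof -
  obtain B where "\<And>x. \<bar>\<phi> x\<bar> \<le> B" using test_fun_bounded[OF assms(2)] by metis
  then show ?thesis by (rule sqint_mult_bounded[OF assms(1) test_fun_measurable[OF assms(2)]])
qed

lemma sqint_integrable_mult: "sqint f \<Longrightarrow> sqint g \<Longrightarrow> integrable lebesgue (\<lambda>x. f x * g x :: real)"
  using sqint_inner[of f g] by simp

lemma l2_inner_real: "sqint f \<Longrightarrow> sqint g \<Longrightarrow> abs_l2 f \<bullet> abs_l2 g = (\<integral>x. f x * g x \<partial>lebesgue :: real)"
  by (simp add: abs_l2_inner)

lemma l2_tendsto_integral:
  fixes F :: "nat \<Rightarrow> 'a::euclidean_space \<Rightarrow> real"
  assumes "\<And>k. sqint (F k)" "sqint f" "(\<lambda>k. abs_l2 (F k)) \<longlonglongrightarrow> abs_l2 f" "sqint h"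
  shows "(\<lambda>k. \<integral>x. h x * F k x \<partial>lebesgue) \<longlonglongrightarrow> (\<integral>x. h x * f x)"
proof -
  have "(\<lambda>k. abs_l2 h \<bullet> abs_l2 (F k)) \<longlonglongrightarrow> abs_l2 h \<bullet> abs_l2 f"
    by (intro tendsto_intros assms)
  then show ?thesis by (simp add: l2_inner_real assms)
qed

definition conv :: "(real^'n \<Rightarrow> real) \<Rightarrow> (real^'n \<Rightarrow> real) \<Rightarrow> real^'n \<Rightarrow> real" where
  "conv f \<rho> z = (\<integral>y. f y * \<rho> (z - y))"

lemma test_fun_reflect: "\<rho> \<in> test_fun UNIV \<Longrightarrow> (\<lambda>y. \<rho> (z - y)) \<in> test_fun UNIV"
  using test_fun_affine[of \<rho> "-1" z] by simp

lemma conv_integrable: "sqint f \<Longrightarrow> \<rho> \<in> test_fun UNIV \<Longrightarrow> integrable lebesgue (\<lambda>y. f y * \<rho> (z - y))"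
  by (rule sqint_times_test[OF _ test_fun_reflect])

lemma has_derivative_quadratic_remainder:
  fixes F :: "'a::real_normed_vector \<Rightarrow> real"
  assumes "bounded_linear D" "\<And>h. norm h \<le> 1 \<Longrightarrow> \<bar>F (z + h) - F z - D h\<bar> \<le> C * (norm h)\<^sup>2"
  shows "(F has_derivative D) (at z)"
  unfolding has_derivative_at
proof (rule conjI[OF assms(1)], rule Lim_null_comparison)
  show "\<forall>\<^sub>F h in at 0. norm (norm (F (z + h) - F z - D h) / norm h) \<le> C * norm h"
    unfolding eventually_at
  proof (intro exI[of _ 1] conjI ballI impI)
    fix h :: 'a assume h: "h \<noteq> 0 \<and> dist h 0 < 1"
    have "norm (F (z + h) - F z - D h) / norm h \<le> C * (norm h)\<^sup>2 / norm h"
      using assms(2)[of h] h by (intro divide_right_mono) auto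
    then show "norm (norm (F (z + h) - F z - D h) / norm h) \<le> C * norm h"
      using h by (simp add: power2_eq_square)
  qed simp
  show "((\<lambda>h. C * norm h) \<longlongrightarrow> 0) (at 0)"
    by (intro tendsto_mult_right_zero tendsto_norm_zero tendsto_ident_at)
qed

text \<open>Differentiation under the integral in quantitative form: for increments of length at
  most 1 the second order Taylor remainder of \<open>\<rho> (z - y)\<close> is at most
  \<open>C * (norm h)\<^sup>2\<close> and is supported in one fixed ball, on which \<open>f\<close>
  is integrable.\<close>

lemma conv_has_derivative:
  assumes f: "sqint f" and \<rho>: "\<rho> \<in> test_fun UNIV"
  shows "(conv f \<rho> has_derivative (\<lambda>h. \<Sum>i\<in>UNIV. h $ i * conv f (pd i \<rho>) z)) (at z)"
proof -
  obtain K where K: "compact K" "\<And>x. x \<notin> K \<Longrightarrow> \<rho> x = 0" "\<And>x i. x \<notin> K \<Longrightarrow> pd i \<rho> x = 0"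
    using test_funE[OF \<rho>] by metis
  obtain R where R: "K \<subseteq> cball 0 R" using compact_imp_bounded[OF K(1)] by (auto simp: bounded_iff subset_iff)
  obtain C where C: "0 \<le> C" "\<And>x h. \<bar>\<rho> (x + h) - \<rho> x - (\<Sum>i\<in>UNIV. h $ i * pd i \<rho> x)\<bar> \<le> C * (norm h)\<^sup>2"
    using test_fun_Taylor[OF \<rho>] by blast
  define S where "S = cball z (R + 1)"
  have iS: "sqint (indicator S :: _ \<Rightarrow> real)"
    by (rule sqint_bounded_support[where B=1 and S=S])
      (simp_all add: S_def borel_measurable_lebesgueI[OF borel_measurable_indicator])
  have fS: "integrable lebesgue (\<lambda>y. \<bar>f y\<bar> * indicator S y)"
    using integrable_abs[OF sqint_integrable_mult[OF f iS]] by (simp add: abs_mult)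
  define M where "M = (\<integral>y. \<bar>f y\<bar> * indicator S y)"
  show ?thesis
  proof (rule has_derivative_quadratic_remainder[where C="C * M"])
    show "bounded_linear (\<lambda>h::real^'a. \<Sum>i\<in>UNIV. h $ i * conv f (pd i \<rho>) z)"
      by (intro bounded_linear_sum bounded_linear_mult_left bounded_linear_compose[OF bounded_linear_mult_left] bounded_linear_vec_nth)
    fix h :: "real^'a" assume h: "norm h \<le> 1"
    define r where "r y = \<rho> (z - y + h) - \<rho> (z - y) - (\<Sum>i\<in>UNIV. h $ i * pd i \<rho> (z - y))" for y
    have i1: "integrable lebesgue (\<lambda>y. f y * \<rho> (z + h - y))" "integrable lebesgue (\<lambda>y. f y * \<rho> (z - y))"
      "integrable lebesgue (\<lambda>y. f y * pd i \<rho> (z - y))" for i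
      by (intro conv_integrable f \<rho> test_fun_pd)+
    have i2: "integrable lebesgue (\<lambda>y. \<Sum>i\<in>UNIV. h $ i * (f y * pd i \<rho> (z - y)))"
      by (intro Bochner_Integration.integrable_sum integrable_mult_right i1)
    have r_eq: "f y * r y = f y * \<rho> (z + h - y) - f y * \<rho> (z - y) - (\<Sum>i\<in>UNIV. h $ i * (f y * pd i \<rho> (z - y)))" for y
      by (simp add: r_def algebra_simps sum_distrib_left)
    have "conv f \<rho> (z + h) - conv f \<rho> z - (\<Sum>i\<in>UNIV. h $ i * conv f (pd i \<rho>) z) = (\<integral>y. f y * r y)"
      unfolding r_eq conv_def using i1 i2 by (simp add: Bochner_Integration.integral_sum)
    also have "\<bar>\<dots>\<bar> \<le> (\<integral>y. (C * (norm h)\<^sup>2) * (\<bar>f y\<bar> * indicator S y))"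
    proof (rule integral_abs_bound_integral)
      show "integrable lebesgue (\<lambda>y. f y * r y)" unfolding r_eq using i1 i2 by simp
      show "integrable lebesgue (\<lambda>y. (C * (norm h)\<^sup>2) * (\<bar>f y\<bar> * indicator S y))"
        by (intro integrable_mult_right fS)
      fix y
      show "\<bar>f y * r y\<bar> \<le> (C * (norm h)\<^sup>2) * (\<bar>f y\<bar> * indicator S y)"
      proof (cases "y \<in> S")
        case True
        then show ?thesis using mult_left_mono[OF C(2)[of "z - y" h], of "\<bar>f y\<bar>"] by (simp add: abs_mult r_def mult_ac)
      next
        case False
        then have "norm (z - y) > R + 1" by (simp add: S_def dist_norm)
        moreover have "norm (z - y) \<le> norm (z - y + h) + norm h" using norm_triangle_ineq4[of "z - y + h" h] by simp
        ultimately have "norm (z - y) > R" "norm (z - y + h) > R" using h by auto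
        then have "z - y \<notin> K" "z - y + h \<notin> K" using R by (auto simp: subset_iff)
        then show ?thesis using K False by (simp add: r_def)
      qed
    qed
    also have "\<dots> = C * M * (norm h)\<^sup>2" by (simp add: M_def)
    finally show "\<bar>conv f \<rho> (z + h) - conv f \<rho> z - (\<Sum>i\<in>UNIV. h $ i * conv f (pd i \<rho>) z)\<bar> \<le> C * M * (norm h)\<^sup>2" .
  qed
qed

lemma pd_conv:
  assumes "sqint f" "\<rho> \<in> test_fun UNIV" shows "pd i (conv f \<rho>) = conv f (pd i \<rho>)"
proof
  fix z show "pd i (conv f \<rho>) z = conv f (pd i \<rho>) z"
    using pd_eq[OF conv_has_derivative[OF assms, of z], of i]
    by (simp add: axis_def if_distrib[of "\<lambda>x. x * _"] cong: if_cong)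
qed

lemma smooth_conv:
  assumes "sqint f" "\<rho> \<in> test_fun UNIV" shows "smooth (conv f \<rho>)"
proof -
  have d: "conv f \<rho> differentiable at z" if "\<rho> \<in> test_fun UNIV" for z \<rho>
    using conv_has_derivative[OF assms(1) that] by (auto simp: differentiable_def)
  have "Ck k (conv f \<rho>)" for k
    using assms(2)
  proof (induction k arbitrary: \<rho>)
    case 0
    then show ?case using d[OF 0] by (simp add: continuous_at_imp_continuous_on differentiable_imp_continuous_within)
  next
    case (Suc k)
    then show ?case using d[OF Suc.prems] pd_conv[OF assms(1) Suc.prems] test_fun_pd[OF Suc.prems] by simp
  qed
  then show ?thesis by (simp add: smooth_def)
qed

definition wpd :: "(real^'n) set \<Rightarrow> 'n \<Rightarrow> (real^'n \<Rightarrow> real) \<Rightarrow> (real^'n \<Rightarrow> real) \<Rightarrow> bool" where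
  "wpd U i f g \<longleftrightarrow> (\<forall>\<phi>\<in>test_fun U. (\<integral>x. f x * pd i \<phi> x) = - (\<integral>x. g x * \<phi> x))"

lemma conv_wpd:
  assumes "wpd U i f g" "\<rho> \<in> test_fun UNIV" "(\<lambda>y. \<rho> (z - y)) \<in> test_fun U"
  shows "conv f (pd i \<rho>) z = conv g \<rho> z"
proof -
  have "pd i (\<lambda>y. \<rho> (z - y)) y = - pd i \<rho> (z - y)" for y
    using pd_affine(1)[of \<rho> z "-1" y i] smooth_differentiable[OF test_fun_smooth[OF assms(2)]] by simp
  moreover have "(\<integral>y. f y * pd i (\<lambda>y. \<rho> (z - y)) y) = - (\<integral>y. g y * \<rho> (z - y))"
    using assms(1,3) unfolding wpd_def by blast
  ultimately have "- (\<integral>y. f y * pd i \<rho> (z - y)) = - (\<integral>y. g y * \<rho> (z - y))"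
    by (simp only: mult_minus_right integral_minus)
  then show ?thesis by (simp only: conv_def neg_equal_iff_equal)
qed

definition mollifier :: "real \<Rightarrow> (real^'n \<Rightarrow> real) \<Rightarrow> bool" where
  "mollifier e \<rho> \<longleftrightarrow> \<rho> \<in> test_fun UNIV \<and> (\<forall>x. 0 \<le> \<rho> x) \<and> (\<forall>x. norm x > e \<longrightarrow> \<rho> x = 0) \<and> (\<integral>x. \<rho> x) = 1"

lemma mollifier_exists:
  assumes e: "0 < e" shows "\<exists>\<rho> :: real^'n \<Rightarrow> real. mollifier e \<rho>"
proof -
  define g where "g x = gexp 0 (e\<^sup>2 - x \<bullet> x)" for x :: "real^'n"
  have c: "smooth (\<lambda>x::real^'n. x $ i)" for i
  proof -
    have "(\<lambda>x::real^'n. axis i 1 \<bullet> x) = (\<lambda>x. x $ i)" by (simp add: inner_axis' fun_eq_iff)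
    then show ?thesis using smooth_intros(2)[of "axis i (1::real)"] by simp
  qed
  have "smooth (\<lambda>x::real^'n. e\<^sup>2 - (\<Sum>i\<in>UNIV. x $ i * x $ i))"
    by (intro smooth_intros c finite)
  then have s: "smooth (\<lambda>x::real^'n. e\<^sup>2 - x \<bullet> x)" by (simp add: inner_vec_def)
  have zero: "g x = 0" if "norm x > e" for x
  proof -
    have "e\<^sup>2 \<le> (norm x)\<^sup>2" using that e by (intro power_mono) auto
    then show ?thesis by (simp add: g_def gexp_def dot_square_norm)
  qed
  have gt: "g \<in> test_fun UNIV"
  proof (rule test_funI[of _ "cball 0 e"])
    show "smooth g" unfolding g_def using smooth_on_chain[OF open_UNIV Dk_gexp _ , of _ 0] s by (simp add: smooth_on_UNIV)
    show "g x = 0" if "x \<notin> cball 0 e" for x using zero that by simp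
  qed auto
  have g0: "0 \<le> g x" for x by (simp add: g_def gexp_nonneg)
  define I where "I = (\<integral>x. g x)"
  have "I \<noteq> 0"
  proof
    assume "I = 0"
    then have "AE x in lebesgue. g x = 0"
      using integral_nonneg_eq_0_iff_AE[OF test_fun_integrable[OF gt]] g0 by (simp add: I_def)
    moreover have "g x \<noteq> 0" if "x \<in> ball 0 e" for x
    proof -
      have "(norm x)\<^sup>2 < e\<^sup>2" using that e by (intro power_strict_mono) auto
      then show ?thesis by (simp add: g_def gexp_def dot_square_norm)
    qed
    ultimately have "AE x in lebesgue. x \<notin> ball (0::real^'n) e"
      by (auto elim!: eventually_mono)
    then have "ball (0::real^'n) e \<in> null_sets lebesgue"
      using AE_iff_null_sets[of "ball (0::real^'n) e" lebesgue] by simp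
    then show False using open_not_negligible[of "ball (0::real^'n) e"] e by (simp add: negligible_iff_null_sets)
  qed
  moreover have "0 \<le> I" unfolding I_def by (rule integral_nonneg_AE) (simp add: g0)
  ultimately have I: "0 < I" by simp
  have "mollifier e (\<lambda>x. (1/I) * g x)"
    unfolding mollifier_def
  proof (intro conjI allI impI test_fun_cmult[OF gt])
    show "(\<integral>x. (1/I) * g x) = 1" using I by (simp add: I_def)
  qed (use g0 zero I in simp_all)
  then show ?thesis by blast
qed

lemma nn_integral_affine_le:
  fixes \<rho> :: "'a::euclidean_space \<Rightarrow> ennreal"
  assumes [measurable]: "\<rho> \<in> borel_measurable borel" and l: "l \<ge> 1"
  shows "(\<integral>\<^sup>+x. \<rho> (c + l *\<^sub>R x) \<partial>lborel) \<le> (\<integral>\<^sup>+x. \<rho> x \<partial>lborel)"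
proof -
  have "(\<integral>\<^sup>+x. \<rho> x \<partial>lborel) = (\<integral>\<^sup>+x. \<rho> x \<partial>density (distr lborel borel (\<lambda>x. c + l *\<^sub>R x)) (\<lambda>_. ennreal (\<bar>l\<bar>^DIM('a))))"
    using lborel_affine[of l c] l by simp
  also have "\<dots> = ennreal (\<bar>l\<bar>^DIM('a)) * (\<integral>\<^sup>+x. \<rho> (c + l *\<^sub>R x) \<partial>lborel)"
    by (simp add: nn_integral_density nn_integral_distr nn_integral_cmult)
  also have "\<dots> \<ge> 1 * (\<integral>\<^sup>+x. \<rho> (c + l *\<^sub>R x) \<partial>lborel)"
    using l by (intro mult_right_mono) (simp_all add: one_le_power)
  finally show ?thesis by simp
qed

text \<open>Cauchy-Schwarz for \<open>f * s\<close> against \<open>s\<close>, where \<open>s\<close>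
  is the square root of the reflected kernel; the total mass 1 of the mollifier makes the second
  factor equal to 1.\<close>

lemma conv_pointwise_bound:
  assumes f: "sqint f" and \<rho>: "mollifier e \<rho>"
  shows "(conv f \<rho> z)\<^sup>2 \<le> (\<integral>y. (f y)\<^sup>2 * \<rho> (z - y))" "integrable lebesgue (\<lambda>y. (f y)\<^sup>2 * \<rho> (z - y))"
proof -
  have t: "\<rho> \<in> test_fun UNIV" and p: "\<And>x. 0 \<le> \<rho> x" and I: "(\<integral>x. \<rho> x) = 1"
    using \<rho> by (auto simp: mollifier_def)
  have r: "(\<lambda>y. \<rho> (z - y)) \<in> test_fun UNIV" by (rule test_fun_reflect[OF t])
  define s where "s y = sqrt (\<rho> (z - y))" for y
  have ss: "s y * s y = \<rho> (z - y)" for y using p by (simp add: s_def)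
  have sm: "s \<in> borel_measurable lebesgue"
    unfolding s_def
    by (rule borel_measurable_continuous_on[OF continuous_on_real_sqrt[OF continuous_on_id] test_fun_measurable[OF r]])
  have sqs: "sqint s"
    unfolding sqint_def using sm test_fun_integrable[OF r] p by (simp add: s_def)
  obtain B where B: "\<And>x. \<bar>\<rho> x\<bar> \<le> B" using test_fun_bounded[OF t] by metis
  have "\<bar>s y\<bar> \<le> sqrt B" for y using B[of "z - y"] p by (simp add: s_def)
  then have sqf: "sqint (\<lambda>y. s y * f y)" by (rule sqint_mult_bounded[OF f sm])
  have eq: "(s y * f y)\<^sup>2 = (f y)\<^sup>2 * \<rho> (z - y)" for y
    by (simp add: ss[symmetric] power2_eq_square mult_ac)
  show "integrable lebesgue (\<lambda>y. (f y)\<^sup>2 * \<rho> (z - y))"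
    using sqint_integrable[OF sqf] by (simp add: eq)
  have "(\<integral>y. \<rho> (z - y)) = 1"
  proof -
    have bm: "(\<lambda>y. \<rho> (z - y)) \<in> borel_measurable borel" by (rule test_fun_borel[OF r])
    have "(\<integral>x. \<rho> x) = (\<integral>x. \<rho> x \<partial>lborel)"
      by (rule integral_completion) (use test_fun_borel[OF t] in simp)
    also have "\<dots> = (\<integral>x. \<rho> x \<partial>distr lborel borel (\<lambda>x. z + (-1) *\<^sub>R x))"
      using lborel_affine[of "-1" z] by (simp add: density_1)
    also have "\<dots> = (\<integral>x. \<rho> (z - x) \<partial>lborel)"
      using test_fun_borel[OF t] by (subst integral_distr) auto
    also have "\<dots> = (\<integral>x. \<rho> (z - x))"
      by (rule integral_completion[symmetric]) (use bm in simp)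
    finally show ?thesis using I by simp
  qed
  then have one: "abs_l2 s \<bullet> abs_l2 s = 1" by (simp add: l2_inner_real sqs ss)
  have "conv f \<rho> z = abs_l2 (\<lambda>y. s y * f y) \<bullet> abs_l2 s"
    unfolding l2_inner_real[OF sqf sqs] conv_def by (rule Bochner_Integration.integral_cong) (simp_all add: ss[symmetric])
  then have "(conv f \<rho> z)\<^sup>2 \<le> (abs_l2 (\<lambda>y. s y * f y) \<bullet> abs_l2 (\<lambda>y. s y * f y)) * (abs_l2 s \<bullet> abs_l2 s)"
    by (simp add: Cauchy_Schwarz_ineq)
  also have "\<dots> = (\<integral>y. (f y)\<^sup>2 * \<rho> (z - y))"
    unfolding one l2_inner_real[OF sqf sqf] by (simp add: eq[unfolded power2_eq_square] power2_eq_square)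
  finally show "(conv f \<rho> z)\<^sup>2 \<le> (\<integral>y. (f y)\<^sup>2 * \<rho> (z - y))" .
qed

lemma conv_AE_cong:
  assumes "AE x in lebesgue. f x = g x" "f \<in> borel_measurable lebesgue" "g \<in> borel_measurable lebesgue" "\<rho> \<in> test_fun UNIV"
  shows "conv f \<rho> = conv g \<rho>"
  unfolding conv_def using assms(1-3) test_fun_measurable[OF test_fun_reflect[OF assms(4)]]
  by (intro ext AE_eq_integral_cong_mult) auto

lemma conv_affine_measurable:
  assumes "sqint f" "\<rho> \<in> test_fun UNIV"
  shows "(\<lambda>x. conv f \<rho> (c + l *\<^sub>R x)) \<in> borel_measurable lebesgue"
  by (intro borel_measurable_lebesgueI borel_measurable_continuous_onI smooth_continuous smooth_on_affine smooth_conv assms)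

text \<open>The pointwise bound is integrated and the order of integration exchanged. The inner
  integral of the kernel along the affine map is at most 1, as the substitution contributes the
  factor l^(-d) and \<open>l \<ge> 1\<close>. The Borel representative \<open>g\<close> makes the
  exchange legitimate.\<close>

lemma conv_affine_sqint:
  assumes f: "sqint f" and \<rho>: "mollifier e \<rho>" and l: "l \<ge> 1"
  shows "sqint (\<lambda>x. conv f \<rho> (c + l *\<^sub>R x))" "norm (abs_l2 (\<lambda>x. conv f \<rho> (c + l *\<^sub>R x))) \<le> norm (abs_l2 f)"
proof -
  have t: "\<rho> \<in> test_fun UNIV" and p: "\<And>x. 0 \<le> \<rho> x" and I: "(\<integral>x. \<rho> x) = 1"
    using \<rho> by (auto simp: mollifier_def)
  have \<rho>m[measurable]: "\<rho> \<in> borel_measurable borel" by (rule test_fun_borel[OF t])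
  obtain g where g[measurable]: "g \<in> borel_measurable lborel" and fg: "AE x in lborel. f x = g x"
    using completion_ex_borel_measurable_real[of f lborel] sqint_measurable[OF f] by auto
  have fgL: "AE x in lebesgue. f x = g x" by (rule AE_completion[OF fg])
  have gm: "g \<in> borel_measurable lebesgue" by (rule measurable_completion) (rule g)
  have sg: "sqint g"
  proof (rule sqint_bound[OF f gm])
    show "AE x in lebesgue. norm (g x) \<le> 1 * norm (f x)" using fgL by eventually_elim simp
  qed
  have cg: "conv f \<rho> = conv g \<rho>"
    by (rule conv_AE_cong[OF fgL sqint_measurable[OF f] gm t])
  have [measurable]: "g \<in> borel_measurable borel" using g by simp
  have \<rho>1: "(\<integral>\<^sup>+x. ennreal (\<rho> x) \<partial>lborel) = 1"
  proof -
    have "(\<integral>\<^sup>+x. ennreal (\<rho> x) \<partial>lborel) = (\<integral>\<^sup>+x. ennreal (\<rho> x) \<partial>lebesgue)"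
      by (simp add: nn_integral_completion)
    also have "\<dots> = ennreal 1"
      using nn_integral_eq_integral[OF test_fun_integrable[OF t]] p I by simp
    finally show ?thesis by simp
  qed
  have pt: "ennreal ((conv g \<rho> z)\<^sup>2) \<le> (\<integral>\<^sup>+y. ennreal ((g y)\<^sup>2 * \<rho> (z - y)) \<partial>lborel)" for z
  proof -
    have "ennreal ((conv g \<rho> z)\<^sup>2) \<le> ennreal (\<integral>y. (g y)\<^sup>2 * \<rho> (z - y))"
      by (intro ennreal_leI conv_pointwise_bound(1)[OF sg \<rho>])
    also have "\<dots> = (\<integral>\<^sup>+y. ennreal ((g y)\<^sup>2 * \<rho> (z - y)) \<partial>lebesgue)"
      by (rule nn_integral_eq_integral[symmetric, OF conv_pointwise_bound(2)[OF sg \<rho>]]) (simp add: p)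
    also have "\<dots> = (\<integral>\<^sup>+y. ennreal ((g y)\<^sup>2 * \<rho> (z - y)) \<partial>lborel)"
      by (rule nn_integral_completion) measurable
    finally show ?thesis .
  qed
  have "(\<integral>\<^sup>+x. ennreal ((conv g \<rho> (c + l *\<^sub>R x))\<^sup>2) \<partial>lborel)
      \<le> (\<integral>\<^sup>+x. \<integral>\<^sup>+y. ennreal ((g y)\<^sup>2 * \<rho> (c + l *\<^sub>R x - y)) \<partial>lborel \<partial>lborel)"
    by (intro nn_integral_mono pt)
  also have "\<dots> = (\<integral>\<^sup>+y. \<integral>\<^sup>+x. ennreal ((g y)\<^sup>2 * \<rho> (c + l *\<^sub>R x - y)) \<partial>lborel \<partial>lborel)"
    by (rule lborel_pair.Fubini'[symmetric]) measurable
  also have "\<dots> = (\<integral>\<^sup>+y. ennreal ((g y)\<^sup>2) * (\<integral>\<^sup>+x. ennreal (\<rho> ((c - y) + l *\<^sub>R x)) \<partial>lborel) \<partial>lborel)"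
    by (simp add: ennreal_mult p nn_integral_cmult algebra_simps)
  also have "\<dots> \<le> (\<integral>\<^sup>+y. ennreal ((g y)\<^sup>2) * 1 \<partial>lborel)"
  proof (intro nn_integral_mono mult_left_mono)
    fix y
    have "(\<integral>\<^sup>+x. ennreal (\<rho> ((c - y) + l *\<^sub>R x)) \<partial>lborel) \<le> (\<integral>\<^sup>+x. ennreal (\<rho> x) \<partial>lborel)"
      by (rule nn_integral_affine_le[where \<rho>="\<lambda>x. ennreal (\<rho> x)", OF _ l]) measurable
    then show "(\<integral>\<^sup>+x. ennreal (\<rho> ((c - y) + l *\<^sub>R x)) \<partial>lborel) \<le> 1" by (simp add: \<rho>1)
  qed simp
  also have "\<dots> = (\<integral>\<^sup>+y. ennreal ((g y)\<^sup>2) \<partial>lebesgue)"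
    by (simp add: nn_integral_completion)
  also have "\<dots> = ennreal (\<integral>y. (g y)\<^sup>2)"
    using sqint_integrable[OF sg] by (intro nn_integral_eq_integral) auto
  finally have main: "(\<integral>\<^sup>+x. ennreal ((conv g \<rho> (c + l *\<^sub>R x))\<^sup>2) \<partial>lborel) \<le> ennreal (\<integral>y. (g y)\<^sup>2)" .
  have cm: "(\<lambda>x. conv g \<rho> (c + l *\<^sub>R x)) \<in> borel_measurable borel"
    by (intro borel_measurable_continuous_onI smooth_continuous smooth_on_affine smooth_conv sg t)
  have main': "(\<integral>\<^sup>+x. ennreal ((conv g \<rho> (c + l *\<^sub>R x))\<^sup>2) \<partial>lebesgue) \<le> ennreal (\<integral>y. (g y)\<^sup>2)"
    using main cm by (subst nn_integral_completion) auto
  have int: "integrable lebesgue (\<lambda>x. (conv g \<rho> (c + l *\<^sub>R x))\<^sup>2)"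
  proof (rule integrableI_nonneg)
    show "(\<lambda>x. (conv g \<rho> (c + l *\<^sub>R x))\<^sup>2) \<in> borel_measurable lebesgue"
      by (intro borel_measurable_power conv_affine_measurable sg t)
    show "(\<integral>\<^sup>+x. ennreal ((conv g \<rho> (c + l *\<^sub>R x))\<^sup>2) \<partial>lebesgue) < \<infinity>"
      using main' by (rule le_less_trans) simp
  qed simp
  show sq: "sqint (\<lambda>x. conv f \<rho> (c + l *\<^sub>R x))"
    unfolding cg sqint_def using int conv_affine_measurable[OF sg t] by simp
  have "ennreal (\<integral>x. (conv g \<rho> (c + l *\<^sub>R x))\<^sup>2) \<le> ennreal (\<integral>y. (g y)\<^sup>2)"
    using main' nn_integral_eq_integral[OF int] by simp
  then have "(\<integral>x. (conv g \<rho> (c + l *\<^sub>R x))\<^sup>2) \<le> (\<integral>y. (g y)\<^sup>2)"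
    by (subst (asm) ennreal_le_iff) (auto intro!: integral_nonneg_AE)
  then have "(norm (abs_l2 (\<lambda>x. conv f \<rho> (c + l *\<^sub>R x))))\<^sup>2 \<le> (norm (abs_l2 g))\<^sup>2"
    using sq norm_abs_l2[OF sg] norm_abs_l2[OF sq] by (simp add: cg)
  moreover have "abs_l2 g = abs_l2 f" using fgL abs_l2_eq_iff[OF f sg] by simp
  ultimately show "norm (abs_l2 (\<lambda>x. conv f \<rho> (c + l *\<^sub>R x))) \<le> norm (abs_l2 f)"
    using power2_le_imp_le by fastforce
qed

section \<open>Density of test functions and convergence of dilated mollifications\<close>

lemma subspace_closure:
  fixes S :: "'a::real_normed_vector set"
  assumes S: "subspace S" shows "subspace (closure S)"
proof (rule subspaceI)
  show "0 \<in> closure S" using subspace_0[OF S] closure_subset by blast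
  fix x y assume "x \<in> closure S" "y \<in> closure S"
  then obtain a b where ab: "\<forall>n. a n \<in> S" "a \<longlonglongrightarrow> x" "\<forall>n. b n \<in> S" "b \<longlonglongrightarrow> y"
    unfolding closure_sequential by blast
  then have "\<forall>n. a n + b n \<in> S" "(\<lambda>n. a n + b n) \<longlonglongrightarrow> x + y"
    by (auto intro: subspace_add[OF S] tendsto_add)
  then show "x + y \<in> closure S" unfolding closure_sequential by (intro exI[of _ "\<lambda>n. a n + b n"] conjI)
next
  fix c and x assume "x \<in> closure S"
  then obtain a where a: "\<forall>n. a n \<in> S" "a \<longlonglongrightarrow> x" unfolding closure_sequential by blast
  then have "\<forall>n. c *\<^sub>R a n \<in> S" "(\<lambda>n. c *\<^sub>R a n) \<longlonglongrightarrow> c *\<^sub>R x"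
    by (auto intro: subspace_scale[OF S] tendsto_scaleR)
  then show "c *\<^sub>R x \<in> closure S" unfolding closure_sequential by (intro exI[of _ "\<lambda>n. c *\<^sub>R a n"] conjI)
qed

text \<open>A class orthogonal to all test functions vanishes by the fundamental lemma, so the
  closure of their span exhausts the space.\<close>

lemma test_fun_dense:
  fixes f :: "real^'n \<Rightarrow> real"
  assumes f: "sqint f" and e: "0 < e"
  shows "\<exists>\<phi>\<in>test_fun UNIV. norm (abs_l2 f - abs_l2 \<phi>) < e"
proof -
  define S where "S = abs_l2 ` test_fun (UNIV :: (real^'n) set)"
  have sub: "subspace S"
  proof (rule subspaceI)
    show "0 \<in> S" unfolding S_def abs_l2_zero[symmetric] by (rule imageI[OF test_fun_zero])
    fix x y assume "x \<in> S" "y \<in> S"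
    then obtain \<phi> \<psi> where *: "\<phi> \<in> test_fun UNIV" "x = abs_l2 \<phi>" "\<psi> \<in> test_fun UNIV" "y = abs_l2 \<psi>" by (auto simp: S_def)
    have "x + y = abs_l2 (\<lambda>x. \<phi> x + \<psi> x)" unfolding * by (intro abs_l2_add test_fun_sqint[OF *(1)] test_fun_sqint[OF *(3)])
    then show "x + y \<in> S" unfolding S_def using test_fun_add[OF *(1,3)] by blast
  next
    fix c x assume "x \<in> S"
    then obtain \<phi> where *: "\<phi> \<in> test_fun UNIV" "x = abs_l2 \<phi>" by (auto simp: S_def)
    have "c *\<^sub>R x = abs_l2 (\<lambda>x. c * \<phi> x)" unfolding * using abs_l2_scaleR[OF test_fun_sqint[OF *(1)], of c] by simp
    then show "c *\<^sub>R x \<in> S" unfolding S_def using test_fun_cmult[OF *(1)] by blast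
  qed
  have "abs_l2 f \<in> closure S"
  proof (rule closed_subspace_eqI[OF closed_closure subspace_closure[OF sub], where W=UNIV])
    fix v :: "(real^'n, real) l2" assume v: "\<And>y. y \<in> closure S \<Longrightarrow> v \<bullet> y = 0"
    have "AE x in lebesgue. x \<in> UNIV \<longrightarrow> rep_l2 v x = 0"
    proof (rule test_fun_fundamental[OF open_UNIV sqint_rep])
      fix \<phi> :: "real^'n \<Rightarrow> real" assume \<phi>: "\<phi> \<in> test_fun UNIV"
      then have "v \<bullet> abs_l2 \<phi> = 0" using v closure_subset[of S] by (auto simp: S_def)
      then show "(\<integral>x. rep_l2 v x * \<phi> x) = 0"
        using l2_inner_real[OF sqint_rep[of v] test_fun_sqint[OF \<phi>]] by simp
    qed
    then show "v = 0" unfolding l2_eq_iff using rep_zero_AE by eventually_elim simp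
  qed auto
  then have "\<exists>y\<in>S. dist y (abs_l2 f) < e" using closure_approachable e by blast
  then obtain \<phi> where "\<phi> \<in> test_fun UNIV" "dist (abs_l2 \<phi>) (abs_l2 f) < e" by (auto simp: S_def)
  then show ?thesis by (auto simp: dist_norm norm_minus_commute)
qed

lemma norm_abs_l2_le:
  fixes f :: "'a::euclidean_space \<Rightarrow> real"
  assumes f: "sqint f" and b: "\<And>x. \<bar>f x\<bar> \<le> C" and S: "\<And>x. x \<notin> cball a R \<Longrightarrow> f x = 0" and C: "0 \<le> C"
  shows "norm (abs_l2 f) \<le> C * sqrt (measure lebesgue (cball a R))"
proof -
  have "(norm (abs_l2 f))\<^sup>2 = (\<integral>x. (norm (f x))\<^sup>2)" by (rule norm_abs_l2[OF f])
  also have "\<dots> \<le> (\<integral>x. C\<^sup>2 * indicator (cball a R) x)"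
  proof (rule integral_mono[OF sqint_integrable[OF f] integrable_indicator_cball])
    fix x show "(norm (f x))\<^sup>2 \<le> C\<^sup>2 * indicator (cball a R) x"
    proof (cases "x \<in> cball a R")
      case True
      have "(norm (f x))\<^sup>2 \<le> C\<^sup>2" using b[of x] by (intro power_mono) auto
      then show ?thesis using True by (simp add: indicator_def)
    qed (use S in simp)
  qed
  also have "\<dots> = C\<^sup>2 * measure lebesgue (cball a R)" by simp
  also have "\<dots> = (C * sqrt (measure lebesgue (cball a R)))\<^sup>2" by (simp add: power_mult_distrib)
  finally show ?thesis by (rule power2_le_imp_le) (simp add: C)
qed

text \<open>Evaluating a function at \<open>dilate a l x\<close> with \<open>l > 1\<close> contracts
  its support towards \<open>a\<close>, which later creates the room at the boundary that
  mollification consumes.\<close>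

definition dilate :: "real^'n \<Rightarrow> real \<Rightarrow> real^'n \<Rightarrow> real^'n" where
  "dilate a l x = (1 - l) *\<^sub>R a + l *\<^sub>R x"

lemma dilate_dist: "dilate a l x - x = (l - 1) *\<^sub>R (x - a)"
  by (simp add: dilate_def algebra_simps)

lemma dilate_center: "dilate a l x - a = l *\<^sub>R (x - a)"
  by (simp add: dilate_def algebra_simps)

text \<open>A test function is Lipschitz, so its mollification at \<open>z\<close> differs from
  \<open>\<phi> x\<close> by at most \<open>L * (e + norm (z - x))\<close>, and dilation displaces
  \<open>x\<close> by \<open>(l - 1) * norm (x - a)\<close>. Since \<open>e \<le> 1\<close> and
  \<open>l \<ge> 1\<close>, the difference lives on \<open>cball a (R + 1)\<close>, so the uniform
  bound becomes a bound in norm.\<close>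

lemma mollify_test_fun_bound:
  fixes \<phi> :: "real^'n \<Rightarrow> real"
  assumes \<phi>: "\<phi> \<in> test_fun UNIV"
  obtains C where "0 \<le> C" "\<And>e \<rho> l. mollifier e \<rho> \<Longrightarrow> 0 \<le> e \<Longrightarrow> e \<le> 1 \<Longrightarrow> 1 \<le> l \<Longrightarrow>
    norm (abs_l2 (\<lambda>x. conv \<phi> \<rho> (dilate a l x)) - abs_l2 \<phi>) \<le> C * (e + (l - 1))"
proof -
  obtain K where K: "compact K" "\<And>x. x \<notin> K \<Longrightarrow> \<phi> x = 0" using test_funE[OF \<phi>] by metis
  obtain R where R: "0 \<le> R" "K \<subseteq> cball a R"
  proof -
    obtain r where "\<forall>y\<in>K. dist a y \<le> r" using compact_imp_bounded[OF K(1)] bounded_any_center by blast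
    then show thesis using that[of "max r 0"] by fastforce
  qed
  obtain L where L: "0 \<le> L" "\<And>x y. \<bar>\<phi> x - \<phi> y\<bar> \<le> L * norm (x - y)" using test_fun_Lipschitz[OF \<phi>] by metis
  define V where "V = sqrt (measure lebesgue (cball a (R + 1)))"
  define C where "C = L * (R + 2) * V"
  have V0: "0 \<le> V" by (simp add: V_def)
  have "norm (abs_l2 (\<lambda>x. conv \<phi> \<rho> (dilate a l x)) - abs_l2 \<phi>) \<le> C * (e + (l - 1))"
    if \<rho>: "mollifier e \<rho>" and e: "0 \<le> e" "e \<le> 1" and l: "1 \<le> l" for e \<rho> l
  proof -
    have t: "\<rho> \<in> test_fun UNIV" and p: "\<And>x. 0 \<le> \<rho> x" and I: "(\<integral>x. \<rho> x) = 1"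
      and far: "\<And>x. norm x > e \<Longrightarrow> \<rho> x = 0"
      using \<rho> by (auto simp: mollifier_def)
    have Iz: "(\<integral>y. \<rho> (z - y)) = 1" for z
    proof -
      have bm: "\<rho> \<in> borel_measurable borel" by (rule test_fun_borel[OF t])
      have "(\<integral>x. \<rho> x) = (\<integral>x. \<rho> x \<partial>lborel)"
        by (rule integral_completion) (use bm in simp)
      also have "\<dots> = (\<integral>x. \<rho> x \<partial>distr lborel borel (\<lambda>x. z + (-1) *\<^sub>R x))"
        using lborel_affine[of "-1" z] by (simp add: density_1)
      also have "\<dots> = (\<integral>x. \<rho> (z - x) \<partial>lborel)"
        using bm by (subst integral_distr) auto
      also have "\<dots> = (\<integral>x. \<rho> (z - x))"
        by (rule integral_completion[symmetric]) (use test_fun_borel[OF test_fun_reflect[OF t]] in simp)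
      finally show ?thesis using I by simp
    qed
    have sq: "sqint (\<lambda>x. conv \<phi> \<rho> (dilate a l x))"
      unfolding dilate_def by (rule conv_affine_sqint(1)[OF test_fun_sqint[OF \<phi>] \<rho> l])
    have diff: "\<bar>conv \<phi> \<rho> z - \<phi> x\<bar> \<le> L * (e + norm (z - x))" for z x
    proof -
      have i1: "integrable lebesgue (\<lambda>y. \<phi> y * \<rho> (z - y))" by (rule conv_integrable[OF test_fun_sqint[OF \<phi>] t])
      have i2: "integrable lebesgue (\<lambda>y. c * \<rho> (z - y))" for c
        by (intro integrable_mult_right test_fun_integrable[OF test_fun_reflect[OF t]])
      have "conv \<phi> \<rho> z - \<phi> x = (\<integral>y. \<phi> y * \<rho> (z - y) - \<phi> x * \<rho> (z - y))"
        using i1 i2[of "\<phi> x"] Iz[of z] by (simp add: conv_def)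
      also have "\<bar>\<dots>\<bar> \<le> (\<integral>y. (L * (e + norm (z - x))) * \<rho> (z - y))"
      proof (rule integral_abs_bound_integral)
        fix y
        show "\<bar>\<phi> y * \<rho> (z - y) - \<phi> x * \<rho> (z - y)\<bar> \<le> (L * (e + norm (z - x))) * \<rho> (z - y)"
        proof (cases "norm (z - y) > e")
          case False
          have "norm (y - x) \<le> norm (z - y) + norm (z - x)"
            using norm_triangle_ineq4[of "z - x" "z - y"] by (simp add: algebra_simps)
          then have "L * norm (y - x) \<le> L * (e + norm (z - x))" using False L(1) by (intro mult_left_mono) auto
          then have "\<bar>\<phi> y - \<phi> x\<bar> \<le> L * (e + norm (z - x))" using L(2)[of y x] by simp
          then have "\<bar>\<phi> y - \<phi> x\<bar> * \<rho> (z - y) \<le> (L * (e + norm (z - x))) * \<rho> (z - y)" by (rule mult_right_mono[OF _ p])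
          moreover have "\<bar>\<phi> y * \<rho> (z - y) - \<phi> x * \<rho> (z - y)\<bar> = \<bar>\<phi> y - \<phi> x\<bar> * \<rho> (z - y)"
            using p[of "z - y"] by (simp flip: left_diff_distrib add: abs_mult)
          ultimately show ?thesis by simp
        qed (use far[of "z - y"] in simp)
      qed (use i1 i2 in auto)
      also have "\<dots> = L * (e + norm (z - x))" using Iz[of z] by simp
      finally show ?thesis .
    qed
    have zero: "conv \<phi> \<rho> (dilate a l x) - \<phi> x = 0" if "x \<notin> cball a (R + 1)" for x
    proof -
      have x: "norm (x - a) > R + 1" using that by (simp add: dist_norm norm_minus_commute)
      have "\<phi> y * \<rho> (dilate a l x - y) = 0" for y
      proof (cases "y \<in> K")
        case True
        have "1 * norm (x - a) \<le> l * norm (x - a)" by (rule mult_right_mono[OF l]) simp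
        also have "\<dots> = norm (dilate a l x - a)" using l by (simp add: dilate_center)
        also have "\<dots> \<le> norm (dilate a l x - y) + norm (y - a)"
          using norm_triangle_ineq[of "dilate a l x - y" "y - a"] by simp
        also have "norm (y - a) \<le> R" using True R by (auto simp: dist_norm norm_minus_commute subset_iff)
        finally have "norm (dilate a l x - y) > e" using x e by simp
        then show ?thesis using far by simp
      qed (use K in simp)
      then have "conv \<phi> \<rho> (dilate a l x) = 0" unfolding conv_def by (simp only: integral_zero)
      moreover have "x \<notin> K" using that R by (auto simp: subset_iff)
      ultimately show ?thesis using K by simp
    qed
    have bound: "\<bar>conv \<phi> \<rho> (dilate a l x) - \<phi> x\<bar> \<le> L * ((R + 2) * (e + (l - 1)))" for x
    proof (cases "x \<in> cball a (R + 1)")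
      case True
      have "norm (dilate a l x - x) \<le> (l - 1) * (R + 1)"
        unfolding dilate_dist using True l by (simp add: dist_norm norm_minus_commute mult_left_mono)
      then have "e + norm (dilate a l x - x) \<le> e + (l - 1) * (R + 1)" by simp
      also have "\<dots> \<le> (R + 2) * (e + (l - 1))"
        using mult_nonneg_nonneg[OF R(1) e(1)] e l by (simp add: algebra_simps)
      finally have "L * (e + norm (dilate a l x - x)) \<le> L * ((R + 2) * (e + (l - 1)))"
        by (rule mult_left_mono[OF _ L(1)])
      then show ?thesis using diff[of "dilate a l x" x] by simp
    qed (use zero L(1) R(1) e l in simp)
    have "abs_l2 (\<lambda>x. conv \<phi> \<rho> (dilate a l x)) - abs_l2 \<phi> = abs_l2 (\<lambda>x. conv \<phi> \<rho> (dilate a l x) - \<phi> x)"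
      by (rule abs_l2_diff[OF sq test_fun_sqint[OF \<phi>]])
    also have "norm \<dots> \<le> (L * ((R + 2) * (e + (l - 1)))) * V"
      unfolding V_def
      by (rule norm_abs_l2_le[OF sqint_diff[OF sq test_fun_sqint[OF \<phi>]] bound zero]) (use L(1) R(1) e l in \<open>auto intro!: mult_nonneg_nonneg\<close>)
    finally show ?thesis by (simp add: C_def mult_ac)
  qed
  moreover have "0 \<le> C" using L(1) R(1) V0 by (simp add: C_def)
  ultimately show thesis using that by blast
qed

lemma conv_diff:
  assumes "sqint f" "sqint g" "\<rho> \<in> test_fun UNIV"
  shows "conv (\<lambda>x. f x - g x) \<rho> z = conv f \<rho> z - conv g \<rho> z"
  using conv_integrable[OF assms(1,3), of z] conv_integrable[OF assms(2,3), of z]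
  by (simp add: conv_def left_diff_distrib)

text \<open>Three terms: \<open>f\<close> is replaced by a nearby test function, the replacement
  error does not grow under the operators by \<open>conv_affine_sqint\<close>, and for the test
  function the rate of \<open>mollify_test_fun_bound\<close> applies.\<close>

lemma mollify_tendsto:
  fixes f :: "real^'n \<Rightarrow> real"
  assumes f: "sqint f" and \<rho>: "\<And>k. mollifier (e k) (\<rho> k)" and e: "\<And>k. 0 \<le> e k" "\<And>k. e k \<le> 1" "e \<longlonglongrightarrow> 0"
    and l: "\<And>k. 1 \<le> l k" "l \<longlonglongrightarrow> 1"
  shows "(\<lambda>k. abs_l2 (\<lambda>x. conv f (\<rho> k) (dilate a (l k) x))) \<longlonglongrightarrow> abs_l2 f"
proof (rule LIMSEQ_I)
  fix r :: real assume r: "0 < r"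
  obtain \<phi> where \<phi>: "\<phi> \<in> test_fun UNIV" "norm (abs_l2 f - abs_l2 \<phi>) < r / 3"
    using test_fun_dense[OF f, of "r / 3"] r by auto
  obtain C where C: "0 \<le> C" "\<And>e \<rho> l. mollifier e \<rho> \<Longrightarrow> 0 \<le> e \<Longrightarrow> e \<le> 1 \<Longrightarrow> 1 \<le> l \<Longrightarrow>
    norm (abs_l2 (\<lambda>x. conv \<phi> \<rho> (dilate a l x)) - abs_l2 \<phi>) \<le> C * (e + (l - 1))"
    using mollify_test_fun_bound[OF \<phi>(1), of a] by metis
  have "(\<lambda>k. C * (e k + (l k - 1))) \<longlonglongrightarrow> C * (0 + (1 - 1))"
    by (intro tendsto_intros e l)
  then have "(\<lambda>k. C * (e k + (l k - 1))) \<longlonglongrightarrow> 0" by simp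
  then have "\<forall>\<^sub>F k in sequentially. C * (e k + (l k - 1)) < r / 3"
    by (rule order_tendstoD) (use r in simp)
  then obtain N where N: "\<And>k. k \<ge> N \<Longrightarrow> C * (e k + (l k - 1)) < r / 3"
    by (auto simp: eventually_sequentially)
  show "\<exists>N. \<forall>k\<ge>N. norm (abs_l2 (\<lambda>x. conv f (\<rho> k) (dilate a (l k) x)) - abs_l2 f) < r"
  proof (intro exI[of _ N] allI impI)
    fix k assume k: "k \<ge> N"
    have t: "\<rho> k \<in> test_fun UNIV" using \<rho> by (simp add: mollifier_def)
    define J where "J g = abs_l2 (\<lambda>x. conv g (\<rho> k) (dilate a (l k) x))" for g
    have sq: "sqint (\<lambda>x. conv g (\<rho> k) (dilate a (l k) x))" if "sqint g" for g
      unfolding dilate_def by (rule conv_affine_sqint(1)[OF that \<rho> l(1)])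
    have Jd: "J f - J \<phi> = J (\<lambda>x. f x - \<phi> x)"
      unfolding J_def using abs_l2_diff[OF sq[OF f] sq[OF test_fun_sqint[OF \<phi>(1)]]]
      by (simp add: conv_diff[OF f test_fun_sqint[OF \<phi>(1)] t])
    have "norm (J (\<lambda>x. f x - \<phi> x)) \<le> norm (abs_l2 (\<lambda>x. f x - \<phi> x))"
      unfolding J_def dilate_def by (rule conv_affine_sqint(2)[OF sqint_diff[OF f test_fun_sqint[OF \<phi>(1)]] \<rho> l(1)])
    then have 1: "norm (J f - J \<phi>) < r / 3"
      unfolding Jd using \<phi>(2) abs_l2_diff[OF f test_fun_sqint[OF \<phi>(1)]] by simp
    have 2: "norm (J \<phi> - abs_l2 \<phi>) < r / 3"
      unfolding J_def by (rule le_less_trans[OF C(2)[OF \<rho>[of k] e(1)[of k] e(2)[of k] l(1)[of k]] N[OF k]])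
    have "J f - abs_l2 f = (J f - J \<phi>) + (J \<phi> - abs_l2 \<phi>) - (abs_l2 f - abs_l2 \<phi>)" by simp
    then have "norm (J f - abs_l2 f) \<le> norm (J f - J \<phi>) + norm (J \<phi> - abs_l2 \<phi>) + norm (abs_l2 f - abs_l2 \<phi>)"
      by (simp only:) (rule order_trans[OF norm_triangle_ineq4 add_right_mono[OF norm_triangle_ineq]])
    then show "norm (abs_l2 (\<lambda>x. conv f (\<rho> k) (dilate a (l k) x)) - abs_l2 f) < r"
      using 1 2 \<phi>(2) by (simp add: J_def)
  qed
qed

section \<open>Calculus of weak derivatives\<close>

lemma dilate_1: "dilate a 1 x = x"
  by (simp add: dilate_def)

text \<open>Mollification with radii below the distance from \<open>K\<close> to the complement of
  \<open>U\<close> commutes with weak differentiation on \<open>K\<close>. The mollified derivatives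
  \<open>G i k\<close> are defined on the whole space, so that they converge in norm there; they are
  claimed to be derivatives of \<open>F k\<close> on \<open>K\<close> only.\<close>

lemma local_smooth_approximation:
  fixes f :: "real^'n \<Rightarrow> real"
  assumes U: "open U" and K: "compact K" "K \<subseteq> U" and f: "sqint f"
    and g: "\<And>i. sqint (g i)" "\<And>i. wpd U i f (g i)"
  obtains F G where "\<And>k. smooth (F k)" "\<And>k. sqint (F k)" "(\<lambda>k. abs_l2 (F k)) \<longlonglongrightarrow> abs_l2 f"
    "\<And>i k. sqint (G i k)" "\<And>i. (\<lambda>k. abs_l2 (G i k)) \<longlonglongrightarrow> abs_l2 (g i)"
    "\<And>i k x. x \<in> K \<Longrightarrow> pd i (F k) x = G i k x"
proof -
  obtain d where d: "0 < d" "(\<Union>x\<in>K. cball x d) \<subseteq> U"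
    using compact_subset_open_imp_cball_epsilon_subset[OF K(1) U K(2)] by blast
  define e where "e k = min d 1 / real (Suc k)" for k
  have e: "0 < e k" "e k \<le> d" "e k \<le> 1" for k
  proof -
    show "0 < e k" using d by (simp add: e_def)
    have "e k \<le> min d 1 / 1" unfolding e_def using d by (intro divide_left_mono) auto
    then show "e k \<le> d" "e k \<le> 1" by auto
  qed
  have e0: "e \<longlonglongrightarrow> 0" unfolding e_def
    using tendsto_mult_right_zero[OF LIMSEQ_Suc[OF lim_1_over_n], of "min d 1"] by simp
  have "\<exists>\<rho>. mollifier (e k) (\<rho> :: real^'n \<Rightarrow> real)" for k by (rule mollifier_exists[OF e(1)])
  then obtain \<rho> :: "nat \<Rightarrow> real^'n \<Rightarrow> real" where \<rho>: "\<And>k. mollifier (e k) (\<rho> k)" by metis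
  have t: "\<rho> k \<in> test_fun UNIV" and far: "norm x > e k \<Longrightarrow> \<rho> k x = 0" for k x
    using \<rho>[of k] by (auto simp: mollifier_def)
  have conv_lim: "(\<lambda>k. abs_l2 (conv h (\<rho> k))) \<longlonglongrightarrow> abs_l2 h" if "sqint h" for h
    using mollify_tendsto[OF that \<rho> less_imp_le[OF e(1)] e(3) e0, of "\<lambda>_. 1" 0] by (simp add: dilate_1)
  have conv_sq: "sqint (conv h (\<rho> k))" if "sqint h" for h k
    using conv_affine_sqint(1)[OF that \<rho>[of k], of 1 0] by simp
  show thesis
  proof (rule that[of "\<lambda>k. conv f (\<rho> k)" "\<lambda>i k. conv (g i) (\<rho> k)"])
    show "smooth (conv f (\<rho> k))" for k by (rule smooth_conv[OF f t])
    show "pd i (conv f (\<rho> k)) x = conv (g i) (\<rho> k) x" if x: "x \<in> K" for i k x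
    proof -
      have "(\<lambda>y. \<rho> k (x - y)) \<in> test_fun U"
      proof (rule test_funI[of _ "cball x d"])
        show "smooth (\<lambda>y. \<rho> k (x - y))" by (rule test_fun_smooth[OF test_fun_reflect[OF t]])
        show "cball x d \<subseteq> U" using d(2) x by blast
        show "\<rho> k (x - y) = 0" if "y \<notin> cball x d" for y
          by (rule far) (use that e(2)[of k] in \<open>simp add: dist_norm\<close>)
      qed auto
      then show ?thesis unfolding pd_conv[OF f t] by (rule conv_wpd[OF g(2) t])
    qed
  qed (use conv_lim conv_sq f g in auto)
qed

lemma wpdD:
  "wpd U i f g \<Longrightarrow> \<phi> \<in> test_fun U \<Longrightarrow> (\<integral>x. f x * pd i \<phi> x) = - (\<integral>x. g x * \<phi> x)"
  by (simp add: wpd_def)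

lemma smooth_mult_pd:
  fixes \<psi> F :: "real^'n \<Rightarrow> real"
  assumes "smooth \<psi>" "smooth F"
  shows "pd i (\<lambda>x. \<psi> x * F x) x = \<psi> x * pd i F x + pd i \<psi> x * F x"
  by (intro pd_mult smooth_differentiable assms)

text \<open>Only one factor is mollified. Then \<open>F k x * \<psi> x\<close> is an admissible test
  function in the definition of the weak derivative of \<open>g\<close>, and each term of the
  resulting identity is a pairing that passes to the limit.\<close>

lemma weak_product_rule:
  fixes f g :: "real^'n \<Rightarrow> real"
  assumes U: "open U" and \<psi>: "\<psi> \<in> test_fun U"
    and f: "sqint f" "\<And>i. sqint (f' i)" "\<And>i. wpd U i f (f' i)"
    and g: "sqint g" "sqint g'" "wpd U i g g'"
  shows "(\<integral>x. \<psi> x * (f x * g' x)) + (\<integral>x. \<psi> x * (f' i x * g x))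
     = - (\<integral>x. pd i \<psi> x * (f x * g x))"
proof -
  obtain K where K: "compact K" "K \<subseteq> U" "\<And>x. x \<notin> K \<Longrightarrow> \<psi> x = 0" "\<And>x i. x \<notin> K \<Longrightarrow> pd i \<psi> x = 0"
    using test_funE[OF \<psi>] by metis
  obtain F G where FG: "\<And>k. smooth (F k)" "\<And>k. sqint (F k)" "(\<lambda>k. abs_l2 (F k)) \<longlonglongrightarrow> abs_l2 f"
    "\<And>i k. sqint (G i k)" "\<And>i. (\<lambda>k. abs_l2 (G i k)) \<longlonglongrightarrow> abs_l2 (f' i)"
    "\<And>i k x. x \<in> K \<Longrightarrow> pd i (F k) x = G i k x"
    using local_smooth_approximation[OF U K(1,2) f] by blast
  have s1: "sqint (\<lambda>x. \<psi> x * g' x)" "sqint (\<lambda>x. \<psi> x * g x)" "sqint (\<lambda>x. pd i \<psi> x * g x)"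
    using sqint_mult_test[OF _ \<psi>] sqint_mult_test[OF _ test_fun_pd[OF \<psi>]] g by simp_all
  have eq: "(\<integral>x. (pd i \<psi> x * g x) * F k x) + (\<integral>x. (\<psi> x * g x) * G i k x)
      = - (\<integral>x. (\<psi> x * g' x) * F k x)" for k
  proof -
    have t: "(\<lambda>x. F k x * \<psi> x) \<in> test_fun U" by (rule test_fun_mult_smooth[OF \<psi> FG(1)])
    have "g x * pd i (\<lambda>x. F k x * \<psi> x) x = (pd i \<psi> x * g x) * F k x + (\<psi> x * g x) * G i k x" for x
      using smooth_mult_pd[OF FG(1) test_fun_smooth[OF \<psi>], of i k x] FG(6)[of x i k] K(3)[of x]
      by (cases "x \<in> K") (simp_all add: algebra_simps)
    then have "(\<lambda>x. g x * pd i (\<lambda>x. F k x * \<psi> x) x) = (\<lambda>x. (pd i \<psi> x * g x) * F k x + (\<psi> x * g x) * G i k x)" by blast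
    from wpdD[OF g(3) t, unfolded this]
    have "(\<integral>x. (pd i \<psi> x * g x) * F k x + (\<psi> x * g x) * G i k x) = - (\<integral>x. g' x * (F k x * \<psi> x))" .
    then show ?thesis
      using sqint_integrable_mult[OF s1(3) FG(2)[of k]] sqint_integrable_mult[OF s1(2) FG(4)[of i k]]
      by (simp add: mult_ac)
  qed
  have "(\<lambda>k. (\<integral>x. (pd i \<psi> x * g x) * F k x) + (\<integral>x. (\<psi> x * g x) * G i k x))
     \<longlonglongrightarrow> (\<integral>x. (pd i \<psi> x * g x) * f x) + (\<integral>x. (\<psi> x * g x) * f' i x)"
    by (intro tendsto_add l2_tendsto_integral FG f s1)
  moreover have "(\<lambda>k. - (\<integral>x. (\<psi> x * g' x) * F k x)) \<longlonglongrightarrow> - (\<integral>x. (\<psi> x * g' x) * f x)"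
    by (intro tendsto_minus l2_tendsto_integral FG f s1)
  ultimately have "(\<integral>x. (pd i \<psi> x * g x) * f x) + (\<integral>x. (\<psi> x * g x) * f' i x)
     = - (\<integral>x. (\<psi> x * g' x) * f x)"
    unfolding eq using LIMSEQ_unique by blast
  then show ?thesis by (simp add: mult_ac)
qed

text \<open>The test functions are now first derivatives of the mollified \<open>f\<close> times
  \<open>\<zeta>\<close>. This produces mixed second derivatives of \<open>F k\<close>, which need
  not converge; they occur with both orders of \<open>i\<close> and \<open>j\<close> and cancel by
  \<open>pd_commute\<close> before the limit is taken. Hence first derivatives of \<open>f\<close>
  and \<open>g\<close> suffice.\<close>

lemma weak_cross_rule:
  fixes f g :: "real^'n \<Rightarrow> real"
  assumes U: "open U" and \<zeta>: "\<zeta> \<in> test_fun U"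
    and f: "sqint f" "\<And>i. sqint (f' i)" "\<And>i. wpd U i f (f' i)"
    and g: "sqint g" "\<And>i. sqint (g' i)" "\<And>i. wpd U i g (g' i)"
  shows "(\<integral>x. \<zeta> x * (f' i x * g' j x)) - (\<integral>x. \<zeta> x * (f' j x * g' i x))
     = (\<integral>x. pd i \<zeta> x * (f' j x * g x)) - (\<integral>x. pd j \<zeta> x * (f' i x * g x))"
proof -
  obtain K where K: "compact K" "K \<subseteq> U" "\<And>x. x \<notin> K \<Longrightarrow> \<zeta> x = 0" "\<And>x i. x \<notin> K \<Longrightarrow> pd i \<zeta> x = 0"
    using test_funE[OF \<zeta>] by metis
  obtain F G where FG: "\<And>k. smooth (F k)" "\<And>k. sqint (F k)" "(\<lambda>k. abs_l2 (F k)) \<longlonglongrightarrow> abs_l2 f"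
    "\<And>i k. sqint (G i k)" "\<And>i. (\<lambda>k. abs_l2 (G i k)) \<longlonglongrightarrow> abs_l2 (f' i)"
    "\<And>i k x. x \<in> K \<Longrightarrow> pd i (F k) x = G i k x"
    using local_smooth_approximation[OF U K(1,2) f] by blast
  have s1: "sqint (\<lambda>x. \<zeta> x * g' i x)" "sqint (\<lambda>x. pd i \<zeta> x * g x)" for i
    using sqint_mult_test[OF _ \<zeta>] sqint_mult_test[OF _ test_fun_pd[OF \<zeta>]] g by simp_all
  have eq: "(\<integral>x. (pd j \<zeta> x * g x) * G i k x) + (\<integral>x. g x * (\<zeta> x * pd j (pd i (F k)) x))
      = - (\<integral>x. (\<zeta> x * g' j x) * G i k x)" for i j k
  proof -
    have t: "(\<lambda>x. pd i (F k) x * \<zeta> x) \<in> test_fun U" by (rule test_fun_mult_smooth[OF \<zeta> smooth_pd[OF FG(1)]])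
    have t2: "(\<lambda>x. pd j (pd i (F k)) x * \<zeta> x) \<in> test_fun U"
      by (rule test_fun_mult_smooth[OF \<zeta> smooth_pd[OF smooth_pd[OF FG(1)]]])
    have "g x * pd j (\<lambda>x. pd i (F k) x * \<zeta> x) x = (pd j \<zeta> x * g x) * G i k x + g x * (\<zeta> x * pd j (pd i (F k)) x)" for x
      using smooth_mult_pd[OF smooth_pd[OF FG(1)] test_fun_smooth[OF \<zeta>], of j i k x] FG(6)[of x i k] K(3,4)[of x]
      by (cases "x \<in> K") (simp_all add: algebra_simps)
    then have "(\<lambda>x. g x * pd j (\<lambda>x. pd i (F k) x * \<zeta> x) x) = (\<lambda>x. (pd j \<zeta> x * g x) * G i k x + g x * (\<zeta> x * pd j (pd i (F k)) x))" by blast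
    from wpdD[OF g(3)[of j] t, unfolded this]
    have "(\<integral>x. (pd j \<zeta> x * g x) * G i k x + g x * (\<zeta> x * pd j (pd i (F k)) x))
        = - (\<integral>x. g' j x * (pd i (F k) x * \<zeta> x))" .
    moreover have "g' j x * (pd i (F k) x * \<zeta> x) = (\<zeta> x * g' j x) * G i k x" for x
      using FG(6)[of x i k] K(3)[of x] by (cases "x \<in> K") simp_all
    moreover have "integrable lebesgue (\<lambda>x. g x * (\<zeta> x * pd j (pd i (F k)) x))"
      using sqint_times_test[OF g(1) t2] by (simp add: mult_ac)
    ultimately show ?thesis
      using sqint_integrable_mult[OF s1(2)[of j] FG(4)[of i k]] by simp
  qed
  have eqk: "(\<integral>x. (pd j \<zeta> x * g x) * G i k x) - (\<integral>x. (pd i \<zeta> x * g x) * G j k x)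
      = (\<integral>x. (\<zeta> x * g' i x) * G j k x) - (\<integral>x. (\<zeta> x * g' j x) * G i k x)" for k
    using eq[of j i k] eq[of i j k] pd_commute[OF FG(1)[of k], of i j] by simp
  have limA: "(\<lambda>k. (\<integral>x. (pd j \<zeta> x * g x) * G i k x) - (\<integral>x. (pd i \<zeta> x * g x) * G j k x))
    \<longlonglongrightarrow> (\<integral>x. (pd j \<zeta> x * g x) * f' i x) - (\<integral>x. (pd i \<zeta> x * g x) * f' j x)"
    by (intro tendsto_diff l2_tendsto_integral FG f s1)
  have limB: "(\<lambda>k. (\<integral>x. (\<zeta> x * g' i x) * G j k x) - (\<integral>x. (\<zeta> x * g' j x) * G i k x))
    \<longlonglongrightarrow> (\<integral>x. (\<zeta> x * g' i x) * f' j x) - (\<integral>x. (\<zeta> x * g' j x) * f' i x)"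
    by (intro tendsto_diff l2_tendsto_integral FG f s1)
  have "(\<integral>x. (pd j \<zeta> x * g x) * f' i x) - (\<integral>x. (pd i \<zeta> x * g x) * f' j x)
    = (\<integral>x. (\<zeta> x * g' i x) * f' j x) - (\<integral>x. (\<zeta> x * g' j x) * f' i x)"
    by (rule LIMSEQ_unique[OF limA[unfolded eqk] limB])
  then show ?thesis by (simp add: mult_ac)
qed

section \<open>A Hardy inequality and tangential derivatives\<close>

lemma abs_l2_mult_norm_le:
  fixes f m :: "'a::euclidean_space \<Rightarrow> real"
  assumes "sqint f" "sqint g"
  shows "\<bar>\<integral>x. f x * g x \<partial>lebesgue\<bar> \<le> norm (abs_l2 f) * norm (abs_l2 g)"
  using Cauchy_Schwarz_ineq2[of "abs_l2 f" "abs_l2 g"] by (simp add: l2_inner_real assms)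

lemma sqint_linear_combination:
  fixes f :: "'k \<Rightarrow> 'a::euclidean_space \<Rightarrow> real"
  assumes "finite J" "\<And>i. sqint (f i)" shows "sqint (\<lambda>x. \<Sum>i\<in>J. c i * f i x)"
  using assms(1)
proof (induction J rule: finite_induct)
  case (insert j J)
  have "sqint (\<lambda>x. c j *\<^sub>R f j x + (\<Sum>i\<in>J. c i * f i x))"
    by (rule sqint_add[OF sqint_scaleR[OF assms(2)] insert.IH])
  then show ?case using insert.hyps by simp
qed (simp add: sqint_zero)

lemma half_space_weight:
  fixes \<alpha> :: "real^'n"
  assumes U: "open U" "\<And>x. x \<in> U \<Longrightarrow> 0 < \<beta> - \<alpha> \<bullet> x"
  shows "smooth_on U (\<lambda>x. 1 / (\<beta> - \<alpha> \<bullet> x))"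
    "x \<in> U \<Longrightarrow> pd i (\<lambda>x. 1 / (\<beta> - \<alpha> \<bullet> x)) x = \<alpha> $ i * (1 / (\<beta> - \<alpha> \<bullet> x))\<^sup>2"
proof -
  have s: "smooth_on U (\<lambda>x. \<beta> - \<alpha> \<bullet> x)"
    by (intro smooth_on_diff smooth_on_const smooth_on_linear U)
  have "smooth_on U (\<lambda>x. (\<lambda>t. 1 * (1/t)^1) (\<beta> - \<alpha> \<bullet> x))"
    by (rule smooth_on_chain[OF U(1) Dk_inverse s]) (use U(2) in auto)
  then show "smooth_on U (\<lambda>x. 1 / (\<beta> - \<alpha> \<bullet> x))" by simp
  assume x: "x \<in> U"
  have D: "((\<lambda>x. \<beta> - \<alpha> \<bullet> x) has_derivative (\<lambda>h. - (\<alpha> \<bullet> h))) (at x)"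
    by (auto intro!: derivative_eq_intros)
  have pdl: "pd i (\<lambda>x. \<beta> - \<alpha> \<bullet> x) x = - \<alpha> $ i"
    unfolding pd_eq[OF D] by (simp add: inner_axis)
  have "((\<lambda>t. 1/t) has_real_derivative - (1/(\<beta> - \<alpha> \<bullet> x))\<^sup>2) (at (\<beta> - \<alpha> \<bullet> x))"
    using U(2)[OF x] by (auto intro!: derivative_eq_intros simp: power2_eq_square divide_simps)
  from pd_chain(1)[OF smooth_on_differentiable[OF s x] this, of i]
  show "pd i (\<lambda>x. 1 / (\<beta> - \<alpha> \<bullet> x)) x = \<alpha> $ i * (1 / (\<beta> - \<alpha> \<bullet> x))\<^sup>2"
    by (simp add: pdl)
qed

text \<open>For \<open>m x = 1 / (\<beta> - \<alpha> \<bullet> x)\<close> the derivative along the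
  unit vector \<open>\<alpha>\<close> is m^2. Integrating m times the
  \<open>\<alpha>\<close>-derivative of \<phi>^2 by parts gives |m \<phi>|^2 = -2 (m \<phi>, D),
  with \<open>D\<close> the \<open>\<alpha>\<close>-derivative of \<open>\<phi>\<close>;
  Cauchy-Schwarz and division by the norm of m \<phi> finish.\<close>

lemma Hardy_half_space:
  fixes \<alpha> :: "real^'n"
  assumes U: "open U" "\<And>x. x \<in> U \<Longrightarrow> 0 < \<beta> - \<alpha> \<bullet> x" and \<alpha>: "norm \<alpha> = 1"
    and \<phi>: "\<phi> \<in> test_fun U"
  shows "norm (abs_l2 (\<lambda>x. 1 / (\<beta> - \<alpha> \<bullet> x) * \<phi> x)) \<le> 2 * norm (abs_l2 (\<lambda>x. \<Sum>i\<in>UNIV. \<alpha> $ i * pd i \<phi> x))"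
proof -
  define m where "m x = 1 / (\<beta> - \<alpha> \<bullet> x)" for x
  have m: "smooth_on U m" unfolding m_def by (rule half_space_weight(1)[OF U])
  have pdm: "pd i m x = \<alpha> $ i * (m x)\<^sup>2" if "x \<in> U" for i x
    unfolding m_def by (rule half_space_weight(2)[OF U that])
  define D where "D x = (\<Sum>i\<in>UNIV. \<alpha> $ i * pd i \<phi> x)" for x
  have m\<phi>: "(\<lambda>x. m x * \<phi> x) \<in> test_fun U" by (rule test_fun_mult_smooth_on[OF \<phi> m U(1)])
  have \<phi>2: "(\<lambda>x. \<phi> x * \<phi> x) \<in> test_fun U" by (rule test_fun_mult_smooth[OF \<phi> test_fun_smooth[OF \<phi>]])
  have sqm: "sqint (\<lambda>x. m x * \<phi> x)" by (rule test_fun_sqint[OF m\<phi>])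
  have sqp: "sqint (pd i \<phi>)" for i by (rule test_fun_sqint[OF test_fun_pd[OF \<phi>]])
  have sqD: "sqint D" unfolding D_def by (rule sqint_linear_combination[OF finite sqp])
  have ibp: "(\<integral>x. (m x * \<phi> x) * (2 * (\<alpha> $ i * pd i \<phi> x))) = - (\<integral>x. (\<alpha> $ i)\<^sup>2 * ((m x * \<phi> x) * (m x * \<phi> x)))" for i
  proof -
    have "(\<integral>x. m x * pd i (\<lambda>x. \<phi> x * \<phi> x) x) = - (\<integral>x. pd i m x * (\<phi> x * \<phi> x))"
      by (rule test_fun_integral_by_parts[OF \<phi>2 m U(1)])
    also have "(\<lambda>x. pd i m x * (\<phi> x * \<phi> x)) = (\<lambda>x. \<alpha> $ i * ((m x * \<phi> x) * (m x * \<phi> x)))"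
    proof
      fix x show "pd i m x * (\<phi> x * \<phi> x) = \<alpha> $ i * ((m x * \<phi> x) * (m x * \<phi> x))"
        using pdm[of x i] test_fun_outside[OF \<phi>, of x] by (cases "x \<in> U") (simp_all add: power2_eq_square)
    qed
    also have "(\<lambda>x. m x * pd i (\<lambda>x. \<phi> x * \<phi> x) x) = (\<lambda>x. 2 * ((m x * \<phi> x) * pd i \<phi> x))"
    proof
      fix x
      have "pd i (\<lambda>x. \<phi> x * \<phi> x) x = \<phi> x * pd i \<phi> x + pd i \<phi> x * \<phi> x"
        by (intro pd_mult smooth_differentiable test_fun_smooth[OF \<phi>])
      then show "m x * pd i (\<lambda>x. \<phi> x * \<phi> x) x = 2 * ((m x * \<phi> x) * pd i \<phi> x)" by simp
    qed
    finally have e: "2 * (\<integral>x. (m x * \<phi> x) * pd i \<phi> x) = - (\<alpha> $ i * (\<integral>x. (m x * \<phi> x) * (m x * \<phi> x)))"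
      by (simp only: integral_mult_right_zero)
    have "(\<integral>x. (m x * \<phi> x) * (2 * (\<alpha> $ i * pd i \<phi> x))) = (\<integral>x. (2 * \<alpha> $ i) * ((m x * \<phi> x) * pd i \<phi> x))"
      by (rule Bochner_Integration.integral_cong) simp_all
    also have "\<dots> = \<alpha> $ i * (2 * (\<integral>x. (m x * \<phi> x) * pd i \<phi> x))"
      by (simp only: integral_mult_right_zero)
    also have "\<dots> = - ((\<alpha> $ i)\<^sup>2 * (\<integral>x. (m x * \<phi> x) * (m x * \<phi> x)))"
      unfolding e by (simp add: power2_eq_square)
    finally show ?thesis by (simp only: integral_mult_right_zero)
  qed
  have \<alpha>2: "(\<Sum>i\<in>UNIV. (\<alpha> $ i)\<^sup>2) = 1"
    using \<alpha> by (simp add: norm_vec_def L2_set_def)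
  define N where "N = norm (abs_l2 (\<lambda>x. m x * \<phi> x))"
  have N2: "(\<integral>x. (m x * \<phi> x) * (m x * \<phi> x)) = N\<^sup>2"
    unfolding N_def norm_abs_l2[OF sqm] by (simp add: power2_eq_square)
  have "(\<integral>x. (m x * \<phi> x) * (2 * D x)) = (\<integral>x. (\<Sum>i\<in>UNIV. (m x * \<phi> x) * (2 * (\<alpha> $ i * pd i \<phi> x))))"
    by (simp add: D_def sum_distrib_left)
  also have "\<dots> = (\<Sum>i\<in>UNIV. \<integral>x. (m x * \<phi> x) * (2 * (\<alpha> $ i * pd i \<phi> x)) \<partial>lebesgue)"
  proof (rule Bochner_Integration.integral_sum)
    fix i :: 'n
    have "integrable lebesgue (\<lambda>x. (2 * \<alpha> $ i) * ((m x * \<phi> x) * pd i \<phi> x))"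
      by (intro integrable_mult_right sqint_integrable_mult sqm sqp)
    then show "integrable lebesgue (\<lambda>x. (m x * \<phi> x) * (2 * (\<alpha> $ i * pd i \<phi> x)))" by (simp add: mult_ac)
  qed
  also have "\<dots> = - N\<^sup>2"
    unfolding ibp integral_mult_right_zero N2 using \<alpha>2 by (simp flip: sum_distrib_right add: sum_negf)
  finally have "(\<integral>x. (m x * \<phi> x) * (2 * D x)) = - N\<^sup>2" .
  moreover have "(\<integral>x. (m x * \<phi> x) * (2 * D x)) = 2 * (\<integral>x. (m x * \<phi> x) * D x)"
    by (simp only: integral_mult_right_zero[symmetric] mult.left_commute)
  ultimately have "N\<^sup>2 \<le> 2 * \<bar>\<integral>x. (m x * \<phi> x) * D x \<partial>lebesgue\<bar>" by simp
  also have "\<dots> \<le> 2 * (N * norm (abs_l2 D))"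
    using abs_l2_mult_norm_le[OF sqm sqD] by (simp add: N_def)
  finally have "N * N \<le> N * (2 * norm (abs_l2 D))" by (simp add: power2_eq_square mult_ac)
  then have "N \<le> 2 * norm (abs_l2 D)"
  proof (cases "N > 0")
    case False
    then show ?thesis using norm_ge_zero[of "abs_l2 D"] by linarith
  qed simp
  moreover have "D = (\<lambda>x. \<Sum>i\<in>UNIV. \<alpha> $ i * pd i \<phi> x)" by (simp add: D_def fun_eq_iff)
  ultimately show ?thesis by (simp add: N_def m_def)
qed

lemma abs_l2_linear_combination:
  fixes f :: "'k \<Rightarrow> 'a::euclidean_space \<Rightarrow> real"
  assumes "finite J" "\<And>i. sqint (f i)" shows "abs_l2 (\<lambda>x. \<Sum>i\<in>J. c i * f i x) = (\<Sum>i\<in>J. c i *\<^sub>R abs_l2 (f i))"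
  using assms(1)
proof (induction J rule: finite_induct)
  case (insert j J)
  have "abs_l2 (\<lambda>x. \<Sum>i\<in>insert j J. c i * f i x) = abs_l2 (\<lambda>x. c j *\<^sub>R f j x + (\<Sum>i\<in>J. c i * f i x))"
    using insert.hyps by simp
  also have "\<dots> = abs_l2 (\<lambda>x. c j *\<^sub>R f j x) + abs_l2 (\<lambda>x. \<Sum>i\<in>J. c i * f i x)"
    by (rule abs_l2_add[symmetric, OF sqint_scaleR[OF assms(2)] sqint_linear_combination[OF insert.hyps(1) assms(2)]])
  also have "abs_l2 (\<lambda>x. c j *\<^sub>R f j x) = c j *\<^sub>R abs_l2 (f j)"
    by (rule abs_l2_scaleR[symmetric, OF assms(2)])
  finally show ?case using insert by simp
qed (simp add: abs_l2_zero)

text \<open>Formally the derivative \<open>\<tau>\<close> along the face vanishes on it. The weak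
  equation for \<open>\<tau>\<close> is tested with m \<phi>_k, where m is the reciprocal distance
  shifted by \<open>s\<close>. As \<open>t\<close> is orthogonal to \<open>\<alpha>\<close>, m does
  not vary along \<open>t\<close>, so what remains is the integral of m \<tau> times the
  \<open>t\<close>-derivative of \<phi>_k against that of h m \<phi>_k. The latter is bounded by
  Hardy's inequality, uniformly in \<open>k\<close> and \<open>s\<close>.\<close>

lemma tangential_weighted_bound:
  fixes \<alpha> t :: "real^'n" and G :: "'n \<Rightarrow> real^'n \<Rightarrow> real"
  assumes U: "open U" "\<And>x. x \<in> U \<Longrightarrow> 0 < \<beta> - \<alpha> \<bullet> x" and \<alpha>: "norm \<alpha> = 1" and t: "t \<bullet> \<alpha> = 0"
    and G: "\<And>i. sqint (G i)" and H: "\<And>i j. sqint (H i j)" "\<And>i j. wpd U j (G i) (H i j)"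
    and \<phi>: "\<And>k. \<phi> k \<in> test_fun U" "\<And>i. (\<lambda>k. abs_l2 (pd i (\<phi> k))) \<longlonglongrightarrow> abs_l2 (G i)"
  obtains C where "0 \<le> C" "\<And>s. 0 < s \<Longrightarrow>
    (\<integral>x. indicator U x * (1 / (\<beta> + s - \<alpha> \<bullet> x)) * (\<Sum>i\<in>UNIV. t $ i * G i x)\<^sup>2) \<le> C"
proof -
  define \<tau> where "\<tau> x = (\<Sum>i\<in>UNIV. t $ i * G i x)" for x
  define h where "h x = (\<Sum>i\<in>UNIV. \<Sum>j\<in>UNIV. (t $ i * t $ j) * H i j x)" for x
  have s\<tau>: "sqint \<tau>" unfolding \<tau>_def by (rule sqint_linear_combination[OF finite G])
  have sh: "sqint h"
  proof -
    have "sqint (\<lambda>x. \<Sum>i\<in>UNIV. 1 * (\<Sum>j\<in>UNIV. (t $ i * t $ j) * H i j x))"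
      by (rule sqint_linear_combination[OF finite sqint_linear_combination[OF finite H(1)]])
    then have "sqint (\<lambda>x. \<Sum>i\<in>UNIV. \<Sum>j\<in>UNIV. (t $ i * t $ j) * H i j x)" by simp
    moreover have "h = (\<lambda>x. \<Sum>i\<in>UNIV. \<Sum>j\<in>UNIV. (t $ i * t $ j) * H i j x)" by (simp add: h_def fun_eq_iff)
    ultimately show ?thesis by simp
  qed
  have sp: "sqint (pd i (\<phi> k))" for i k by (rule test_fun_sqint[OF test_fun_pd[OF \<phi>(1)]])
  define Dn where "Dn k x = (\<Sum>i\<in>UNIV. \<alpha> $ i * pd i (\<phi> k) x)" for k x
  have Dn_lim: "(\<lambda>k. abs_l2 (Dn k)) \<longlonglongrightarrow> (\<Sum>i\<in>UNIV. \<alpha> $ i *\<^sub>R abs_l2 (G i))"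
  proof -
    have "abs_l2 (Dn k) = (\<Sum>i\<in>UNIV. \<alpha> $ i *\<^sub>R abs_l2 (pd i (\<phi> k)))" for k
      unfolding Dn_def by (rule abs_l2_linear_combination[OF finite sp])
    then show ?thesis by (simp only:) (intro tendsto_sum tendsto_scaleR tendsto_const \<phi>(2))
  qed
  then have "Bseq (\<lambda>k. abs_l2 (Dn k))" by (intro convergent_imp_Bseq convergentI)
  then obtain B where B: "0 < B" "\<And>k. norm (abs_l2 (Dn k)) \<le> B" unfolding Bseq_def by blast
  have "(\<integral>x. indicator U x * (1 / (\<beta> + s - \<alpha> \<bullet> x)) * (\<tau> x)\<^sup>2) \<le> norm (abs_l2 h) * (2 * B)"
    if s: "0 < s" for s
  proof -
    define m where "m x = 1 / (\<beta> + s - \<alpha> \<bullet> x)" for x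
    \<comment> \<open>Cut off outside \<open>U\<close>, the shifted weight is bounded by
      \<open>1 / s\<close> on the whole space and multiplies square integrable functions; this is
      what permits the limit in \<open>k\<close>.\<close>
    define m' where "m' x = indicator U x * m x" for x
    have Us: "0 < \<beta> + s - \<alpha> \<bullet> x" if "x \<in> U" for x using U(2)[OF that] s by simp
    have m: "smooth_on U m" unfolding m_def by (rule half_space_weight(1)[OF U(1) Us])
    have pdm: "pd i m x = \<alpha> $ i * (m x)\<^sup>2" if "x \<in> U" for i x
      unfolding m_def by (rule half_space_weight(2)[OF U(1) Us that])
    have m'b: "\<bar>m' x\<bar> \<le> 1 / s" for x
    proof (cases "x \<in> U")
      case True
      have "s \<le> \<beta> + s - \<alpha> \<bullet> x" using U(2)[OF True] by simp
      then show ?thesis using True s by (simp add: m'_def m_def frac_le)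
    qed (simp add: m'_def s less_imp_le)
    have m'm: "m' \<in> borel_measurable lebesgue"
    proof (rule borel_measurable_lebesgueI)
      show "m' \<in> borel_measurable borel"
        unfolding m'_def m_def
        by (intro borel_measurable_times borel_measurable_indicator borel_measurable_divide borel_measurable_const
            borel_measurable_diff borel_measurable_inner) (use U(1) in auto)
    qed
    have sm: "sqint (\<lambda>x. m' x * f x)" if "sqint f" for f :: "real^'n \<Rightarrow> real"
      by (rule sqint_mult_bounded[OF that m'm m'b])
    have m\<phi>: "(\<lambda>x. m x * \<phi> k x) \<in> test_fun U" for k by (rule test_fun_mult_smooth_on[OF \<phi>(1) m U(1)])
    have Nm: "norm (abs_l2 (\<lambda>x. m x * \<phi> k x)) \<le> 2 * B" for k
    proof -
      have "norm (abs_l2 (\<lambda>x. m x * \<phi> k x)) \<le> 2 * norm (abs_l2 (Dn k))"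
        unfolding m_def Dn_def by (rule Hardy_half_space[OF U(1) Us \<alpha> \<phi>(1)])
      then show ?thesis using B(2)[of k] by simp
    qed
    have w: "(\<integral>x. G i x * pd j (\<lambda>x. m x * \<phi> k x) x) = - (\<integral>x. H i j x * (m x * \<phi> k x))" for i j k
      by (rule wpdD[OF H(2) m\<phi>])
    have int1: "integrable lebesgue (\<lambda>x. G i x * pd j (\<lambda>x. m x * \<phi> k x) x)" for i j k
      by (rule sqint_times_test[OF G test_fun_pd[OF m\<phi>]])
    have int2: "integrable lebesgue (\<lambda>x. H i j x * (m x * \<phi> k x))" for i j k
      by (rule sqint_times_test[OF H(1) m\<phi>])
    have pt: "(\<Sum>i\<in>UNIV. \<Sum>j\<in>UNIV. (t $ i * t $ j) * (G i x * pd j (\<lambda>x. m x * \<phi> k x) x))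
        = (m' x * \<tau> x) * (\<Sum>j\<in>UNIV. t $ j * pd j (\<phi> k) x)" for x k
    proof (cases "x \<in> U")
      case True
      have p: "pd j (\<lambda>x. m x * \<phi> k x) x = m x * pd j (\<phi> k) x + (m x)\<^sup>2 * \<phi> k x * \<alpha> $ j" for j
        using pd_mult[OF smooth_on_differentiable[OF m True] smooth_differentiable[OF test_fun_smooth[OF \<phi>(1)[of k]]], of j]
          pdm[OF True, of j] by simp
      have ta: "(\<Sum>j\<in>UNIV. t $ j * \<alpha> $ j) = 0" using t by (simp add: inner_vec_def)
      have "(\<Sum>j\<in>UNIV. t $ j * pd j (\<lambda>x. m x * \<phi> k x) x)
          = m x * (\<Sum>j\<in>UNIV. t $ j * pd j (\<phi> k) x) + (m x)\<^sup>2 * \<phi> k x * (\<Sum>j\<in>UNIV. t $ j * \<alpha> $ j)"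
        unfolding p by (simp add: sum_distrib_left sum.distrib algebra_simps)
      then have e: "(\<Sum>j\<in>UNIV. t $ j * pd j (\<lambda>x. m x * \<phi> k x) x) = m x * (\<Sum>j\<in>UNIV. t $ j * pd j (\<phi> k) x)"
        by (simp add: ta)
      have "(\<Sum>i\<in>UNIV. \<Sum>j\<in>UNIV. (t $ i * t $ j) * (G i x * pd j (\<lambda>x. m x * \<phi> k x) x))
         = (\<Sum>i\<in>UNIV. \<Sum>j\<in>UNIV. (t $ i * G i x) * (t $ j * pd j (\<lambda>x. m x * \<phi> k x) x))"
        by (simp only: mult_ac)
      also have "\<dots> = \<tau> x * (\<Sum>j\<in>UNIV. t $ j * pd j (\<lambda>x. m x * \<phi> k x) x)"
        unfolding \<tau>_def sum_product ..
      finally show ?thesis unfolding e using True by (simp add: m'_def mult_ac)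
    next
      case False
      have "pd j (\<lambda>x. m x * \<phi> k x) x = 0" for j by (rule test_fun_outside[OF test_fun_pd[OF m\<phi>] False])
      then show ?thesis using False by (simp add: m'_def)
    qed
    have key: "(\<integral>x. (m' x * \<tau> x) * (\<Sum>j\<in>UNIV. t $ j * pd j (\<phi> k) x)) \<le> norm (abs_l2 h) * (2 * B)" for k
    proof -
      have "(\<integral>x. (m' x * \<tau> x) * (\<Sum>j\<in>UNIV. t $ j * pd j (\<phi> k) x))
        = (\<integral>x. (\<Sum>i\<in>UNIV. \<Sum>j\<in>UNIV. (t $ i * t $ j) * (G i x * pd j (\<lambda>x. m x * \<phi> k x) x)))"
        unfolding pt ..
      also have "\<dots> = (\<Sum>i\<in>UNIV. \<Sum>j\<in>UNIV. (t $ i * t $ j) * (\<integral>x. G i x * pd j (\<lambda>x. m x * \<phi> k x) x))"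
        using int1 by (simp add: Bochner_Integration.integral_sum)
      also have "\<dots> = - (\<Sum>i\<in>UNIV. \<Sum>j\<in>UNIV. (t $ i * t $ j) * (\<integral>x. H i j x * (m x * \<phi> k x)))"
        unfolding w by (simp add: sum_negf)
      also have "(\<Sum>i\<in>UNIV. \<Sum>j\<in>UNIV. (t $ i * t $ j) * (\<integral>x. H i j x * (m x * \<phi> k x)))
        = (\<integral>x. (\<Sum>i\<in>UNIV. \<Sum>j\<in>UNIV. (t $ i * t $ j) * (H i j x * (m x * \<phi> k x))))"
        using int2 by (simp add: Bochner_Integration.integral_sum)
      also have "\<dots> = (\<integral>x. h x * (m x * \<phi> k x))"
        by (rule Bochner_Integration.integral_cong) (simp_all add: h_def sum_distrib_right mult.assoc)
      also have "- (\<integral>x. h x * (m x * \<phi> k x)) \<le> norm (abs_l2 h) * norm (abs_l2 (\<lambda>x. m x * \<phi> k x))"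
        using abs_l2_mult_norm_le[OF sh test_fun_sqint[OF m\<phi>[of k]]] by linarith
      also have "\<dots> \<le> norm (abs_l2 h) * (2 * B)" by (intro mult_left_mono Nm) simp
      finally show ?thesis .
    qed
    have sT: "sqint (\<lambda>x. \<Sum>j\<in>UNIV. t $ j * pd j (\<phi> k) x)" for k
      by (rule sqint_linear_combination[OF finite sp])
    have Tlim: "(\<lambda>k. abs_l2 (\<lambda>x. \<Sum>j\<in>UNIV. t $ j * pd j (\<phi> k) x)) \<longlonglongrightarrow> abs_l2 \<tau>"
      unfolding \<tau>_def abs_l2_linear_combination[OF finite sp] abs_l2_linear_combination[OF finite G]
      by (intro tendsto_sum tendsto_scaleR tendsto_const \<phi>(2))
    have "(\<lambda>k. \<integral>x. (m' x * \<tau> x) * (\<Sum>j\<in>UNIV. t $ j * pd j (\<phi> k) x) \<partial>lebesgue) \<longlonglongrightarrow> (\<integral>x. (m' x * \<tau> x) * \<tau> x)"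
      by (rule l2_tendsto_integral[OF sT s\<tau> Tlim sm[OF s\<tau>]])
    then have "(\<integral>x. (m' x * \<tau> x) * \<tau> x) \<le> norm (abs_l2 h) * (2 * B)"
      by (rule LIMSEQ_le_const2) (use key in blast)
    then show ?thesis by (simp add: m'_def m_def power2_eq_square mult_ac)
  qed
  then show thesis using that[of "norm (abs_l2 h) * (2 * B)"] B(1) by (simp add: \<tau>_def)
qed

text \<open>Fatou's lemma for the shifts \<open>s\<close> tending to 0, as the bound of
  \<open>tangential_weighted_bound\<close> does not depend on them.\<close>

lemma tangential_derivative_integrable:
  fixes \<alpha> t :: "real^'n" and G :: "'n \<Rightarrow> real^'n \<Rightarrow> real"
  assumes U: "open U" "\<And>x. x \<in> U \<Longrightarrow> 0 < \<beta> - \<alpha> \<bullet> x" and \<alpha>: "norm \<alpha> = 1" and t: "t \<bullet> \<alpha> = 0"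
    and G: "\<And>i. sqint (G i)" and H: "\<And>i j. sqint (H i j)" "\<And>i j. wpd U j (G i) (H i j)"
    and \<phi>: "\<And>k. \<phi> k \<in> test_fun U" "\<And>i. (\<lambda>k. abs_l2 (pd i (\<phi> k))) \<longlonglongrightarrow> abs_l2 (G i)"
  shows "integrable lebesgue (\<lambda>x. indicator U x * (1 / (\<beta> - \<alpha> \<bullet> x)) * (\<Sum>i\<in>UNIV. t $ i * G i x)\<^sup>2)"
proof -
  define \<tau> where "\<tau> x = (\<Sum>i\<in>UNIV. t $ i * G i x)" for x
  have s\<tau>: "sqint \<tau>" unfolding \<tau>_def by (rule sqint_linear_combination[OF finite G])
  have [measurable]: "\<tau> \<in> borel_measurable lebesgue" by (rule sqint_measurable[OF s\<tau>])
  obtain C where C: "0 \<le> C" "\<And>s. 0 < s \<Longrightarrow> (\<integral>x. indicator U x * (1 / (\<beta> + s - \<alpha> \<bullet> x)) * (\<tau> x)\<^sup>2) \<le> C"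
    using tangential_weighted_bound[OF U \<alpha> t G H \<phi>] unfolding \<tau>_def by blast
  define s where "s k = 1 / real (Suc k)" for k
  have s: "0 < s k" for k by (simp add: s_def)
  have s0: "s \<longlonglongrightarrow> 0" unfolding s_def by (rule LIMSEQ_Suc[OF lim_1_over_n])
  have lm: "(\<lambda>x. indicator U x * (1 / (\<beta> + r - \<alpha> \<bullet> x)) :: real) \<in> borel_measurable lebesgue" for r
    by (intro borel_measurable_lebesgueI borel_measurable_times borel_measurable_indicator borel_measurable_divide borel_measurable_const
            borel_measurable_diff borel_measurable_inner) (use U(1) in auto)
  define q where "q r x = indicator U x * (1 / (\<beta> + r - \<alpha> \<bullet> x)) * (\<tau> x)\<^sup>2" for r x
  have qm: "q r \<in> borel_measurable lebesgue" for r
    unfolding q_def by (intro borel_measurable_times lm borel_measurable_power) measurable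
  have q0: "0 \<le> q r x" if "0 \<le> r" for r x
    using that U(2)[of x] by (cases "x \<in> U") (simp_all add: q_def)
  have qint: "integrable lebesgue (q (s k))" for k
  proof (rule Bochner_Integration.integrable_bound[OF _ qm])
    show "integrable lebesgue (\<lambda>x. (1 / s k) * (norm (\<tau> x))\<^sup>2)"
      by (intro integrable_mult_right sqint_integrable s\<tau>)
    show "AE x in lebesgue. norm (q (s k) x) \<le> norm ((1 / s k) * (norm (\<tau> x))\<^sup>2)"
    proof (intro AE_I2)
      fix x show "norm (q (s k) x) \<le> norm ((1 / s k) * (norm (\<tau> x))\<^sup>2)"
      proof (cases "x \<in> U")
        case True
        have "1 / (\<beta> + s k - \<alpha> \<bullet> x) \<le> 1 / s k" using U(2)[OF True] s[of k] by (intro divide_left_mono) auto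
        then have "1 / (\<beta> + s k - \<alpha> \<bullet> x) * (\<tau> x)\<^sup>2 \<le> 1 / s k * (\<tau> x)\<^sup>2" by (rule mult_right_mono) simp
        moreover have "norm (q (s k) x) = 1 / (\<beta> + s k - \<alpha> \<bullet> x) * (\<tau> x)\<^sup>2"
          using s[of k] True U(2)[OF True] by (simp add: q_def)
        moreover have "norm ((1 / s k) * (norm (\<tau> x))\<^sup>2) = 1 / s k * (\<tau> x)\<^sup>2"
          using s[of k] by (simp add: abs_mult)
        ultimately show ?thesis by (simp only:)
      qed (simp add: q_def)
    qed
  qed
  have "(\<integral>\<^sup>+x. ennreal (q 0 x) \<partial>lebesgue) = (\<integral>\<^sup>+x. liminf (\<lambda>k. ennreal (q (s k) x)) \<partial>lebesgue)"
  proof (rule nn_integral_cong)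
    fix x
    have "(\<lambda>k. q (s k) x) \<longlonglongrightarrow> q 0 x"
    proof (cases "x \<in> U")
      case True
      have "(\<lambda>k. indicator U x * (1 / (\<beta> + s k - \<alpha> \<bullet> x)) * (\<tau> x)\<^sup>2) \<longlonglongrightarrow> indicator U x * (1 / (\<beta> + 0 - \<alpha> \<bullet> x)) * (\<tau> x)\<^sup>2"
        by (intro tendsto_intros s0) (use U(2)[OF True] in simp)
      then show ?thesis by (simp only: q_def)
    qed (simp add: q_def)
    then have "(\<lambda>k. ennreal (q (s k) x)) \<longlonglongrightarrow> ennreal (q 0 x)" by (rule tendsto_ennrealI)
    then show "ennreal (q 0 x) = liminf (\<lambda>k. ennreal (q (s k) x))"
      by (intro lim_imp_Liminf[symmetric]) simp_all
  qed
  also have "\<dots> \<le> liminf (\<lambda>k. \<integral>\<^sup>+x. ennreal (q (s k) x) \<partial>lebesgue)"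
    using qm by (intro nn_integral_liminf) measurable
  also have "\<dots> \<le> ennreal C"
  proof (rule Liminf_le)
    show "\<forall>\<^sub>F k in sequentially. (\<integral>\<^sup>+x. ennreal (q (s k) x) \<partial>lebesgue) \<le> ennreal C"
    proof (rule always_eventually, rule allI)
      fix k
      have "(\<integral>\<^sup>+x. ennreal (q (s k) x) \<partial>lebesgue) = ennreal (\<integral>x. q (s k) x)"
        by (rule nn_integral_eq_integral[OF qint]) (use q0 s in \<open>simp add: less_imp_le\<close>)
      also have "\<dots> \<le> ennreal C" unfolding q_def by (intro ennreal_leI C(2) s)
      finally show "(\<integral>\<^sup>+x. ennreal (q (s k) x) \<partial>lebesgue) \<le> ennreal C" .
    qed
  qed simp
  finally have "(\<integral>\<^sup>+x. ennreal (q 0 x) \<partial>lebesgue) < \<infinity>" by (rule le_less_trans) simp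
  then have "integrable lebesgue (q 0)"
    by (intro integrableI_nonneg qm) (simp_all add: q0)
  then show ?thesis unfolding q_def \<tau>_def by simp
qed

section \<open>The Miranda--Talenti inequality on convex polytopes\<close>

text \<open>The minor is a null Lagrangian. The cross rule removes one of the two second derivatives
  from each product, and the product rule, with a derivative of \<open>\<zeta>\<close> as the
  cutoff, turns the remaining terms G H into second derivatives of \<open>\<zeta>\<close> times G
  G.\<close>

lemma minor_identity:
  fixes G :: "'n \<Rightarrow> real^'n \<Rightarrow> real"
  assumes U: "open U" and \<zeta>: "\<zeta> \<in> test_fun U"
    and G: "\<And>i. sqint (G i)" and H: "\<And>i j. sqint (H i j)" "\<And>i j. wpd U j (G i) (H i j)" "\<And>i j x. H i j x = H j i x"
  shows "(\<integral>x. \<zeta> x * (H j j x * H k k x)) - (\<integral>x. \<zeta> x * (H j k x * H j k x))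
    = - (1/2) * (\<integral>x. pd j (pd j \<zeta>) x * (G k x * G k x)) - (1/2) * (\<integral>x. pd k (pd k \<zeta>) x * (G j x * G j x))
      + (\<integral>x. pd j (pd k \<zeta>) x * (G k x * G j x))"
proof -
  have cross: "(\<integral>x. \<zeta> x * (H j j x * H k k x)) - (\<integral>x. \<zeta> x * (H j k x * H k j x))
     = (\<integral>x. pd j \<zeta> x * (H j k x * G k x)) - (\<integral>x. pd k \<zeta> x * (H j j x * G k x))"
    by (rule weak_cross_rule[where f="G j" and g="G k" and f'="H j" and g'="H k" and i=j and j=k, OF U \<zeta> G H(1,2) G H(1,2)])
  have p1: "(\<integral>x. pd j \<zeta> x * (G k x * H k j x)) + (\<integral>x. pd j \<zeta> x * (H k j x * G k x))
     = - (\<integral>x. pd j (pd j \<zeta>) x * (G k x * G k x))"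
    by (rule weak_product_rule[where f="G k" and f'="H k", OF U test_fun_pd[OF \<zeta>] G H(1,2) G H(1,2)])
  have p2: "(\<integral>x. pd k \<zeta> x * (G k x * H j j x)) + (\<integral>x. pd k \<zeta> x * (H k j x * G j x))
     = - (\<integral>x. pd j (pd k \<zeta>) x * (G k x * G j x))"
    by (rule weak_product_rule[where f="G k" and f'="H k", OF U test_fun_pd[OF \<zeta>] G H(1,2) G H(1,2)])
  have p3: "(\<integral>x. pd k \<zeta> x * (G j x * H j k x)) + (\<integral>x. pd k \<zeta> x * (H j k x * G j x))
     = - (\<integral>x. pd k (pd k \<zeta>) x * (G j x * G j x))"
    by (rule weak_product_rule[where f="G j" and f'="H j", OF U test_fun_pd[OF \<zeta>] G H(1,2) G H(1,2)])
  show ?thesis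
    using cross p1 p2 p3 unfolding H(3)[of k j] by (simp add: mult.commute[of "G _ _" "H _ _ _"])
qed

text \<open>Cauchy-Schwarz with (1/l)^2 split into the powers 1/2 and 3/2 of 1/l. For the weight
  \<open>eta\<close> this inequality is the concavity.\<close>

lemma weighted_Cauchy_Schwarz:
  fixes l t :: "'k \<Rightarrow> real"
  assumes "\<And>i. i \<in> I \<Longrightarrow> 0 < l i"
  shows "(\<Sum>i\<in>I. t i * (1 / l i)^2)\<^sup>2 \<le> (\<Sum>i\<in>I. 1 / l i) * (\<Sum>i\<in>I. (t i)\<^sup>2 * (1 / l i)^3)"
proof -
  have e: "(1 / l i)^3 = (1 / l i)^2 * (1 / l i)" for i by (simp add: power3_eq_cube power2_eq_square)
  have "(\<Sum>i\<in>I. sqrt (1 / l i) * (t i * (1 / l i) * sqrt (1 / l i)))\<^sup>2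
     \<le> (\<Sum>i\<in>I. (sqrt (1 / l i))\<^sup>2) * (\<Sum>i\<in>I. (t i * (1 / l i) * sqrt (1 / l i))\<^sup>2)"
    by (rule Cauchy_Schwarz_ineq_sum)
  also have "(\<Sum>i\<in>I. sqrt (1 / l i) * (t i * (1 / l i) * sqrt (1 / l i))) = (\<Sum>i\<in>I. t i * (1 / l i)^2)"
  proof (rule sum.cong)
    fix i assume "i \<in> I"
    then have "sqrt (1 / l i) * sqrt (1 / l i) = 1 / l i" using assms[of i] by simp
    then show "sqrt (1 / l i) * (t i * (1 / l i) * sqrt (1 / l i)) = t i * (1 / l i)^2"
      by (metis (no_types, opaque_lifting) mult.assoc mult.commute power2_eq_square)
  qed simp
  also have "(\<Sum>i\<in>I. (sqrt (1 / l i))\<^sup>2) = (\<Sum>i\<in>I. 1 / l i)"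
    by (rule sum.cong) (use assms in \<open>auto simp: less_imp_le\<close>)
  also have "(\<Sum>i\<in>I. (t i * (1 / l i) * sqrt (1 / l i))\<^sup>2) = (\<Sum>i\<in>I. (t i)\<^sup>2 * (1 / l i)^3)"
  proof (rule sum.cong)
    fix i assume "i \<in> I"
    then have "(sqrt (1 / l i))\<^sup>2 = 1 / l i" using assms[of i] by simp
    then show "(t i * (1 / l i) * sqrt (1 / l i))\<^sup>2 = (t i)\<^sup>2 * (1 / l i)^3"
      unfolding e power_mult_distrib by (simp only: mult.assoc)
  qed simp
  finally show ?thesis .
qed

section \<open>Scaling limits of the cutoff profile\<close>

lemma hfun_scaled_tendsto:
  assumes t: "0 < t" and s: "\<And>n. 0 < s n" "s \<longlonglongrightarrow> 0"
  shows "(\<lambda>n. s n * hfun ((1 / s n) * t - 1)) \<longlonglongrightarrow> t"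
proof -
  have ev: "\<forall>\<^sub>F n in sequentially. s n < t" by (rule order_tendstoD(2)[OF s(2) t])
  have "(\<lambda>n. (t - s n) * exp (- (s n / (t - s n)))) \<longlonglongrightarrow> (t - 0) * exp (- (0 / (t - 0)))"
    by (intro tendsto_intros s) (use t in simp)
  moreover have "\<forall>\<^sub>F n in sequentially. (t - s n) * exp (- (s n / (t - s n))) = s n * hfun ((1 / s n) * t - 1)"
    using ev
  proof eventually_elim
    case (elim n)
    have u: "(1 / s n) * t - 1 = (t - s n) / s n" using s(1)[of n] by (simp add: field_simps)
    show ?case unfolding u using elim s(1)[of n] by (simp add: hfun_def gexp_def divide_le_0_iff)
  qed
  ultimately show ?thesis by (auto intro: Lim_transform_eventually)
qed

lemma hfun_scaled_bounds:
  assumes "0 < s" "0 < t" shows "0 \<le> s * hfun ((1 / s) * t - 1)" "s * hfun ((1 / s) * t - 1) \<le> t"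
proof -
  define u where "u = (1 / s) * t - 1"
  have "0 \<le> hfun u" by (cases "u \<le> 0") (simp_all add: hfun_def gexp_def)
  then show "0 \<le> s * hfun ((1 / s) * t - 1)" using assms by (simp add: u_def)
  have "hfun u \<le> u + 1"
  proof (cases "u \<le> 0")
    case True
    have "0 \<le> u + 1" using assms by (simp add: u_def)
    then show ?thesis using True by (simp add: hfun_def gexp_def)
  next
    case False
    then have "u * gexp 0 u \<le> u * 1" by (intro mult_left_mono gexp_0_le_1) simp
    then show ?thesis by (simp add: hfun_def)
  qed
  then have "s * hfun u \<le> s * (u + 1)" using assms by (intro mult_left_mono) auto
  also have "\<dots> = t" using assms by (simp add: u_def)
  finally show "s * hfun ((1 / s) * t - 1) \<le> t" by (simp add: u_def)
qed

lemma gexp3_scaled_tendsto: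
  assumes t: "0 < t" and s: "\<And>n. 0 < s n" "s \<longlonglongrightarrow> 0"
  shows "(\<lambda>n. gexp 3 ((1 / s n) * t - 1) * ((1 / s n) * t)) \<longlonglongrightarrow> 0"
proof (rule tendsto_sandwich[of "\<lambda>_. 0" _ _ "\<lambda>n. (s n / (t - s n))\<^sup>2"])
  show "\<forall>\<^sub>F n in sequentially. 0 \<le> gexp 3 ((1 / s n) * t - 1) * ((1 / s n) * t)"
    using t s(1) by (intro always_eventually) (simp add: gexp_nonneg less_imp_le)
  have ev: "\<forall>\<^sub>F n in sequentially. s n < t" by (rule order_tendstoD(2)[OF s(2) t])
  then show "\<forall>\<^sub>F n in sequentially. gexp 3 ((1 / s n) * t - 1) * ((1 / s n) * t) \<le> (s n / (t - s n))\<^sup>2"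
  proof eventually_elim
    case (elim n)
    have u: "(1 / s n) * t - 1 = (t - s n) / s n" using s(1)[of n] by (simp add: field_simps)
    have "gexp 3 ((t - s n) / s n) * (1 + (t - s n) / s n) \<le> 1 / ((t - s n) / s n)\<^sup>2"
      by (rule gexp3_bound(2)) (use elim s(1)[of n] in simp)
    moreover have "1 + (t - s n) / s n = (1 / s n) * t" using s(1)[of n] by (simp add: field_simps)
    moreover have "1 / ((t - s n) / s n)\<^sup>2 = (s n / (t - s n))\<^sup>2" by (simp add: power_divide)
    ultimately show ?case unfolding u by simp
  qed
  have "(\<lambda>n. (s n / (t - s n))\<^sup>2) \<longlonglongrightarrow> (0 / (t - 0))\<^sup>2"
    by (intro tendsto_intros s) (use t in simp)
  then show "(\<lambda>n. (s n / (t - s n))\<^sup>2) \<longlonglongrightarrow> 0" by simp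
qed simp

text \<open>Unit normals make \<open>b i - a i \<bullet> x\<close> the distance to the bounding
  hyperplane and allow Hardy's inequality to be applied face by face.\<close>

locale half_space_domain =
  fixes U :: "(real^'n) set" and I :: "'k set" and a :: "'k \<Rightarrow> real^'n" and b :: "'k \<Rightarrow> real"
  assumes finI: "finite I" and bdd: "bounded U" and norm_a: "\<And>i. i \<in> I \<Longrightarrow> norm (a i) = 1"
    and Omega: "U = {x. \<forall>i\<in>I. a i \<bullet> x < b i}"
begin

text \<open>The weight \<open>eta d\<close> is concave and vanishes on the boundary; \<open>zeta d s\<close> is a test function that
  tends to it as \<open>s \<rightarrow> 0\<close>.\<close>

definition ell :: "'k \<Rightarrow> real^'n \<Rightarrow> real" where "ell i x = b i - a i \<bullet> x"
definition SS :: "real \<Rightarrow> real^'n \<Rightarrow> real" where "SS d x = 1 + d * (\<Sum>i\<in>I. 1 / ell i x)"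
definition eta :: "real \<Rightarrow> real^'n \<Rightarrow> real" where "eta d x = 1 / SS d x"
text \<open>\<open>QQ\<close> collects the first derivatives of the sum of the
  \<open>1 / ell i\<close>, and \<open>2 * PP\<close> the second ones; all derivatives of
  \<open>eta\<close> are expressed by them.\<close>

definition QQ :: "'n \<Rightarrow> real^'n \<Rightarrow> real" where "QQ j x = (\<Sum>i\<in>I. a i $ j * (1 / ell i x)^2)"
definition PP :: "'n \<Rightarrow> 'n \<Rightarrow> real^'n \<Rightarrow> real" where "PP j k x = (\<Sum>i\<in>I. a i $ j * a i $ k * (1 / ell i x)^3)"
definition zeta :: "real \<Rightarrow> real \<Rightarrow> real^'n \<Rightarrow> real" where
  "zeta d s x = (if x \<in> U then s * hfun ((1 / s) * eta d x - 1) else 0)"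

lemma open_Omega: "open U"
proof -
  have "U = (\<Inter>i\<in>I. {x. a i \<bullet> x < b i})" by (auto simp: Omega)
  then show ?thesis using finI by (auto intro!: open_INT open_halfspace_lt)
qed

lemma ell_pos: "x \<in> U \<Longrightarrow> i \<in> I \<Longrightarrow> 0 < ell i x"
  by (simp add: Omega ell_def)

lemma inv_ell:
  assumes "i \<in> I"
  shows "smooth_on U (\<lambda>x. 1 / ell i x)" "x \<in> U \<Longrightarrow> pd j (\<lambda>x. 1 / ell i x) x = a i $ j * (1 / ell i x)\<^sup>2"
  unfolding ell_def by (rule half_space_weight[OF open_Omega]; use Omega assms in simp)+

lemma smooth_SS: "smooth_on U (SS d)"
  unfolding SS_def
  by (intro smooth_on_add smooth_on_mult smooth_on_const smooth_on_sum open_Omega finI inv_ell)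

lemma pd_SS: "x \<in> U \<Longrightarrow> pd j (SS d) x = d * QQ j x"
proof -
  assume x: "x \<in> U"
  have s: "smooth_on U (\<lambda>x. \<Sum>i\<in>I. 1 / ell i x)" by (intro smooth_on_sum open_Omega finI inv_ell)
  have ds: "(\<lambda>x. \<Sum>i\<in>I. 1 / ell i x) differentiable at x" by (rule smooth_on_differentiable[OF s x])
  have "pd j (SS d) x = pd j (\<lambda>x. 1 + d * (\<Sum>i\<in>I. 1 / ell i x)) x" unfolding SS_def ..
  also have "\<dots> = pd j (\<lambda>x. 1) x + pd j (\<lambda>x. d * (\<Sum>i\<in>I. 1 / ell i x)) x"
    by (rule pd_add) (use ds in \<open>auto intro: differentiable_mult\<close>)
  also have "\<dots> = d * pd j (\<lambda>x. \<Sum>i\<in>I. 1 / ell i x) x" by (simp add: pd_cmult[OF ds])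
  also have "pd j (\<lambda>x. \<Sum>i\<in>I. 1 / ell i x) x = (\<Sum>i\<in>I. pd j (\<lambda>x. 1 / ell i x) x)"
    by (rule pd_sum[OF finI]) (rule smooth_on_differentiable[OF inv_ell(1) x])
  also have "\<dots> = QQ j x" unfolding QQ_def using inv_ell(2)[OF _ x] by simp
  finally show ?thesis .
qed

lemma SS_ge_1: "0 < d \<Longrightarrow> x \<in> U \<Longrightarrow> 1 \<le> SS d x"
  unfolding SS_def using ell_pos by (simp add: sum_nonneg less_imp_le)

lemma eta_bounds: "0 < d \<Longrightarrow> x \<in> U \<Longrightarrow> 0 < eta d x" "0 < d \<Longrightarrow> x \<in> U \<Longrightarrow> eta d x \<le> 1"
  using SS_ge_1[of d x] by (auto simp: eta_def)

lemma smooth_eta: "0 < d \<Longrightarrow> smooth_on U (eta d)"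
proof -
  assume d: "0 < d"
  have "smooth_on U (\<lambda>x. (\<lambda>t. 1 * (1/t)^1) (SS d x))"
    by (rule smooth_on_chain[OF open_Omega Dk_inverse smooth_SS]) (use SS_ge_1[OF d] in force)
  then show ?thesis unfolding eta_def by simp
qed

lemma pd_eta: "0 < d \<Longrightarrow> x \<in> U \<Longrightarrow> pd j (eta d) x = - d * ((eta d x)\<^sup>2 * QQ j x)"
proof -
  assume d: "0 < d" and x: "x \<in> U"
  have "((\<lambda>t. 1/t) has_real_derivative - (1/SS d x)\<^sup>2) (at (SS d x))"
    using SS_ge_1[OF d x] by (auto intro!: derivative_eq_intros simp: power2_eq_square divide_simps)
  from pd_chain(1)[OF smooth_on_differentiable[OF smooth_SS x] this, of j]
  show ?thesis unfolding eta_def by (simp add: pd_SS[OF x])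
qed

lemma pd_QQ: "x \<in> U \<Longrightarrow> pd k (QQ j) x = 2 * PP j k x" and smooth_QQ: "smooth_on U (QQ j)"
proof -
  have s2: "smooth_on U (\<lambda>x. (1 / ell i x)^2)" if "i \<in> I" for i
    unfolding power2_eq_square by (intro smooth_on_mult open_Omega inv_ell that)
  show "smooth_on U (QQ j)" unfolding QQ_def by (intro smooth_on_sum smooth_on_mult smooth_on_const open_Omega finI s2)
  assume x: "x \<in> U"
  have "pd k (QQ j) x = (\<Sum>i\<in>I. pd k (\<lambda>x. a i $ j * (1 / ell i x)^2) x)"
    unfolding QQ_def
    by (rule pd_sum[OF finI]) (intro smooth_on_differentiable[OF _ x] smooth_on_mult smooth_on_const open_Omega s2)
  also have "\<dots> = (\<Sum>i\<in>I. 2 * (a i $ j * a i $ k * (1 / ell i x)^3))"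
  proof (rule sum.cong)
    fix i assume i: "i \<in> I"
    have di: "(\<lambda>x. 1 / ell i x) differentiable at x" by (rule smooth_on_differentiable[OF inv_ell(1)[OF i] x])
    have "pd k (\<lambda>x. a i $ j * (1 / ell i x)^2) x = a i $ j * pd k (\<lambda>x. (1 / ell i x) * (1 / ell i x)) x"
      unfolding power2_eq_square by (rule pd_cmult[OF differentiable_mult[OF di di]])
    also have "pd k (\<lambda>x. (1 / ell i x) * (1 / ell i x)) x = 2 * (a i $ k * (1 / ell i x)^3)"
      unfolding pd_mult[OF di di] inv_ell(2)[OF i x] by (simp add: power2_eq_square power3_eq_cube)
    finally show "pd k (\<lambda>x. a i $ j * (1 / ell i x)^2) x = 2 * (a i $ j * a i $ k * (1 / ell i x)^3)"
      by simp
  qed simp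
  finally show "pd k (QQ j) x = 2 * PP j k x" by (simp add: PP_def sum_distrib_left)
qed

lemma pd2_eta:
  assumes d: "0 < d" and x: "x \<in> U"
  shows "pd k (pd j (eta d)) x = 2 * d\<^sup>2 * (eta d x)^3 * QQ j x * QQ k x - 2 * d * (eta d x)\<^sup>2 * PP j k x"
proof -
  have e: "(eta d) differentiable at x" by (rule smooth_on_differentiable[OF smooth_eta[OF d] x])
  have q: "(QQ j) differentiable at x" by (rule smooth_on_differentiable[OF smooth_QQ x])
  have ee: "(\<lambda>x. eta d x * eta d x) differentiable at x" by (rule differentiable_mult[OF e e])
  have "pd k (pd j (eta d)) x = pd k (\<lambda>x. - d * ((eta d x * eta d x) * QQ j x)) x"
    by (rule pd_cong[OF open_Omega x]) (simp add: pd_eta[OF d] power2_eq_square)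
  also have "\<dots> = - d * ((eta d x * eta d x) * pd k (QQ j) x + (eta d x * pd k (eta d) x + pd k (eta d) x * eta d x) * QQ j x)"
    unfolding pd_cmult[OF differentiable_mult[OF ee q]] pd_mult[OF ee q] pd_mult[OF e e] ..
  finally show ?thesis
    unfolding pd_QQ[OF x] pd_eta[OF d x] by (simp add: power2_eq_square power3_eq_cube algebra_simps)
qed

text \<open>One summand, or all of them, is at most \<open>SS d x\<close>. Read as
  \<open>eta d x \<le> ell i x / d\<close>, the second part says that the weight vanishes at least
  linearly at every face; it is used to absorb powers of \<open>1 / ell i\<close>.\<close>

lemma eta_ell_le_1: "0 < d \<Longrightarrow> x \<in> U \<Longrightarrow> d * eta d x * (\<Sum>i\<in>I. 1 / ell i x) \<le> 1"
  "0 < d \<Longrightarrow> x \<in> U \<Longrightarrow> i \<in> I \<Longrightarrow> d * eta d x * (1 / ell i x) \<le> 1"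
proof -
  assume d: "0 < d" and x: "x \<in> U"
  have "d * (\<Sum>i\<in>I. 1 / ell i x) \<le> SS d x" by (simp add: SS_def)
  then have "d * (\<Sum>i\<in>I. 1 / ell i x) / SS d x \<le> 1" using SS_ge_1[OF d x] by (simp add: pos_divide_le_eq)
  then show *: "d * eta d x * (\<Sum>i\<in>I. 1 / ell i x) \<le> 1" by (simp add: eta_def)
  assume i: "i \<in> I"
  have "1 / ell i x \<le> (\<Sum>i\<in>I. 1 / ell i x)"
    using ell_pos[OF x] by (intro member_le_sum i finI) (simp add: less_imp_le)
  then have "d * eta d x * (1 / ell i x) \<le> d * eta d x * (\<Sum>i\<in>I. 1 / ell i x)"
    using d eta_bounds(1)[OF d x] by (intro mult_left_mono) auto
  then show "d * eta d x * (1 / ell i x) \<le> 1" using * by simp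
qed

lemma zeta_test_fun:
  assumes d: "0 < d" and s: "0 < s" shows "zeta d s \<in> test_fun U"
proof -
  \<comment> \<open>Where some \<open>ell i x\<close> is below \<open>d * s\<close>, the preceding
    lemma gives \<open>eta d x \<le> s\<close>; the argument of \<open>hfun\<close> is then at most
    0 and the cutoff vanishes.\<close>
  define K where "K = {x. \<forall>i\<in>I. d * s \<le> ell i x}"
  have "K = (\<Inter>i\<in>I. {x. a i \<bullet> x \<le> b i - d * s})" by (auto simp: K_def ell_def algebra_simps)
  then have clK: "closed K" by (auto intro!: closed_INT closed_halfspace_le)
  have KU: "K \<subseteq> U"
  proof
    fix x assume "x \<in> K"
    then have "0 < ell i x" if "i \<in> I" for i using that mult_pos_pos[OF d s] unfolding K_def by (smt (verit) mem_Collect_eq)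
    then show "x \<in> U" by (simp add: Omega ell_def)
  qed
  have cK: "compact K" using clK bounded_subset[OF bdd KU] by (simp add: compact_eq_bounded_closed)
  have zero: "zeta d s x = 0" if "x \<notin> K" for x
  proof (cases "x \<in> U")
    case True
    obtain i where i: "i \<in> I" "ell i x < d * s" using \<open>x \<notin> K\<close> by (auto simp: K_def not_le)
    have "d * eta d x \<le> ell i x" using eta_ell_le_1(2)[OF d True i(1)] ell_pos[OF True i(1)] by (simp add: pos_divide_le_eq)
    then have "eta d x \<le> s" using i(2) d by (smt (verit) mult_less_cancel_left_pos)
    then have "(1 / s) * eta d x - 1 \<le> 0" using s by simp
    then show ?thesis by (simp add: zeta_def hfun_def gexp_def)
  qed (simp add: zeta_def)
  have sm: "smooth_on U (\<lambda>x. s * hfun ((1 / s) * eta d x - 1))"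
    by (intro smooth_on_mult smooth_on_const open_Omega smooth_on_chain[OF open_Omega Dk_hfun]
        smooth_on_diff smooth_eta d) simp
  have "smooth_on UNIV (zeta d s)"
  proof (rule smooth_on_local)
    fix x :: "real^'n"
    show "\<exists>T. open T \<and> x \<in> T \<and> smooth_on T (zeta d s)"
    proof (cases "x \<in> U")
      case True
      have "smooth_on U (zeta d s) \<longleftrightarrow> smooth_on U (\<lambda>x. s * hfun ((1 / s) * eta d x - 1))"
        by (rule smooth_on_cong[OF open_Omega]) (simp add: zeta_def)
      then show ?thesis using sm True open_Omega by blast
    next
      case False
      have "smooth_on (- K) (zeta d s) \<longleftrightarrow> smooth_on (- K) (\<lambda>x. 0)"
        by (rule smooth_on_cong) (use clK zero in auto)
      then have "smooth_on (- K) (zeta d s)" by (simp add: smooth_on_const)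
      then show ?thesis using False KU clK by (intro exI[of _ "- K"]) auto
    qed
  qed
  then show ?thesis using cK KU zero by (intro test_funI[of _ K]) (simp_all add: smooth_on_UNIV)
qed

lemma pd_zeta:
  assumes d: "0 < d" and s: "0 < s" and x: "x \<in> U"
  shows "pd j (zeta d s) x = (gexp 0 ((1 / s) * eta d x - 1) + gexp 1 ((1 / s) * eta d x - 1)) * pd j (eta d) x"
    "pd k (pd j (zeta d s)) x = (gexp 0 ((1 / s) * eta d x - 1) + gexp 1 ((1 / s) * eta d x - 1)) * pd k (pd j (eta d)) x
       + gexp 3 ((1 / s) * eta d x - 1) * (1 / s) * pd k (eta d) x * pd j (eta d) x"
proof -
  have de: "(eta d) differentiable at y" if "y \<in> U" for y by (rule smooth_on_differentiable[OF smooth_eta[OF d] that])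
  have dp: "(pd j (eta d)) differentiable at x" by (rule smooth_on_differentiable[OF smooth_on_pd[OF smooth_eta[OF d]] x])
  have aff: "((\<lambda>t. (1 / s) * t - 1) has_real_derivative 1 / s) (at t)" for t
    using DERIV_diff[OF DERIV_cmult[OF DERIV_ident, of "1 / s"] DERIV_const[of 1]] by simp
  have h1: "((\<lambda>t. s * hfun ((1 / s) * t - 1)) has_real_derivative (gexp 0 ((1 / s) * t - 1) + gexp 1 ((1 / s) * t - 1))) (at t)" for t
  proof -
    have "((\<lambda>t. s * hfun ((1 / s) * t - 1)) has_real_derivative s * ((gexp 0 ((1 / s) * t - 1) + gexp 1 ((1 / s) * t - 1)) * (1 / s))) (at t)"
      by (intro DERIV_cmult DERIV_chain2[OF hfun_has_derivative aff])
    moreover have "s * (c * (1 / s)) = c" for c using s by simp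
    ultimately show ?thesis by (simp only:)
  qed
  have h2: "((\<lambda>t. gexp 0 ((1 / s) * t - 1) + gexp 1 ((1 / s) * t - 1)) has_real_derivative gexp 3 ((1 / s) * t - 1) * (1 / s)) (at t)" for t
    by (rule DERIV_chain2[OF hfun_has_derivative2 aff])
  have first: "pd j (zeta d s) y = (gexp 0 ((1 / s) * eta d y - 1) + gexp 1 ((1 / s) * eta d y - 1)) * pd j (eta d) y" if y: "y \<in> U" for y j
  proof -
    have "pd j (zeta d s) y = pd j (\<lambda>x. s * hfun ((1 / s) * eta d x - 1)) y"
      by (rule pd_cong[OF open_Omega y]) (simp add: zeta_def)
    then show ?thesis using pd_chain(1)[OF de[OF y] h1] by simp
  qed
  show "pd j (zeta d s) x = (gexp 0 ((1 / s) * eta d x - 1) + gexp 1 ((1 / s) * eta d x - 1)) * pd j (eta d) x"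
    by (rule first[OF x])
  have "pd k (pd j (zeta d s)) x = pd k (\<lambda>y. (gexp 0 ((1 / s) * eta d y - 1) + gexp 1 ((1 / s) * eta d y - 1)) * pd j (eta d) y) x"
    by (rule pd_cong[OF open_Omega x first])
  also have "\<dots> = (gexp 0 ((1 / s) * eta d x - 1) + gexp 1 ((1 / s) * eta d x - 1)) * pd k (pd j (eta d)) x
       + (gexp 3 ((1 / s) * eta d x - 1) * (1 / s) * pd k (eta d) x) * pd j (eta d) x"
    unfolding pd_mult[OF pd_chain(2)[OF de[OF x] h2] dp] pd_chain(1)[OF de[OF x] h2] ..
  finally show "pd k (pd j (zeta d s)) x = (gexp 0 ((1 / s) * eta d x - 1) + gexp 1 ((1 / s) * eta d x - 1)) * pd k (pd j (eta d)) x
       + gexp 3 ((1 / s) * eta d x - 1) * (1 / s) * pd k (eta d) x * pd j (eta d) x" .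
qed

text \<open>The size of the cutoff error: with u = eta/s - 1 it is the second derivative of
  \<open>hfun\<close> at u times u + 1. It is bounded by 6 and tends to 0 at each point of
  \<open>U\<close> as \<open>s\<close> tends to 0.\<close>

definition kap :: "real \<Rightarrow> real \<Rightarrow> real^'n \<Rightarrow> real" where
  "kap d s x = gexp 3 ((1 / s) * eta d x - 1) * ((1 / s) * eta d x)"

text \<open>For different \<open>j\<close> and \<open>k\<close> the left-hand side is the Hessian
  form of the cutoff at the vector with entries p and -q in the directions j and k. The first
  derivative of \<open>hfun\<close> multiplies the Hessian form of \<open>eta\<close>, which is
  nonpositive by concavity. The second derivative multiplies d^2 e^4 T^2 / s; there d e T^2 \<le> R
  and d e / l_i \<le> 1 lower the third power of 1/l_i in \<open>R\<close> to the first, for which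
  the weighted tangential derivatives are integrable.\<close>

lemma zeta_pair_le:
  fixes p q :: real
  assumes d: "0 < d" and s: "0 < s" and x: "x \<in> U"
  shows "pd j (pd j (zeta d s)) x * p\<^sup>2 + pd k (pd k (zeta d s)) x * q\<^sup>2 - 2 * pd j (pd k (zeta d s)) x * (p * q)
    \<le> kap d s x * (1 / d) * (\<Sum>i\<in>I. (1 / ell i x) * (a i $ j * p - a i $ k * q)\<^sup>2)"
proof -
  define e where "e = eta d x"
  define g1 where "g1 = gexp 0 ((1 / s) * e - 1) + gexp 1 ((1 / s) * e - 1)"
  define g3 where "g3 = gexp 3 ((1 / s) * e - 1)"
  define t where "t i = a i $ j * p - a i $ k * q" for i
  define T where "T = (\<Sum>i\<in>I. t i * (1 / ell i x)^2)"
  define R where "R = (\<Sum>i\<in>I. (t i)\<^sup>2 * (1 / ell i x)^3)"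
  have e: "0 < e" "e \<le> 1" unfolding e_def using eta_bounds[OF d x] by auto
  have g: "0 \<le> g1" "0 \<le> g3" unfolding g1_def g3_def by (simp_all add: gexp_nonneg)
  have Teq: "T = QQ j x * p - QQ k x * q"
    unfolding T_def QQ_def t_def sum_distrib_right sum_subtractf[symmetric]
    by (rule sum.cong) (simp_all add: algebra_simps)
  have Req: "R = PP j j x * p\<^sup>2 + PP k k x * q\<^sup>2 - 2 * PP k j x * (p * q)"
    unfolding R_def PP_def t_def sum_distrib_left sum_distrib_right sum.distrib[symmetric] sum_subtractf[symmetric]
    by (rule sum.cong) (simp_all add: power2_eq_square algebra_simps)
  have R0: "0 \<le> R" unfolding R_def using ell_pos[OF x] by (intro sum_nonneg) (simp add: less_imp_le)
  have CS: "T\<^sup>2 \<le> (\<Sum>i\<in>I. 1 / ell i x) * R"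
    unfolding T_def R_def by (rule weighted_Cauchy_Schwarz[OF ell_pos[OF x]])
  have deT: "d * e * T\<^sup>2 \<le> R"
  proof -
    have "d * e * T\<^sup>2 \<le> d * e * ((\<Sum>i\<in>I. 1 / ell i x) * R)" using CS d e by (intro mult_left_mono) auto
    also have "\<dots> = (d * e * (\<Sum>i\<in>I. 1 / ell i x)) * R" by simp
    also have "\<dots> \<le> 1 * R" unfolding e_def using eta_ell_le_1(1)[OF d x] R0 by (rule mult_right_mono)
    finally show ?thesis by simp
  qed
  define E where "E = 2 * d\<^sup>2 * e^3 * T\<^sup>2 - 2 * d * e\<^sup>2 * R"
  have "E = 2 * d * e\<^sup>2 * (d * e * T\<^sup>2 - R)" by (simp add: E_def power2_eq_square power3_eq_cube algebra_simps)
  then have E0: "E \<le> 0" using deT d e by (simp add: mult_nonneg_nonpos)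
  have "pd j (pd j (zeta d s)) x * p\<^sup>2 + pd k (pd k (zeta d s)) x * q\<^sup>2 - 2 * pd j (pd k (zeta d s)) x * (p * q)
     = g1 * E + g3 * (1 / s) * (d\<^sup>2 * e^4 * T\<^sup>2)"
    unfolding pd_zeta(2)[OF d s x] pd2_eta[OF d x] pd_eta[OF d x] e_def[symmetric]
    unfolding g1_def[symmetric] g3_def[symmetric] E_def Teq Req
    by (simp add: power2_eq_square power3_eq_cube power4_eq_xxxx algebra_simps)
  also have "\<dots> \<le> g3 * (1 / s) * (d\<^sup>2 * e^4 * T\<^sup>2)" using E0 g by (simp add: mult_nonneg_nonpos)
  also have "\<dots> \<le> g3 * (1 / s) * ((e / d) * (\<Sum>i\<in>I. (1 / ell i x) * (t i)\<^sup>2))"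
  proof (rule mult_left_mono)
    have "d\<^sup>2 * e^4 * T\<^sup>2 = d * e^3 * (d * e * T\<^sup>2)" by (simp add: power2_eq_square power3_eq_cube power4_eq_xxxx)
    also have "\<dots> \<le> d * e^3 * R" using deT d e by (intro mult_left_mono) auto
    also have "\<dots> = (\<Sum>i\<in>I. (d * e^3 * (1 / ell i x)^2) * ((1 / ell i x) * (t i)\<^sup>2))"
      unfolding R_def sum_distrib_left by (rule sum.cong) (simp_all add: power2_eq_square power3_eq_cube)
    also have "\<dots> \<le> (\<Sum>i\<in>I. (e / d) * ((1 / ell i x) * (t i)\<^sup>2))"
    proof (rule sum_mono, rule mult_right_mono)
      fix i assume i: "i \<in> I"
      have l: "0 < ell i x" by (rule ell_pos[OF x i])
      have "(d * e * (1 / ell i x))^2 \<le> 1^2"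
        unfolding e_def by (rule power_mono[OF eta_ell_le_1(2)[OF d x i]]) (use d l eta_bounds(1)[OF d x] in simp)
      then have "(e / d) * (d * e * (1 / ell i x))^2 \<le> (e / d) * 1" using d e by (intro mult_left_mono) auto
      moreover have "(e / d) * (d * e * (1 / ell i x))^2 = d * e^3 * (1 / ell i x)^2"
        using d by (simp add: power2_eq_square power3_eq_cube)
      ultimately show "d * e^3 * (1 / ell i x)^2 \<le> e / d" by simp
      show "0 \<le> 1 / ell i x * (t i)\<^sup>2" using l by simp
    qed
    finally show "d\<^sup>2 * e^4 * T\<^sup>2 \<le> (e / d) * (\<Sum>i\<in>I. (1 / ell i x) * (t i)\<^sup>2)"
      by (simp add: sum_distrib_left)
  qed (use g s in simp)
  also have "\<dots> = kap d s x * (1 / d) * (\<Sum>i\<in>I. (1 / ell i x) * (t i)\<^sup>2)"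
    by (simp add: kap_def g3_def e_def)
  finally show ?thesis by (simp add: t_def)
qed

end

section \<open>Removing the cutoff and then the weight\<close>

context half_space_domain
begin

lemma kap_bounds:
  assumes "0 < d" "0 < s" "x \<in> U" shows "0 \<le> kap d s x" "kap d s x \<le> 6"
proof -
  show "0 \<le> kap d s x"
    unfolding kap_def using eta_bounds(1)[OF assms(1,3)] assms(2) by (simp add: gexp_nonneg)
  show "kap d s x \<le> 6"
    using gexp3_bound(1)[of "(1 / s) * eta d x - 1"] by (simp add: kap_def)
qed

lemma eta_measurable: "eta d \<in> borel_measurable borel"
  unfolding eta_def SS_def ell_def by measurable

lemma kap_measurable: "(\<lambda>x. indicator U x * kap d s x) \<in> borel_measurable lebesgue"
proof (rule borel_measurable_lebesgueI)
  have g: "gexp 3 \<in> borel_measurable borel"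
    using DERIV_isCont[OF gexp_has_derivative] by (intro borel_measurable_continuous_onI) (simp add: continuous_at_imp_continuous_on)
  have u: "(\<lambda>x. (1 / s) * eta d x - 1) \<in> borel_measurable borel"
    by (intro borel_measurable_diff borel_measurable_times borel_measurable_const eta_measurable)
  have gu: "(\<lambda>x. gexp 3 ((1 / s) * eta d x - 1)) \<in> borel_measurable borel"
    by (rule measurable_compose[OF u g])
  show "(\<lambda>x. indicator U x * kap d s x) \<in> borel_measurable borel"
    unfolding kap_def
    by (intro borel_measurable_times borel_measurable_indicator borel_measurable_const eta_measurable gu)
      (use open_Omega in auto)
qed

text \<open>With \<open>G\<close> the gradient, \<open>a i $ j * G k x - a i $ k * G j x\<close> is
  the derivative along the vector with entry \<open>a i $ j\<close> at k and
  \<open>- a i $ k\<close> at j. That vector is orthogonal to \<open>a i\<close>, so each summand is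
  a tangential derivative weighted with its own face distance.\<close>

definition WW :: "('n \<Rightarrow> real^'n \<Rightarrow> real) \<Rightarrow> 'n \<Rightarrow> 'n \<Rightarrow> real^'n \<Rightarrow> real" where
  "WW G j k x = (\<Sum>i\<in>I. indicator U x * (1 / ell i x) * (a i $ j * G k x - a i $ k * G j x)\<^sup>2)"

lemma WW_integrable:
  assumes G: "\<And>i. sqint (G i)" and H: "\<And>i j. sqint (H i j)" "\<And>i j. wpd U j (G i) (H i j)"
    and \<phi>: "\<And>k. \<phi> k \<in> test_fun U" "\<And>i. (\<lambda>k. abs_l2 (pd i (\<phi> k))) \<longlonglongrightarrow> abs_l2 (G i)"
  shows "integrable lebesgue (WW G j k)"
proof -
  have "integrable lebesgue (\<lambda>x. indicator U x * (1 / ell i x) * (a i $ j * G k x - a i $ k * G j x)\<^sup>2)" if i: "i \<in> I" for i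
  proof -
    define t where "t = (a i $ j) *\<^sub>R axis k 1 - (a i $ k) *\<^sub>R (axis j 1 :: real^'n)"
    have t: "t \<bullet> a i = 0" by (simp add: t_def inner_diff_left inner_axis')
    have "(\<Sum>l\<in>UNIV. axis m 1 $ l * G l x) = G m x" for m x
      by (simp add: axis_def if_distrib[of "\<lambda>x. x * _"] cong: if_cong)
    then have tG: "(\<Sum>l\<in>UNIV. t $ l * G l x) = a i $ j * G k x - a i $ k * G j x" for x
      by (simp add: t_def left_diff_distrib sum_subtractf mult.assoc sum_distrib_left[symmetric])
    have "integrable lebesgue (\<lambda>x. indicator U x * (1 / (b i - a i \<bullet> x)) * (\<Sum>l\<in>UNIV. t $ l * G l x)\<^sup>2)"
      by (rule tangential_derivative_integrable[OF open_Omega _ norm_a[OF i] t G H \<phi>]) (use i Omega in simp)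
    then show ?thesis unfolding tG ell_def .
  qed
  then show ?thesis unfolding WW_def by (intro Bochner_Integration.integrable_sum) auto
qed

lemma minor_zeta_bound:
  assumes d: "0 < d" and s: "0 < s"
    and G: "\<And>i. sqint (G i)" and H: "\<And>i j. sqint (H i j)" "\<And>i j. wpd U j (G i) (H i j)" "\<And>i j x. H i j x = H j i x"
    and \<phi>: "\<And>k. \<phi> k \<in> test_fun U" "\<And>i. (\<lambda>k. abs_l2 (pd i (\<phi> k))) \<longlonglongrightarrow> abs_l2 (G i)"
  shows "- (1 / (2 * d)) * (\<integral>x. (indicator U x * kap d s x) * WW G j k x)
    \<le> (\<integral>x. zeta d s x * (H j j x * H k k x - H j k x * H j k x))"
    "integrable lebesgue (\<lambda>x. (indicator U x * kap d s x) * WW G j k x)"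
proof -
  have z: "zeta d s \<in> test_fun U" by (rule zeta_test_fun[OF d s])
  have int: "integrable lebesgue (\<lambda>x. \<psi> x * (f x * g x))" if "\<psi> \<in> test_fun U" "sqint f" "sqint g" for \<psi> f g :: "real^'n \<Rightarrow> real"
    using sqint_integrable_mult[OF sqint_mult_test[OF that(2,1)] that(3)] by (simp add: mult.assoc)
  have W: "integrable lebesgue (WW G j k)" by (rule WW_integrable[OF G H(1,2) \<phi>])
  have W0: "0 \<le> WW G j k x" for x
    unfolding WW_def using ell_pos[of x] by (intro sum_nonneg) (auto simp: indicator_def less_imp_le)
  show iK: "integrable lebesgue (\<lambda>x. (indicator U x * kap d s x) * WW G j k x)"
  proof (rule Bochner_Integration.integrable_bound[OF integrable_mult_right[OF W, of 6]])
    show "(\<lambda>x. (indicator U x * kap d s x) * WW G j k x) \<in> borel_measurable lebesgue"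
      by (rule borel_measurable_times[OF kap_measurable borel_measurable_integrable[OF W]])
    show "AE x in lebesgue. norm ((indicator U x * kap d s x) * WW G j k x) \<le> norm (6 * WW G j k x)"
    proof (intro AE_I2)
      fix x
      show "norm ((indicator U x * kap d s x) * WW G j k x) \<le> norm (6 * WW G j k x)"
      proof (cases "x \<in> U")
        case True
        then have "\<bar>kap d s x\<bar> \<le> 6" using kap_bounds[OF d s True] by simp
        then show ?thesis using True mult_right_mono[of "\<bar>kap d s x\<bar>" 6 "\<bar>WW G j k x\<bar>"] by (simp add: abs_mult)
      qed simp
    qed
  qed
  \<comment> \<open>The integrand on the right of \<open>minor_identity\<close> is -1/2 times
    \<open>P\<close>, and \<open>zeta_pair_le\<close> bounds \<open>P\<close> from above with
    \<open>p = G k x\<close> and \<open>q = G j x\<close>.\<close>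
  define P where "P x = pd j (pd j (zeta d s)) x * (G k x * G k x) + pd k (pd k (zeta d s)) x * (G j x * G j x)
     - 2 * (pd j (pd k (zeta d s)) x * (G k x * G j x))" for x
  have z2: "pd i (pd l (zeta d s)) \<in> test_fun U" for i l by (intro test_fun_pd z)
  have i3: "integrable lebesgue (\<lambda>x. pd j (pd j (zeta d s)) x * (G k x * G k x))"
    "integrable lebesgue (\<lambda>x. pd k (pd k (zeta d s)) x * (G j x * G j x))"
    "integrable lebesgue (\<lambda>x. pd j (pd k (zeta d s)) x * (G k x * G j x))"
    by (intro int z2 G)+
  have iP: "integrable lebesgue P" unfolding P_def using i3 by simp
  have "(\<integral>x. P x) = (\<integral>x. pd j (pd j (zeta d s)) x * (G k x * G k x))
     + (\<integral>x. pd k (pd k (zeta d s)) x * (G j x * G j x)) - 2 * (\<integral>x. pd j (pd k (zeta d s)) x * (G k x * G j x))"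
    unfolding P_def using i3 by simp
  moreover have "(\<integral>x. zeta d s x * (H j j x * H k k x - H j k x * H j k x))
     = (\<integral>x. zeta d s x * (H j j x * H k k x)) - (\<integral>x. zeta d s x * (H j k x * H j k x))"
    using int[OF z H(1)[of j j] H(1)[of k k]] int[OF z H(1)[of j k] H(1)[of j k]] by (simp add: right_diff_distrib)
  ultimately have eq: "(\<integral>x. zeta d s x * (H j j x * H k k x - H j k x * H j k x)) = - (1/2) * (\<integral>x. P x)"
    using minor_identity[OF open_Omega z G H, of j k] by linarith
  have "(\<integral>x. P x) \<le> (\<integral>x. (1 / d) * ((indicator U x * kap d s x) * WW G j k x))"
  proof (rule integral_mono[OF iP integrable_mult_right[OF iK]])
    fix x
    show "P x \<le> (1 / d) * ((indicator U x * kap d s x) * WW G j k x)"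
    proof (cases "x \<in> U")
      case True
      have "P x \<le> kap d s x * (1 / d) * (\<Sum>i\<in>I. (1 / ell i x) * (a i $ j * G k x - a i $ k * G j x)\<^sup>2)"
        using zeta_pair_le[OF d s True, of j "G k x" k "G j x"] by (simp add: P_def power2_eq_square)
      also have "(\<Sum>i\<in>I. (1 / ell i x) * (a i $ j * G k x - a i $ k * G j x)\<^sup>2) = WW G j k x"
        using True by (simp add: WW_def)
      finally show ?thesis using True by (simp add: mult_ac)
    next
      case False
      then show ?thesis using test_fun_outside[OF z2 False] by (simp add: P_def)
    qed
  qed
  then have "(\<integral>x. P x) \<le> (1 / d) * (\<integral>x. (indicator U x * kap d s x) * WW G j k x)"
    by (simp only: integral_mult_right_zero)
  then show "- (1 / (2 * d)) * (\<integral>x. (indicator U x * kap d s x) * WW G j k x)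
    \<le> (\<integral>x. zeta d s x * (H j j x * H k k x - H j k x * H j k x))"
    unfolding eq by simp
qed

text \<open>The limit \<open>s\<close> to 0 with \<open>d\<close> fixed. On the left of
  \<open>minor_zeta_bound\<close> the factor \<open>kap\<close> tends to 0 and is dominated by 6,
  while \<open>WW\<close> is integrable; on the right the cutoff tends to \<open>eta d\<close> and
  stays below 1.\<close>

lemma minor_eta_nonneg:
  assumes d: "0 < d"
    and G: "\<And>i. sqint (G i)" and H: "\<And>i j. sqint (H i j)" "\<And>i j. wpd U j (G i) (H i j)" "\<And>i j x. H i j x = H j i x"
    and \<phi>: "\<And>k. \<phi> k \<in> test_fun U" "\<And>i. (\<lambda>k. abs_l2 (pd i (\<phi> k))) \<longlonglongrightarrow> abs_l2 (G i)"
  shows "0 \<le> (\<integral>x. indicator U x * eta d x * (H j j x * H k k x - H j k x * H j k x))"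
proof -
  define s where "s n = 1 / real (Suc n)" for n
  have s: "0 < s n" for n by (simp add: s_def)
  have s0: "s \<longlonglongrightarrow> 0" unfolding s_def by (rule LIMSEQ_Suc[OF lim_1_over_n])
  define D where "D x = H j j x * H k k x - H j k x * H j k x" for x
  have iD: "integrable lebesgue D" unfolding D_def
    using sqint_integrable_mult[OF H(1)[of j j] H(1)[of k k]] sqint_integrable_mult[OF H(1)[of j k] H(1)[of j k]] by simp
  have W: "integrable lebesgue (WW G j k)" by (rule WW_integrable[OF G H(1,2) \<phi>])
  have "(\<lambda>n. \<integral>x. (indicator U x * kap d (s n) x) * WW G j k x \<partial>lebesgue) \<longlonglongrightarrow> integral\<^sup>L lebesgue (\<lambda>x::real^'n. 0)"
  proof (rule integral_dominated_convergence[where w="\<lambda>x. 6 * \<bar>WW G j k x\<bar>"])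
    show "integrable lebesgue (\<lambda>x. 6 * \<bar>WW G j k x\<bar>)" by (intro integrable_mult_right integrable_abs W)
    show "(\<lambda>x. (indicator U x * kap d (s n) x) * WW G j k x) \<in> borel_measurable lebesgue" for n
      by (rule borel_measurable_times[OF kap_measurable borel_measurable_integrable[OF W]])
    show "AE x in lebesgue. (\<lambda>n. (indicator U x * kap d (s n) x) * WW G j k x) \<longlonglongrightarrow> 0"
    proof (intro AE_I2)
      fix x
      show "(\<lambda>n. (indicator U x * kap d (s n) x) * WW G j k x) \<longlonglongrightarrow> 0"
      proof (cases "x \<in> U")
        case True
        have "(\<lambda>n. kap d (s n) x) \<longlonglongrightarrow> 0"
          unfolding kap_def by (rule gexp3_scaled_tendsto[OF eta_bounds(1)[OF d True] s s0])
        then show ?thesis using True by (simp add: tendsto_mult_left_zero)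
      qed simp
    qed
    show "AE x in lebesgue. norm ((indicator U x * kap d (s n) x) * WW G j k x) \<le> 6 * \<bar>WW G j k x\<bar>" for n
    proof (intro AE_I2)
      fix x
      show "norm ((indicator U x * kap d (s n) x) * WW G j k x) \<le> 6 * \<bar>WW G j k x\<bar>"
      proof (cases "x \<in> U")
        case True
        then have "\<bar>kap d (s n) x\<bar> \<le> 6" using kap_bounds[OF d s True] by simp
        then show ?thesis using True mult_right_mono[of "\<bar>kap d (s n) x\<bar>" 6 "\<bar>WW G j k x\<bar>"] by (simp add: abs_mult)
      qed simp
    qed
  qed simp
  then have L1: "(\<lambda>n. - (1 / (2 * d)) * (\<integral>x. (indicator U x * kap d (s n) x) * WW G j k x)) \<longlonglongrightarrow> 0"
    by (intro tendsto_mult_right_zero) simp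
  have L2: "(\<lambda>n. \<integral>x. zeta d (s n) x * D x \<partial>lebesgue) \<longlonglongrightarrow> (\<integral>x. indicator U x * eta d x * D x)"
  proof (rule integral_dominated_convergence[where w="\<lambda>x. \<bar>D x\<bar>"])
    show "integrable lebesgue (\<lambda>x. \<bar>D x\<bar>)" by (intro integrable_abs iD)
    show "(\<lambda>x. indicator U x * eta d x * D x) \<in> borel_measurable lebesgue"
      by (intro borel_measurable_times borel_measurable_integrable[OF iD] borel_measurable_lebesgueI eta_measurable borel_measurable_indicator)
        (use open_Omega in auto)
    show "(\<lambda>x. zeta d (s n) x * D x) \<in> borel_measurable lebesgue" for n
      by (rule borel_measurable_times[OF test_fun_measurable[OF zeta_test_fun[OF d s]] borel_measurable_integrable[OF iD]])
    show "AE x in lebesgue. (\<lambda>n. zeta d (s n) x * D x) \<longlonglongrightarrow> indicator U x * eta d x * D x"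
    proof (intro AE_I2 tendsto_mult tendsto_const)
      fix x
      show "(\<lambda>n. zeta d (s n) x) \<longlonglongrightarrow> indicator U x * eta d x"
        using hfun_scaled_tendsto[OF eta_bounds(1)[OF d, of x] s s0]
        by (cases "x \<in> U") (simp_all add: zeta_def)
    qed
    show "AE x in lebesgue. norm (zeta d (s n) x * D x) \<le> \<bar>D x\<bar>" for n
    proof (intro AE_I2)
      fix x
      have "\<bar>zeta d (s n) x\<bar> \<le> 1"
      proof (cases "x \<in> U")
        case True
        then show ?thesis
          using hfun_scaled_bounds[OF s[of n] eta_bounds(1)[OF d True]] eta_bounds(2)[OF d True] by (simp add: zeta_def)
      qed (simp add: zeta_def)
      then show "norm (zeta d (s n) x * D x) \<le> \<bar>D x\<bar>"
        using mult_right_mono[of "\<bar>zeta d (s n) x\<bar>" 1 "\<bar>D x\<bar>"] by (simp add: abs_mult)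
    qed
  qed
  have "0 \<le> (\<integral>x. indicator U x * eta d x * D x)"
    by (rule LIMSEQ_le[OF L1 L2]) (use minor_zeta_bound(1)[where j=j and k=k, OF d s G H \<phi>] in \<open>auto simp: D_def\<close>)
  then show ?thesis by (simp add: D_def)
qed

text \<open>Now \<open>d\<close> tends to 0: inside \<open>U\<close> the weight \<open>eta d\<close>
  increases to 1, so dominated convergence removes it.\<close>

lemma minor_nonneg:
  assumes G: "\<And>i. sqint (G i)" and H: "\<And>i j. sqint (H i j)" "\<And>i j. wpd U j (G i) (H i j)" "\<And>i j x. H i j x = H j i x"
    and \<phi>: "\<And>k. \<phi> k \<in> test_fun U" "\<And>i. (\<lambda>k. abs_l2 (pd i (\<phi> k))) \<longlonglongrightarrow> abs_l2 (G i)"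
  shows "0 \<le> (\<integral>x. indicator U x * (H j j x * H k k x - H j k x * H j k x))"
proof -
  define d where "d n = 1 / real (Suc n)" for n
  have d: "0 < d n" for n by (simp add: d_def)
  have d0: "d \<longlonglongrightarrow> 0" unfolding d_def by (rule LIMSEQ_Suc[OF lim_1_over_n])
  define D where "D x = H j j x * H k k x - H j k x * H j k x" for x
  have iD: "integrable lebesgue D" unfolding D_def
    using sqint_integrable_mult[OF H(1)[of j j] H(1)[of k k]] sqint_integrable_mult[OF H(1)[of j k] H(1)[of j k]] by simp
  have im: "(indicator U :: _ \<Rightarrow> real) \<in> borel_measurable lebesgue"
    by (intro borel_measurable_lebesgueI borel_measurable_indicator) (use open_Omega in auto)
  have "(\<lambda>n. \<integral>x. indicator U x * eta (d n) x * D x \<partial>lebesgue) \<longlonglongrightarrow> (\<integral>x. indicator U x * D x)"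
  proof (rule integral_dominated_convergence[where w="\<lambda>x. \<bar>D x\<bar>"])
    show "integrable lebesgue (\<lambda>x. \<bar>D x\<bar>)" by (intro integrable_abs iD)
    show "(\<lambda>x. indicator U x * D x) \<in> borel_measurable lebesgue"
      by (rule borel_measurable_times[OF im borel_measurable_integrable[OF iD]])
    show "(\<lambda>x. indicator U x * eta (d n) x * D x) \<in> borel_measurable lebesgue" for n
      by (intro borel_measurable_times im borel_measurable_integrable[OF iD] borel_measurable_lebesgueI[OF eta_measurable])
    show "AE x in lebesgue. (\<lambda>n. indicator U x * eta (d n) x * D x) \<longlonglongrightarrow> indicator U x * D x"
    proof (intro AE_I2 tendsto_mult tendsto_const)
      fix x
      have "(\<lambda>n. 1 / (1 + d n * (\<Sum>i\<in>I. 1 / ell i x))) \<longlonglongrightarrow> 1 / (1 + 0 * (\<Sum>i\<in>I. 1 / ell i x))"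
        by (intro tendsto_intros d0) simp
      then have "(\<lambda>n. indicator U x * eta (d n) x) \<longlonglongrightarrow> indicator U x * 1"
        unfolding eta_def SS_def by (intro tendsto_mult tendsto_const) simp
      then show "(\<lambda>n. indicator U x * eta (d n) x) \<longlonglongrightarrow> indicator U x" by simp
    qed
    show "AE x in lebesgue. norm (indicator U x * eta (d n) x * D x) \<le> \<bar>D x\<bar>" for n
    proof (intro AE_I2)
      fix x
      show "norm (indicator U x * eta (d n) x * D x) \<le> \<bar>D x\<bar>"
      proof (cases "x \<in> U")
        case True
        then have "\<bar>eta (d n) x\<bar> \<le> 1" using eta_bounds[OF d True, of n] by simp
        then show ?thesis using True mult_right_mono[of "\<bar>eta (d n) x\<bar>" 1 "\<bar>D x\<bar>"] by (simp add: abs_mult)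
      qed simp
    qed
  qed
  moreover have "0 \<le> (\<integral>x. indicator U x * eta (d n) x * D x)" for n
    unfolding D_def by (rule minor_eta_nonneg[OF d G H \<phi>])
  ultimately have "0 \<le> (\<integral>x. indicator U x * D x)"
    by (intro LIMSEQ_le_const[of _ _ 0]) auto
  then show ?thesis by (simp add: D_def)
qed

text \<open>Summed over all \<open>j\<close> and \<open>k\<close>, the minors H_jj H_kk - H_jk^2
  give the square of the trace minus the squared Frobenius norm, and each of them has a nonnegative
  integral.\<close>

theorem Miranda_Talenti:
  assumes G: "\<And>i. sqint (G i)" and H: "\<And>i j. sqint (H i j)" "\<And>i j. wpd U j (G i) (H i j)" "\<And>i j x. H i j x = H j i x"
    and \<phi>: "\<And>k. \<phi> k \<in> test_fun U" "\<And>i. (\<lambda>k. abs_l2 (pd i (\<phi> k))) \<longlonglongrightarrow> abs_l2 (G i)"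
  shows "(\<integral>x. indicator U x * (\<Sum>j\<in>UNIV. \<Sum>k\<in>UNIV. (H j k x)\<^sup>2))
     \<le> (\<integral>x. indicator U x * (\<Sum>j\<in>UNIV. H j j x)\<^sup>2)"
proof -
  have im: "(indicator U :: _ \<Rightarrow> real) \<in> borel_measurable lebesgue"
    by (intro borel_measurable_lebesgueI borel_measurable_indicator) (use open_Omega in auto)
  have int: "integrable lebesgue (\<lambda>x. indicator U x * (f x * g x))" if "sqint f" "sqint g" for f g :: "real^'n \<Rightarrow> real"
    using sqint_integrable_mult[OF sqint_mult_bounded[OF that(1) im, of 1] that(2)] by (simp add: mult.assoc)
  have sw: "(\<integral>x. (\<Sum>j\<in>UNIV. \<Sum>k\<in>UNIV. f j k x)) = (\<Sum>j\<in>UNIV. \<Sum>k\<in>UNIV. \<integral>x. f j k x \<partial>lebesgue)"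
    if "\<And>j k. integrable lebesgue (f j k)" for f :: "'n \<Rightarrow> 'n \<Rightarrow> real^'n \<Rightarrow> real"
    using that by (simp add: Bochner_Integration.integral_sum)
  have "0 \<le> (\<Sum>j\<in>UNIV. \<Sum>k\<in>UNIV. \<integral>x. indicator U x * (H j j x * H k k x - H j k x * H j k x) \<partial>lebesgue)"
    by (intro sum_nonneg minor_nonneg[OF G H \<phi>])
  also have "\<dots> = (\<Sum>j\<in>UNIV. \<Sum>k\<in>UNIV. \<integral>x. indicator U x * (H j j x * H k k x) \<partial>lebesgue)
      - (\<Sum>j\<in>UNIV. \<Sum>k\<in>UNIV. \<integral>x. indicator U x * (H j k x * H j k x) \<partial>lebesgue)"
    using int[OF H(1) H(1)] by (simp add: right_diff_distrib sum_subtractf)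
  also have "(\<Sum>j\<in>UNIV. \<Sum>k\<in>UNIV. \<integral>x. indicator U x * (H j j x * H k k x) \<partial>lebesgue)
      = (\<integral>x. indicator U x * (\<Sum>j\<in>UNIV. H j j x)\<^sup>2)"
  proof -
    have "indicator U x * (\<Sum>j\<in>UNIV. H j j x)\<^sup>2 = (\<Sum>j\<in>UNIV. \<Sum>k\<in>UNIV. indicator U x * (H j j x * H k k x))" for x
      by (simp only: power2_eq_square sum_product) (simp only: sum_distrib_left)
    then show ?thesis
      using sw[of "\<lambda>j k x. indicator U x * (H j j x * H k k x)"] int[OF H(1) H(1)] by (simp only:)
  qed
  also have "(\<Sum>j\<in>UNIV. \<Sum>k\<in>UNIV. \<integral>x. indicator U x * (H j k x * H j k x) \<partial>lebesgue)
      = (\<integral>x. indicator U x * (\<Sum>j\<in>UNIV. \<Sum>k\<in>UNIV. (H j k x)\<^sup>2))"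
  proof -
    have "indicator U x * (\<Sum>j\<in>UNIV. \<Sum>k\<in>UNIV. (H j k x)\<^sup>2) = (\<Sum>j\<in>UNIV. \<Sum>k\<in>UNIV. indicator U x * (H j k x * H j k x))" for x
      unfolding power2_eq_square sum_distrib_left ..
    then show ?thesis
      using sw[of "\<lambda>j k x. indicator U x * (H j k x * H j k x)"] int[OF H(1) H(1)] by (simp only:)
  qed
  finally show ?thesis by simp
qed

end

text \<open>A member of \<open>X_space\<close> in scalar form. The test functions carry the zero
  boundary values and converge with their first derivatives only.\<close>

definition sobolev_data :: "(real^'n) set \<Rightarrow> (real^'n \<Rightarrow> real) \<Rightarrow> ('n \<Rightarrow> real^'n \<Rightarrow> real) \<Rightarrow>
    ('n \<Rightarrow> 'n \<Rightarrow> real^'n \<Rightarrow> real) \<Rightarrow> (nat \<Rightarrow> real^'n \<Rightarrow> real) \<Rightarrow> bool" where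
  "sobolev_data U w G H \<phi> \<longleftrightarrow> sqint w \<and> (\<forall>i. sqint (G i)) \<and> (\<forall>i j. sqint (H i j)) \<and>
     (\<forall>i j. wpd U j (G i) (H i j)) \<and> (\<forall>k. \<phi> k \<in> test_fun U) \<and> (\<lambda>k. abs_l2 (\<phi> k)) \<longlonglongrightarrow> abs_l2 w \<and>
     (\<forall>i. (\<lambda>k. abs_l2 (pd i (\<phi> k))) \<longlonglongrightarrow> abs_l2 (G i))"

text \<open>\<open>H2_norm\<close> contains no gradient, so values must be bounded by second
  derivatives. Hardy's inequality for a half-space containing \<open>U\<close>, whose distance
  function is at most 2 R on \<open>U\<close>, gives |w| \<le> 4 R |G_p|; integrating by parts along
  the test functions gives |G_p|^2 \<le> |H_pp| |w|. Together they give the constant 16 R^2.\<close>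

lemma Poincare_Hessian:
  fixes U :: "(real^'n) set"
  assumes U: "open U" "bounded U"
  obtains C where "0 \<le> C" "\<And>w G H \<phi> h. sobolev_data U w G H \<phi> \<Longrightarrow> (\<And>i. norm (abs_l2 (H i i)) \<le> h) \<Longrightarrow>
     norm (abs_l2 w) \<le> C * h"
proof -
  obtain R where R: "0 < R" "\<And>x. x \<in> U \<Longrightarrow> norm x < R"
    using U(2) by (metis bounded_pos_less)
  \<comment> \<open>Any coordinate direction will do: \<open>U\<close> is bounded in each of
    them.\<close>
  obtain p :: 'n where True by simp
  define \<alpha> where "\<alpha> = (axis p 1 :: real^'n)"
  have \<alpha>: "norm \<alpha> = 1" by (simp add: \<alpha>_def)
  have l: "0 < R - \<alpha> \<bullet> x" "R - \<alpha> \<bullet> x \<le> 2 * R" if "x \<in> U" for x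
    using R(2)[OF that] Cauchy_Schwarz_ineq2[of \<alpha> x] \<alpha> by (auto simp: abs_le_iff)
  have main: "norm (abs_l2 w) \<le> (16 * R\<^sup>2) * h"
    if data: "sobolev_data U w G H \<phi>"
      and h: "\<And>i. norm (abs_l2 (H i i)) \<le> h" for w G H and \<phi> :: "nat \<Rightarrow> real^'n \<Rightarrow> real" and h
  proof -
    have w: "sqint w" and G: "\<And>i. sqint (G i)" and H: "\<And>i j. sqint (H i j)" "\<And>i j. wpd U j (G i) (H i j)"
      and \<phi>: "\<And>k. \<phi> k \<in> test_fun U" "(\<lambda>k. abs_l2 (\<phi> k)) \<longlonglongrightarrow> abs_l2 w" "\<And>i. (\<lambda>k. abs_l2 (pd i (\<phi> k))) \<longlonglongrightarrow> abs_l2 (G i)"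
      using data by (simp_all add: sobolev_data_def)
    have P: "norm (abs_l2 (\<phi> k)) \<le> 4 * R * norm (abs_l2 (pd p (\<phi> k)))" for k
    proof -
      define f where "f x = 1 / (R - \<alpha> \<bullet> x) * \<phi> k x" for x
      have f: "f \<in> test_fun U"
        unfolding f_def by (rule test_fun_mult_smooth_on[OF \<phi>(1) half_space_weight(1)[OF U(1) l(1)] U(1)])
      have sf: "sqint f" by (rule test_fun_sqint[OF f])
      have "(norm (abs_l2 (\<phi> k)))\<^sup>2 = (\<integral>x. (norm (\<phi> k x))\<^sup>2)"
        by (rule norm_abs_l2[OF test_fun_sqint[OF \<phi>(1)]])
      also have "\<dots> \<le> (\<integral>x. (2 * R)\<^sup>2 * (norm (f x))\<^sup>2)"
      proof (rule integral_mono[OF sqint_integrable[OF test_fun_sqint[OF \<phi>(1)]] integrable_mult_right[OF sqint_integrable[OF sf]]])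
        fix x
        show "(norm (\<phi> k x))\<^sup>2 \<le> (2 * R)\<^sup>2 * (norm (f x))\<^sup>2"
        proof (cases "x \<in> U")
          case True
          have "\<phi> k x = (R - \<alpha> \<bullet> x) * f x" using l(1)[OF True] by (simp add: f_def)
          then have "norm (\<phi> k x) = (R - \<alpha> \<bullet> x) * norm (f x)" using l(1)[OF True] by (simp add: abs_mult)
          also have "\<dots> \<le> 2 * R * norm (f x)" by (rule mult_right_mono[OF l(2)[OF True]]) simp
          finally have "(norm (\<phi> k x))\<^sup>2 \<le> (2 * R * norm (f x))\<^sup>2" by (rule power_mono) simp
          then show ?thesis by (simp add: power_mult_distrib)
        next
          case False then show ?thesis using test_fun_outside[OF \<phi>(1) False] by simp
        qed
      qed
      also have "\<dots> = (2 * R * norm (abs_l2 f))\<^sup>2" by (simp add: norm_abs_l2[OF sf] power_mult_distrib)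
      finally have "norm (abs_l2 (\<phi> k)) \<le> 2 * R * norm (abs_l2 f)" by (rule power2_le_imp_le) (use R(1) in simp)
      also have "norm (abs_l2 f) \<le> 2 * norm (abs_l2 (\<lambda>x. \<Sum>i\<in>UNIV. \<alpha> $ i * pd i (\<phi> k) x))"
        unfolding f_def by (rule Hardy_half_space[OF U(1) l(1) \<alpha> \<phi>(1)])
      also have "(\<lambda>x. \<Sum>i\<in>UNIV. \<alpha> $ i * pd i (\<phi> k) x) = pd p (\<phi> k)"
        by (simp add: \<alpha>_def axis_def if_distrib[of "\<lambda>x. x * _"] fun_eq_iff cong: if_cong)
      finally show ?thesis using R(1) by simp
    qed
    have wG: "norm (abs_l2 w) \<le> 4 * R * norm (abs_l2 (G p))"
      by (rule LIMSEQ_le[OF tendsto_norm[OF \<phi>(2)] tendsto_mult_left[OF tendsto_norm[OF \<phi>(3)]]]) (use P in blast)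
    have "(\<lambda>k. \<integral>x. G p x * pd p (\<phi> k) x \<partial>lebesgue) \<longlonglongrightarrow> (\<integral>x. G p x * G p x)"
      by (rule l2_tendsto_integral[OF test_fun_sqint[OF test_fun_pd[OF \<phi>(1)]] G \<phi>(3) G])
    moreover have "(\<integral>x. G p x * pd p (\<phi> k) x) = - (\<integral>x. H p p x * \<phi> k x)" for k
      by (rule wpdD[OF H(2) \<phi>(1)])
    moreover have "(\<lambda>k. - (\<integral>x. H p p x * \<phi> k x)) \<longlonglongrightarrow> - (\<integral>x. H p p x * w x)"
      by (intro tendsto_minus l2_tendsto_integral[OF test_fun_sqint[OF \<phi>(1)] w \<phi>(2) H(1)])
    ultimately have "(\<integral>x. G p x * G p x) = - (\<integral>x. H p p x * w x)"
      using LIMSEQ_unique by simp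
    also have "\<dots> \<le> norm (abs_l2 (H p p)) * norm (abs_l2 w)"
      using abs_l2_mult_norm_le[OF H(1) w, of p p] by linarith
    finally have "(norm (abs_l2 (G p)))\<^sup>2 \<le> norm (abs_l2 (H p p)) * norm (abs_l2 w)"
      using norm_abs_l2[OF G, of p] by (simp add: power2_eq_square)
    also have "\<dots> \<le> h * norm (abs_l2 w)" by (rule mult_right_mono[OF h]) simp
    finally have G2: "(norm (abs_l2 (G p)))\<^sup>2 \<le> h * norm (abs_l2 w)" .
    have "(norm (abs_l2 w))\<^sup>2 \<le> (4 * R * norm (abs_l2 (G p)))\<^sup>2" by (rule power_mono[OF wG]) simp
    also have "\<dots> = 16 * R\<^sup>2 * (norm (abs_l2 (G p)))\<^sup>2" by (simp add: power_mult_distrib)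
    also have "\<dots> \<le> 16 * R\<^sup>2 * (h * norm (abs_l2 w))" by (rule mult_left_mono[OF G2]) simp
    finally have *: "norm (abs_l2 w) * norm (abs_l2 w) \<le> (16 * R\<^sup>2 * h) * norm (abs_l2 w)"
      by (simp add: power2_eq_square mult_ac)
    show ?thesis
    proof (cases "norm (abs_l2 w) = 0")
      case True
      have "0 \<le> h" using h[of p] norm_ge_zero order_trans by blast
      then show ?thesis using True by simp
    next
      case False
      then have "0 < norm (abs_l2 w)" by simp
      then show ?thesis using * by (simp only: mult_le_cancel_right_pos)
    qed
  qed
  show thesis by (rule that[of "16 * R\<^sup>2", OF _ main]) simp
qed

section \<open>Weak derivatives and restrictions as operators\<close>

lemma L2_of_test_fun: "\<phi> \<in> test_fun \<Omega> \<Longrightarrow> L2_of \<Omega> \<phi> = abs_l2 \<phi>"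
proof -
  assume \<phi>: "\<phi> \<in> test_fun \<Omega>"
  have "(\<lambda>x. if x \<in> \<Omega> then \<phi> x else 0) = \<phi>" using test_fun_outside[OF \<phi>] by (auto simp: fun_eq_iff)
  then show ?thesis by (simp add: L2_of_def)
qed

lemma pfield_bounded_linear:
  fixes h :: "'b::euclidean_space \<Rightarrow> 'c::euclidean_space"
  assumes "bounded_linear h" shows "\<exists>B. pfield (\<lambda>x::'a::euclidean_space. h) B"
  using pfield_const[OF assms, where thesis="\<exists>B. pfield (\<lambda>x::'a. h) B"] by blast

lemma sqint_bounded_linear:
  assumes "bounded_linear h" "sqint f" shows "sqint (\<lambda>x. h (f x))"
  using pfield_bounded_linear[OF assms(1)] pfield_sqint[OF _ assms(2)] by blast

lemma pop_const_abs:
  assumes "bounded_linear h" "sqint f" shows "pop (\<lambda>x. h) (abs_l2 f) = abs_l2 (\<lambda>x. h (f x))"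
  using pfield_bounded_linear[OF assms(1)] pop_abs[OF _ assms(2)] by blast

lemma bounded_linear_pop_const:
  assumes "bounded_linear h" shows "bounded_linear (pop (\<lambda>x::'a::euclidean_space. h))"
  using pfield_bounded_linear[OF assms, where 'a='a] bounded_linear_pop by blast

lemma bounded_linear_entry: "bounded_linear (\<lambda>M :: real^'n^'m. M $ i $ j)"
  by (rule bounded_linear_compose[OF bounded_linear_vec_nth bounded_linear_vec_nth])

lemma bounded_linear_axis: "bounded_linear (axis i :: 'b::euclidean_space \<Rightarrow> 'b^'n)"
proof (rule bounded_linear_intro[where K=1])
  fix x y :: 'b and r :: real
  show "axis i (x + y) = axis i x + axis i y" by (simp add: axis_def vec_eq_iff)
  show "axis i (r *\<^sub>R x) = r *\<^sub>R axis i x" by (simp add: axis_def vec_eq_iff)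
  show "norm (axis i x) \<le> norm x * 1" by (simp add: norm_eq_sqrt_inner inner_axis_axis)
qed

lemma sqint_vec_nth: "sqint f \<Longrightarrow> sqint (\<lambda>x. f x $ i)"
  by (rule sqint_bounded_linear[OF bounded_linear_vec_nth])

lemma sqint_entry: "sqint f \<Longrightarrow> sqint (\<lambda>x. (f x :: real^'n^'m) $ i $ j)"
  by (rule sqint_bounded_linear[OF bounded_linear_entry])

lemma inner_L2_of_axis:
  fixes G :: "'n::finite vfun"
  assumes "\<phi> \<in> test_fun \<Omega>"
  shows "G \<bullet> L2_of \<Omega> (\<lambda>x. axis i (\<phi> x)) = (\<integral>x. rep_l2 G x $ i * \<phi> x)"
proof -
  have e: "(\<lambda>x. if x \<in> \<Omega> then axis i (\<phi> x) else 0) = (\<lambda>x. axis i (\<phi> x))"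
    using test_fun_outside[OF assms] by (auto simp: fun_eq_iff axis_def vec_eq_iff)
  have s: "sqint (\<lambda>x. axis i (\<phi> x))" by (rule sqint_bounded_linear[OF bounded_linear_axis test_fun_sqint[OF assms]])
  show ?thesis
    using abs_l2_inner[OF sqint_rep[of G] s] by (simp add: L2_of_def e inner_axis)
qed

lemma inner_L2_of_axis_axis:
  fixes H :: "'n::finite mfun"
  assumes "\<phi> \<in> test_fun \<Omega>"
  shows "H \<bullet> L2_of \<Omega> (\<lambda>x. axis i (axis j (\<phi> x))) = (\<integral>x. rep_l2 H x $ i $ j * \<phi> x)"
proof -
  have e: "(\<lambda>x. if x \<in> \<Omega> then axis i (axis j (\<phi> x)) else 0) = (\<lambda>x. axis i (axis j (\<phi> x)))"
    using test_fun_outside[OF assms] by (auto simp: fun_eq_iff axis_def vec_eq_iff)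
  have s: "sqint (\<lambda>x. axis i (axis j (\<phi> x)))"
    by (intro sqint_bounded_linear[OF bounded_linear_axis] test_fun_sqint[OF assms])
  show ?thesis
    using abs_l2_inner[OF sqint_rep[of H] s] by (simp add: L2_of_def e inner_axis)
qed

lemma inner_L2_of_test_fun:
  "\<phi> \<in> test_fun \<Omega> \<Longrightarrow> u \<bullet> L2_of \<Omega> \<phi> = (\<integral>x. rep_l2 u x * \<phi> x)"
  using l2_inner_real[OF sqint_rep[of u] test_fun_sqint] by (simp add: L2_of_test_fun)

lemma is_weak_grad_iff:
  "is_weak_grad \<Omega> u G \<longleftrightarrow> G \<in> L2 \<Omega> \<and> (\<forall>i. wpd \<Omega> i (rep_l2 u) (\<lambda>x. rep_l2 G x $ i))"
  unfolding is_weak_grad_def wpd_def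
  by (auto simp: inner_L2_of_axis inner_L2_of_test_fun test_fun_pd)

lemma is_weak_hess_iff:
  "is_weak_hess \<Omega> u H \<longleftrightarrow> H \<in> L2 \<Omega> \<and> (\<forall>\<phi>\<in>test_fun \<Omega>. \<forall>i j.
     (\<integral>x. rep_l2 u x * pd i (pd j \<phi>) x) = (\<integral>x. rep_l2 H x $ i $ j * \<phi> x))"
  unfolding is_weak_hess_def
  by (auto simp: inner_L2_of_axis_axis inner_L2_of_test_fun test_fun_pd)

lemma test_fun_inner_unique:
  fixes f g :: "real^'n \<Rightarrow> real"
  assumes \<Omega>: "open \<Omega>" and f: "sqint f" "sqint g"
    and eq: "\<And>\<phi>. \<phi> \<in> test_fun \<Omega> \<Longrightarrow> (\<integral>x. f x * \<phi> x) = (\<integral>x. g x * \<phi> x)"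
  shows "AE x in lebesgue. x \<in> \<Omega> \<longrightarrow> f x = g x"
proof -
  have "AE x in lebesgue. x \<in> \<Omega> \<longrightarrow> f x - g x = 0"
  proof (rule test_fun_fundamental[OF \<Omega> sqint_diff[OF f]])
    fix \<phi> assume \<phi>: "\<phi> \<in> test_fun \<Omega>"
    show "(\<integral>x. (f x - g x) * \<phi> x) = 0"
      using sqint_times_test[OF f(1) \<phi>] sqint_times_test[OF f(2) \<phi>] eq[OF \<phi>] by (simp add: left_diff_distrib)
  qed
  then show ?thesis by eventually_elim simp
qed

lemma L2_eqI:
  assumes "F \<in> L2 \<Omega>" "G \<in> L2 \<Omega>" "AE x in lebesgue. x \<in> \<Omega> \<longrightarrow> rep_l2 F x = rep_l2 G x"
  shows "F = G"
proof -
  have 1: "AE x in lebesgue. x \<notin> \<Omega> \<longrightarrow> rep_l2 F x = 0" using assms(1) by (simp add: L2_def)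
  have 2: "AE x in lebesgue. x \<notin> \<Omega> \<longrightarrow> rep_l2 G x = 0" using assms(2) by (simp add: L2_def)
  show ?thesis
    unfolding l2_eq_iff using assms(3) 1 2
  proof eventually_elim
    case (elim x) then show ?case by (cases "x \<in> \<Omega>") simp_all
  qed
qed

lemma is_weak_hess_unique:
  fixes u :: "'n::finite sfun"
  assumes \<Omega>: "open \<Omega>" and H: "is_weak_hess \<Omega> u H" "is_weak_hess \<Omega> u H'"
  shows "H = H'"
proof (rule L2_eqI)
  show "H \<in> L2 \<Omega>" "H' \<in> L2 \<Omega>" using H by (simp_all add: is_weak_hess_def)
  have "AE x in lebesgue. x \<in> \<Omega> \<longrightarrow> rep_l2 H x $ i $ j = rep_l2 H' x $ i $ j" for i j
    by (rule test_fun_inner_unique[OF \<Omega> sqint_entry[OF sqint_rep] sqint_entry[OF sqint_rep]])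
      (use H in \<open>auto simp: is_weak_hess_iff\<close>)
  then have "AE x in lebesgue. \<forall>i\<in>UNIV. \<forall>j\<in>UNIV. x \<in> \<Omega> \<longrightarrow> rep_l2 H x $ i $ j = rep_l2 H' x $ i $ j"
    by (intro AE_finite_allI finite)
  then show "AE x in lebesgue. x \<in> \<Omega> \<longrightarrow> rep_l2 H x = rep_l2 H' x"
    by eventually_elim (simp add: vec_eq_iff)
qed

lemma weak_hess_eq:
  assumes "open \<Omega>" "is_weak_hess \<Omega> u H" shows "weak_hess \<Omega> u = H"
  unfolding weak_hess_def using assms is_weak_hess_unique by blast

lemma is_weak_hess_weak_hess:
  assumes "open \<Omega>" "u \<in> H2 \<Omega>" shows "is_weak_hess \<Omega> u (weak_hess \<Omega> u)"
  using assms weak_hess_eq unfolding H2_def by blast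

lemma is_weak_grad_unique:
  fixes u :: "'n::finite sfun"
  assumes \<Omega>: "open \<Omega>" and G: "is_weak_grad \<Omega> u G" "is_weak_grad \<Omega> u G'"
  shows "G = G'"
proof (rule L2_eqI)
  show "G \<in> L2 \<Omega>" "G' \<in> L2 \<Omega>" using G by (simp_all add: is_weak_grad_def)
  have "AE x in lebesgue. x \<in> \<Omega> \<longrightarrow> rep_l2 G x $ i = rep_l2 G' x $ i" for i
    by (rule test_fun_inner_unique[OF \<Omega> sqint_vec_nth[OF sqint_rep] sqint_vec_nth[OF sqint_rep]])
      (use G in \<open>auto simp: is_weak_grad_iff wpd_def\<close>)
  then have "AE x in lebesgue. \<forall>i\<in>UNIV. x \<in> \<Omega> \<longrightarrow> rep_l2 G x $ i = rep_l2 G' x $ i"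
    by (intro AE_finite_allI finite)
  then show "AE x in lebesgue. x \<in> \<Omega> \<longrightarrow> rep_l2 G x = rep_l2 G' x"
    by eventually_elim (simp add: vec_eq_iff)
qed

lemma weak_grad_eq:
  assumes "open \<Omega>" "is_weak_grad \<Omega> u G" shows "weak_grad \<Omega> u = G"
  unfolding weak_grad_def using assms is_weak_grad_unique by blast

section \<open>Restriction to a subdomain\<close>

definition cut :: "'a::euclidean_space set \<Rightarrow> 'a \<Rightarrow> 'b::euclidean_space \<Rightarrow> 'b" where
  "cut T x v = (if x \<in> T then v else 0)"

lemma pfield_cut: "T \<in> sets lebesgue \<Longrightarrow> pfield (cut T) 1"
proof -
  assume T: "T \<in> sets lebesgue"
  have "linear (cut T x :: 'b \<Rightarrow> 'b)" for x
    by (rule linearI) (simp_all add: cut_def)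
  moreover have "(\<lambda>x. cut T x v) \<in> borel_measurable lebesgue" for v :: 'b
    unfolding cut_def using T by (intro measurable_If_set) auto
  ultimately show ?thesis by (auto simp: pfield_def cut_def)
qed

lemma restr_eq_pop: "restr T = pop (cut T)"
  by (simp add: restr_def L2_of_def pop_def cut_def fun_eq_iff)

lemma bounded_linear_restr: "T \<in> sets lebesgue \<Longrightarrow> bounded_linear (restr T)"
  unfolding restr_eq_pop by (rule bounded_linear_pop[OF pfield_cut])

lemma restr_adjoint: "T \<in> sets lebesgue \<Longrightarrow> restr T F \<bullet> G = F \<bullet> restr T G"
  unfolding restr_eq_pop by (rule pop_adjoint[OF pfield_cut pfield_cut]) (simp_all add: cut_def)

lemma restr_AE: "T \<in> sets lebesgue \<Longrightarrow> AE x in lebesgue. rep_l2 (restr T F) x = (if x \<in> T then rep_l2 F x else 0)"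
  unfolding restr_eq_pop using rep_pop_AE[OF pfield_cut, of T F] by (simp add: cut_def)

lemma L2_iff_restr: "T \<in> sets lebesgue \<Longrightarrow> F \<in> L2 T \<longleftrightarrow> restr T F = F"
proof -
  assume T: "T \<in> sets lebesgue"
  show ?thesis
  proof
    assume "F \<in> L2 T"
    then have "AE x in lebesgue. x \<notin> T \<longrightarrow> rep_l2 F x = 0" by (simp add: L2_def)
    with restr_AE[OF T, of F] have "AE x in lebesgue. rep_l2 (restr T F) x = rep_l2 F x" by eventually_elim auto
    then show "restr T F = F" by (simp add: l2_eq_iff)
  next
    assume "restr T F = F"
    then have "AE x in lebesgue. rep_l2 F x = (if x \<in> T then rep_l2 F x else 0)" using restr_AE[OF T, of F] by simp
    then show "F \<in> L2 T" unfolding L2_def mem_Collect_eq by eventually_elim auto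
  qed
qed

lemma restr_restr:
  assumes "S \<in> sets lebesgue" "T \<in> sets lebesgue"
  shows "restr S (restr T F) = restr (S \<inter> T) F"
  unfolding l2_eq_iff using restr_AE[OF assms(1), of "restr T F"] restr_AE[OF assms(2), of F] restr_AE[OF sets.Int[OF assms], of F]
  by eventually_elim auto

lemma restr_in_L2: "T \<in> sets lebesgue \<Longrightarrow> restr T F \<in> L2 T"
  by (simp add: L2_iff_restr restr_restr)

lemma restr_empty: "restr {} F = 0"
proof -
  have "AE x in lebesgue. rep_l2 (restr {} F) x = 0" using restr_AE[of "{}" F] by simp
  then show ?thesis unfolding l2_eq_iff using rep_zero_AE by eventually_elim simp
qed

lemma L2_of_sqint:
  fixes f :: "'a::euclidean_space \<Rightarrow> 'b::euclidean_space"
  assumes "continuous_on UNIV f" "bounded T" "T \<in> sets lebesgue"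
  shows "sqint (\<lambda>x. if x \<in> T then f x else 0)"
proof -
  have "compact (f ` closure T)"
    by (rule compact_continuous_image[OF continuous_on_subset[OF assms(1)]]) (use assms(2) in auto)
  then obtain B where B: "\<And>x. x \<in> closure T \<Longrightarrow> norm (f x) \<le> B"
    by (meson bounded_iff compact_imp_bounded imageI)
  show ?thesis
  proof (rule sqint_bounded_support[where B="max B 0" and S=T])
    show "(\<lambda>x. if x \<in> T then f x else 0) \<in> borel_measurable lebesgue"
      using borel_measurable_lebesgueI[OF borel_measurable_continuous_onI[OF assms(1)]] assms(3)
      by (intro measurable_If_set) auto
    show "norm (if x \<in> T then f x else 0) \<le> max B 0" for x
      using B[of x] closure_subset[of T] by (auto simp: le_max_iff_disj)
  qed (use assms(2) in auto)
qed

lemma restr_L2_of: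
  fixes f :: "'a::euclidean_space \<Rightarrow> 'b::euclidean_space"
  assumes "continuous_on UNIV f" "bounded S" "S \<in> sets lebesgue" "T \<in> sets lebesgue" "T \<subseteq> S"
  shows "restr T (L2_of S f) = L2_of T f"
  unfolding restr_eq_pop L2_of_def pop_abs[OF pfield_cut[OF assms(4)] L2_of_sqint[OF assms(1-3)]]
  using assms(5) by (intro arg_cong[where f=abs_l2]) (auto simp: cut_def fun_eq_iff)

lemma L2_of_in_L2:
  fixes f :: "'a::euclidean_space \<Rightarrow> 'b::euclidean_space"
  assumes "continuous_on UNIV f" "bounded T" "T \<in> sets lebesgue"
  shows "L2_of T f \<in> L2 T"
  using restr_L2_of[OF assms assms(3) order_refl] L2_iff_restr[OF assms(3)] by blast

lemma closed_eq_linear: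
  fixes f g :: "'a::real_normed_vector \<Rightarrow> 'b::real_normed_vector"
  assumes "bounded_linear f" "bounded_linear g"
  shows "closed {x. f x = g x}" "subspace {x. f x = g x}"
proof -
  show "closed {x. f x = g x}"
    by (intro closed_Collect_eq linear_continuous_on assms)
  have "linear f" "linear g" using assms by (simp_all add: bounded_linear.linear)
  then show "subspace {x. f x = g x}"
    by (auto intro!: subspaceI simp: linear_0 linear_add linear_scale)
qed

lemma L2_closed_subspace:
  assumes "T \<in> sets lebesgue"
  shows "closed (L2 T :: ('a::euclidean_space, 'b::euclidean_space) l2 set)"
    "subspace (L2 T :: ('a::euclidean_space, 'b::euclidean_space) l2 set)"
proof -
  have e: "(L2 T :: ('a, 'b) l2 set) = {F. restr T F = F}" using L2_iff_restr[OF assms] by blast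
  note c = closed_eq_linear[OF bounded_linear_restr[OF assms] bounded_linear_ident]
  show "closed (L2 T :: ('a, 'b) l2 set)" "subspace (L2 T :: ('a, 'b) l2 set)"
    unfolding e by (rule c)+
qed

lemma bounded_linear_transpose: "bounded_linear (transpose :: real^'n^'n \<Rightarrow> real^'n^'n)"
proof -
  have "linear (transpose :: real^'n^'n \<Rightarrow> real^'n^'n)"
    by (rule linearI) (simp_all add: transpose_def vec_eq_iff)
  then show ?thesis by (rule linear_conv_bounded_linear[THEN iffD1])
qed

text \<open>Vanishing outside \<open>T\<close> and symmetry are both equations between bounded
  linear operators, restriction or transposition and the identity, and such solution sets are closed
  subspaces.\<close>

lemma L2sym_closed_subspace:
  assumes "T \<in> sets lebesgue" shows "closed (L2sym T)" "subspace (L2sym T)"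
proof -
  obtain B where B: "pfield (\<lambda>x::real^'a. (transpose :: real^'a^'a \<Rightarrow> _)) B"
    using pfield_bounded_linear[OF bounded_linear_transpose] by blast
  have "(AE x in lebesgue. transpose (rep_l2 Q x) = rep_l2 Q x) \<longleftrightarrow> pop (\<lambda>x. transpose) Q = Q" for Q :: "'a mfun"
  proof
    assume "AE x in lebesgue. transpose (rep_l2 Q x) = rep_l2 Q x"
    with rep_pop_AE[OF B, of Q] show "pop (\<lambda>x. transpose) Q = Q"
      unfolding l2_eq_iff by eventually_elim simp
  next
    assume "pop (\<lambda>x. transpose) Q = Q"
    then show "AE x in lebesgue. transpose (rep_l2 Q x) = rep_l2 Q x"
      using rep_pop_AE[OF B, of Q] by (simp add: eq_commute)
  qed
  then have e: "L2sym T = L2 T \<inter> {Q :: 'a mfun. pop (\<lambda>x. transpose) Q = Q}"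
    by (auto simp: L2sym_def)
  note c = closed_eq_linear[OF bounded_linear_pop[OF B] bounded_linear_ident]
  show "closed (L2sym T)" "subspace (L2sym T)"
    unfolding e by (intro closed_Int subspace_inter L2_closed_subspace[OF assms] c)+
qed

section \<open>The iterated divergence\<close>

lemma smooth_div_Div:
  assumes "\<Phi> \<in> smooth_sym" shows "smooth (div_Div \<Phi>)"
    "div_Div \<Phi> x = (\<Sum>j\<in>UNIV. \<Sum>k\<in>UNIV. pd j (pd k (\<lambda>y. \<Phi> y $ j $ k)) x)"
proof -
  have s: "smooth (\<lambda>y. \<Phi> y $ j $ k)" for j k using assms by (simp add: smooth_sym_def)
  have "div_Div \<Phi> x = (\<Sum>j\<in>UNIV. \<Sum>k\<in>UNIV. pd j (pd k (\<lambda>y. \<Phi> y $ j $ k)) x)" for x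
  proof -
    have "div_Div \<Phi> x = (\<Sum>j\<in>UNIV. pd j (\<lambda>y. \<Sum>k\<in>UNIV. pd k (\<lambda>z. \<Phi> z $ j $ k) y) x)"
      by (simp add: div_Div_def divergence_def row_Div_def)
    also have "\<dots> = (\<Sum>j\<in>UNIV. \<Sum>k\<in>UNIV. pd j (pd k (\<lambda>y. \<Phi> y $ j $ k)) x)"
      by (rule sum.cong[OF refl], rule pd_sum[OF finite]) (rule smooth_differentiable[OF smooth_pd[OF s]])
    finally show ?thesis .
  qed
  then show "div_Div \<Phi> x = (\<Sum>j\<in>UNIV. \<Sum>k\<in>UNIV. pd j (pd k (\<lambda>y. \<Phi> y $ j $ k)) x)" for x .
  then have e: "div_Div \<Phi> = (\<lambda>x. \<Sum>j\<in>UNIV. \<Sum>k\<in>UNIV. pd j (pd k (\<lambda>y. \<Phi> y $ j $ k)) x)" by blast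
  show "smooth (div_Div \<Phi>)" unfolding e by (intro smooth_intros smooth_pd s finite)
qed

lemma smooth_sym_continuous: "\<Phi> \<in> smooth_sym \<Longrightarrow> continuous_on UNIV \<Phi>"
proof -
  assume "\<Phi> \<in> smooth_sym"
  then have s: "smooth (\<lambda>y. \<Phi> y $ j $ k)" for j k by (simp add: smooth_sym_def)
  have e: "\<Phi> = (\<lambda>x. \<chi> j. \<chi> k. \<Phi> x $ j $ k)" by (simp add: vec_eq_iff)
  show ?thesis by (subst e) (intro continuous_on_vec_lambda smooth_continuous s)
qed

lemma div_Div_test_fun:
  fixes \<Phi> :: "real^'n \<Rightarrow> real^'n^'n"
  assumes \<Phi>: "\<Phi> \<in> smooth_sym" and \<phi>: "\<phi> \<in> test_fun T"
  shows "(\<integral>x. div_Div \<Phi> x * \<phi> x) = (\<Sum>j\<in>UNIV. \<Sum>k\<in>UNIV. \<integral>x. \<Phi> x $ j $ k * pd k (pd j \<phi>) x \<partial>lebesgue)"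
proof -
  have s: "smooth (\<lambda>y. \<Phi> y $ j $ k)" for j k using \<Phi> by (simp add: smooth_sym_def)
  have \<phi>U: "\<phi> \<in> test_fun UNIV" using test_fun_mono[OF \<phi>] by simp
  have ibp: "(\<integral>x. pd i m x * \<psi> x) = - (\<integral>x. m x * pd i \<psi> x)" if "smooth m" "\<psi> \<in> test_fun UNIV" for m \<psi> and i :: 'n
    using test_fun_integral_by_parts[OF that(2) _ open_UNIV, of m i] that(1) by (simp add: smooth_on_UNIV)
  have int: "integrable lebesgue (\<lambda>x. pd j (pd k (\<lambda>y. \<Phi> y $ j $ k)) x * \<phi> x)" for j k
    by (rule test_fun_integrable[OF test_fun_mult_smooth[OF \<phi>U smooth_pd[OF smooth_pd[OF s]]]])
  have "(\<integral>x. div_Div \<Phi> x * \<phi> x) = (\<integral>x. (\<Sum>j\<in>UNIV. \<Sum>k\<in>UNIV. pd j (pd k (\<lambda>y. \<Phi> y $ j $ k)) x * \<phi> x))"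
    unfolding smooth_div_Div(2)[OF \<Phi>] sum_distrib_right ..
  also have "\<dots> = (\<Sum>j\<in>UNIV. \<Sum>k\<in>UNIV. \<integral>x. pd j (pd k (\<lambda>y. \<Phi> y $ j $ k)) x * \<phi> x \<partial>lebesgue)"
    using int by (simp add: Bochner_Integration.integral_sum)
  also have "\<dots> = (\<Sum>j\<in>UNIV. \<Sum>k\<in>UNIV. \<integral>x. \<Phi> x $ j $ k * pd k (pd j \<phi>) x \<partial>lebesgue)"
    by (intro sum.cong refl) (simp only: ibp[OF smooth_pd[OF s] \<phi>U] ibp[OF s test_fun_pd[OF \<phi>U]] minus_minus)
  finally show ?thesis .
qed

text \<open>The completion in the graph norm as a subset of a Hilbert product; closedness is what
  makes orthogonal projection onto it possible.\<close>

definition divDiv_graph :: "(real^'n) set \<Rightarrow> ('n mfun \<times> 'n sfun) set" where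
  "divDiv_graph T = closure ((\<lambda>\<Phi>. (L2_of T \<Phi>, L2_of T (div_Div \<Phi>))) ` smooth_sym)"

lemma is_divDiv_iff: "is_divDiv T Q q \<longleftrightarrow> (Q, q) \<in> divDiv_graph T"
proof
  assume "is_divDiv T Q q"
  then obtain \<Phi> where \<Phi>: "\<And>k. \<Phi> k \<in> smooth_sym" "(\<lambda>k. L2_of T (\<Phi> k)) \<longlonglongrightarrow> Q" "(\<lambda>k. L2_of T (div_Div (\<Phi> k))) \<longlonglongrightarrow> q"
    by (auto simp: is_divDiv_def)
  then have "(\<lambda>k. (L2_of T (\<Phi> k), L2_of T (div_Div (\<Phi> k)))) \<longlonglongrightarrow> (Q, q)" by (intro tendsto_Pair)
  then show "(Q, q) \<in> divDiv_graph T"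
    unfolding divDiv_graph_def closure_sequential
    by (intro exI[of _ "\<lambda>k. (L2_of T (\<Phi> k), L2_of T (div_Div (\<Phi> k)))"]) (use \<Phi>(1) in auto)
next
  assume "(Q, q) \<in> divDiv_graph T"
  then obtain s where s: "\<And>k. s k \<in> (\<lambda>\<Phi>. (L2_of T \<Phi>, L2_of T (div_Div \<Phi>))) ` smooth_sym" "s \<longlonglongrightarrow> (Q, q)"
    unfolding divDiv_graph_def closure_sequential by auto
  then have "\<forall>k. \<exists>\<Phi>. \<Phi> \<in> smooth_sym \<and> s k = (L2_of T \<Phi>, L2_of T (div_Div \<Phi>))" by blast
  then obtain \<Phi> where \<Phi>: "\<And>k. \<Phi> k \<in> smooth_sym" "\<And>k. s k = (L2_of T (\<Phi> k), L2_of T (div_Div (\<Phi> k)))" by metis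
  then have "s = (\<lambda>k. (L2_of T (\<Phi> k), L2_of T (div_Div (\<Phi> k))))" by blast
  with s(2) have "(\<lambda>k. L2_of T (\<Phi> k)) \<longlonglongrightarrow> Q" "(\<lambda>k. L2_of T (div_Div (\<Phi> k))) \<longlonglongrightarrow> q"
    using tendsto_fst[of s] tendsto_snd[of s] by fastforce+
  then show "is_divDiv T Q q" unfolding is_divDiv_def using \<Phi>(1) by blast
qed

lemma L2_of_add:
  assumes "sqint (\<lambda>x. if x \<in> T then f x else 0)" "sqint (\<lambda>x. if x \<in> T then g x else 0)"
  shows "L2_of T f + L2_of T g = L2_of T (\<lambda>x. f x + g x)"
  unfolding L2_of_def abs_l2_add[OF assms] by (rule arg_cong[where f=abs_l2]) auto

lemma L2_of_scaleR:
  assumes "sqint (\<lambda>x. if x \<in> T then f x else 0)"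
  shows "c *\<^sub>R L2_of T f = L2_of T (\<lambda>x. c *\<^sub>R f x)"
  unfolding L2_of_def abs_l2_scaleR[OF assms] by (rule arg_cong[where f=abs_l2]) auto

lemma smooth_sym_add:
  fixes \<Phi> \<Psi> :: "real^'n \<Rightarrow> real^'n^'n"
  assumes "\<Phi> \<in> smooth_sym" "\<Psi> \<in> smooth_sym"
  shows "(\<lambda>x. \<Phi> x + \<Psi> x) \<in> smooth_sym" "div_Div (\<lambda>x. \<Phi> x + \<Psi> x) = (\<lambda>x. div_Div \<Phi> x + div_Div \<Psi> x)"
proof -
  have s: "smooth (\<lambda>y. \<Phi> y $ j $ k)" "smooth (\<lambda>y. \<Psi> y $ j $ k)" for j k
    using assms by (simp_all add: smooth_sym_def)
  have t: "transpose (\<Phi> x) = \<Phi> x" "transpose (\<Psi> x) = \<Psi> x" for x using assms by (simp_all add: smooth_sym_def)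
  have tr: "transpose (\<Phi> x + \<Psi> x) = \<Phi> x + \<Psi> x" for x
    using linear_add[OF bounded_linear.linear[OF bounded_linear_transpose]] t by metis
  show in_sym: "(\<lambda>x. \<Phi> x + \<Psi> x) \<in> smooth_sym"
    unfolding smooth_sym_def mem_Collect_eq using tr by (auto intro!: smooth_intros s)
  have "pd j (pd k (\<lambda>y. (\<Phi> y + \<Psi> y) $ j $ k)) x = pd j (pd k (\<lambda>y. \<Phi> y $ j $ k)) x + pd j (pd k (\<lambda>y. \<Psi> y $ j $ k)) x" for j k x
  proof -
    have "pd k (\<lambda>y. (\<Phi> y + \<Psi> y) $ j $ k) = (\<lambda>x. pd k (\<lambda>y. \<Phi> y $ j $ k) x + pd k (\<lambda>y. \<Psi> y $ j $ k) x)"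
      using pd_add[OF smooth_differentiable[OF s(1)] smooth_differentiable[OF s(2)]] by (simp add: fun_eq_iff)
    then show ?thesis
      using pd_add[OF smooth_differentiable[OF smooth_pd[OF s(1)]] smooth_differentiable[OF smooth_pd[OF s(2)]]] by simp
  qed
  then show "div_Div (\<lambda>x. \<Phi> x + \<Psi> x) = (\<lambda>x. div_Div \<Phi> x + div_Div \<Psi> x)"
    by (intro ext) (simp only: smooth_div_Div(2)[OF in_sym] smooth_div_Div(2)[OF assms(1)] smooth_div_Div(2)[OF assms(2)] sum.distrib)
qed

lemma smooth_sym_scaleR:
  fixes \<Phi> :: "real^'n \<Rightarrow> real^'n^'n"
  assumes "\<Phi> \<in> smooth_sym"
  shows "(\<lambda>x. c *\<^sub>R \<Phi> x) \<in> smooth_sym" "div_Div (\<lambda>x. c *\<^sub>R \<Phi> x) = (\<lambda>x. c *\<^sub>R div_Div \<Phi> x)"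
proof -
  have s: "smooth (\<lambda>y. \<Phi> y $ j $ k)" for j k using assms by (simp add: smooth_sym_def)
  have t: "transpose (\<Phi> x) = \<Phi> x" for x using assms by (simp add: smooth_sym_def)
  have tr: "transpose (c *\<^sub>R \<Phi> x) = c *\<^sub>R \<Phi> x" for x
    using linear_scale[OF bounded_linear.linear[OF bounded_linear_transpose]] t by metis
  show in_sym: "(\<lambda>x. c *\<^sub>R \<Phi> x) \<in> smooth_sym"
    unfolding smooth_sym_def mem_Collect_eq using tr by (auto intro!: smooth_intros s)
  have "pd j (pd k (\<lambda>y. (c *\<^sub>R \<Phi> y) $ j $ k)) x = c * pd j (pd k (\<lambda>y. \<Phi> y $ j $ k)) x" for j k x
  proof -
    have "pd k (\<lambda>y. (c *\<^sub>R \<Phi> y) $ j $ k) = (\<lambda>x. c * pd k (\<lambda>y. \<Phi> y $ j $ k) x)"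
      using pd_cmult[OF smooth_differentiable[OF s]] by (simp add: fun_eq_iff)
    then show ?thesis using pd_cmult[OF smooth_differentiable[OF smooth_pd[OF s]]] by simp
  qed
  then show "div_Div (\<lambda>x. c *\<^sub>R \<Phi> x) = (\<lambda>x. c *\<^sub>R div_Div \<Phi> x)"
    by (intro ext) (simp only: smooth_div_Div(2)[OF in_sym] smooth_div_Div(2)[OF assms] sum_distrib_left real_scaleR_def)
qed

lemma divDiv_graph_closed_subspace:
  fixes T :: "(real^'n) set"
  assumes T: "open T" "bounded T"
  shows "closed (divDiv_graph T)" "subspace (divDiv_graph T)"
proof -
  have Tm: "T \<in> sets lebesgue" using T(1) by auto
  have sq: "sqint (\<lambda>x. if x \<in> T then \<Phi> x else 0)" "sqint (\<lambda>x. if x \<in> T then div_Div \<Phi> x else 0)"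
    if "\<Phi> \<in> smooth_sym" for \<Phi>
    by (intro L2_of_sqint smooth_sym_continuous smooth_continuous smooth_div_Div(1) that T(2) Tm)+
  show "closed (divDiv_graph T)" by (simp add: divDiv_graph_def)
  show "subspace (divDiv_graph T)"
    unfolding divDiv_graph_def
  proof (rule subspace_closure, rule subspaceI)
    have z: "(\<lambda>x. 0) \<in> (smooth_sym :: (real^'n \<Rightarrow> real^'n^'n) set)"
      by (auto simp: smooth_sym_def transpose_def vec_eq_iff intro: smooth_intros)
    have dd: "div_Div (\<lambda>x::real^'n. 0) x = 0" for x using smooth_sym_scaleR(2)[OF z, of 0] by (simp add: fun_eq_iff)
    show "0 \<in> (\<lambda>\<Phi>. (L2_of T \<Phi>, L2_of T (div_Div \<Phi>))) ` smooth_sym"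
      by (rule image_eqI[OF _ z]) (simp add: dd L2_of_def abs_l2_zero zero_prod_def cong: if_cong)
  next
    fix x y assume "x \<in> (\<lambda>\<Phi>. (L2_of T \<Phi>, L2_of T (div_Div \<Phi>))) ` smooth_sym" "y \<in> (\<lambda>\<Phi>. (L2_of T \<Phi>, L2_of T (div_Div \<Phi>))) ` smooth_sym"
    then obtain \<Phi> \<Psi> where *: "\<Phi> \<in> smooth_sym" "\<Psi> \<in> smooth_sym" "x = (L2_of T \<Phi>, L2_of T (div_Div \<Phi>))" "y = (L2_of T \<Psi>, L2_of T (div_Div \<Psi>))" by blast
    show "x + y \<in> (\<lambda>\<Phi>. (L2_of T \<Phi>, L2_of T (div_Div \<Phi>))) ` smooth_sym"
      by (rule image_eqI[OF _ smooth_sym_add(1)[OF *(1,2)]])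
        (simp add: * smooth_sym_add(2)[OF *(1,2)] L2_of_add[OF sq(1)[OF *(1)] sq(1)[OF *(2)]] L2_of_add[OF sq(2)[OF *(1)] sq(2)[OF *(2)]])
  next
    fix c and x assume "x \<in> (\<lambda>\<Phi>. (L2_of T \<Phi>, L2_of T (div_Div \<Phi>))) ` smooth_sym"
    then obtain \<Phi> where *: "\<Phi> \<in> smooth_sym" "x = (L2_of T \<Phi>, L2_of T (div_Div \<Phi>))" by blast
    show "c *\<^sub>R x \<in> (\<lambda>\<Phi>. (L2_of T \<Phi>, L2_of T (div_Div \<Phi>))) ` smooth_sym"
      by (rule image_eqI[OF _ smooth_sym_scaleR(1)[OF *(1)]])
        (simp add: * smooth_sym_scaleR(2)[OF *(1)] L2_of_scaleR[OF sq(1)[OF *(1)]] L2_of_scaleR[OF sq(2)[OF *(1)]])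
  qed
qed

lemma divDiv_graph_L2:
  fixes T :: "(real^'n) set"
  assumes T: "open T" "bounded T" "T \<in> sets lebesgue" and Qq: "(Q, q) \<in> divDiv_graph T"
  shows "q \<in> L2 T"
proof -
  obtain \<Phi> where \<Phi>: "\<And>k. \<Phi> k \<in> smooth_sym" "(\<lambda>k. L2_of T (div_Div (\<Phi> k))) \<longlonglongrightarrow> q"
    using Qq unfolding is_divDiv_iff[symmetric] is_divDiv_def by blast
  have "L2_of T (div_Div (\<Phi> k)) \<in> L2 T" for k
    by (intro L2_of_in_L2 smooth_continuous smooth_div_Div(1) \<Phi> T)
  then show ?thesis using closed_sequentially[OF L2_closed_subspace(1)[OF T(3)] _ \<Phi>(2)] by blast
qed

text \<open>Closability of the iterated divergence: after two integrations by parts the pairing with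
  a test function depends continuously on the matrix field alone. Linearity of the graph turns this
  into uniqueness, so that \<open>divDiv\<close> is well defined.\<close>

lemma divDiv_graph_zero:
  fixes T :: "(real^'n) set"
  assumes T: "open T" "bounded T" "T \<in> sets lebesgue" and Qq: "(0, q) \<in> divDiv_graph T"
  shows "q = 0"
proof (rule L2_eqI[OF divDiv_graph_L2[OF T Qq]])
  show "0 \<in> L2 T" by (rule subspace_0[OF L2_closed_subspace(2)[OF T(3)]])
  obtain \<Phi> where \<Phi>: "\<And>k. \<Phi> k \<in> smooth_sym" "(\<lambda>k. L2_of T (\<Phi> k)) \<longlonglongrightarrow> 0" "(\<lambda>k. L2_of T (div_Div (\<Phi> k))) \<longlonglongrightarrow> q"
    using Qq unfolding is_divDiv_iff[symmetric] is_divDiv_def by blast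
  have sq: "sqint (\<lambda>x. if x \<in> T then \<Phi> k x else 0)" "sqint (\<lambda>x. if x \<in> T then div_Div (\<Phi> k) x else 0)" for k
    by (intro L2_of_sqint smooth_sym_continuous smooth_continuous smooth_div_Div(1) \<Phi>(1) T)+
  have "AE x in lebesgue. x \<in> T \<longrightarrow> rep_l2 q x = 0"
  proof (rule test_fun_fundamental[OF T(1) sqint_rep])
    fix \<phi> assume \<phi>: "\<phi> \<in> test_fun T"
    have "L2_of T (div_Div (\<Phi> k)) \<bullet> abs_l2 \<phi> = (\<Sum>i\<in>UNIV. \<Sum>j\<in>UNIV. pop (\<lambda>x M. M $ i $ j) (L2_of T (\<Phi> k)) \<bullet> abs_l2 (pd j (pd i \<phi>)))" for k
    proof -
      have t: "pd j (pd i \<phi>) \<in> test_fun T" for i j by (intro test_fun_pd \<phi>)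
      have "L2_of T (div_Div (\<Phi> k)) \<bullet> abs_l2 \<phi> = (\<integral>x. div_Div (\<Phi> k) x * \<phi> x)"
        unfolding L2_of_def l2_inner_real[OF sq(2) test_fun_sqint[OF \<phi>]]
        by (rule Bochner_Integration.integral_cong) (use test_fun_outside[OF \<phi>] in auto)
      also have "\<dots> = (\<Sum>i\<in>UNIV. \<Sum>j\<in>UNIV. \<integral>x. \<Phi> k x $ i $ j * pd j (pd i \<phi>) x \<partial>lebesgue)"
        by (rule div_Div_test_fun[OF \<Phi>(1) \<phi>])
      also have "\<dots> = (\<Sum>i\<in>UNIV. \<Sum>j\<in>UNIV. pop (\<lambda>x M. M $ i $ j) (L2_of T (\<Phi> k)) \<bullet> abs_l2 (pd j (pd i \<phi>)))"
      proof (intro sum.cong refl)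
        fix i j
        show "(\<integral>x. \<Phi> k x $ i $ j * pd j (pd i \<phi>) x) = pop (\<lambda>x M. M $ i $ j) (L2_of T (\<Phi> k)) \<bullet> abs_l2 (pd j (pd i \<phi>))"
          unfolding L2_of_def pop_const_abs[OF bounded_linear_entry sq(1)] l2_inner_real[OF sqint_entry[OF sq(1)] test_fun_sqint[OF t]]
          by (rule Bochner_Integration.integral_cong) (use test_fun_outside[OF t[of j i]] in auto)
      qed
      finally show ?thesis .
    qed
    moreover have "(\<lambda>k. \<Sum>i\<in>UNIV. \<Sum>j\<in>UNIV. pop (\<lambda>x M. M $ i $ j) (L2_of T (\<Phi> k)) \<bullet> abs_l2 (pd j (pd i \<phi>)))
      \<longlonglongrightarrow> (\<Sum>i\<in>UNIV. \<Sum>j\<in>UNIV. pop (\<lambda>x M. M $ i $ j) 0 \<bullet> abs_l2 (pd j (pd i \<phi>)))"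
      by (intro tendsto_sum tendsto_inner tendsto_const bounded_linear.tendsto[OF bounded_linear_pop_const[OF bounded_linear_entry]] \<Phi>(2))
    moreover have "pop (\<lambda>x::real^'n. \<lambda>M::real^'n^'n. M $ i $ j) 0 = 0" for i j
      by (rule linear_0[OF bounded_linear.linear[OF bounded_linear_pop_const[OF bounded_linear_entry]]])
    moreover have "(\<lambda>k. L2_of T (div_Div (\<Phi> k)) \<bullet> abs_l2 \<phi>) \<longlonglongrightarrow> q \<bullet> abs_l2 \<phi>"
      by (intro tendsto_inner tendsto_const \<Phi>(3))
    ultimately have "q \<bullet> abs_l2 \<phi> = 0" using LIMSEQ_unique by fastforce
    then show "(\<integral>x. rep_l2 q x * \<phi> x) = 0"
      using l2_inner_real[OF sqint_rep[of q] test_fun_sqint[OF \<phi>]] by simp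
  qed
  with rep_zero_AE show "AE x in lebesgue. x \<in> T \<longrightarrow> rep_l2 q x = rep_l2 0 x" by eventually_elim auto
qed

lemma divDiv_graph_unique:
  fixes T :: "(real^'n) set"
  assumes T: "open T" "bounded T" "T \<in> sets lebesgue" and Qq: "(Q, q) \<in> divDiv_graph T" "(Q, q') \<in> divDiv_graph T"
  shows "q = q'"
proof -
  have "(Q, q) - (Q, q') \<in> divDiv_graph T"
    by (rule subspace_diff[OF divDiv_graph_closed_subspace(2)[OF T(1,2)] Qq])
  then have "(0, q - q') \<in> divDiv_graph T" by simp
  from divDiv_graph_zero[OF T this] show ?thesis by simp
qed

lemma divDiv_eq:
  fixes T :: "(real^'n) set"
  assumes T: "open T" "bounded T" "T \<in> sets lebesgue" and Qq: "(Q, q) \<in> divDiv_graph T"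
  shows "divDiv T Q = q"
  unfolding divDiv_def is_divDiv_iff using divDiv_graph_unique[OF T] Qq by blast

section \<open>The Hessian estimate under the Cordes condition\<close>

lemma H2_space_linear:
  fixes U :: "(real^'n) set"
  assumes U: "open U" "U \<in> sets lebesgue"
  shows "subspace (H2 U)"
    "u \<in> H2 U \<Longrightarrow> v \<in> H2 U \<Longrightarrow> weak_hess U (u + v) = weak_hess U u + weak_hess U v"
    "u \<in> H2 U \<Longrightarrow> weak_hess U (c *\<^sub>R u) = c *\<^sub>R weak_hess U u"
    "is_weak_grad U u G \<Longrightarrow> is_weak_grad U v G' \<Longrightarrow> is_weak_grad U (u + v) (G + G')"
    "is_weak_grad U u G \<Longrightarrow> is_weak_grad U (c *\<^sub>R u) (c *\<^sub>R G)"
proof -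
  have L: "subspace (L2 U :: 'n sfun set)" "subspace (L2 U :: 'n vfun set)" "subspace (L2 U :: 'n mfun set)"
    by (rule L2_closed_subspace[OF U(2)])+
  have ha: "is_weak_hess U (u + v) (H + H')" if "is_weak_hess U u H" "is_weak_hess U v H'" for u v H H'
    using that subspace_add[OF L(3)] by (simp add: is_weak_hess_def inner_add_left)
  have hs: "is_weak_hess U (c *\<^sub>R u) (c *\<^sub>R H)" if "is_weak_hess U u H" for c u H
    using that subspace_scale[OF L(3)] by (simp add: is_weak_hess_def)
  have ga: "is_weak_grad U (u + v) (G + G')" if "is_weak_grad U u G" "is_weak_grad U v G'" for u v G G'
    using that subspace_add[OF L(2)] by (simp add: is_weak_grad_def inner_add_left)
  have gs: "is_weak_grad U (c *\<^sub>R u) (c *\<^sub>R G)" if "is_weak_grad U u G" for c u G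
    using that subspace_scale[OF L(2)] by (simp add: is_weak_grad_def)
  have z: "(0 :: 'n sfun) \<in> H2 U"
  proof -
    have "is_weak_grad U 0 0" "is_weak_hess U 0 0"
      using subspace_0[OF L(2)] subspace_0[OF L(3)] by (simp_all add: is_weak_grad_def is_weak_hess_def)
    then show ?thesis using subspace_0[OF L(1)] unfolding H2_def by blast
  qed
  show "subspace (H2 U)"
  proof (rule subspaceI[OF z])
    show "x + y \<in> H2 U" if "x \<in> H2 U" "y \<in> H2 U" for x y
      using that subspace_add[OF L(1)] ha ga unfolding H2_def by blast
    show "c *\<^sub>R x \<in> H2 U" if "x \<in> H2 U" for c x
      using that subspace_scale[OF L(1)] hs gs unfolding H2_def by blast
  qed
  show "weak_hess U (u + v) = weak_hess U u + weak_hess U v" if "u \<in> H2 U" "v \<in> H2 U"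
    by (rule weak_hess_eq[OF U(1) ha]) (intro is_weak_hess_weak_hess U that)+
  show "weak_hess U (c *\<^sub>R u) = c *\<^sub>R weak_hess U u" if "u \<in> H2 U"
    by (rule weak_hess_eq[OF U(1) hs]) (intro is_weak_hess_weak_hess U that)
  show "is_weak_grad U u G \<Longrightarrow> is_weak_grad U v G' \<Longrightarrow> is_weak_grad U (u + v) (G + G')" by (rule ga)
  show "is_weak_grad U u G \<Longrightarrow> is_weak_grad U (c *\<^sub>R u) (c *\<^sub>R G)" by (rule gs)
qed

lemma L2_of_grad_sqint:
  assumes \<phi>: "\<phi> \<in> test_fun U"
  shows "L2_of U (grad \<phi>) = abs_l2 (grad \<phi>)" "sqint (grad \<phi>)"
proof -
  have "(\<lambda>x. if x \<in> U then grad \<phi> x else 0) = grad \<phi>"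
    using test_fun_outside[OF test_fun_pd[OF \<phi>]] by (auto simp: fun_eq_iff grad_def vec_eq_iff)
  then show "L2_of U (grad \<phi>) = abs_l2 (grad \<phi>)" by (simp add: L2_of_def)
  have "sqint (\<lambda>x. \<Sum>i\<in>J. axis i (pd i \<phi> x))" if "finite J" for J
    using that
  proof (induction J rule: finite_induct)
    case (insert i J)
    have "sqint (\<lambda>x. axis i (pd i \<phi> x) + (\<Sum>i\<in>J. axis i (pd i \<phi> x)))"
      by (rule sqint_add[OF sqint_bounded_linear[OF bounded_linear_axis test_fun_sqint[OF test_fun_pd[OF \<phi>]]] insert.IH])
    then show ?case using insert.hyps by simp
  qed (simp add: sqint_zero)
  from this[OF finite, of UNIV] have "sqint (\<lambda>x. \<Sum>i\<in>UNIV. axis i (pd i \<phi> x))" .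
  moreover have "(\<lambda>x. \<Sum>i\<in>UNIV. axis i (pd i \<phi> x)) = grad \<phi>"
    by (simp add: fun_eq_iff vec_eq_iff grad_def axis_def if_distrib cong: if_cong)
  ultimately show "sqint (grad \<phi>)" by simp
qed

lemma X_space_linear:
  fixes U :: "(real^'n) set"
  assumes U: "open U" "U \<in> sets lebesgue"
  shows "subspace (X_space U)"
proof (rule subspaceI)
  note H = subspace_0[OF H2_space_linear(1)[OF U]] subspace_add[OF H2_space_linear(1)[OF U]] subspace_scale[OF H2_space_linear(1)[OF U]]
  have L1: "subspace (L2 U :: 'n sfun set)" by (rule L2_closed_subspace[OF U(2)])
  have wg: "is_weak_grad U u (weak_grad U u)" if "\<exists>G. is_weak_grad U u G" for u
    using that weak_grad_eq[OF U(1)] by metis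
  have z: "is_weak_grad U 0 0"
    using subspace_0[OF L2_closed_subspace(2)[OF U(2)]] by (simp add: is_weak_grad_def)
  show "0 \<in> X_space U"
  proof -
    have "grad (\<lambda>x::real^'n. 0) = (\<lambda>x. 0)" by (simp add: fun_eq_iff grad_def vec_eq_iff)
    then have "L2_of U (\<lambda>x::real^'n. 0::real) = 0" "L2_of U (grad (\<lambda>x::real^'n. 0)) = 0"
      by (simp_all add: L2_of_def abs_l2_zero)
    then have "0 \<in> H10 U"
      unfolding H10_def mem_Collect_eq using subspace_0[OF L1] z weak_grad_eq[OF U(1) z]
      by (intro conjI exI[of _ "0 :: 'n vfun"] exI[of _ "\<lambda>k x. 0"]) (simp_all add: test_fun_zero)
    then show ?thesis using H(1) by (simp add: X_space_def)
  qed
next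
  note H = subspace_0[OF H2_space_linear(1)[OF U]] subspace_add[OF H2_space_linear(1)[OF U]] subspace_scale[OF H2_space_linear(1)[OF U]]
  have L1: "subspace (L2 U :: 'n sfun set)" by (rule L2_closed_subspace[OF U(2)])
  have wg: "is_weak_grad U u (weak_grad U u)" if "\<exists>G. is_weak_grad U u G" for u
    using that weak_grad_eq[OF U(1)] by metis
  fix x y assume "x \<in> X_space U" "y \<in> X_space U"
  then have xy: "x \<in> H2 U" "y \<in> H2 U" "x \<in> H10 U" "y \<in> H10 U" by (simp_all add: X_space_def)
  obtain \<phi> where \<phi>: "x \<in> L2 U" "\<exists>G. is_weak_grad U x G" "\<And>k. \<phi> k \<in> test_fun U" "(\<lambda>k. L2_of U (\<phi> k)) \<longlonglongrightarrow> x" "(\<lambda>k. L2_of U (grad (\<phi> k))) \<longlonglongrightarrow> weak_grad U x"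
    using xy(3) unfolding H10_def by blast
  obtain \<psi> where \<psi>: "y \<in> L2 U" "\<exists>G. is_weak_grad U y G" "\<And>k. \<psi> k \<in> test_fun U" "(\<lambda>k. L2_of U (\<psi> k)) \<longlonglongrightarrow> y" "(\<lambda>k. L2_of U (grad (\<psi> k))) \<longlonglongrightarrow> weak_grad U y"
    using xy(4) unfolding H10_def by blast
  have s: "(\<lambda>x. \<phi> k x + \<psi> k x) \<in> test_fun U" for k by (rule test_fun_add[OF \<phi>(3) \<psi>(3)])
  have 1: "L2_of U (\<lambda>x. \<phi> k x + \<psi> k x) = L2_of U (\<phi> k) + L2_of U (\<psi> k)" for k
    unfolding L2_of_test_fun[OF s] L2_of_test_fun[OF \<phi>(3)] L2_of_test_fun[OF \<psi>(3)]
    by (rule abs_l2_add[symmetric, OF test_fun_sqint[OF \<phi>(3)] test_fun_sqint[OF \<psi>(3)]])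
  have "grad (\<lambda>x. \<phi> k x + \<psi> k x) = (\<lambda>x. grad (\<phi> k) x + grad (\<psi> k) x)" for k
    by (intro ext) (simp add: grad_def vec_eq_iff pd_add smooth_differentiable test_fun_smooth[OF \<phi>(3)] test_fun_smooth[OF \<psi>(3)])
  then have 2: "L2_of U (grad (\<lambda>x. \<phi> k x + \<psi> k x)) = L2_of U (grad (\<phi> k)) + L2_of U (grad (\<psi> k))" for k
    unfolding L2_of_grad_sqint(1)[OF s] L2_of_grad_sqint(1)[OF \<phi>(3)] L2_of_grad_sqint(1)[OF \<psi>(3)]
    using abs_l2_add[OF L2_of_grad_sqint(2)[OF \<phi>(3)] L2_of_grad_sqint(2)[OF \<psi>(3)]] by simp
  have g: "is_weak_grad U (x + y) (weak_grad U x + weak_grad U y)"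
    by (rule H2_space_linear(4)[OF U wg[OF \<phi>(2)] wg[OF \<psi>(2)]])
  have "x + y \<in> H10 U"
    unfolding H10_def mem_Collect_eq weak_grad_eq[OF U(1) g]
    using g s subspace_add[OF L1 \<phi>(1) \<psi>(1)] tendsto_add[OF \<phi>(4) \<psi>(4)] tendsto_add[OF \<phi>(5) \<psi>(5)]
    by (intro conjI exI[of _ "weak_grad U x + weak_grad U y"] exI[of _ "\<lambda>k x. \<phi> k x + \<psi> k x"]) (simp_all add: 1 2)
  then show "x + y \<in> X_space U" using H(2)[OF xy(1,2)] by (simp add: X_space_def)
next
  note H = subspace_0[OF H2_space_linear(1)[OF U]] subspace_add[OF H2_space_linear(1)[OF U]] subspace_scale[OF H2_space_linear(1)[OF U]]
  have L1: "subspace (L2 U :: 'n sfun set)" by (rule L2_closed_subspace[OF U(2)])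
  have wg: "is_weak_grad U u (weak_grad U u)" if "\<exists>G. is_weak_grad U u G" for u
    using that weak_grad_eq[OF U(1)] by metis
  fix c :: real and x assume "x \<in> X_space U"
  then have x: "x \<in> H2 U" "x \<in> H10 U" by (simp_all add: X_space_def)
  obtain \<phi> where \<phi>: "x \<in> L2 U" "\<exists>G. is_weak_grad U x G" "\<And>k. \<phi> k \<in> test_fun U" "(\<lambda>k. L2_of U (\<phi> k)) \<longlonglongrightarrow> x" "(\<lambda>k. L2_of U (grad (\<phi> k))) \<longlonglongrightarrow> weak_grad U x"
    using x(2) unfolding H10_def by blast
  have s: "(\<lambda>x. c * \<phi> k x) \<in> test_fun U" for k by (rule test_fun_cmult[OF \<phi>(3)])
  have 1: "L2_of U (\<lambda>x. c * \<phi> k x) = c *\<^sub>R L2_of U (\<phi> k)" for k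
    unfolding L2_of_test_fun[OF s] L2_of_test_fun[OF \<phi>(3)] using abs_l2_scaleR[OF test_fun_sqint[OF \<phi>(3)], of c k] by simp
  have "grad (\<lambda>x. c * \<phi> k x) = (\<lambda>x. c *\<^sub>R grad (\<phi> k) x)" for k
    by (intro ext) (simp add: grad_def vec_eq_iff pd_cmult smooth_differentiable test_fun_smooth[OF \<phi>(3)])
  then have 2: "L2_of U (grad (\<lambda>x. c * \<phi> k x)) = c *\<^sub>R L2_of U (grad (\<phi> k))" for k
    unfolding L2_of_grad_sqint(1)[OF s] L2_of_grad_sqint(1)[OF \<phi>(3)]
    using abs_l2_scaleR[OF L2_of_grad_sqint(2)[OF \<phi>(3)], of c k] by simp
  have g: "is_weak_grad U (c *\<^sub>R x) (c *\<^sub>R weak_grad U x)"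
    by (rule H2_space_linear(5)[OF U wg[OF \<phi>(2)]])
  have "c *\<^sub>R x \<in> H10 U"
    unfolding H10_def mem_Collect_eq weak_grad_eq[OF U(1) g]
    using g s subspace_scale[OF L1 \<phi>(1)] tendsto_scaleR[OF tendsto_const \<phi>(4)] tendsto_scaleR[OF tendsto_const \<phi>(5)]
    by (intro conjI exI[of _ "c *\<^sub>R weak_grad U x"] exI[of _ "\<lambda>k x. c * \<phi> k x"]) (simp_all add: 1 2)
  then show "c *\<^sub>R x \<in> X_space U" using H(3)[OF x(1)] by (simp add: X_space_def)
qed

text \<open>Second derivatives of test functions commute, so the transposed field is a weak Hessian
  of the same function; uniqueness identifies the two.\<close>

lemma weak_hess_symmetric:
  fixes U :: "(real^'n) set"
  assumes U: "open U" "U \<in> sets lebesgue" and H: "is_weak_hess U u H"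
  shows "H \<in> L2sym U"
proof -
  obtain B where B: "pfield (\<lambda>x::real^'n. (transpose :: real^'n^'n \<Rightarrow> _)) B"
    using pfield_bounded_linear[OF bounded_linear_transpose] by blast
  have HL: "AE x in lebesgue. x \<notin> U \<longrightarrow> rep_l2 H x = 0" using H by (simp add: is_weak_hess_def L2_def)
  have tr: "AE x in lebesgue. rep_l2 (pop (\<lambda>x. transpose) H) x = transpose (rep_l2 H x)" by (rule rep_pop_AE[OF B])
  have trL: "pop (\<lambda>x. transpose) H \<in> L2 U"
    unfolding L2_def mem_Collect_eq using HL tr
    by eventually_elim (simp add: transpose_def vec_eq_iff)
  have "is_weak_hess U u (pop (\<lambda>x. transpose) H)"
    unfolding is_weak_hess_iff
  proof (intro conjI trL ballI allI)
    fix \<phi> i j assume \<phi>: "\<phi> \<in> test_fun U"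
    have "(\<integral>x. rep_l2 u x * pd i (pd j \<phi>) x) = (\<integral>x. rep_l2 u x * pd j (pd i \<phi>) x)"
      by (simp only: pd_commute[OF test_fun_smooth[OF \<phi>], of i j])
    also have "\<dots> = (\<integral>x. rep_l2 H x $ j $ i * \<phi> x)"
      using H \<phi> unfolding is_weak_hess_iff by blast
    also have "\<dots> = (\<integral>x. rep_l2 (pop (\<lambda>x. transpose) H) x $ i $ j * \<phi> x)"
    proof (rule AE_eq_integral_cong_mult)
      show "AE x in lebesgue. rep_l2 H x $ j $ i = rep_l2 (pop (\<lambda>x. transpose) H) x $ i $ j"
        using tr by eventually_elim (simp add: transpose_def)
    qed (intro sqint_measurable[OF sqint_entry[OF sqint_rep]] test_fun_measurable[OF \<phi>])+
    finally show "(\<integral>x. rep_l2 u x * pd i (pd j \<phi>) x) = (\<integral>x. rep_l2 (pop (\<lambda>x. transpose) H) x $ i $ j * \<phi> x)" .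
  qed
  then have e: "pop (\<lambda>x. transpose) H = H" using is_weak_hess_unique[OF U(1) _ H] by blast
  have "AE x in lebesgue. transpose (rep_l2 H x) = rep_l2 H x"
    using tr unfolding e by eventually_elim simp
  then show ?thesis using H by (simp add: L2sym_def is_weak_hess_def)
qed

lemma X_space_data:
  fixes U :: "(real^'n) set"
  assumes U: "open U" "U \<in> sets lebesgue" and w: "w \<in> X_space U"
  obtains G H \<phi> where "sobolev_data U (rep_l2 w) G H \<phi>" "\<And>i j x. H i j x = H j i x"
    "AE x in lebesgue. \<forall>i j. H i j x = rep_l2 (weak_hess U w) x $ i $ j"
proof -
  have wH: "w \<in> H2 U" "w \<in> H10 U" using w by (simp_all add: X_space_def)
  obtain \<phi> where \<phi>: "\<exists>G. is_weak_grad U w G" "\<And>k. \<phi> k \<in> test_fun U" "(\<lambda>k. L2_of U (\<phi> k)) \<longlonglongrightarrow> w" "(\<lambda>k. L2_of U (grad (\<phi> k))) \<longlonglongrightarrow> weak_grad U w"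
    using wH(2) unfolding H10_def by blast
  have g: "is_weak_grad U w (weak_grad U w)" using \<phi>(1) weak_grad_eq[OF U(1)] by metis
  have h: "is_weak_hess U w (weak_hess U w)" by (rule is_weak_hess_weak_hess[OF U(1) wH(1)])
  define G where "G i x = rep_l2 (weak_grad U w) x $ i" for i x
  define M where "M = rep_l2 (weak_hess U w)"
  \<comment> \<open>Symmetrized so that symmetry holds at every point, as
    \<open>minor_identity\<close> requires, and not only almost everywhere.\<close>
  define H where "H i j x = (1/2) * (M x $ i $ j + M x $ j $ i)" for i j x
  have "AE x in lebesgue. transpose (M x) = M x"
    using weak_hess_symmetric[OF U h] by (simp add: L2sym_def M_def)
  then have HM: "AE x in lebesgue. \<forall>i j. H i j x = M x $ i $ j"
  proof eventually_elim
    case (elim x)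
    have "M x $ j $ i = M x $ i $ j" for i j
    proof -
      have "transpose (M x) $ i $ j = M x $ j $ i" by (simp add: transpose_def)
      then show ?thesis using elim by simp
    qed
    then show ?case by (simp add: H_def)
  qed
  have Gsq: "sqint (G i)" for i unfolding G_def by (rule sqint_vec_nth[OF sqint_rep])
  have Msq: "sqint (\<lambda>x. M x $ i $ j)" for i j unfolding M_def by (rule sqint_entry[OF sqint_rep])
  have Hsq: "sqint (H i j)" for i j
    using sqint_scaleR[OF sqint_add[OF Msq[of i j] Msq[of j i]], of "1/2"] by (simp add: H_def[abs_def])
  have Gl: "(\<lambda>k. abs_l2 (pd i (\<phi> k))) \<longlonglongrightarrow> abs_l2 (G i)" for i
  proof -
    have "(\<lambda>k. pop (\<lambda>x v. v $ i) (L2_of U (grad (\<phi> k)))) \<longlonglongrightarrow> pop (\<lambda>x v. v $ i) (weak_grad U w)"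
      by (rule bounded_linear.tendsto[OF bounded_linear_pop_const[OF bounded_linear_vec_nth] \<phi>(4)])
    moreover have "pop (\<lambda>x v. v $ i) (L2_of U (grad (\<phi> k))) = abs_l2 (pd i (\<phi> k))" for k
      unfolding L2_of_grad_sqint(1)[OF \<phi>(2)] pop_const_abs[OF bounded_linear_vec_nth L2_of_grad_sqint(2)[OF \<phi>(2)]]
      by (rule arg_cong[where f=abs_l2]) (simp add: grad_def fun_eq_iff)
    ultimately show ?thesis by (simp add: pop_def G_def[abs_def])
  qed
  have wp: "wpd U j (G i) (H i j)" for i j
    unfolding wpd_def
  proof
    fix \<psi> assume \<psi>: "\<psi> \<in> test_fun U"
    have "wpd U i (rep_l2 w) (G i)" using g unfolding is_weak_grad_iff G_def[abs_def] by blast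
    from wpdD[OF this test_fun_pd[OF \<psi>, of j]]
    have "(\<integral>x. G i x * pd j \<psi> x) = - (\<integral>x. rep_l2 w x * pd i (pd j \<psi>) x)" by simp
    also have "\<dots> = - (\<integral>x. M x $ i $ j * \<psi> x)"
      using h \<psi> unfolding is_weak_hess_iff M_def by simp
    also have "(\<integral>x. M x $ i $ j * \<psi> x) = (\<integral>x. H i j x * \<psi> x)"
    proof (rule AE_eq_integral_cong_mult)
      show "AE x in lebesgue. M x $ i $ j = H i j x" using HM by eventually_elim simp
    qed (intro sqint_measurable Msq Hsq test_fun_measurable[OF \<psi>])+
    finally show "(\<integral>x. G i x * pd j \<psi> x) = - (\<integral>x. H i j x * \<psi> x)" .
  qed
  have "(\<lambda>k. abs_l2 (\<phi> k)) \<longlonglongrightarrow> abs_l2 (rep_l2 w)" using \<phi>(3) by (simp add: L2_of_test_fun[OF \<phi>(2)])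
  then have "sobolev_data U (rep_l2 w) G H \<phi>"
    unfolding sobolev_data_def using Gsq Hsq wp \<phi>(2) Gl by simp
  moreover have "H i j x = H j i x" for i j x by (simp add: H_def)
  ultimately show thesis using HM unfolding M_def by (rule that)
qed

section \<open>Polytopes as half-space domains and the global Hessian bound\<close>

lemma interior_Inter_finite:
  assumes "finite F" shows "interior (\<Inter>F) = (\<Inter>h\<in>F. interior h)"
  using assms by (induction F rule: finite_induct) (simp_all add: interior_Int)

text \<open>An open convex set is the interior of its closure. Taking interiors in the
  representation of the closure by finitely many closed half-spaces makes the inequalities strict,
  and division by the norms of the normals makes these unit vectors.\<close>

lemma polytope_half_space_domain:
  fixes U :: "(real^'n) set"
  assumes "convex_polytopal_domain U"
  shows "\<exists>(I :: (real^'n) set set) a b. half_space_domain U I a b"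
proof -
  have U: "open U" "bounded U" "convex U" "polytope (closure U)"
    using assms by (auto simp: convex_polytopal_domain_def)
  have "polyhedron (closure U)" by (rule polytope_imp_polyhedron[OF U(4)])
  then obtain F where F: "finite F" "closure U = \<Inter>F" "\<forall>h\<in>F. \<exists>a b. a \<noteq> 0 \<and> h = {x. a \<bullet> x \<le> b}"
    unfolding polyhedron_def by blast
  from F(3) obtain a b where ab: "\<And>h. h \<in> F \<Longrightarrow> a h \<noteq> 0" "\<And>h. h \<in> F \<Longrightarrow> h = {x. a h \<bullet> x \<le> b h}"
    by metis
  define a' where "a' h = a h /\<^sub>R norm (a h)" for h
  define b' where "b' h = b h / norm (a h)" for h
  have int: "interior h = {x. a' h \<bullet> x < b' h}" if h: "h \<in> F" for h
  proof -
    have "interior h = {x. a h \<bullet> x < b h}"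
      using interior_halfspace_le[OF ab(1)[OF h], of "b h"] ab(2)[OF h] by simp
    also have "\<dots> = {x. a' h \<bullet> x < b' h}"
      using ab(1)[OF h] by (auto simp: a'_def b'_def divide_inverse mult.commute)
    finally show ?thesis .
  qed
  have "U = interior (closure U)"
    using convex_interior_closure[OF U(3)] interior_open[OF U(1)] by simp
  also have "\<dots> = (\<Inter>h\<in>F. interior h)" unfolding F(2) by (rule interior_Inter_finite[OF F(1)])
  also have "\<dots> = {x. \<forall>h\<in>F. a' h \<bullet> x < b' h}" using int by auto
  finally have "half_space_domain U F a' b'"
    using F(1) U(2) ab(1) by unfold_locales (auto simp: a'_def)
  then show ?thesis by blast
qed

text \<open>Truncated so as to be bounded everywhere, not only almost everywhere.\<close>

definition contract :: "(real^'n) set \<Rightarrow> real \<Rightarrow> (real^'n \<Rightarrow> real^'n^'n) \<Rightarrow> real^'n \<Rightarrow> real^'n^'n" where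
  "contract U K A x = (if x \<in> U \<and> norm (A x) \<le> K then A x else 0)"

lemma pfield_contract:
  fixes U :: "(real^'n) set"
  assumes U: "U \<in> sets lebesgue" and A: "A \<in> borel_measurable (lebesgue_on U)" and K: "0 \<le> K"
  shows "pfield (\<lambda>x D. contract U K A x \<bullet> D) K" "pfield (\<lambda>x (r::real). r *\<^sub>R contract U K A x) K"
proof -
  define B where "B x = (if x \<in> U then A x else 0)" for x
  have B: "B \<in> borel_measurable lebesgue"
    unfolding B_def using borel_measurable_if[OF U, of A] A by simp
  have e: "contract U K A x = (if norm (B x) \<le> K then B x else 0)" for x
    by (auto simp: contract_def B_def)
  have set: "{x \<in> space lebesgue. norm (B x) \<le> K} \<in> sets lebesgue"
    using B by measurable
  have C: "contract U K A \<in> borel_measurable lebesgue"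
  proof -
    have "(\<lambda>x. if norm (B x) \<le> K then B x else 0) \<in> borel_measurable lebesgue"
      by (rule measurable_If[OF B _ set]) simp
    then show ?thesis unfolding e[abs_def] .
  qed
  have b: "norm (contract U K A x) \<le> K" for x using K by (simp add: contract_def)
  show "pfield (\<lambda>x D. contract U K A x \<bullet> D) K"
    unfolding pfield_def
  proof (intro conjI allI K)
    show "linear (\<lambda>D. contract U K A x \<bullet> D)" for x by (rule linearI) (simp_all add: inner_add_right)
    show "norm (contract U K A x \<bullet> v) \<le> K * norm v" for x v
      using Cauchy_Schwarz_ineq2[of "contract U K A x" v] mult_right_mono[OF b[of x], of "norm v"] by simp
    show "(\<lambda>x. contract U K A x \<bullet> v) \<in> borel_measurable lebesgue" for v
      by (intro borel_measurable_inner C borel_measurable_const)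
  qed
  show "pfield (\<lambda>x (r::real). r *\<^sub>R contract U K A x) K"
    unfolding pfield_def
  proof (intro conjI allI K)
    show "linear (\<lambda>r::real. r *\<^sub>R contract U K A x)" for x by (rule linearI) (simp_all add: scaleR_add_left)
    show "norm (v *\<^sub>R contract U K A x) \<le> K * norm v" for x and v :: real
      using mult_left_mono[OF b[of x], of "\<bar>v\<bar>"] by (simp add: mult.commute)
    show "(\<lambda>x. v *\<^sub>R contract U K A x) \<in> borel_measurable lebesgue" for v :: real
      by (intro borel_measurable_scaleR C borel_measurable_const)
  qed
qed

text \<open>With N the norm of the Hessian, Miranda-Talenti bounds N^2 by the squared norm of the
  trace, and the integrated pointwise Cordes estimate bounds that by (1 - \<theta>) N^2 plus C times
  the squared norm of A:D^2 w; the first term is absorbed on the left. The factor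
  \<open>P + 1\<close> adds the norm of \<open>w\<close> itself by
  \<open>Poincare_Hessian\<close>.\<close>

lemma Hessian_estimate:
  fixes U :: "(real^'n) set"
  assumes poly: "convex_polytopal_domain U" and ell: "elliptic_coefficient U A" and cor: "cordes U A"
  obtains K C where "0 < K" "0 < C" "AE x in lebesgue. x \<in> U \<longrightarrow> norm (A x) \<le> K"
    "\<And>w. w \<in> X_space U \<Longrightarrow> H2_norm U w \<le> C * norm (pop (\<lambda>x D. contract U K A x \<bullet> D) (weak_hess U w))"
proof -
  have U: "open U" "bounded U" using poly by (auto simp: convex_polytopal_domain_def)
  have Um: "U \<in> sets lebesgue" using U(1) by auto
  obtain I :: "(real^'n) set set" and a b where "half_space_domain U I a b"
    using polytope_half_space_domain[OF poly] by blast
  then interpret half_space_domain U I a b .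
  obtain K \<theta> C where K: "0 < K" "0 < \<theta>" "\<theta> < 1" "0 < C"
    and AC: "AE x in lebesgue. x \<in> U \<longrightarrow> norm (A x) \<le> K \<and> (\<forall>D. (trace D)\<^sup>2 \<le> (1 - \<theta>) * (D \<bullet> D) + C * (A x \<bullet> D)\<^sup>2)"
    using elliptic_cordes_bounds[OF ell cor Um] by blast
  obtain P where P: "0 \<le> P" "\<And>w G H \<phi> h. sobolev_data U w G H \<phi> \<Longrightarrow> (\<And>i. norm (abs_l2 (H i i)) \<le> h) \<Longrightarrow> norm (abs_l2 w) \<le> P * h"
    using Poincare_Hessian[OF U] by blast
  have A: "A \<in> borel_measurable (lebesgue_on U)" using ell by (simp add: elliptic_coefficient_def)
  note pf = pfield_contract(1)[OF Um A less_imp_le[OF K(1)]]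
  define AM where "AM = pop (\<lambda>x D. contract U K A x \<bullet> D)"
  have im: "(indicator U :: _ \<Rightarrow> real) \<in> borel_measurable lebesgue"
    using Um by simp
  have est: "H2_norm U w \<le> ((P + 1) * sqrt (C / \<theta>)) * norm (AM (weak_hess U w))" if w: "w \<in> X_space U" for w
  proof -
    obtain G H \<phi> where data: "sobolev_data U (rep_l2 w) G H \<phi>" and Hs: "\<And>i j x. H i j x = H j i x"
      and HM: "AE x in lebesgue. \<forall>i j. H i j x = rep_l2 (weak_hess U w) x $ i $ j"
      using X_space_data[OF U(1) Um w] by blast
    have d: "\<And>i. sqint (G i)" "\<And>i j. sqint (H i j)" "\<And>i j. wpd U j (G i) (H i j)"
      "\<And>k. \<phi> k \<in> test_fun U" "\<And>i. (\<lambda>k. abs_l2 (pd i (\<phi> k))) \<longlonglongrightarrow> abs_l2 (G i)"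
      using data by (simp_all add: sobolev_data_def)
    define M where "M = rep_l2 (weak_hess U w)"
    define N where "N = norm (weak_hess U w)"
    have "w \<in> H2 U" using w by (simp add: X_space_def)
    from is_weak_hess_weak_hess[OF U(1) this] have hL2: "weak_hess U w \<in> L2 U" by (simp add: is_weak_hess_def)
    then have M0: "AE x in lebesgue. x \<notin> U \<longrightarrow> M x = 0" by (simp add: L2_def M_def)
    have Msq: "sqint M" unfolding M_def by simp
    have AMsq: "sqint (\<lambda>x. contract U K A x \<bullet> M x)" by (rule pfield_sqint[OF pf Msq])
    have trsq: "sqint (\<lambda>x. trace (M x))"
    proof -
      have "sqint (\<lambda>x. \<Sum>i\<in>UNIV. 1 * M x $ i $ i)" by (rule sqint_linear_combination[OF finite sqint_entry[OF Msq]])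
      then show ?thesis by (simp add: trace_def)
    qed
    have N2: "N\<^sup>2 = (\<integral>x. (norm (M x))\<^sup>2)"
      using norm_abs_l2[OF Msq] by (simp add: N_def M_def)
    have AM2: "(norm (AM (weak_hess U w)))\<^sup>2 = (\<integral>x. (contract U K A x \<bullet> M x)\<^sup>2)"
      using norm_abs_l2[OF AMsq] by (simp add: AM_def pop_def M_def)
    have "N\<^sup>2 = (\<integral>x. indicator U x * (\<Sum>j\<in>UNIV. \<Sum>k\<in>UNIV. (H j k x)\<^sup>2))"
      unfolding N2
    proof (rule integral_cong_AE)
      show "AE x in lebesgue. (norm (M x))\<^sup>2 = indicator U x * (\<Sum>j\<in>UNIV. \<Sum>k\<in>UNIV. (H j k x)\<^sup>2)"
        using M0 HM
      proof eventually_elim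
        case (elim x)
        have "(norm (M x))\<^sup>2 = (\<Sum>j\<in>UNIV. \<Sum>k\<in>UNIV. (H j k x)\<^sup>2)"
          unfolding power2_norm_eq_inner inner_matrix M_def using elim(2) by (simp add: power2_eq_square)
        then show ?case using elim(1) by (cases "x \<in> U") auto
      qed
      show "(\<lambda>x. (norm (M x))\<^sup>2) \<in> borel_measurable lebesgue"
        by (rule borel_measurable_integrable[OF sqint_integrable[OF Msq]])
      show "(\<lambda>x. indicator U x * (\<Sum>j\<in>UNIV. \<Sum>k\<in>UNIV. (H j k x)\<^sup>2)) \<in> borel_measurable lebesgue"
        by (intro borel_measurable_times im borel_measurable_sum borel_measurable_power sqint_measurable d)
    qed
    also have "\<dots> \<le> (\<integral>x. indicator U x * (\<Sum>j\<in>UNIV. H j j x)\<^sup>2)"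
      by (rule Miranda_Talenti[OF d(1,2,3) Hs d(4,5)])
    also have "\<dots> = (\<integral>x. (trace (M x))\<^sup>2)"
    proof (rule integral_cong_AE)
      show "AE x in lebesgue. indicator U x * (\<Sum>j\<in>UNIV. H j j x)\<^sup>2 = (trace (M x))\<^sup>2"
        using M0 HM
      proof eventually_elim
        case (elim x)
        have "(\<Sum>j\<in>UNIV. H j j x) = trace (M x)" using elim(2) by (simp add: trace_def M_def)
        then show ?case using elim(1) by (cases "x \<in> U") (auto simp: trace_def)
      qed
      show "(\<lambda>x. indicator U x * (\<Sum>j\<in>UNIV. H j j x)\<^sup>2) \<in> borel_measurable lebesgue"
        by (intro borel_measurable_times im borel_measurable_sum borel_measurable_power sqint_measurable d)
      show "(\<lambda>x. (trace (M x))\<^sup>2) \<in> borel_measurable lebesgue"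
        by (intro borel_measurable_power sqint_measurable trsq)
    qed
    also have "\<dots> \<le> (\<integral>x. (1 - \<theta>) * (norm (M x))\<^sup>2 + C * (contract U K A x \<bullet> M x)\<^sup>2)"
    proof (rule integral_mono_AE)
      show "integrable lebesgue (\<lambda>x. (trace (M x))\<^sup>2)" using sqint_integrable[OF trsq] by simp
      show "integrable lebesgue (\<lambda>x. (1 - \<theta>) * (norm (M x))\<^sup>2 + C * (contract U K A x \<bullet> M x)\<^sup>2)"
        using sqint_integrable[OF Msq] sqint_integrable[OF AMsq] by simp
      show "AE x in lebesgue. (trace (M x))\<^sup>2 \<le> (1 - \<theta>) * (norm (M x))\<^sup>2 + C * (contract U K A x \<bullet> M x)\<^sup>2"
        using M0 AC
      proof eventually_elim
        case (elim x)
        show ?case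
        proof (cases "x \<in> U")
          case True
          then have "contract U K A x = A x" using elim(2) by (simp add: contract_def)
          then show ?thesis using elim(2) True by (simp add: power2_norm_eq_inner)
        qed (use elim(1) in \<open>simp add: trace_def\<close>)
      qed
    qed
    also have "\<dots> = (1 - \<theta>) * N\<^sup>2 + C * (norm (AM (weak_hess U w)))\<^sup>2"
      unfolding N2 AM2 using sqint_integrable[OF Msq] sqint_integrable[OF AMsq] by simp
    finally have "\<theta> * N\<^sup>2 \<le> C * (norm (AM (weak_hess U w)))\<^sup>2" by (simp add: algebra_simps)
    then have "N\<^sup>2 \<le> (C / \<theta>) * (norm (AM (weak_hess U w)))\<^sup>2" using K(2) by (simp add: field_simps)
    also have "\<dots> = (sqrt (C / \<theta>) * norm (AM (weak_hess U w)))\<^sup>2" using K by (simp add: power_mult_distrib)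
    finally have NA: "N \<le> sqrt (C / \<theta>) * norm (AM (weak_hess U w))"
      by (rule power2_le_imp_le) (use K in simp)
    have "norm (abs_l2 (H i i)) \<le> N" for i
    proof -
      have pfe: "pfield (\<lambda>x::real^'n. \<lambda>D::real^'n^'n. D $ i $ i) 1"
        unfolding pfield_def
      proof (intro conjI allI)
        show "linear (\<lambda>D::real^'n^'n. D $ i $ i)" by (rule linearI) simp_all
        show "norm (D $ i $ i) \<le> 1 * norm D" for D :: "real^'n^'n"
          using component_le_norm_cart[of "D $ i" i] Finite_Cartesian_Product.norm_nth_le[of D i] by simp
      qed simp_all
      have "abs_l2 (H i i) = pop (\<lambda>x D. D $ i $ i) (weak_hess U w)"
        unfolding pop_def using HM
        by (subst abs_l2_eq_iff[OF d(2) sqint_entry[OF sqint_rep]]) (auto elim: eventually_mono)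
      then show ?thesis using norm_pop_le[OF pfe, of "weak_hess U w"] by (simp add: N_def)
    qed
    then have wN: "norm w \<le> P * N" using P(2)[OF data] by simp
    have "H2_norm U w \<le> norm w + N"
      unfolding H2_norm_def N_def by (rule sqrt_sum_squares_le_sum) simp_all
    also have "\<dots> \<le> (P + 1) * N" using wN by (simp add: algebra_simps)
    also have "\<dots> \<le> (P + 1) * (sqrt (C / \<theta>) * norm (AM (weak_hess U w)))" using NA P(1) by (intro mult_left_mono) auto
    finally show ?thesis by simp
  qed
  have "0 < (P + 1) * sqrt (C / \<theta>)" using P(1) K by (intro mult_pos_pos) auto
  moreover have "AE x in lebesgue. x \<in> U \<longrightarrow> norm (A x) \<le> K" using AC by eventually_elim simp
  ultimately show thesis using that K(1) est unfolding AM_def by blast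
qed

section \<open>Zero extensions with square integrable Hessian\<close>

lemma sum_delta2:
  fixes f :: "'n::finite \<Rightarrow> 'n \<Rightarrow> real"
  shows "(\<Sum>a\<in>UNIV. \<Sum>b\<in>UNIV. f a b * ((if a = i then (if b = j then 1 else 0) else 0) + (if a = j then (if b = i then 1 else 0) else 0))) = f i j + f j i"
proof -
  have 1: "(\<Sum>a\<in>UNIV. \<Sum>b\<in>UNIV. f a b * (if a = i then (if b = j then 1 else 0) else 0)) = f i j" for i j
  proof -
    have "(\<Sum>b\<in>UNIV. f a b * (if a = i then (if b = j then 1 else 0) else 0)) = (if a = i then f a j else 0)" for a
      by (cases "a = i") (simp_all add: if_distrib[of "\<lambda>x. _ * x"] cong: if_cong)
    then show ?thesis by simp
  qed
  show ?thesis by (simp add: distrib_left sum.distrib 1)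
qed

text \<open>Insert \<phi> times the symmetric matrix e_i e_j^T + e_j e_i^T, whose iterated
  divergence is twice the mixed derivative. The test functions range over the whole space, so the
  identity states that the zero extension of \<open>z\<close> has the weak Hessian
  \<open>- Z\<close> across the boundary as well.\<close>

lemma weak_hess_from_orthogonality:
  fixes U :: "(real^'n) set"
  assumes U: "open U" "bounded U" "U \<in> sets lebesgue"
    and z: "z \<in> L2 U" and Z: "Z \<in> L2sym U"
    and orth: "\<And>\<Phi>. \<Phi> \<in> smooth_sym \<Longrightarrow> z \<bullet> L2_of U (div_Div \<Phi>) + Z \<bullet> L2_of U \<Phi> = 0"
    and \<phi>: "\<phi> \<in> test_fun UNIV"
  shows "(\<integral>x. rep_l2 z x * pd i (pd j \<phi>) x) = (\<integral>x. - rep_l2 Z x $ i $ j * \<phi> x)"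
proof -
  \<comment> \<open>For \<open>i = j\<close> the two parts add up to the single entry 2, so that the
    factor 2 below is the same in all cases.\<close>
  define c where "c a b = (if a = i then (if b = j then 1 else 0) else 0) + (if a = j then (if b = i then 1 else 0) else (0::real))" for a b
  define \<Phi> where "\<Phi> x = (\<chi> a b. c a b * \<phi> x)" for x
  have c_sym: "c a b = c b a" for a b by (simp add: c_def)
  have \<Phi>: "\<Phi> \<in> smooth_sym"
    unfolding smooth_sym_def \<Phi>_def using c_sym
    by (auto simp: transpose_def vec_eq_iff intro!: test_fun_smooth[OF test_fun_cmult[OF \<phi>]])
  have ent: "(\<lambda>y. \<Phi> y $ a $ b) = (\<lambda>y. c a b * \<phi> y)" for a b by (simp add: \<Phi>_def)
  have p2: "pd a (pd b (\<lambda>y. c a b * \<phi> y)) x = pd a (pd b \<phi>) x * c a b" for a b x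
  proof -
    have "pd b (\<lambda>y. c a b * \<phi> y) = (\<lambda>x. c a b * pd b \<phi> x)"
      using pd_cmult[OF smooth_differentiable[OF test_fun_smooth[OF \<phi>]]] by (simp add: fun_eq_iff)
    then show ?thesis
      using pd_cmult[OF smooth_differentiable[OF test_fun_smooth[OF test_fun_pd[OF \<phi>]]]] by simp
  qed
  have dd: "div_Div \<Phi> x = 2 * pd i (pd j \<phi>) x" for x
  proof -
    have "div_Div \<Phi> x = (\<Sum>a\<in>UNIV. \<Sum>b\<in>UNIV. pd a (pd b \<phi>) x * c a b)"
      unfolding smooth_div_Div(2)[OF \<Phi>] ent p2 ..
    also have "\<dots> = pd i (pd j \<phi>) x + pd j (pd i \<phi>) x"
      unfolding c_def by (rule sum_delta2)
    finally show ?thesis by (simp add: pd_commute[OF test_fun_smooth[OF \<phi>], of i j])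
  qed
  have z0: "AE x in lebesgue. x \<notin> U \<longrightarrow> rep_l2 z x = 0" using z by (simp add: L2_def)
  have Z0: "AE x in lebesgue. x \<notin> U \<longrightarrow> rep_l2 Z x = 0" "AE x in lebesgue. transpose (rep_l2 Z x) = rep_l2 Z x"
    using Z by (simp_all add: L2sym_def L2_def)
  have p\<phi>: "pd i (pd j \<phi>) \<in> test_fun UNIV" by (intro test_fun_pd \<phi>)
  have sq: "sqint (\<lambda>x. if x \<in> U then div_Div \<Phi> x else 0)" "sqint (\<lambda>x. if x \<in> U then \<Phi> x else 0)"
    by (intro L2_of_sqint smooth_continuous smooth_div_Div(1) smooth_sym_continuous \<Phi> U)+
  have "z \<bullet> L2_of U (div_Div \<Phi>) = (\<integral>x. rep_l2 z x * (if x \<in> U then div_Div \<Phi> x else 0))"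
    unfolding L2_of_def using l2_inner_real[OF sqint_rep[of z] sq(1)] by simp
  also have "\<dots> = (\<integral>x. 2 * (rep_l2 z x * pd i (pd j \<phi>) x))"
  proof (rule integral_cong_AE)
    show "AE x in lebesgue. rep_l2 z x * (if x \<in> U then div_Div \<Phi> x else 0) = 2 * (rep_l2 z x * pd i (pd j \<phi>) x)"
      using z0 by eventually_elim (simp add: dd)
  qed (intro borel_measurable_times borel_measurable_const rep_measurable sqint_measurable[OF sq(1)] test_fun_measurable[OF p\<phi>])+
  finally have 1: "z \<bullet> L2_of U (div_Div \<Phi>) = 2 * (\<integral>x. rep_l2 z x * pd i (pd j \<phi>) x)" by simp
  have sZ: "sqint (\<lambda>x. rep_l2 Z x $ i $ j)" by (rule sqint_entry[OF sqint_rep])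
  have "Z \<bullet> L2_of U \<Phi> = (\<integral>x. rep_l2 Z x \<bullet> (if x \<in> U then \<Phi> x else 0))"
    unfolding L2_of_def using abs_l2_inner[OF sqint_rep[of Z] sq(2)] by simp
  also have "\<dots> = (\<integral>x. 2 * (rep_l2 Z x $ i $ j * \<phi> x))"
  proof (rule integral_cong_AE)
    show "AE x in lebesgue. rep_l2 Z x \<bullet> (if x \<in> U then \<Phi> x else 0) = 2 * (rep_l2 Z x $ i $ j * \<phi> x)"
      using Z0
    proof eventually_elim
      case (elim x)
      have "rep_l2 Z x $ j $ i = transpose (rep_l2 Z x) $ i $ j" by (simp add: transpose_def)
      then have s: "rep_l2 Z x $ j $ i = rep_l2 Z x $ i $ j" using elim(2) by simp
      have "rep_l2 Z x \<bullet> \<Phi> x = (\<Sum>a\<in>UNIV. \<Sum>b\<in>UNIV. (rep_l2 Z x $ a $ b * \<phi> x) * c a b)"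
        by (simp add: inner_matrix \<Phi>_def mult_ac)
      also have "\<dots> = rep_l2 Z x $ i $ j * \<phi> x + rep_l2 Z x $ j $ i * \<phi> x"
        unfolding c_def by (rule sum_delta2)
      finally have "rep_l2 Z x \<bullet> \<Phi> x = 2 * (rep_l2 Z x $ i $ j * \<phi> x)" by (simp add: s)
      then show ?case using elim(1) by (cases "x \<in> U") simp_all
    qed
    show "(\<lambda>x. rep_l2 Z x \<bullet> (if x \<in> U then \<Phi> x else 0)) \<in> borel_measurable lebesgue"
      by (rule borel_measurable_integrable[OF sqint_inner[OF sqint_rep sq(2)]])
  qed (intro borel_measurable_times borel_measurable_const sqint_measurable[OF sZ] test_fun_measurable[OF \<phi>])
  finally have 2: "Z \<bullet> L2_of U \<Phi> = 2 * (\<integral>x. rep_l2 Z x $ i $ j * \<phi> x)" by simp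
  show ?thesis using orth[OF \<Phi>] unfolding 1 2 by simp
qed

lemma abs_l2_axis_sum:
  fixes f :: "'n::finite \<Rightarrow> real^'n \<Rightarrow> real"
  assumes "\<And>i. sqint (f i)"
  shows "sqint (\<lambda>x. \<chi> i. f i x)" "abs_l2 (\<lambda>x. \<chi> i. f i x) = (\<Sum>i\<in>UNIV. pop (\<lambda>x. axis i) (abs_l2 (f i)))"
proof -
  have s: "sqint (\<lambda>x. axis i (f i x))" for i by (rule sqint_bounded_linear[OF bounded_linear_axis assms])
  have "sqint (\<lambda>x. \<Sum>i\<in>J. axis i (f i x)) \<and> abs_l2 (\<lambda>x. \<Sum>i\<in>J. axis i (f i x)) = (\<Sum>i\<in>J. pop (\<lambda>x. axis i) (abs_l2 (f i)))"
    if "finite J" for J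
    using that
  proof (induction J rule: finite_induct)
    case (insert i J)
    have "sqint (\<lambda>x. axis i (f i x) + (\<Sum>i\<in>J. axis i (f i x)))"
      using insert.IH by (intro sqint_add s) simp
    moreover have "abs_l2 (\<lambda>x. axis i (f i x) + (\<Sum>i\<in>J. axis i (f i x))) = pop (\<lambda>x. axis i) (abs_l2 (f i)) + (\<Sum>i\<in>J. pop (\<lambda>x. axis i) (abs_l2 (f i)))"
      using insert.IH by (simp add: abs_l2_add[OF s, symmetric] pop_const_abs[OF bounded_linear_axis assms])
    ultimately show ?case using insert.hyps by simp
  qed (simp add: sqint_zero abs_l2_zero)
  from this[OF finite, of UNIV]
  have "sqint (\<lambda>x. \<Sum>i\<in>UNIV. axis i (f i x)) \<and> abs_l2 (\<lambda>x. \<Sum>i\<in>UNIV. axis i (f i x)) = (\<Sum>i\<in>UNIV. pop (\<lambda>x. axis i) (abs_l2 (f i)))" .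
  moreover have "(\<lambda>x. \<Sum>i\<in>UNIV. axis i (f i x)) = (\<lambda>x. \<chi> i. f i x)"
    by (simp add: fun_eq_iff vec_eq_iff axis_def if_distrib cong: if_cong)
  ultimately show "sqint (\<lambda>x. \<chi> i. f i x)" "abs_l2 (\<lambda>x. \<chi> i. f i x) = (\<Sum>i\<in>UNIV. pop (\<lambda>x. axis i) (abs_l2 (f i)))"
    by simp_all
qed

text \<open>Integration by parts moves one derivative, then Cauchy-Schwarz. Convergence of values
  and of second derivatives thus implies that of the gradients.\<close>

lemma gradient_interpolation:
  assumes "\<psi> \<in> test_fun U"
  shows "(norm (abs_l2 (pd i \<psi>)))\<^sup>2 \<le> norm (abs_l2 \<psi>) * norm (abs_l2 (pd i (pd i \<psi>)))"
proof -
  note t = assms test_fun_pd[OF assms] test_fun_pd[OF test_fun_pd[OF assms]]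
  have "(norm (abs_l2 (pd i \<psi>)))\<^sup>2 = (\<integral>x. pd i \<psi> x * pd i \<psi> x)"
    using norm_abs_l2[OF test_fun_sqint[OF t(2)]] by (simp add: power2_eq_square)
  also have "\<dots> = - (\<integral>x. pd i (pd i \<psi>) x * \<psi> x)"
    by (rule test_fun_integral_by_parts[OF test_fun_mono[OF assms subset_UNIV] _ open_UNIV])
      (use test_fun_smooth[OF t(2)] in \<open>simp add: smooth_on_UNIV\<close>)
  also have "\<dots> \<le> norm (abs_l2 (pd i (pd i \<psi>))) * norm (abs_l2 \<psi>)"
    using abs_l2_mult_norm_le[OF test_fun_sqint[OF t(3)[of i i]] test_fun_sqint[OF t(1)]] by linarith
  finally show ?thesis by (simp add: mult.commute)
qed

lemma Cauchy_interpolation: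
  fixes a :: "nat \<Rightarrow> 'a::real_normed_vector" and b :: "nat \<Rightarrow> 'b::real_normed_vector" and c :: "nat \<Rightarrow> 'c::real_normed_vector"
  assumes "Cauchy a" "Cauchy b" "\<And>k l. (norm (c k - c l))\<^sup>2 \<le> norm (a k - a l) * norm (b k - b l)"
  shows "Cauchy c"
proof (rule CauchyI)
  fix e :: real assume e: "0 < e"
  obtain M where M: "\<And>m n. m \<ge> M \<Longrightarrow> n \<ge> M \<Longrightarrow> norm (a m - a n) < e" using CauchyD[OF assms(1) e] by blast
  obtain N where N: "\<And>m n. m \<ge> N \<Longrightarrow> n \<ge> N \<Longrightarrow> norm (b m - b n) < e" using CauchyD[OF assms(2) e] by blast
  have "norm (c m - c n) < e" if "m \<ge> max M N" "n \<ge> max M N" for m n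
  proof -
    have "norm (a m - a n) * norm (b m - b n) < e * e"
      using M[of m n] N[of m n] that e by (intro mult_strict_mono') auto
    then have "(norm (c m - c n))\<^sup>2 < e\<^sup>2" using assms(3)[of m n] by (simp add: power2_eq_square)
    then show ?thesis using e by (simp add: power_less_imp_less_base)
  qed
  then show "\<exists>M. \<forall>m\<ge>M. \<forall>n\<ge>M. norm (c m - c n) < e" by blast
qed

lemma conv_second_weak:
  fixes f g :: "real^'n \<Rightarrow> real"
  assumes w: "\<And>\<phi>. \<phi> \<in> test_fun UNIV \<Longrightarrow> (\<integral>x. f x * pd i (pd j \<phi>) x) = (\<integral>x. g x * \<phi> x)"
    and \<rho>: "\<rho> \<in> test_fun UNIV"
  shows "conv f (pd i (pd j \<rho>)) = conv g \<rho>"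
proof
  fix z :: "real^'n"
  have r: "pd k (\<lambda>y. \<psi> (z - y)) y = - pd k \<psi> (z - y)" if "\<psi> \<in> test_fun UNIV" for \<psi> k y
    using pd_affine(1)[of \<psi> z "-1" y k] smooth_differentiable[OF test_fun_smooth[OF that]] by simp
  have "pd i (pd j (\<lambda>y. \<rho> (z - y))) y = pd i (pd j \<rho>) (z - y)" for y
  proof -
    have "pd j (\<lambda>y. \<rho> (z - y)) = (\<lambda>y. (-1) * pd j \<rho> (z - y))" using r[OF \<rho>, of j] by (simp add: fun_eq_iff)
    then have "pd i (pd j (\<lambda>y. \<rho> (z - y))) y = pd i (\<lambda>y. (-1) * pd j \<rho> (z - y)) y" by simp
    also have "\<dots> = (-1) * pd i (\<lambda>y. pd j \<rho> (z - y)) y"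
      by (rule pd_cmult[OF smooth_differentiable[OF test_fun_smooth[OF test_fun_reflect[OF test_fun_pd[OF \<rho>]]]]])
    finally show ?thesis using r[OF test_fun_pd[OF \<rho>]] by simp
  qed
  then show "conv f (pd i (pd j \<rho>)) z = conv g \<rho> z"
    using w[OF test_fun_reflect[OF \<rho>, of z]] by (simp add: conv_def)
qed

text \<open>If \<open>y\<close> in \<open>U\<close> contributes to the convolution at
  \<open>x\<close>, then \<open>x\<close> is the convex combination of \<open>y\<close> with weight
  1/l and of a point \<open>c\<close> of \<open>cball x0 r\<close> with weight 1 - 1/l; the
  mollification radius \<open>r * (l - 1)\<close> is chosen for exactly this. Those combinations
  form the compact set \<open>K\<close>, and they stay inside the open convex set because
  \<open>c\<close> is an interior point.\<close>

lemma dilated_mollification_test_fun: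
  fixes U :: "(real^'n) set"
  assumes U: "open U" "bounded U" "convex U" and r: "cball x0 r \<subseteq> U" "0 < r" and l: "1 < l"
    and f: "sqint f" "\<And>x. x \<notin> U \<Longrightarrow> f x = 0" and \<rho>: "mollifier (r * (l - 1)) \<rho>"
  shows "(\<lambda>x. conv f \<rho> (dilate x0 l x)) \<in> test_fun U"
proof -
  define K where "K = (\<lambda>(y, c). (1 / l) *\<^sub>R y + (1 - 1 / l) *\<^sub>R c) ` (closure U \<times> cball x0 r)"
  have t: "\<rho> \<in> test_fun UNIV" and far: "\<And>x. norm x > r * (l - 1) \<Longrightarrow> \<rho> x = 0"
    using \<rho> by (auto simp: mollifier_def)
  show ?thesis
  proof (rule test_funI[of _ K])
    show "smooth (\<lambda>x. conv f \<rho> (dilate x0 l x))"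
      unfolding dilate_def by (rule smooth_on_affine[OF smooth_conv[OF f(1) t]])
    show "compact K"
      unfolding K_def by (rule compact_continuous_image)
        (auto simp: case_prod_unfold U(2) intro!: continuous_intros compact_Times)
    show "K \<subseteq> U"
    proof
      fix x assume "x \<in> K"
      then obtain y c where yc: "y \<in> closure U" "c \<in> cball x0 r" "x = (1 / l) *\<^sub>R y + (1 - 1 / l) *\<^sub>R c"
        by (auto simp: K_def)
      have "c \<in> interior U" using yc(2) r(1) U(1) by (auto simp: interior_open)
      then have "y - (1 - 1 / l) *\<^sub>R (y - c) \<in> interior U"
        by (rule mem_interior_closure_convex_shrink[OF U(3) _ yc(1)]) (use l in auto)
      moreover have "y - (1 - 1 / l) *\<^sub>R (y - c) = x" by (simp add: yc(3) algebra_simps)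
      ultimately show "x \<in> U" using interior_subset by auto
    qed
    fix x assume x: "x \<notin> K"
    have "f y * \<rho> (dilate x0 l x - y) = 0" for y
    proof (cases "y \<in> U \<and> norm (dilate x0 l x - y) \<le> r * (l - 1)")
      case True
      define c where "c = x0 + (1 / (l - 1)) *\<^sub>R (dilate x0 l x - y)"
      have "norm (c - x0) = norm (dilate x0 l x - y) / (l - 1)" using l by (simp add: c_def)
      also have "\<dots> \<le> r" using True l by (simp add: pos_divide_le_eq)
      finally have "c \<in> cball x0 r" by (simp add: dist_norm norm_minus_commute)
      moreover have "x = (1 / l) *\<^sub>R y + (1 - 1 / l) *\<^sub>R c"
      proof -
        have "(1 - 1 / l) *\<^sub>R c = (1 - 1 / l) *\<^sub>R x0 + ((1 - 1 / l) * (1 / (l - 1))) *\<^sub>R (dilate x0 l x - y)"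
          by (simp add: c_def scaleR_add_right)
        also have "(1 - 1 / l) * (1 / (l - 1)) = 1 / l" using l by (simp add: field_simps)
        finally have "(1 / l) *\<^sub>R y + (1 - 1 / l) *\<^sub>R c = (1 - 1 / l) *\<^sub>R x0 + (1 / l) *\<^sub>R dilate x0 l x"
          by (simp add: scaleR_diff_right)
        also have "(1 / l) *\<^sub>R dilate x0 l x = (1 / l - 1) *\<^sub>R x0 + x"
          using l by (simp add: dilate_def scaleR_add_right diff_divide_distrib)
        finally show ?thesis by (simp add: scaleR_diff_left)
      qed
      ultimately have "x \<in> K" unfolding K_def using True closure_subset by (force intro!: image_eqI[of _ _ "(y, c)"])
      then show ?thesis using x by blast
    qed (use f(2) far in force)
    then show "conv f \<rho> (dilate x0 l x) = 0" unfolding conv_def by (simp only: integral_zero)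
  qed
qed

text \<open>A dilation about an interior point moves the support of the zero extension into the domain, so that
  mollification produces test functions. They converge together with their Hessians, and by interpolation
  with their gradients.\<close>

theorem orthogonal_complement_in_X_space:
  fixes U :: "(real^'n) set"
  assumes U: "open U" "bounded U" "U \<in> sets lebesgue" "convex U" "U \<noteq> {}"
    and z: "z \<in> L2 U" and Z: "Z \<in> L2sym U"
    and orth: "\<And>\<Phi>. \<Phi> \<in> smooth_sym \<Longrightarrow> z \<bullet> L2_of U (div_Div \<Phi>) + Z \<bullet> L2_of U \<Phi> = 0"
  shows "z \<in> X_space U" "weak_hess U z = - Z"
proof -
  \<comment> \<open>A representative that vanishes at every point outside \<open>U\<close>, as the
    support argument for the mollifications demands.\<close>
  define f where "f x = (if x \<in> U then rep_l2 z x else 0)" for x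
  define h where "h i j x = - rep_l2 Z x $ i $ j" for i j x
  have z0: "AE x in lebesgue. x \<notin> U \<longrightarrow> rep_l2 z x = 0" using z by (simp add: L2_def)
  then have fz: "AE x in lebesgue. f x = rep_l2 z x" by eventually_elim (simp add: f_def)
  have fm: "f \<in> borel_measurable lebesgue"
    unfolding f_def using U(3) by (intro measurable_If_set) auto
  have f: "sqint f"
    by (rule sqint_bound[OF sqint_rep[of z] fm, of 1]) (auto simp: f_def)
  have absf: "abs_l2 f = z" using fz abs_l2_eq_iff[OF f sqint_rep[of z]] by simp
  have hsq: "sqint (h i j)" for i j unfolding h_def by (rule sqint_uminus[OF sqint_entry[OF sqint_rep]])
  have fh: "(\<integral>x. f x * pd i (pd j \<phi>) x) = (\<integral>x. h i j x * \<phi> x)" if "\<phi> \<in> test_fun UNIV" for \<phi> i j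
  proof -
    have "(\<integral>x. f x * pd i (pd j \<phi>) x) = (\<integral>x. rep_l2 z x * pd i (pd j \<phi>) x)"
      by (rule AE_eq_integral_cong_mult[OF fz fm rep_measurable test_fun_measurable[OF test_fun_pd[OF test_fun_pd[OF that]]]])
    then show ?thesis
      unfolding h_def using weak_hess_from_orthogonality[OF U(1,2,3) z Z orth that] by simp
  qed
  obtain x0 where "x0 \<in> U" using U(5) by blast
  then obtain r0 where x0: "0 < r0" "cball x0 r0 \<subseteq> U" using U(1) unfolding open_contains_cball by blast
  \<comment> \<open>The cap at 1 keeps the mollification radii
    \<open>r * (l k - 1) = r * s k\<close> below 1, within the range of
    \<open>mollify_tendsto\<close>.\<close>
  define r where "r = min r0 1"
  have r: "0 < r" "r \<le> 1" "cball x0 r \<subseteq> U" using x0 by (auto simp: r_def)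
  define s where "s k = 1 / real (Suc k)" for k
  have s: "0 < s k" "s k \<le> 1" for k by (simp_all add: s_def)
  have s0: "s \<longlonglongrightarrow> 0" unfolding s_def by (rule LIMSEQ_Suc[OF lim_1_over_n])
  define l where "l k = 1 + s k" for k
  have l: "1 < l k" for k using s by (simp add: l_def)
  have l1: "l \<longlonglongrightarrow> 1" unfolding l_def using tendsto_add[OF tendsto_const s0, of 1] by simp
  have "\<exists>\<rho>. mollifier (r * (l k - 1)) (\<rho> :: real^'n \<Rightarrow> real)" for k
    by (rule mollifier_exists) (use r s in \<open>simp add: l_def\<close>)
  then obtain \<rho> :: "nat \<Rightarrow> real^'n \<Rightarrow> real" where \<rho>: "\<And>k. mollifier (r * (l k - 1)) (\<rho> k)" by metis
  have t: "\<rho> k \<in> test_fun UNIV" for k using \<rho> by (simp add: mollifier_def)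
  have moll: "(\<lambda>k. abs_l2 (\<lambda>x. conv g (\<rho> k) (dilate x0 (l k) x))) \<longlonglongrightarrow> abs_l2 g" if "sqint g" for g
  proof (rule mollify_tendsto[OF that \<rho> _ _ _ less_imp_le[OF l] l1])
    show "0 \<le> r * (l k - 1)" "r * (l k - 1) \<le> 1" for k
      using r s[of k] by (simp_all add: l_def mult_le_one)
    show "(\<lambda>k. r * (l k - 1)) \<longlonglongrightarrow> 0"
      unfolding l_def using tendsto_mult_right_zero[OF s0, of r] by simp
  qed
  define \<phi> where "\<phi> k x = conv f (\<rho> k) (dilate x0 (l k) x)" for k x
  have \<phi>: "\<phi> k \<in> test_fun U" for k
    unfolding \<phi>_def by (rule dilated_mollification_test_fun[OF U(1,2,4) r(3,1) l f _ \<rho>]) (simp add: f_def)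
  have pd_dil: "pd i (\<lambda>x. c * conv g \<psi> (dilate x0 (l k) x)) = (\<lambda>x. (c * l k) * conv g (pd i \<psi>) (dilate x0 (l k) x))"
    if "sqint g" "\<psi> \<in> test_fun UNIV" for i k g \<psi> c
  proof
    fix x
    have d: "conv g \<psi> differentiable at y" for y by (rule smooth_differentiable[OF smooth_conv[OF that]])
    show "pd i (\<lambda>x. c * conv g \<psi> (dilate x0 (l k) x)) x = (c * l k) * conv g (pd i \<psi>) (dilate x0 (l k) x)"
      unfolding dilate_def pd_cmult[OF pd_affine(2)[OF d]] pd_affine(1)[OF d] pd_conv[OF that] by simp
  qed
  \<comment> \<open>Each derivative brings out a factor \<open>l k\<close> from the dilation. The
    weak Hessian on the whole space then turns second derivatives of the mollification into
    mollifications of \<open>h i j\<close>, valid also where the kernel reaches across the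
    boundary.\<close>
  have \<phi>2: "pd i (pd j (\<phi> k)) = (\<lambda>x. (l k)\<^sup>2 *\<^sub>R conv (h i j) (\<rho> k) (dilate x0 (l k) x))" for i j k
  proof -
    have "pd j (\<phi> k) = (\<lambda>x. l k * conv f (pd j (\<rho> k)) (dilate x0 (l k) x))"
      using pd_dil[OF f t[of k], where i=j and c=1 and k=k] by (simp add: \<phi>_def[abs_def])
    then have "pd i (pd j (\<phi> k)) = (\<lambda>x. (l k * l k) * conv f (pd i (pd j (\<rho> k))) (dilate x0 (l k) x))"
      using pd_dil[OF f test_fun_pd[OF t[of k]], where i=i and c="l k" and k=k] by simp
    moreover have "conv f (pd i (pd j (\<rho> k))) = conv (h i j) (\<rho> k)" by (rule conv_second_weak[OF fh t])
    ultimately show ?thesis by (simp add: power2_eq_square)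
  qed
  have lim0: "(\<lambda>k. abs_l2 (\<phi> k)) \<longlonglongrightarrow> z" using moll[OF f] by (simp add: \<phi>_def[abs_def] absf)
  have lim2: "(\<lambda>k. abs_l2 (pd i (pd j (\<phi> k)))) \<longlonglongrightarrow> abs_l2 (h i j)" for i j
  proof -
    have sq: "sqint (\<lambda>x. conv (h i j) (\<rho> k) (dilate x0 (l k) x))" for k
      unfolding dilate_def by (rule conv_affine_sqint(1)[OF hsq \<rho> less_imp_le[OF l]])
    have "(\<lambda>k. (l k)\<^sup>2 *\<^sub>R abs_l2 (\<lambda>x. conv (h i j) (\<rho> k) (dilate x0 (l k) x))) \<longlonglongrightarrow> 1\<^sup>2 *\<^sub>R abs_l2 (h i j)"
      by (intro tendsto_intros l1 moll hsq)
    then show ?thesis by (simp only: \<phi>2 abs_l2_scaleR[OF sq]) simp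
  qed
  have diff: "pd i (\<lambda>x. \<phi> k x + (-1) * \<phi> m x) = (\<lambda>x. pd i (\<phi> k) x + (-1) * pd i (\<phi> m) x)"
    "pd i (\<lambda>x. pd j (\<phi> k) x + (-1) * pd j (\<phi> m) x) = (\<lambda>x. pd i (pd j (\<phi> k)) x + (-1) * pd i (pd j (\<phi> m)) x)" for i j k m
  proof -
    have lin: "pd i (\<lambda>x. p x + (-1) * q x) = (\<lambda>x. pd i p x + (-1) * pd i q x)" if "p \<in> test_fun U" "q \<in> test_fun U" for p q
    proof
      fix x
      have d: "p differentiable at x" "q differentiable at x" "(\<lambda>x. (-1) * q x) differentiable at x"
        by (rule smooth_differentiable[OF test_fun_smooth[OF that(1)]] smooth_differentiable[OF test_fun_smooth[OF that(2)]]
          smooth_differentiable[OF test_fun_smooth[OF test_fun_cmult[OF that(2)]]])+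
      show "pd i (\<lambda>x. p x + (-1) * q x) x = pd i p x + (-1) * pd i q x"
        unfolding pd_add[OF d(1,3)] pd_cmult[OF d(2)] ..
    qed
    show "pd i (\<lambda>x. \<phi> k x + (-1) * \<phi> m x) = (\<lambda>x. pd i (\<phi> k) x + (-1) * pd i (\<phi> m) x)" by (rule lin[OF \<phi> \<phi>])
    show "pd i (\<lambda>x. pd j (\<phi> k) x + (-1) * pd j (\<phi> m) x) = (\<lambda>x. pd i (pd j (\<phi> k)) x + (-1) * pd i (pd j (\<phi> m)) x)"
      by (rule lin[OF test_fun_pd[OF \<phi>] test_fun_pd[OF \<phi>]])
  qed
  have absd: "abs_l2 (\<lambda>x. p x + (-1) * q x) = abs_l2 p - abs_l2 q" if "p \<in> test_fun U" "q \<in> test_fun U" for p q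
    using abs_l2_diff[OF test_fun_sqint[OF that(1)] test_fun_sqint[OF that(2)]] by simp
  have conv1: "convergent (\<lambda>k. abs_l2 (pd i (\<phi> k)))" for i
  proof -
    have "Cauchy (\<lambda>k. abs_l2 (pd i (\<phi> k)))"
    proof (rule Cauchy_interpolation)
      show "Cauchy (\<lambda>k. abs_l2 (\<phi> k))" by (rule LIMSEQ_imp_Cauchy[OF lim0])
      show "Cauchy (\<lambda>k. abs_l2 (pd i (pd i (\<phi> k))))" by (rule LIMSEQ_imp_Cauchy[OF lim2])
      fix k m
      show "(norm (abs_l2 (pd i (\<phi> k)) - abs_l2 (pd i (\<phi> m))))\<^sup>2
        \<le> norm (abs_l2 (\<phi> k) - abs_l2 (\<phi> m)) * norm (abs_l2 (pd i (pd i (\<phi> k))) - abs_l2 (pd i (pd i (\<phi> m))))"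
        using gradient_interpolation[OF test_fun_add[OF \<phi>[of k] test_fun_cmult[OF \<phi>[of m], of "-1"]], of i]
        unfolding diff absd[OF \<phi> \<phi>] absd[OF test_fun_pd[OF \<phi>] test_fun_pd[OF \<phi>]] absd[OF test_fun_pd[OF test_fun_pd[OF \<phi>]] test_fun_pd[OF test_fun_pd[OF \<phi>]]] .
    qed
    then show ?thesis by (simp add: Cauchy_convergent_iff)
  qed
  then obtain g where g: "\<And>i. (\<lambda>k. abs_l2 (pd i (\<phi> k))) \<longlonglongrightarrow> g i" unfolding convergent_def by metis
  have gL: "g i \<in> L2 U" for i
  proof (rule closed_sequentially[OF L2_closed_subspace(1)[OF U(3)] _ g])
    show "abs_l2 (pd i (\<phi> k)) \<in> L2 U" for k
      using L2_of_in_L2[OF test_fun_continuous[OF test_fun_pd[OF \<phi>]] U(2,3)] by (simp add: L2_of_test_fun[OF test_fun_pd[OF \<phi>]])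
  qed
  define G where "G = abs_l2 (\<lambda>x. \<chi> i. rep_l2 (g i) x)"
  have G_AE: "AE x in lebesgue. rep_l2 G x = (\<chi> i. rep_l2 (g i) x)"
    unfolding G_def by (rule rep_abs_AE[OF abs_l2_axis_sum(1)[OF sqint_rep]])
  have "AE x in lebesgue. \<forall>i\<in>UNIV. x \<notin> U \<longrightarrow> rep_l2 (g i) x = 0"
    by (intro AE_finite_allI finite) (use gL in \<open>simp add: L2_def\<close>)
  with G_AE have GL: "G \<in> L2 U"
    unfolding L2_def mem_Collect_eq by eventually_elim (simp add: vec_eq_iff)
  have wg: "is_weak_grad U z G"
    unfolding is_weak_grad_iff wpd_def
  proof (intro conjI GL allI ballI)
    fix i \<psi> assume \<psi>: "\<psi> \<in> test_fun U"
    note s\<psi> = test_fun_sqint[OF \<psi>] test_fun_sqint[OF test_fun_pd[OF \<psi>]]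
    have eq: "abs_l2 (pd i \<psi>) \<bullet> abs_l2 (\<phi> k) = - (abs_l2 \<psi> \<bullet> abs_l2 (pd i (\<phi> k)))" for k
    proof -
      have "(\<integral>x. \<phi> k x * pd i \<psi> x) = - (\<integral>x. pd i (\<phi> k) x * \<psi> x)"
        by (rule test_fun_integral_by_parts[OF test_fun_mono[OF \<psi> subset_UNIV] _ open_UNIV])
          (use test_fun_smooth[OF \<phi>] in \<open>simp add: smooth_on_UNIV\<close>)
      then show ?thesis
        by (simp add: l2_inner_real s\<psi> test_fun_sqint[OF \<phi>] test_fun_sqint[OF test_fun_pd[OF \<phi>]] mult.commute)
    qed
    have "(\<lambda>k. abs_l2 (pd i \<psi>) \<bullet> abs_l2 (\<phi> k)) \<longlonglongrightarrow> abs_l2 (pd i \<psi>) \<bullet> z" by (intro tendsto_intros lim0)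
    moreover have "(\<lambda>k. - (abs_l2 \<psi> \<bullet> abs_l2 (pd i (\<phi> k)))) \<longlonglongrightarrow> - (abs_l2 \<psi> \<bullet> g i)" by (intro tendsto_intros g)
    ultimately have "abs_l2 (pd i \<psi>) \<bullet> z = - (abs_l2 \<psi> \<bullet> g i)" unfolding eq using LIMSEQ_unique by blast
    then have "(\<integral>x. rep_l2 z x * pd i \<psi> x) = - (\<integral>x. rep_l2 (g i) x * \<psi> x)"
      using l2_inner_real[OF s\<psi>(2) sqint_rep[of z]] l2_inner_real[OF s\<psi>(1) sqint_rep[of "g i"]]
      by (simp add: mult.commute)
    also have "(\<integral>x. rep_l2 (g i) x * \<psi> x) = (\<integral>x. rep_l2 G x $ i * \<psi> x)"
    proof (rule AE_eq_integral_cong_mult)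
      show "AE x in lebesgue. rep_l2 (g i) x = rep_l2 G x $ i" using G_AE by eventually_elim simp
    qed (intro rep_measurable sqint_measurable[OF sqint_vec_nth[OF sqint_rep]] test_fun_measurable[OF \<psi>])+
    finally show "(\<integral>x. rep_l2 z x * pd i \<psi> x) = - (\<integral>x. rep_l2 G x $ i * \<psi> x)" .
  qed
  have mZ: "- Z \<in> L2 U" by (rule subspace_neg[OF L2_closed_subspace(2)[OF U(3)]]) (use Z in \<open>simp add: L2sym_def\<close>)
  have mZ_AE: "AE x in lebesgue. rep_l2 (- Z) x = - rep_l2 Z x"
    using rep_scaleR_AE[of "-1" Z] by simp
  have wh: "is_weak_hess U z (- Z)"
    unfolding is_weak_hess_iff
  proof (intro conjI mZ ballI allI)
    fix \<psi> i j assume \<psi>: "\<psi> \<in> test_fun U"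
    have "(\<integral>x. rep_l2 z x * pd i (pd j \<psi>) x) = (\<integral>x. - rep_l2 Z x $ i $ j * \<psi> x)"
      by (rule weak_hess_from_orthogonality[OF U(1,2,3) z Z orth test_fun_mono[OF \<psi> subset_UNIV]])
    also have "\<dots> = (\<integral>x. rep_l2 (- Z) x $ i $ j * \<psi> x)"
    proof (rule AE_eq_integral_cong_mult)
      show "AE x in lebesgue. - rep_l2 Z x $ i $ j = rep_l2 (- Z) x $ i $ j" using mZ_AE by eventually_elim simp
      show "(\<lambda>x. - rep_l2 Z x $ i $ j) \<in> borel_measurable lebesgue" using sqint_measurable[OF hsq[of i j]] by (simp add: h_def[abs_def])
    qed (intro sqint_measurable[OF sqint_entry[OF sqint_rep]] test_fun_measurable[OF \<psi>])+
    finally show "(\<integral>x. rep_l2 z x * pd i (pd j \<psi>) x) = (\<integral>x. rep_l2 (- Z) x $ i $ j * \<psi> x)" .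
  qed
  show "weak_hess U z = - Z" by (rule weak_hess_eq[OF U(1) wh])
  have gradlim: "(\<lambda>k. L2_of U (grad (\<phi> k))) \<longlonglongrightarrow> G"
  proof -
    have "L2_of U (grad (\<phi> k)) = (\<Sum>i\<in>UNIV. pop (\<lambda>x. axis i) (abs_l2 (pd i (\<phi> k))))" for k
      using abs_l2_axis_sum(2)[of "\<lambda>i. pd i (\<phi> k)", OF test_fun_sqint[OF test_fun_pd[OF \<phi>]]]
        L2_of_grad_sqint(1)[OF \<phi>[of k]] by (simp add: grad_def[abs_def])
    moreover have "G = (\<Sum>i\<in>UNIV. pop (\<lambda>x. axis i) (g i))"
      unfolding G_def using abs_l2_axis_sum(2)[of "\<lambda>i. rep_l2 (g i)"] by simp
    ultimately show ?thesis
      by (simp only:) (intro tendsto_sum bounded_linear.tendsto[OF bounded_linear_pop_const[OF bounded_linear_axis]] g)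
  qed
  have "z \<in> H2 U" using z wg wh unfolding H2_def by blast
  moreover have "z \<in> H10 U"
    unfolding H10_def mem_Collect_eq weak_grad_eq[OF U(1) wg]
    using z wg \<phi> lim0 gradlim by (intro conjI exI[of _ G] exI[of _ \<phi>]) (simp_all add: L2_of_test_fun[OF \<phi>])
  ultimately show "z \<in> X_space U" by (simp add: X_space_def)
qed

section \<open>The broken space\<close>

text \<open>Near each of its points the frontier lies on the graph of the Lipschitz function: above
  the graph are points of the open set \<open>T\<close>, and points strictly below it have a
  neighbourhood disjoint from \<open>T\<close>. That graph is the Lipschitz image of a hyperplane,
  hence null. It yields that a Lipschitz partition covers the domain up to a null set.\<close>

lemma negligible_lipschitz_frontier:
  fixes T :: "(real^'n) set"
  assumes "lipschitz_domain T"
  shows "negligible (frontier T)"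
proof (subst locally_negligible_alt, rule ballI)
  have T: "open T" using assms by (simp add: lipschitz_domain_def)
  fix p assume p: "p \<in> frontier T"
  then obtain r e L \<gamma> where r: "0 < r" and e: "norm e = 1" and \<gamma>: "L-lipschitz_on {y. y \<bullet> e = 0} \<gamma>"
    and eq: "T \<inter> ball p r = {x \<in> ball p r. \<gamma> (x - (x \<bullet> e) *\<^sub>R e) < x \<bullet> e}"
    using assms unfolding lipschitz_domain_def by blast
  have ee: "e \<bullet> e = 1" using e by (simp add: norm_eq_1)
  define P where "P x = x - (x \<bullet> e) *\<^sub>R e" for x
  have eq': "x \<in> T \<longleftrightarrow> \<gamma> (P x) < x \<bullet> e" if "x \<in> ball p r" for x
    using that eq unfolding P_def by blast
  have Pe: "P x \<bullet> e = 0" for x by (simp add: P_def inner_diff_left ee)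
  have "continuous_on UNIV P" unfolding P_def[abs_def] by (intro continuous_intros)
  then have cont: "continuous_on UNIV (\<lambda>x. \<gamma> (P x))"
    by (rule continuous_on_compose2[OF lipschitz_on_continuous_on[OF \<gamma>]]) (use Pe in auto)
  have op: "open {x. x \<bullet> e < \<gamma> (P x)}"
    by (rule open_Collect_less) (auto intro!: cont continuous_intros)
  have "frontier T \<inter> ball p r \<subseteq> (\<lambda>y. y + \<gamma> y *\<^sub>R e) ` {y. e \<bullet> y = 0}"
  proof
    fix x assume x: "x \<in> frontier T \<inter> ball p r"
    then have "x \<notin> T" using T by (simp add: frontier_def interior_open)
    then have ge: "x \<bullet> e \<le> \<gamma> (P x)" using eq'[of x] x by (simp add: not_less)
    have "\<not> x \<bullet> e < \<gamma> (P x)"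
    proof
      assume lt: "x \<bullet> e < \<gamma> (P x)"
      have "open ({x. x \<bullet> e < \<gamma> (P x)} \<inter> ball p r)" using op by blast
      moreover have "x \<in> {x. x \<bullet> e < \<gamma> (P x)} \<inter> ball p r" using lt x by simp
      moreover have "x \<in> closure T" using x by (simp add: frontier_def)
      ultimately obtain y where "y \<in> ball p r" "y \<bullet> e < \<gamma> (P y)" "y \<in> T"
        using open_Int_closure_eq_empty[of "{x. x \<bullet> e < \<gamma> (P x)} \<inter> ball p r" T] by blast
      then show False using eq'[of y] by simp
    qed
    then have "x = P x + \<gamma> (P x) *\<^sub>R e" using ge by (simp add: P_def)
    then show "x \<in> (\<lambda>y. y + \<gamma> y *\<^sub>R e) ` {y. e \<bullet> y = 0}" using Pe by (auto simp: inner_commute)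
  qed
  moreover have "negligible ((\<lambda>y. y + \<gamma> y *\<^sub>R e) ` {y. e \<bullet> y = 0})"
  proof (rule negligible_locally_Lipschitz_image)
    show "negligible {y. e \<bullet> y = 0}" using e by (intro negligible_hyperplane) auto
    fix x assume x: "x \<in> {y. e \<bullet> y = 0}"
    have "norm (y + \<gamma> y *\<^sub>R e - (x + \<gamma> x *\<^sub>R e)) \<le> (1 + L) * norm (y - x)" if "e \<bullet> y = 0" for y
    proof -
      have d: "y + \<gamma> y *\<^sub>R e - (x + \<gamma> x *\<^sub>R e) = (y - x) + (\<gamma> y - \<gamma> x) *\<^sub>R e" by (simp add: algebra_simps)
      have "norm (y + \<gamma> y *\<^sub>R e - (x + \<gamma> x *\<^sub>R e)) \<le> norm (y - x) + \<bar>\<gamma> y - \<gamma> x\<bar>"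
        unfolding d using norm_triangle_ineq[of "y - x" "(\<gamma> y - \<gamma> x) *\<^sub>R e"] e by simp
      moreover have "\<bar>\<gamma> y - \<gamma> x\<bar> \<le> L * norm (y - x)"
        using lipschitz_onD[OF \<gamma>, of y x] that x by (simp add: dist_norm dist_real_def inner_commute)
      ultimately show ?thesis by (simp add: algebra_simps)
    qed
    then show "\<exists>T B. open T \<and> x \<in> T \<and> (\<forall>y\<in>{y. e \<bullet> y = 0} \<inter> T. norm (y + \<gamma> y *\<^sub>R e - (x + \<gamma> x *\<^sub>R e)) \<le> B * norm (y - x))"
      by (intro exI[of _ UNIV] exI[of _ "1 + L"]) simp
  qed simp
  ultimately have "negligible (frontier T \<inter> ball p r)" by (rule negligible_subset[rotated])
  then show "\<exists>U. openin (top_of_set (frontier T)) U \<and> p \<in> U \<and> negligible U"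
    using p r by (intro exI[of _ "frontier T \<inter> ball p r"]) (simp add: openin_open_Int)
qed

text \<open>The Lipschitz geometry of the elements is condensed into \<open>null\<close>, by which
  integrals over the domain are sums over the elements.\<close>

locale mesh =
  fixes \<Omega> :: "(real^'n) set" and \<T> :: "(real^'n) set set"
  assumes \<Omega>: "open \<Omega>" "bounded \<Omega>"
    and finite: "finite \<T>" and disjoint: "disjoint \<T>"
    and element: "\<And>T. T \<in> \<T> \<Longrightarrow> open T" "\<And>T. T \<in> \<T> \<Longrightarrow> T \<subseteq> \<Omega>"
    and null: "\<Omega> - \<Union>\<T> \<in> null_sets lebesgue"
begin

abbreviation "HQ \<equiv> HdivDiv_mesh \<Omega> \<T>"
abbreviation "tnorm \<equiv> trace_norm \<Omega> \<T>"
abbreviation "unorm \<equiv> U_norm \<Omega> \<T>"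
abbreviation "UH \<equiv> U_hat \<Omega> \<T>"
abbreviation "UU \<equiv> U_space \<Omega> \<T>"
abbreviation "VV \<equiv> V_space \<Omega> \<T>"
abbreviation "vnorm \<equiv> V_norm \<T>"
abbreviation "vinner \<equiv> V_inner \<T>"
abbreviation "tr \<equiv> tr2 \<Omega> \<T>"

lemma \<Omega>_sets: "\<Omega> \<in> sets lebesgue" using \<Omega>(1) by auto

lemma element_sets: "T \<in> \<T> \<Longrightarrow> T \<in> sets lebesgue" using element(1) by auto

lemma element_bounded: "T \<in> \<T> \<Longrightarrow> bounded T" using element(2) \<Omega>(2) bounded_subset by blast

lemma restr_element: "S \<in> \<T> \<Longrightarrow> T \<in> \<T> \<Longrightarrow> restr S (restr T F) = (if S = T then restr S F else 0)"
  using disjointD[OF disjoint, of S T] by (simp add: restr_restr element_sets restr_empty)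

lemma restr_element_sum:
  assumes "S \<in> \<T>" "\<And>T. T \<in> \<T> \<Longrightarrow> F T \<in> L2 T"
  shows "restr S (\<Sum>T\<in>\<T>. F T) = F S"
proof -
  note l = bounded_linear.linear[OF bounded_linear_restr[OF element_sets[OF assms(1)]]]
  have "restr S (F T) = (if S = T then F S else 0)" if "T \<in> \<T>" for T
    using restr_element[OF assms(1) that, of "F T"] assms(2)[OF that] L2_iff_restr[OF element_sets[OF that]] by metis
  then have "restr S (\<Sum>T\<in>\<T>. F T) = (\<Sum>T\<in>\<T>. if S = T then F S else 0)"
    by (simp add: linear_sum[OF l])
  then show ?thesis using assms(1) finite by simp
qed

lemma L2_element: "T \<in> \<T> \<Longrightarrow> F \<in> L2 T \<Longrightarrow> F \<in> L2 \<Omega>"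
  using element(2) by (auto simp: L2_def elim!: eventually_mono)

lemma L2_sum: "(\<And>T. T \<in> \<T> \<Longrightarrow> F T \<in> L2 T) \<Longrightarrow> (\<Sum>T\<in>\<T>. F T) \<in> L2 \<Omega>"
  by (rule subspace_sum[OF L2_closed_subspace(2)[OF \<Omega>_sets]]) (rule L2_element)

text \<open>The difference of both sides vanishes outside the domain and on every element, and the
  remaining points form a null set.\<close>

lemma restr_sum:
  fixes F :: "(real^'n, 'b::euclidean_space) l2"
  assumes F: "F \<in> L2 \<Omega>" shows "(\<Sum>T\<in>\<T>. restr T F) = F"
proof -
  define D where "D = (\<Sum>T\<in>\<T>. restr T F) - F"
  have r: "restr T F \<in> L2 T" if "T \<in> \<T>" for T by (rule restr_in_L2[OF element_sets[OF that]])
  have "D \<in> L2 \<Omega>"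
    unfolding D_def by (rule subspace_diff[OF L2_closed_subspace(2)[OF \<Omega>_sets] L2_sum[OF r] F])
  then have out: "AE x in lebesgue. x \<notin> \<Omega> \<longrightarrow> rep_l2 D x = 0" by (simp add: L2_def)
  have "restr S D = 0" if S: "S \<in> \<T>" for S
    unfolding D_def linear_diff[OF bounded_linear.linear[OF bounded_linear_restr[OF element_sets[OF S]]]]
    using restr_element_sum[OF S r] by simp
  then have "AE x in lebesgue. x \<in> S \<longrightarrow> rep_l2 D x = 0" if S: "S \<in> \<T>" for S
    using restr_AE[OF element_sets[OF S], of D] rep_zero_AE[where 'a="real^'n" and 'b='b]
    unfolding \<open>\<And>S. S \<in> \<T> \<Longrightarrow> restr S D = 0\<close>[OF S] by eventually_elim simp
  then have "AE x in lebesgue. \<forall>S\<in>\<T>. x \<in> S \<longrightarrow> rep_l2 D x = 0" by (intro AE_finite_allI finite)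
  moreover have "AE x in lebesgue. x \<notin> \<Omega> - \<Union>\<T>" by (rule AE_not_in[OF null])
  ultimately have "AE x in lebesgue. rep_l2 D x = rep_l2 0 x"
    using out rep_zero_AE by eventually_elim auto
  then have "D = 0" by (simp add: l2_eq_iff)
  then show ?thesis by (simp add: D_def)
qed

lemma inner_sum_restr:
  assumes F: "F \<in> L2 \<Omega>" shows "(\<Sum>T\<in>\<T>. restr T F \<bullet> restr T G) = F \<bullet> G"
proof -
  have "restr T F \<bullet> restr T G = restr T F \<bullet> G" if "T \<in> \<T>" for T
    using restr_adjoint[OF element_sets[OF that], of "restr T F" G] restr_element[OF that that, of F] by simp
  then have "(\<Sum>T\<in>\<T>. restr T F \<bullet> restr T G) = (\<Sum>T\<in>\<T>. restr T F) \<bullet> G" by (simp add: inner_sum_left)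
  then show ?thesis by (simp add: restr_sum[OF F])
qed

text \<open>The graph of the broken iterated divergence inside a global product space. The
  elementwise conditions are preimages of closed subspaces under continuous restrictions, so it is
  again a closed subspace.\<close>

definition graph :: "('n mfun \<times> 'n sfun) set" where
  "graph = {(Q, q). Q \<in> L2sym \<Omega> \<and> q \<in> L2 \<Omega> \<and> (\<forall>T\<in>\<T>. (restr T Q, restr T q) \<in> divDiv_graph T)}"

definition dd :: "'n mfun \<Rightarrow> 'n sfun" where
  "dd Q = (\<Sum>T\<in>\<T>. divDiv T (restr T Q))"

lemma graph_closed_subspace: "closed graph" "subspace graph"
proof -
  define h :: "(real^'n) set \<Rightarrow> 'n mfun \<times> 'n sfun \<Rightarrow> 'n mfun \<times> 'n sfun" where "h T x = (restr T (fst x), restr T (snd x))" for T x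
  have bl: "bounded_linear (h T)" if "T \<in> \<T>" for T
    unfolding h_def[abs_def]
    by (intro bounded_linear_Pair bounded_linear_compose[OF bounded_linear_restr[OF element_sets[OF that]]]
        bounded_linear_fst bounded_linear_snd)
  have e: "graph = (L2sym \<Omega> \<times> L2 \<Omega>) \<inter> (\<Inter>T\<in>\<T>. h T -` divDiv_graph T)"
    by (auto simp: graph_def h_def)
  show "closed graph"
    unfolding e
    by (intro closed_Int closed_Times closed_INT ballI closed_vimage linear_continuous_on bl
        L2sym_closed_subspace(1) L2_closed_subspace(1) \<Omega>_sets divDiv_graph_closed_subspace(1) element(1) element_bounded)
  have v: "subspace (h T -` divDiv_graph T)" if "T \<in> \<T>" for T
    by (rule linear_subspace_vimage[OF bounded_linear.linear[OF bl[OF that]] divDiv_graph_closed_subspace(2)])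
      (use that in \<open>simp_all add: element(1) element_bounded\<close>)
  have "subspace (\<Inter>T\<in>\<T>. h T -` divDiv_graph T)" by (rule subspace_Inter) (use v in blast)
  then show "subspace graph"
    unfolding e by (intro subspace_inter subspace_Times L2sym_closed_subspace(2) L2_closed_subspace(2) \<Omega>_sets)
qed

lemma graph_D:
  assumes "(Q, q) \<in> graph"
  shows "T \<in> \<T> \<Longrightarrow> divDiv T (restr T Q) = restr T q" "dd Q = q" "Q \<in> HQ" "Q \<in> L2sym \<Omega>" "q \<in> L2 \<Omega>"
proof -
  have g: "Q \<in> L2sym \<Omega>" "q \<in> L2 \<Omega>" "\<And>T. T \<in> \<T> \<Longrightarrow> (restr T Q, restr T q) \<in> divDiv_graph T"
    using assms by (auto simp: graph_def)
  show e: "divDiv T (restr T Q) = restr T q" if "T \<in> \<T>" for T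
    by (rule divDiv_eq[OF element(1) element_bounded element_sets g(3)]) (use that in simp_all)
  show "dd Q = q" unfolding dd_def using restr_sum[OF g(2)] by (simp add: e)
  show "Q \<in> HQ"
    unfolding HdivDiv_mesh_def HdivDiv_def is_divDiv_iff using g by blast
qed (use assms in \<open>auto simp: graph_def\<close>)

lemma graph_dd:
  assumes Q: "Q \<in> HQ" shows "(Q, dd Q) \<in> graph"
proof -
  define q where "q T = divDiv T (restr T Q)" for T
  have g: "(restr T Q, q T) \<in> divDiv_graph T" if T: "T \<in> \<T>" for T
  proof -
    note e = element(1)[OF T] element_bounded[OF T] element_sets[OF T]
    obtain q' where q': "(restr T Q, q') \<in> divDiv_graph T"
      using Q T unfolding HdivDiv_mesh_def HdivDiv_def is_divDiv_iff by blast
    then show ?thesis using divDiv_eq[OF e q'] by (simp add: q_def)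
  qed
  have L: "q T \<in> L2 T" if T: "T \<in> \<T>" for T
    by (rule divDiv_graph_L2[OF element(1) element_bounded element_sets g]) (use T in simp_all)
  have "dd Q \<in> L2 \<Omega>" unfolding dd_def q_def[symmetric] by (rule L2_sum[OF L])
  moreover have "restr T (dd Q) = q T" if "T \<in> \<T>" for T
    unfolding dd_def q_def[symmetric] by (rule restr_element_sum[OF that L])
  ultimately show ?thesis using Q g by (simp add: graph_def HdivDiv_mesh_def)
qed

lemma dd_linear:
  "subspace HQ"
  "Q \<in> HQ \<Longrightarrow> R \<in> HQ \<Longrightarrow> dd (Q + R) = dd Q + dd R"
  "Q \<in> HQ \<Longrightarrow> dd (c *\<^sub>R Q) = c *\<^sub>R dd Q"
  "dd 0 = 0"
proof -
  have a: "(Q + R, dd Q + dd R) \<in> graph" if "Q \<in> HQ" "R \<in> HQ" for Q R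
    using subspace_add[OF graph_closed_subspace(2) graph_dd[OF that(1)] graph_dd[OF that(2)]] by simp
  have s: "(c *\<^sub>R Q, c *\<^sub>R dd Q) \<in> graph" if "Q \<in> HQ" for Q c
    using subspace_scale[OF graph_closed_subspace(2) graph_dd[OF that], of c] by simp
  have z: "(0, 0) \<in> graph" using subspace_0[OF graph_closed_subspace(2)] by (simp add: zero_prod_def)
  show "subspace HQ"
    by (rule subspaceI) (use graph_D(3)[OF z] graph_D(3)[OF a] graph_D(3)[OF s] in blast)+
  show "Q \<in> HQ \<Longrightarrow> R \<in> HQ \<Longrightarrow> dd (Q + R) = dd Q + dd R" by (rule graph_D(2)[OF a])
  show "Q \<in> HQ \<Longrightarrow> dd (c *\<^sub>R Q) = c *\<^sub>R dd Q" by (rule graph_D(2)[OF s])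
  show "dd 0 = 0" by (rule graph_D(2)[OF z])
qed

text \<open>A field that is smooth on the whole domain is smooth on each element, with the same
  derivatives. Through this inclusion the orthogonal complement of the broken graph knows nothing of
  the interfaces between elements.\<close>

lemma smooth_graph:
  assumes \<Phi>: "\<Phi> \<in> smooth_sym" shows "(L2_of \<Omega> \<Phi>, L2_of \<Omega> (div_Div \<Phi>)) \<in> graph"
proof -
  note c = smooth_sym_continuous[OF \<Phi>] smooth_continuous[OF smooth_div_Div(1)[OF \<Phi>]]
  have "AE x in lebesgue. rep_l2 (L2_of \<Omega> \<Phi>) x = (if x \<in> \<Omega> then \<Phi> x else 0)"
    unfolding L2_of_def by (rule rep_abs_AE[OF L2_of_sqint[OF c(1) \<Omega>(2) \<Omega>_sets]])
  then have "AE x in lebesgue. transpose (rep_l2 (L2_of \<Omega> \<Phi>) x) = rep_l2 (L2_of \<Omega> \<Phi>) x"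
  proof eventually_elim
    case (elim x)
    have "transpose (0 :: real^'n^'n) = 0" by (simp add: transpose_def vec_eq_iff)
    then show ?case using \<Phi> unfolding elim by (simp add: smooth_sym_def)
  qed
  then have "L2_of \<Omega> \<Phi> \<in> L2sym \<Omega>" using L2_of_in_L2[OF c(1) \<Omega>(2) \<Omega>_sets] by (simp add: L2sym_def)
  moreover have "(restr T (L2_of \<Omega> \<Phi>), restr T (L2_of \<Omega> (div_Div \<Phi>))) \<in> divDiv_graph T" if "T \<in> \<T>" for T
    unfolding restr_L2_of[OF c(1) \<Omega>(2) \<Omega>_sets element_sets[OF that] element(2)[OF that]]
      restr_L2_of[OF c(2) \<Omega>(2) \<Omega>_sets element_sets[OF that] element(2)[OF that]] divDiv_graph_def
    by (rule closure_subset[THEN subsetD]) (rule imageI[OF \<Phi>])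
  ultimately show ?thesis using L2_of_in_L2[OF c(2) \<Omega>(2) \<Omega>_sets] by (simp add: graph_def)
qed

text \<open>The element contributions recombine into inner products over the domain; the mesh
  survives only in \<open>dd\<close> and in the range of \<open>Q\<close>.\<close>

lemma tr2_eq:
  assumes "u \<in> H2 \<Omega>" and Q: "Q \<in> HQ"
  shows "tr u Q = dd Q \<bullet> u - Q \<bullet> weak_hess \<Omega> u"
proof -
  note g = graph_dd[OF Q]
  have "tr u Q = (\<Sum>T\<in>\<T>. restr T (dd Q) \<bullet> restr T u) - (\<Sum>T\<in>\<T>. restr T Q \<bullet> restr T (weak_hess \<Omega> u))"
    using Q by (simp add: tr2_def sum_subtractf graph_D(1)[OF g])
  moreover have "Q \<in> L2 \<Omega>" using graph_D(4)[OF g] by (simp add: L2sym_def)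
  ultimately show ?thesis by (simp add: inner_sum_restr graph_D(5)[OF g])
qed

lemma tr2_linear:
  assumes u: "u \<in> H2 \<Omega>"
  shows "v \<in> H2 \<Omega> \<Longrightarrow> tr (u + v) = tr u + tr v"
    "tr (c *\<^sub>R u) = c *\<^sub>R tr u"
proof -
  note H = H2_space_linear[OF \<Omega>(1) \<Omega>_sets]
  have out: "tr w Q = 0" if "Q \<notin> HQ" for w Q using that by (simp add: tr2_def)
  show "tr (u + v) = tr u + tr v" if v: "v \<in> H2 \<Omega>"
  proof
    fix Q
    show "tr (u + v) Q = (tr u + tr v) Q"
      by (cases "Q \<in> HQ")
        (simp_all add: out tr2_eq subspace_add[OF H(1)] u v H(2) inner_add_right)
  qed
  show "tr (c *\<^sub>R u) = c *\<^sub>R tr u"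
  proof
    fix Q
    show "tr (c *\<^sub>R u) Q = (c *\<^sub>R tr u) Q"
      by (cases "Q \<in> HQ")
        (simp_all add: out tr2_eq subspace_scale[OF H(1)] u H(3) scaleR_fun_def algebra_simps)
  qed
qed

text \<open>An isometric linear embedding of the test space into a Hilbert product:
  \<open>vinner\<close> becomes the inner product there, from which symmetry, definiteness and
  Cauchy-Schwarz are inherited.\<close>

definition emb :: "'n test \<Rightarrow> 'n sfun \<times> 'n mfun \<times> 'n sfun" where
  "emb x = (fst x, snd x, dd (snd x))"

lemma V_space_subspace: "subspace VV"
  unfolding V_space_def by (rule subspace_Times[OF L2_closed_subspace(2)[OF \<Omega>_sets] dd_linear(1)])

lemma emb_linear:
  "x \<in> VV \<Longrightarrow> y \<in> VV \<Longrightarrow> emb (x + y) = emb x + emb y"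
  "x \<in> VV \<Longrightarrow> emb (c *\<^sub>R x) = c *\<^sub>R emb x"
  by (auto simp: emb_def V_space_def dd_linear(2,3))

lemma emb_eq_0: "emb x = 0 \<Longrightarrow> x = 0"
  by (simp add: emb_def zero_prod_def prod_eq_iff)

lemma V_inner_eq:
  assumes "x \<in> VV" "y \<in> VV"
  shows "vinner x y = emb x \<bullet> emb y"
proof -
  obtain v Q w R where e: "x = (v, Q)" "y = (w, R)" by (cases x, cases y)
  have Q: "Q \<in> HQ" "R \<in> HQ" using assms by (auto simp: e V_space_def)
  note g = graph_dd[OF Q(1)] graph_dd[OF Q(2)]
  have "Q \<in> L2 \<Omega>" using graph_D(4)[OF g(1)] by (simp add: L2sym_def)
  then have "HdivDiv_mesh_inner \<T> Q R = Q \<bullet> R + dd Q \<bullet> dd R"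
    unfolding HdivDiv_mesh_inner_def sum.distrib
    by (simp add: graph_D(1)[OF g(1)] graph_D(1)[OF g(2)] inner_sum_restr graph_D(5)[OF g(1)])
  then show ?thesis by (simp add: V_inner_def emb_def e)
qed

lemma V_norm_eq: "x \<in> VV \<Longrightarrow> vnorm x = norm (emb x)"
  by (simp add: V_norm_def V_inner_eq norm_eq_sqrt_inner)

end

lemma lipschitz_partition_mesh:
  fixes \<Omega> :: "(real^'n) set"
  assumes "open \<Omega>" "bounded \<Omega>" "lipschitz_partition \<Omega> \<T>"
  shows "mesh \<Omega> \<T>"
proof
  have p: "finite \<T>" "disjoint \<T>" "\<And>T. T \<in> \<T> \<Longrightarrow> lipschitz_domain T" "\<And>T. T \<in> \<T> \<Longrightarrow> T \<subseteq> \<Omega>"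
    "(\<Union>T\<in>\<T>. closure T) = closure \<Omega>"
    using assms(3) by (simp_all add: lipschitz_partition_def)
  show "open \<Omega>" "bounded \<Omega>" "finite \<T>" "disjoint \<T>" by (fact assms p)+
  show o: "open T" if "T \<in> \<T>" for T using p(3)[OF that] by (simp add: lipschitz_domain_def)
  show "T \<subseteq> \<Omega>" if "T \<in> \<T>" for T by (rule p(4)[OF that])
  have "negligible (\<Union>(frontier ` \<T>))"
    by (rule negligible_Union) (use p(1,3) negligible_lipschitz_frontier in auto)
  moreover have "\<Omega> - \<Union>\<T> \<subseteq> \<Union>(frontier ` \<T>)"
  proof
    fix x assume x: "x \<in> \<Omega> - \<Union>\<T>"
    then have "x \<in> (\<Union>T\<in>\<T>. closure T)" using p(5) closure_subset by blast
    then obtain T where T: "T \<in> \<T>" "x \<in> closure T" by blast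
    then have "x \<in> frontier T" using x o[OF T(1)] by (auto simp: frontier_def interior_open)
    then show "x \<in> \<Union>(frontier ` \<T>)" using T(1) by blast
  qed
  ultimately show "\<Omega> - \<Union>\<T> \<in> null_sets lebesgue"
    using negligible_subset negligible_iff_null_sets by blast
qed

section \<open>Inf-sup stability and continuity\<close>

text \<open>\<open>K\<close> and \<open>C\<close> come from \<open>Hessian_estimate\<close> and are
  fixed before a mesh is chosen, so every constant built from them depends on the domain and the
  coefficient alone.\<close>

locale cordes_mesh = mesh \<Omega> \<T> for \<Omega> :: "(real^'n) set" and \<T> +
  fixes A :: "real^'n \<Rightarrow> real^'n^'n" and K C :: real
  assumes convex: "convex \<Omega>" "\<Omega> \<noteq> {}"
    and A: "A \<in> borel_measurable (lebesgue_on \<Omega>)"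
    and K: "0 < K" "AE x in lebesgue. x \<in> \<Omega> \<longrightarrow> norm (A x) \<le> K"
    and C: "0 < C" "\<And>w. w \<in> X_space \<Omega> \<Longrightarrow> H2_norm \<Omega> w \<le> C * norm (pop (\<lambda>x D. contract \<Omega> K A x \<bullet> D) (weak_hess \<Omega> w))"
begin

text \<open>\<open>AM\<close> and \<open>Av\<close> are adjoint to each other and use the truncated
  coefficient, which coincides with \<open>A\<close> almost everywhere on the domain;
  \<open>Av_eq\<close> relates it to the term in \<open>b_form\<close>.\<close>

definition AM :: "'n mfun \<Rightarrow> 'n sfun" where "AM = pop (\<lambda>x D. contract \<Omega> K A x \<bullet> D)"

definition Av :: "'n sfun \<Rightarrow> 'n mfun" where "Av = pop (\<lambda>x (r::real). r *\<^sub>R contract \<Omega> K A x)"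

lemmas contract_field = pfield_contract[OF \<Omega>_sets A less_imp_le[OF K(1)]]

lemma Av_eq: "L2_of \<Omega> (\<lambda>x. rep_l2 v x *\<^sub>R A x) = Av v"
proof -
  have m: "(\<lambda>x. if x \<in> \<Omega> then rep_l2 v x *\<^sub>R A x else 0) \<in> borel_measurable lebesgue"
  proof -
    have "(\<lambda>x. if x \<in> \<Omega> then A x else 0) \<in> borel_measurable lebesgue"
      using borel_measurable_if[OF \<Omega>_sets, of A] A by simp
    then have "(\<lambda>x. rep_l2 v x *\<^sub>R (if x \<in> \<Omega> then A x else 0)) \<in> borel_measurable lebesgue"
      by (intro borel_measurable_scaleR rep_measurable)
    then show ?thesis by (rule measurable_cong[THEN iffD1, rotated]) simp
  qed
  have "AE x in lebesgue. norm (if x \<in> \<Omega> then rep_l2 v x *\<^sub>R A x else 0) \<le> K * norm (rep_l2 v x)"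
    using K(2)
  proof eventually_elim
    case (elim x)
    then show ?case using mult_right_mono[of "norm (A x)" K "\<bar>rep_l2 v x\<bar>"] K(1) by (simp add: mult.commute)
  qed
  then have sq: "sqint (\<lambda>x. if x \<in> \<Omega> then rep_l2 v x *\<^sub>R A x else 0)"
    by (rule sqint_bound[OF sqint_rep m])
  have "AE x in lebesgue. (if x \<in> \<Omega> then rep_l2 v x *\<^sub>R A x else 0) = rep_l2 v x *\<^sub>R contract \<Omega> K A x"
    using K(2) by eventually_elim (simp add: contract_def)
  then show ?thesis
    unfolding L2_of_def Av_def pop_def
    by (subst abs_l2_eq_iff[OF sq pfield_sqint[OF contract_field(2) sqint_rep]])
qed

lemma Av_adjoint: "M \<bullet> Av v = AM M \<bullet> v"
  unfolding Av_def AM_def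
  by (rule pop_adjoint[OF contract_field, symmetric]) (simp add: inner_commute)

lemma AM_linear: "AM (M + N) = AM M + AM N" "AM (c *\<^sub>R M) = c *\<^sub>R AM M" "norm (AM M) \<le> K * norm M"
  unfolding AM_def by (rule pop_add[OF contract_field(1)] pop_scaleR[OF contract_field(1)] norm_pop_le[OF contract_field(1)])+

lemma AM_L2: "AM M \<in> L2 \<Omega>"
  unfolding L2_def mem_Collect_eq AM_def
  using rep_pop_AE[OF contract_field(1), of M] by eventually_elim (simp add: contract_def)

lemmas H2_linear = H2_space_linear[OF \<Omega>(1) \<Omega>_sets]

lemma X_H2: "w \<in> X_space \<Omega> \<Longrightarrow> w \<in> H2 \<Omega>" by (simp add: X_space_def)

lemma b_form_eq:
  assumes "u \<in> L2 \<Omega>" "x \<in> VV"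
  shows "b_form \<Omega> A \<T> (u, M, \<mu>) x = - (u \<bullet> dd (snd x)) + AM M \<bullet> fst x + M \<bullet> snd x + \<mu> (snd x)"
proof -
  obtain v Q where x: "x = (v, Q)" by (cases x)
  have g: "(Q, dd Q) \<in> graph" using assms(2) by (simp add: x V_space_def graph_dd)
  show ?thesis
    using assms(1) by (simp add: b_form_def x Av_eq inner_add_right Av_adjoint graph_D(1)[OF g] inner_sum_restr)
qed

lemma b_form_tr2:
  assumes "u \<in> L2 \<Omega>" "w \<in> H2 \<Omega>" and x: "x \<in> VV"
  shows "b_form \<Omega> A \<T> (u, M, tr w) x = (w - u) \<bullet> dd (snd x) + AM M \<bullet> fst x + (M - weak_hess \<Omega> w) \<bullet> snd x"
proof -
  have Q: "snd x \<in> HQ" using x by (auto simp: V_space_def)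
  show ?thesis
    unfolding b_form_eq[OF assms(1) x] tr2_eq[OF assms(2) Q]
    by (simp add: inner_diff_left inner_commute[of "dd (snd x)"] inner_commute[of "snd x"])
qed

lemma U_space_E:
  assumes "x \<in> UU"
  obtains u M w where "x = (u, M, tr w)" "u \<in> L2 \<Omega>" "M \<in> L2sym \<Omega>" "w \<in> X_space \<Omega>"
  using assms unfolding U_space_def U_hat_def by blast

lemma U_space_subspace: "subspace UU"
proof -
  have "subspace UH"
  proof (rule subspaceI)
    note X = X_space_linear[OF \<Omega>(1) \<Omega>_sets]
    show "0 \<in> UH"
      using tr2_linear(2)[OF X_H2[OF subspace_0[OF X]], of 0] subspace_0[OF X] by (force simp: U_hat_def)
    show "x + y \<in> UH" if xy: "x \<in> UH" "y \<in> UH" for x y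
    proof -
      obtain v w where "x = tr v" "y = tr w" "v \<in> X_space \<Omega>" "w \<in> X_space \<Omega>"
        using xy unfolding U_hat_def by blast
      then show ?thesis using tr2_linear(1)[of v w] subspace_add[OF X] X_H2 unfolding U_hat_def by (metis imageI)
    qed
    show "c *\<^sub>R x \<in> UH" if x: "x \<in> UH" for c x
    proof -
      obtain v where "x = tr v" "v \<in> X_space \<Omega>" using x unfolding U_hat_def by blast
      then show ?thesis using tr2_linear(2)[of v c] subspace_scale[OF X] X_H2 unfolding U_hat_def by (metis imageI)
    qed
  qed
  then show ?thesis
    unfolding U_space_def by (intro subspace_Times L2_closed_subspace(2)[OF \<Omega>_sets] L2sym_closed_subspace(2)[OF \<Omega>_sets])
qed

lemma b_form_linear_left:
  assumes "x \<in> UU" "v \<in> VV"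
  shows "y \<in> UU \<Longrightarrow> b_form \<Omega> A \<T> (x + y) v = b_form \<Omega> A \<T> x v + b_form \<Omega> A \<T> y v"
    "b_form \<Omega> A \<T> (c *\<^sub>R x) v = c * b_form \<Omega> A \<T> x v"
proof -
  obtain u M \<mu> where x: "x = (u, M, \<mu>)" "u \<in> L2 \<Omega>" using assms(1) by (auto simp: U_space_def)
  note L = subspace_add[OF L2_closed_subspace(2)[OF \<Omega>_sets]] subspace_scale[OF L2_closed_subspace(2)[OF \<Omega>_sets]]
  show "b_form \<Omega> A \<T> (x + y) v = b_form \<Omega> A \<T> x v + b_form \<Omega> A \<T> y v" if "y \<in> UU"
  proof -
    obtain u' M' \<mu>' where y: "y = (u', M', \<mu>')" "u' \<in> L2 \<Omega>" using \<open>y \<in> _\<close> by (auto simp: U_space_def)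
    show ?thesis
      unfolding x(1) y(1) add_Pair b_form_eq[OF x(2) assms(2)] b_form_eq[OF y(2) assms(2)] b_form_eq[OF L(1)[OF x(2) y(2)] assms(2)]
      by (simp add: AM_linear inner_add_left)
  qed
  show "b_form \<Omega> A \<T> (c *\<^sub>R x) v = c * b_form \<Omega> A \<T> x v"
    unfolding x(1) scaleR_Pair b_form_eq[OF x(2) assms(2)] b_form_eq[OF L(2)[OF x(2)] assms(2)]
    by (simp add: AM_linear scaleR_fun_def algebra_simps)
qed

lemma b_form_linear_right:
  assumes "x \<in> UU" "v \<in> VV"
  shows "w \<in> VV \<Longrightarrow> b_form \<Omega> A \<T> x (v + w) = b_form \<Omega> A \<T> x v + b_form \<Omega> A \<T> x w"
    "b_form \<Omega> A \<T> x (c *\<^sub>R v) = c * b_form \<Omega> A \<T> x v"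
proof -
  obtain u M z where x: "x = (u, M, tr z)" "u \<in> L2 \<Omega>" "z \<in> H2 \<Omega>"
    using U_space_E[OF assms(1)] X_H2 by metis
  note V = subspace_add[OF V_space_subspace] subspace_scale[OF V_space_subspace]
  have e: "dd (snd (v + w)) = dd (snd v) + dd (snd w)" if "w \<in> VV" for w
    using emb_linear(1)[OF assms(2) that] by (simp add: emb_def)
  have s: "dd (snd (c *\<^sub>R v)) = c *\<^sub>R dd (snd v)"
    using emb_linear(2)[OF assms(2)] by (simp add: emb_def)
  show "b_form \<Omega> A \<T> x (v + w) = b_form \<Omega> A \<T> x v + b_form \<Omega> A \<T> x w" if w: "w \<in> VV"
    unfolding x(1) b_form_tr2[OF x(2,3) V(1)[OF assms(2) w]] b_form_tr2[OF x(2,3) assms(2)] b_form_tr2[OF x(2,3) w] e[OF w]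
    by (simp add: inner_add_right)
  show "b_form \<Omega> A \<T> x (c *\<^sub>R v) = c * b_form \<Omega> A \<T> x v"
    unfolding x(1) b_form_tr2[OF x(2,3) V(2)[OF assms(2)]] b_form_tr2[OF x(2,3) assms(2)] s
    by (simp add: algebra_simps)
qed

section \<open>The trace norm and the norm of the trial space\<close>

lemma H2_norm_eq: "H2_norm \<Omega> u = norm (u, weak_hess \<Omega> u)"
  by (simp add: H2_norm_def norm_Pair)

lemma trace_norm_greatest:
  assumes "\<mu> \<in> UH" "\<And>w. w \<in> H2 \<Omega> \<Longrightarrow> tr w = \<mu> \<Longrightarrow> r \<le> H2_norm \<Omega> w"
  shows "r \<le> tnorm \<mu>"
proof -
  obtain w where "w \<in> H2 \<Omega>" "tr w = \<mu>" using assms(1) X_H2 unfolding U_hat_def by blast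
  then show ?thesis unfolding trace_norm_def by (intro cInf_greatest) (use assms(2) in auto)
qed

lemma trace_norm_le: "w \<in> H2 \<Omega> \<Longrightarrow> tnorm (tr w) \<le> H2_norm \<Omega> w"
  unfolding trace_norm_def
  by (rule cInf_lower) (auto simp: H2_norm_def intro!: bdd_belowI[of _ 0])

lemma trace_norm_nonneg: "\<mu> \<in> UH \<Longrightarrow> 0 \<le> tnorm \<mu>"
  by (rule trace_norm_greatest) (simp_all add: H2_norm_def)

lemma trace_norm_add:
  assumes \<mu>: "\<mu> \<in> UH" and \<nu>: "\<nu> \<in> UH"
  shows "tnorm (\<mu> + \<nu>) \<le> tnorm \<mu> + tnorm \<nu>"
proof -
  have "tnorm (\<mu> + \<nu>) - tnorm \<mu> \<le> tnorm \<nu>"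
  proof (rule trace_norm_greatest[OF \<nu>])
    fix w assume w: "w \<in> H2 \<Omega>" "tr w = \<nu>"
    have "tnorm (\<mu> + \<nu>) - H2_norm \<Omega> w \<le> tnorm \<mu>"
    proof (rule trace_norm_greatest[OF \<mu>])
      fix z assume z: "z \<in> H2 \<Omega>" "tr z = \<mu>"
      have "tnorm (\<mu> + \<nu>) \<le> H2_norm \<Omega> (z + w)"
        using trace_norm_le[OF subspace_add[OF H2_linear(1) z(1) w(1)]] tr2_linear(1)[OF z(1) w(1)] z(2) w(2) by simp
      also have "\<dots> \<le> H2_norm \<Omega> z + H2_norm \<Omega> w"
        using norm_triangle_ineq[of "(z, weak_hess \<Omega> z)" "(w, weak_hess \<Omega> w)"]
        by (simp add: H2_norm_eq H2_linear(2)[OF z(1) w(1)])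
      finally show "tnorm (\<mu> + \<nu>) - H2_norm \<Omega> w \<le> H2_norm \<Omega> z" by simp
    qed
    then show "tnorm (\<mu> + \<nu>) - tnorm \<mu> \<le> H2_norm \<Omega> w" by simp
  qed
  then show ?thesis by simp
qed

lemma U_hat_scale: "\<mu> \<in> UH \<Longrightarrow> c *\<^sub>R \<mu> \<in> UH"
proof -
  assume "\<mu> \<in> UH"
  then obtain w where w: "w \<in> X_space \<Omega>" "\<mu> = tr w" unfolding U_hat_def by blast
  then show ?thesis
    unfolding U_hat_def w(2) tr2_linear(2)[OF X_H2[OF w(1)], symmetric]
    using subspace_scale[OF X_space_linear[OF \<Omega>(1) \<Omega>_sets]] by blast
qed

lemma trace_norm_scale:
  assumes \<mu>: "\<mu> \<in> UH"
  shows "tnorm (c *\<^sub>R \<mu>) = \<bar>c\<bar> * tnorm \<mu>"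
proof (cases "c = 0")
  case True
  have "tnorm (0 *\<^sub>R \<mu>) \<le> 0"
  proof -
    have z: "(0 :: 'n sfun) \<in> H2 \<Omega>" by (rule subspace_0[OF H2_linear(1)])
    have "tr 0 = 0 *\<^sub>R \<mu>" "weak_hess \<Omega> 0 = 0"
      using tr2_linear(2)[OF z, of 0] H2_linear(3)[OF z, of 0] by simp_all
    then show ?thesis using trace_norm_le[OF z] by (simp add: H2_norm_def)
  qed
  then show ?thesis using True trace_norm_nonneg[OF U_hat_scale[OF \<mu>, of 0]] by simp
next
  case False
  have le: "tnorm (c *\<^sub>R \<mu>) \<le> \<bar>c\<bar> * tnorm \<mu>" if \<mu>: "\<mu> \<in> UH" and c: "c \<noteq> 0" for c \<mu>
  proof -
    have "tnorm (c *\<^sub>R \<mu>) / \<bar>c\<bar> \<le> tnorm \<mu>"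
    proof (rule trace_norm_greatest[OF \<mu>])
      fix w assume w: "w \<in> H2 \<Omega>" "tr w = \<mu>"
      have "tnorm (c *\<^sub>R \<mu>) \<le> H2_norm \<Omega> (c *\<^sub>R w)"
        using trace_norm_le[OF subspace_scale[OF H2_linear(1) w(1)], of c] tr2_linear(2)[OF w(1), of c] w(2) by simp
      also have "\<dots> = \<bar>c\<bar> * H2_norm \<Omega> w"
        unfolding H2_norm_eq H2_linear(3)[OF w(1)] using norm_scaleR[of c "(w, weak_hess \<Omega> w)"] unfolding scaleR_Pair .
      finally show "tnorm (c *\<^sub>R \<mu>) / \<bar>c\<bar> \<le> H2_norm \<Omega> w" using c by (simp add: field_simps)
    qed
    then show ?thesis using c by (simp add: field_simps)
  qed
  have "\<bar>c\<bar> * tnorm \<mu> \<le> tnorm (c *\<^sub>R \<mu>)"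
    using le[OF U_hat_scale[OF \<mu>, of c], of "inverse c"] False by (simp add: field_simps)
  then show ?thesis using le[OF \<mu> False] by simp
qed

lemma U_norm_eq: "unorm x = norm (norm (fst x), norm (fst (snd x)), tnorm (snd (snd x)))"
  by (simp add: U_norm_def norm_Pair split_beta)

lemma norm_triple_mono:
  fixes a b c a' b' c' :: real
  assumes "0 \<le> a" "0 \<le> b" "0 \<le> c" "a \<le> a'" "b \<le> b'" "c \<le> c'"
  shows "norm (a, b, c) \<le> norm (a', b', c')"
  unfolding norm_Pair using assms by (intro real_sqrt_le_mono add_mono power_mono) auto

lemma U_norm_add:
  assumes "x \<in> UU" "y \<in> UU"
  shows "unorm (x + y) \<le> unorm x + unorm y"
proof -
  have m: "snd (snd x) \<in> UH" "snd (snd y) \<in> UH" "snd (snd (x + y)) \<in> UH"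
    using assms subspace_add[OF U_space_subspace assms] by (auto simp: U_space_def)
  let ?n = "\<lambda>x. (norm (fst x), norm (fst (snd x)), tnorm (snd (snd x)))"
  have "unorm (x + y) \<le> norm (?n x + ?n y)"
    unfolding U_norm_eq add_Pair
    using trace_norm_add[OF m(1,2)] trace_norm_nonneg[OF m(3)] by (intro norm_triple_mono) (simp_all add: norm_triangle_ineq)
  also have "\<dots> \<le> unorm x + unorm y" unfolding U_norm_eq by (rule norm_triangle_ineq)
  finally show ?thesis .
qed

lemma U_norm_scale:
  assumes "x \<in> UU"
  shows "unorm (c *\<^sub>R x) = \<bar>c\<bar> * unorm x"
proof -
  have m: "snd (snd x) \<in> UH" using assms by (auto simp: U_space_def)
  have "unorm (c *\<^sub>R x) = norm (\<bar>c\<bar> *\<^sub>R (norm (fst x), norm (fst (snd x)), tnorm (snd (snd x))))"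
    unfolding U_norm_eq scaleR_Pair by (simp add: trace_norm_scale[OF m])
  then show ?thesis by (simp only: norm_scaleR U_norm_eq abs_abs)
qed

lemma norm_triple_bounds:
  fixes a b c :: real
  shows "\<bar>a\<bar> \<le> norm (a, b, c)" "\<bar>b\<bar> \<le> norm (a, b, c)" "\<bar>c\<bar> \<le> norm (a, b, c)" "norm (a, b, c) \<le> \<bar>a\<bar> + \<bar>b\<bar> + \<bar>c\<bar>"
proof -
  note n = norm_fst_le[of a "(b, c)"] norm_snd_le[of "(b, c)" a] norm_fst_le[of b c] norm_snd_le[of c b]
    norm_Pair_le[of a "(b, c)"] norm_Pair_le[of b c]
  show "\<bar>a\<bar> \<le> norm (a, b, c)" "\<bar>b\<bar> \<le> norm (a, b, c)" "\<bar>c\<bar> \<le> norm (a, b, c)" "norm (a, b, c) \<le> \<bar>a\<bar> + \<bar>b\<bar> + \<bar>c\<bar>"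
    using n unfolding real_norm_def by linarith+
qed

text \<open>Every function \<open>w\<close> with this trace gives the bound with
  \<open>H2_norm \<Omega> w\<close>. Dividing by the factor depending on \<open>Q\<close> allows
  passing to the infimum; when that factor is zero the value is zero directly.\<close>

lemma trace_bound:
  assumes \<mu>: "\<mu> \<in> UH" and Q: "Q \<in> HQ"
  shows "\<bar>\<mu> Q\<bar> \<le> (norm (dd Q) + norm Q) * tnorm \<mu>"
proof -
  define q where "q = norm (dd Q) + norm Q"
  have b: "\<bar>\<mu> Q\<bar> \<le> q * H2_norm \<Omega> w" if w: "w \<in> H2 \<Omega>" "tr w = \<mu>" for w
  proof -
    have h: "norm w \<le> H2_norm \<Omega> w" "norm (weak_hess \<Omega> w) \<le> H2_norm \<Omega> w"
      unfolding H2_norm_eq using norm_fst_le[of w] norm_snd_le[of "weak_hess \<Omega> w" w] by auto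
    have "\<bar>\<mu> Q\<bar> \<le> norm (dd Q) * norm w + norm Q * norm (weak_hess \<Omega> w)"
      using Cauchy_Schwarz_ineq2[of "dd Q" w] Cauchy_Schwarz_ineq2[of Q "weak_hess \<Omega> w"]
      by (simp add: w(2)[symmetric] tr2_eq[OF w(1) Q])
    also have "\<dots> \<le> q * H2_norm \<Omega> w"
      unfolding q_def distrib_right by (intro add_mono mult_left_mono h) simp_all
    finally show ?thesis .
  qed
  have q: "0 \<le> q" by (simp add: q_def)
  show ?thesis
  proof (cases "q = 0")
    case True
    obtain w where "w \<in> H2 \<Omega>" "tr w = \<mu>" using \<mu> X_H2 unfolding U_hat_def by blast
    from b[OF this] True show ?thesis by (simp add: q_def[symmetric])
  next
    case False
    then have q0: "0 < q" using q by simp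
    have "\<bar>\<mu> Q\<bar> / q \<le> tnorm \<mu>"
      by (rule trace_norm_greatest[OF \<mu>]) (use b q0 in \<open>simp add: field_simps\<close>)
    then show ?thesis unfolding q_def[symmetric] using q0 by (simp add: field_simps)
  qed
qed

text \<open>Definiteness in the last component is not built into the infimum: a trace of norm zero
  vanishes on the broken space by \<open>trace_bound\<close>, and elsewhere by the convention of
  extension by zero.\<close>

lemma U_norm_eq_0:
  assumes "x \<in> UU" "unorm x \<le> 0"
  shows "x = 0"
proof -
  obtain u M w where x: "x = (u, M, tr w)" using U_space_E[OF assms(1)] by metis
  let ?\<mu> = "tr w"
  have \<mu>: "?\<mu> \<in> UH" using assms(1) by (simp add: x U_space_def)
  have n: "norm u = 0" "norm M = 0" "tnorm ?\<mu> = 0"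
    using norm_triple_bounds(1-3)[where a="norm u" and b="norm M" and c="tnorm ?\<mu>"] assms(2)
    unfolding U_norm_eq x fst_conv snd_conv by linarith+
  have "?\<mu> Q = 0" for Q
  proof (cases "Q \<in> HQ")
    case True
    from trace_bound[OF \<mu> this] n(3) show ?thesis by simp
  qed (simp add: tr2_def)
  then have "?\<mu> = 0" by (simp add: fun_eq_iff)
  then show ?thesis using n(1,2) by (simp add: x zero_prod_def)
qed

lemma V_space_bounds:
  "norm (fst x) \<le> norm (emb x)" "norm (snd x) \<le> norm (emb x)" "norm (dd (snd x)) \<le> norm (emb x)"
  using norm_triple_bounds(1-3)[where a="norm (fst x)" and b="norm (snd x)" and c="norm (dd (snd x))"] by (simp_all add: emb_def norm_Pair)

text \<open>The constant counts the terms: \<open>K\<close> from the contraction with the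
  coefficient, 1 each from the pairings of \<open>u\<close> and \<open>M\<close> with the test
  field, and 2 from the trace, which is bounded by the norms of the field and of its
  divergence.\<close>

lemma b_form_continuous:
  assumes x: "x \<in> UU" and v: "v \<in> VV"
  shows "\<bar>b_form \<Omega> A \<T> x v\<bar> \<le> (K + 4) * unorm x * vnorm v"
proof -
  obtain u M \<mu> where e: "x = (u, M, \<mu>)" "u \<in> L2 \<Omega>" "\<mu> \<in> UH" using x by (auto simp: U_space_def)
  have Q: "snd v \<in> HQ" using v by (auto simp: V_space_def)
  define U where "U = unorm x"
  define V where "V = vnorm v"
  have U: "norm u \<le> U" "norm M \<le> U" "tnorm \<mu> \<le> U"
    using norm_triple_bounds(1-3)[where a="norm u" and b="norm M" and c="tnorm \<mu>"] by (simp_all add: U_def U_norm_eq e)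
  have V: "norm (fst v) \<le> V" "norm (snd v) \<le> V" "norm (dd (snd v)) \<le> V"
    unfolding V_def V_norm_eq[OF v] by (rule V_space_bounds)+
  have nn: "0 \<le> U" "0 \<le> V" using order_trans[OF norm_ge_zero U(1)] order_trans[OF norm_ge_zero V(1)] .
  have cs: "\<bar>a \<bullet> b\<bar> \<le> s * t" if "norm a \<le> s" "norm b \<le> t" for a b :: "'p::real_inner" and s t
    using order_trans[OF Cauchy_Schwarz_ineq2 mult_mono[OF that]] order_trans[OF norm_ge_zero that(1)] by simp
  have "\<bar>u \<bullet> dd (snd v)\<bar> \<le> U * V" "\<bar>M \<bullet> snd v\<bar> \<le> U * V" by (intro cs U V)+
  moreover have "\<bar>AM M \<bullet> fst v\<bar> \<le> (K * U) * V"
    by (rule cs[OF order_trans[OF AM_linear(3) mult_left_mono[OF U(2)]] V(1)]) (use K(1) in simp)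
  moreover have "\<bar>\<mu> (snd v)\<bar> \<le> 2 * (U * V)"
  proof -
    have "\<bar>\<mu> (snd v)\<bar> \<le> (norm (dd (snd v)) + norm (snd v)) * tnorm \<mu>" by (rule trace_bound[OF e(3) Q])
    also have "\<dots> \<le> (V + V) * U"
      using V U(3) trace_norm_nonneg[OF e(3)] nn by (intro mult_mono add_mono) auto
    finally show ?thesis by (simp add: algebra_simps)
  qed
  ultimately have "\<bar>b_form \<Omega> A \<T> x v\<bar> \<le> U * V + (K * U) * V + U * V + 2 * (U * V)"
    unfolding e(1) b_form_eq[OF e(2) v] by linarith
  then show ?thesis unfolding U_def[symmetric] V_def[symmetric] by (simp add: algebra_simps)
qed

text \<open>With h = C (1 + K) N bounding the H^2 norm of the lifted trace, \<open>inf_sup\<close>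
  bounds \<open>u\<close> and \<open>M\<close> by h + N each and the trace by h, in total 3 h + 2
  N.\<close>

definition C_stab :: real where "C_stab = 3 * (C * (1 + K)) + 2"

text \<open>The supremum in the usual inf-sup condition is replaced by an arbitrary bound
  \<open>N\<close> of the functional. This is convenient for the discrete stability, where such a
  bound comes from the Fortin operator.\<close>

lemma inf_sup:
  assumes x: "x \<in> UU" and N0: "0 \<le> N"
    and b: "\<And>v. v \<in> VV \<Longrightarrow> \<bar>b_form \<Omega> A \<T> x v\<bar> \<le> N * vnorm v"
  shows "unorm x \<le> C_stab * N"
proof -
  obtain u M w where e: "x = (u, M, tr w)" "u \<in> L2 \<Omega>" "M \<in> L2sym \<Omega>" and wX: "w \<in> X_space \<Omega>"
    using U_space_E[OF x] by metis
  note w = X_H2[OF wX]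
  have wL: "w \<in> L2 \<Omega>" using w by (simp add: H2_def)
  define H where "H = weak_hess \<Omega> w"
  have H: "H \<in> L2sym \<Omega>"
    unfolding H_def by (rule weak_hess_symmetric[OF \<Omega>(1) \<Omega>_sets is_weak_hess_weak_hess[OF \<Omega>(1) w]])
  obtain p where p: "p \<in> graph" "\<And>y. y \<in> graph \<Longrightarrow> ((M - H, w - u) - p) \<bullet> y = 0"
    using closed_subspace_projection[OF graph_closed_subspace, of "(M - H, w - u)"] by blast
  obtain R r where pe: "p = (R, r)" by (cases p)
  note g = graph_D[OF p(1)[unfolded pe]]
  define Z where "Z = M - H - R"
  define z where "z = w - u - r"
  note L = L2_closed_subspace(2)[OF \<Omega>_sets] L2sym_closed_subspace(2)[OF \<Omega>_sets]
  have orth: "Z \<bullet> Q + z \<bullet> q = 0" if "(Q, q) \<in> graph" for Q q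
    using p(2)[OF that] by (simp add: pe Z_def z_def)
  have zL: "z \<in> L2 \<Omega>" "Z \<in> L2sym \<Omega>"
    unfolding z_def Z_def by (intro subspace_diff[OF L(1)] wL e(2) g(5)) (intro subspace_diff[OF L(2)] e(3) H g(4))
  have zX: "z \<in> X_space \<Omega>" "weak_hess \<Omega> z = - Z"
    by (rule orthogonal_complement_in_X_space[OF \<Omega> \<Omega>_sets convex zL]; use orth[OF smooth_graph] in \<open>simp add: add.commute\<close>)+
  define y where "y = w + (-1) *\<^sub>R z"
  note mz = X_H2[OF zX(1)]
  have mz': "(-1) *\<^sub>R z \<in> H2 \<Omega>" by (rule subspace_scale[OF H2_linear(1) mz])
  note X = X_space_linear[OF \<Omega>(1) \<Omega>_sets]
  have yX: "y \<in> X_space \<Omega>" unfolding y_def by (intro subspace_add[OF X] subspace_scale[OF X] wX zX(1))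
  have yH: "weak_hess \<Omega> y = H + Z"
    unfolding y_def H2_linear(2)[OF w mz'] H2_linear(3)[OF mz] zX(2) by (simp add: H_def)
  \<comment> \<open>As the Hessian of \<open>z\<close> is \<open>- Z\<close>, the value of the trace
    at \<open>Q\<close> is exactly the pairing of (Z, z) with (Q, dd Q), which vanishes by
    orthogonality to the graph.\<close>
  have "tr z Q = 0" for Q
  proof (cases "Q \<in> HQ")
    case True
    from orth[OF graph_dd[OF True]] show ?thesis
      unfolding tr2_eq[OF mz True] zX(2) by (simp add: inner_commute add.commute)
  qed (simp add: tr2_def)
  then have trz: "tr z = 0" by (simp add: fun_eq_iff)
  have trw: "tr y = tr w"
    unfolding y_def tr2_linear(1)[OF w mz'] tr2_linear(2)[OF mz] trz by simp
  have r: "y - u = r" "M - weak_hess \<Omega> y = R"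
    unfolding yH Z_def by (simp_all add: y_def z_def)
  have e': "x = (u, M, tr y)" using e(1) trw by simp
  have bx: "b_form \<Omega> A \<T> x v = r \<bullet> dd (snd v) + AM M \<bullet> fst v + R \<bullet> snd v" if "v \<in> VV" for v
    unfolding e' b_form_tr2[OF e(2) X_H2[OF yX] that] r ..
  have step: "n \<le> N" if "n * n \<le> N * n" "0 \<le> n" for n :: real
    using that N0 by (cases "n = 0") simp_all
  have z0: "0 \<in> L2 \<Omega>" "0 \<in> HQ" by (rule subspace_0[OF L(1)] subspace_0[OF dd_linear(1)])+
  \<comment> \<open>At (0, R) the form equals |R|^2 + |r|^2 and at (AM M, 0) it equals the squared
    norm of \<open>AM M\<close>; in both cases the square root of this value is the norm of the test
    function.\<close>
  have N: "norm (R, r) \<le> N" and NA: "norm (AM M) \<le> N"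
  proof -
    have v: "(0, R) \<in> VV" "(AM M, 0) \<in> VV"
      using z0 g(3) AM_L2 by (simp_all add: V_space_def)
    have n: "vnorm (0, R) = norm (R, r)" "vnorm (AM M, 0) = norm (AM M)"
      unfolding V_norm_eq[OF v(1)] V_norm_eq[OF v(2)] by (simp_all add: emb_def norm_Pair g(2) dd_linear(4))
    have q: "norm (R, r) * norm (R, r) \<le> N * norm (R, r)"
      using b[OF v(1)] unfolding bx[OF v(1)] n by (simp add: g(2) norm_Pair dot_square_norm power2_eq_square[symmetric])
    have q': "norm (AM M) * norm (AM M) \<le> N * norm (AM M)"
      using b[OF v(2)] unfolding bx[OF v(2)] n by (simp add: dd_linear(4) dot_square_norm power2_eq_square)
    show "norm (R, r) \<le> N" "norm (AM M) \<le> N" by (rule step[OF q norm_ge_zero] step[OF q' norm_ge_zero])+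
  qed
  have nR: "norm R \<le> N" "norm r \<le> N" using N norm_fst_le[of R r] norm_snd_le[of r R] by auto
  define h where "h = C * ((1 + K) * N)"
  have "norm (AM (weak_hess \<Omega> y)) \<le> (1 + K) * N"
  proof -
    \<comment> \<open>The Hessian of the lifted trace is not tested itself; it is recovered as M -
      R, both parts of which have controlled contraction with the coefficient.\<close>
    have "weak_hess \<Omega> y = M + (-1) *\<^sub>R R" using r(2) by (simp add: algebra_simps)
    then have "AM (weak_hess \<Omega> y) = AM M - AM R" by (simp only: AM_linear(1,2)) simp
    then have "norm (AM (weak_hess \<Omega> y)) \<le> norm (AM M) + norm (AM R)" by (simp add: norm_triangle_ineq4)
    also have "\<dots> \<le> N + K * N"
      using NA AM_linear(3)[of R] mult_left_mono[OF nR(1), of K] K(1) by linarith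
    finally show ?thesis by (simp add: algebra_simps)
  qed
  then have hy: "H2_norm \<Omega> y \<le> h"
    using order_trans[OF C(2)[OF yX, folded AM_def] mult_left_mono[OF _ less_imp_le[OF C(1)]]] unfolding h_def by blast
  have y: "norm y \<le> h" "norm (weak_hess \<Omega> y) \<le> h"
    using hy norm_fst_le[of y "weak_hess \<Omega> y"] norm_snd_le[of "weak_hess \<Omega> y" y] unfolding H2_norm_eq by auto
  have "norm u \<le> h + N" using norm_triangle_ineq4[of y r] y(1) nR(2) r(1) by (simp add: algebra_simps)
  moreover have "norm M \<le> h + N" using norm_triangle_ineq[of "weak_hess \<Omega> y" R] y(2) nR(1) r(2) by (simp add: algebra_simps)
  moreover have "0 \<le> tnorm (tr y)" "tnorm (tr y) \<le> h"
    using trace_norm_nonneg[of "tr y"] yX trace_norm_le[OF X_H2[OF yX]] hy by (auto simp: U_hat_def)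
  ultimately have "unorm x \<le> (h + N) + (h + N) + h"
    using norm_triple_bounds(4)[where a="norm u" and b="norm M" and c="tnorm (tr y)"] by (simp add: U_norm_eq e')
  then show ?thesis by (simp add: C_stab_def h_def algebra_simps)
qed

end

section \<open>The discrete problem\<close>

context cordes_mesh
begin

lemma V_inner_bilinear:
  assumes "x \<in> VV" "z \<in> VV"
  shows "y \<in> VV \<Longrightarrow> vinner (x + y) z = vinner x z + vinner y z"
    "vinner (c *\<^sub>R x) z = c * vinner x z"
    "vinner x z = vinner z x"
    "\<bar>vinner x z\<bar> \<le> vnorm x * vnorm z"
    "vinner x x = (vnorm x)\<^sup>2"
    "vinner x x = 0 \<Longrightarrow> x = 0"
    "0 \<le> vnorm x"
  using assms Cauchy_Schwarz_ineq2[of "emb x" "emb z"] inner_commute[of "emb x" "emb z"] emb_eq_0[of x]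
  by (simp_all add: V_inner_eq V_norm_eq subspace_add[OF V_space_subspace] subspace_scale[OF V_space_subspace]
      emb_linear inner_add_left power2_norm_eq_inner)

context
  fixes Uh :: "'n trial set" and Vh :: "'n test set" and PiF C_F
  assumes Uh: "fin_dim_subspace_of Uh UU" and Vh: "fin_dim_subspace_of Vh VV"
    and C_F: "0 < C_F" and fortin: "is_fortin \<Omega> A \<T> Uh Vh PiF C_F"
begin

abbreviation b where "b \<equiv> b_form \<Omega> A \<T>"

abbreviation \<Theta> where "\<Theta> \<equiv> trial_to_test \<Omega> A \<T> Vh"

lemma subspaces: "subspace Uh" "subspace Vh" "x \<in> Uh \<Longrightarrow> x \<in> UU" "v \<in> Vh \<Longrightarrow> v \<in> VV"
  using Uh Vh by (auto simp: fin_dim_subspace_of_def)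

text \<open>Definiteness of \<open>vinner\<close>, evaluated at the difference of the two
  candidates. It resolves the definite description in \<open>trial_to_test\<close> and is the means
  of proving that operator linear.\<close>

lemma trial_to_test_unique:
  assumes "s \<in> Vh" "t \<in> Vh" "\<And>v. v \<in> Vh \<Longrightarrow> vinner s v = vinner t v"
  shows "s = t"
proof -
  have m: "(-1) *\<^sub>R t \<in> Vh" "s + (-1) *\<^sub>R t \<in> Vh"
    using subspace_scale[OF subspaces(2) assms(2)] subspace_add[OF subspaces(2) assms(1)] by blast+
  note V = subspaces(4)[OF m(2)]
  have "vinner (s + (-1) *\<^sub>R t) (s + (-1) *\<^sub>R t) = 0"
    unfolding V_inner_bilinear(1)[OF subspaces(4)[OF assms(1)] V subspaces(4)[OF m(1)]]
      V_inner_bilinear(2)[OF subspaces(4)[OF assms(2)] V] using assms(3)[OF m(2)] by simp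
  then have "s + (-1) *\<^sub>R t = 0" by (rule V_inner_bilinear(6)[OF V V])
  then show ?thesis by simp
qed

lemma trial_to_test:
  assumes w: "w \<in> Uh"
  shows "\<Theta> w \<in> Vh" "v \<in> Vh \<Longrightarrow> vinner (\<Theta> w) v = b w v"
proof -
  note wU = subspaces(3)[OF w]
  obtain B where B: "finite B" "Vh = span B" using Vh by (auto simp: fin_dim_subspace_of_def)
  have BV: "B \<subseteq> VV" using B(2) span_superset subspaces(4) by blast
  have "\<exists>t\<in>span B. \<forall>y\<in>span B. vinner t y = b w y"
    by (rule Riesz_finite_span[OF V_space_subspace _ _ _ _ _ _ B(1) BV])
      (simp_all add: V_inner_bilinear(1-3,6) b_form_linear_right[OF wU])
  then obtain t where t: "t \<in> Vh" "\<And>y. y \<in> Vh \<Longrightarrow> vinner t y = b w y" using B(2) by blast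
  have "\<Theta> w = t"
    unfolding trial_to_test_def
  proof (rule the_equality)
    show "s = t" if "s \<in> Vh \<and> (\<forall>v\<in>Vh. vinner s v = b w v)" for s
      by (rule trial_to_test_unique) (use that t in auto)
  qed (use t in blast)
  then show "\<Theta> w \<in> Vh" "v \<in> Vh \<Longrightarrow> vinner (\<Theta> w) v = b w v" using t by auto
qed

lemma trial_to_test_linear:
  assumes x: "x \<in> Uh"
  shows "y \<in> Uh \<Longrightarrow> \<Theta> (x + y) = \<Theta> x + \<Theta> y" "\<Theta> (c *\<^sub>R x) = c *\<^sub>R \<Theta> x"
proof -
  note t = trial_to_test and U = subspace_add[OF subspaces(1)] subspace_scale[OF subspaces(1)]
  note V = subspace_add[OF subspaces(2)] subspace_scale[OF subspaces(2)]
  show "\<Theta> (x + y) = \<Theta> x + \<Theta> y" if y: "y \<in> Uh"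
  proof (rule trial_to_test_unique[OF t(1)[OF U(1)[OF x y]] V(1)[OF t(1)[OF x] t(1)[OF y]]])
    fix v assume v: "v \<in> Vh"
    show "vinner (\<Theta> (x + y)) v = vinner (\<Theta> x + \<Theta> y) v"
      using x y v by (simp add: V_inner_bilinear(1) t U subspaces(3,4) b_form_linear_left(1))
  qed
  show "\<Theta> (c *\<^sub>R x) = c *\<^sub>R \<Theta> x"
  proof (rule trial_to_test_unique[OF t(1)[OF U(2)[OF x]] V(2)[OF t(1)[OF x]]])
    fix v assume v: "v \<in> Vh"
    show "vinner (\<Theta> (c *\<^sub>R x)) v = vinner (c *\<^sub>R \<Theta> x) v"
      using x v by (simp add: V_inner_bilinear(2) t U subspaces(3,4) b_form_linear_left(2))
  qed
qed

lemma fortin_rules: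
  assumes v: "v \<in> VV"
  shows "PiF v \<in> Vh" "vnorm (PiF v) \<le> C_F * vnorm v" "x \<in> Uh \<Longrightarrow> b x (PiF v) = b x v"
  using fortin v by (simp_all add: is_fortin_def)

lemma C_stab_nonneg: "0 \<le> C_stab"
  using C(1) K(1) by (simp add: C_stab_def)

text \<open>Fortin's argument: b(x, v) = b(x, PiF v) is the inner product of
  \<open>\<Theta> x\<close> with \<open>PiF v\<close>, so the functional on the full test space is
  bounded by \<open>C_F * vnorm (\<Theta> x)\<close> and the continuous stability applies.\<close>

lemma trial_to_test_stable:
  assumes x: "x \<in> Uh"
  shows "unorm x \<le> C_stab * (C_F * vnorm (\<Theta> x))"
proof (rule inf_sup[OF subspaces(3)[OF x]])
  note T = subspaces(4)[OF trial_to_test(1)[OF x]]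
  note nn = V_inner_bilinear(7)[OF T T]
  show "0 \<le> C_F * vnorm (\<Theta> x)" using C_F nn by simp
  fix v assume v: "v \<in> VV"
  note F = fortin_rules[OF v]
  have "\<bar>b x v\<bar> = \<bar>vinner (\<Theta> x) (PiF v)\<bar>" by (simp add: trial_to_test(2)[OF x F(1)] F(3)[OF x])
  also have "\<dots> \<le> vnorm (\<Theta> x) * vnorm (PiF v)" by (rule V_inner_bilinear(4)[OF T subspaces(4)[OF F(1)]])
  also have "\<dots> \<le> vnorm (\<Theta> x) * (C_F * vnorm v)" by (rule mult_left_mono[OF F(2) nn])
  finally show "\<bar>b x v\<bar> \<le> C_F * vnorm (\<Theta> x) * vnorm v" by (simp add: algebra_simps)
qed

lemma discrete_form:
  assumes x: "x \<in> Uh" and y: "y \<in> Uh"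
  shows "b x (\<Theta> y) = vinner (\<Theta> x) (\<Theta> y)"
  using trial_to_test(2)[OF x trial_to_test(1)[OF y]] by simp

lemma discrete_form_definite:
  assumes x: "x \<in> Uh" and z: "b x (\<Theta> x) = 0"
  shows "x = 0"
proof (rule U_norm_eq_0[OF subspaces(3)[OF x]])
  note T = subspaces(4)[OF trial_to_test(1)[OF x]]
  have "vnorm (\<Theta> x) = 0"
    using V_inner_bilinear(5)[OF T T] z discrete_form[OF x x] by simp
  then show "unorm x \<le> 0" using trial_to_test_stable[OF x] by simp
qed

lemma discrete_solution_unique_exists: "\<exists>!uh. is_discrete_solution \<Omega> A \<T> Uh Vh f uh"
proof -
  obtain B where B: "finite B" "Uh = span B" using Uh by (auto simp: fin_dim_subspace_of_def)
  have BU: "B \<subseteq> Uh" using B(2) span_superset by blast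
  note U = subspace_add[OF subspaces(1)] subspace_scale[OF subspaces(1)]
  note t = subspaces(4)[OF trial_to_test(1)]
  have F: "F_form f (v + w) = F_form f v + F_form f w" "F_form f (c *\<^sub>R v) = c * F_form f v" for v w c
    by (simp_all add: F_form_def split_beta inner_add_right)
  \<comment> \<open>\<open>Riesz_finite_span\<close> on the trial side, with the form b(x, \<Theta>
    y) as inner product and the load composed with \<open>\<Theta>\<close> as functional.\<close>
  have "\<exists>x\<in>span B. \<forall>y\<in>span B. b x (\<Theta> y) = F_form f (\<Theta> y)"
  proof (rule Riesz_finite_span[OF subspaces(1) _ _ _ _ _ _ B(1) BU])
    show "b x (\<Theta> y) = b y (\<Theta> x)" if "x \<in> Uh" "y \<in> Uh" for x y
      using that V_inner_bilinear(3)[OF t[OF that(1)] t[OF that(2)]] by (simp add: discrete_form)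
  qed (simp_all add: discrete_form_definite trial_to_test_linear F b_form_linear_left subspaces(3) t)
  then obtain x where x: "x \<in> Uh" "\<And>y. y \<in> Uh \<Longrightarrow> b x (\<Theta> y) = F_form f (\<Theta> y)" using B(2) by blast
  show ?thesis
  proof (rule ex1I[of _ x])
    show "is_discrete_solution \<Omega> A \<T> Uh Vh f x" using x by (simp add: is_discrete_solution_def)
    fix y assume y: "is_discrete_solution \<Omega> A \<T> Uh Vh f y"
    then have yU: "y \<in> Uh" by (simp add: is_discrete_solution_def)
    have d: "y + (-1) *\<^sub>R x \<in> Uh" by (intro U yU x)
    have "b y (\<Theta> (y + (-1) *\<^sub>R x)) = F_form f (\<Theta> (y + (-1) *\<^sub>R x))"
      using y d unfolding is_discrete_solution_def by blast
    then have "b (y + (-1) *\<^sub>R x) (\<Theta> (y + (-1) *\<^sub>R x)) = 0"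
      unfolding b_form_linear_left(1)[OF subspaces(3)[OF yU] t[OF d] subspaces(3)[OF U(2)[OF x(1)]]]
        b_form_linear_left(2)[OF subspaces(3)[OF x(1)] t[OF d]] x(2)[OF d] by simp
    from discrete_form_definite[OF d this] show "y = x" by simp
  qed
qed

text \<open>If \<open>C_F < 1\<close>, then iterating \<open>b x v = b x (PiF v)\<close> shows \<open>b x v = 0\<close>.\<close>

lemma fortin_constant_ge_1:
  assumes "Uh \<noteq> {0}" shows "1 \<le> C_F"
proof (rule ccontr)
  assume "\<not> 1 \<le> C_F"
  then have lt: "C_F < 1" by simp
  obtain x where x: "x \<in> Uh" "x \<noteq> 0" using assms subspace_0[OF subspaces(1)] by blast
  note xU = subspaces(3)[OF x(1)]
  have "\<bar>b x v\<bar> \<le> 0 * vnorm v" if v: "v \<in> VV" for v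
  proof -
    have it: "(PiF ^^ k) v \<in> VV \<and> b x ((PiF ^^ k) v) = b x v \<and> vnorm ((PiF ^^ k) v) \<le> C_F ^ k * vnorm v" for k
    proof (induction k)
      case (Suc k)
      then have k: "(PiF ^^ k) v \<in> VV" by simp
      have "vnorm (PiF ((PiF ^^ k) v)) \<le> C_F * (C_F ^ k * vnorm v)"
        using order_trans[OF fortin_rules(2)[OF k] mult_left_mono] Suc C_F by simp
      then show ?case using Suc fortin_rules(3)[OF k x(1)] subspaces(4)[OF fortin_rules(1)[OF k]] by simp
    qed (use v in simp)
    have "\<bar>b x v\<bar> \<le> (K + 4) * unorm x * (C_F ^ k * vnorm v)" for k
    proof -
      have "\<bar>b x v\<bar> \<le> (K + 4) * unorm x * vnorm ((PiF ^^ k) v)"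
        using b_form_continuous[OF xU, of "(PiF ^^ k) v"] it[of k] by simp
      also have "\<dots> \<le> (K + 4) * unorm x * (C_F ^ k * vnorm v)"
        using it[of k] K(1) by (intro mult_left_mono) (auto simp: U_norm_eq)
      finally show ?thesis .
    qed
    moreover have "(\<lambda>k. (K + 4) * unorm x * (C_F ^ k * vnorm v)) \<longlonglongrightarrow> (K + 4) * unorm x * (0 * vnorm v)"
      using C_F lt by (intro tendsto_intros LIMSEQ_realpow_zero) auto
    ultimately have "\<bar>b x v\<bar> \<le> (K + 4) * unorm x * (0 * vnorm v)"
      by (intro LIMSEQ_le_const) auto
    then show ?thesis by simp
  qed
  from inf_sup[OF xU order_refl this] U_norm_eq_0[OF xU] x(2) show False by simp
qed

text \<open>Let e be the difference between a best approximation w and the discrete solution.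
  Consistency, tested with \<open>\<Theta> e\<close>, gives |\<Theta> e|^2 = b(w - u, \<Theta> e),
  hence |\<Theta> e| \<le> (K + 4) D with D the best approximation error. Discrete stability
  converts this into a bound of e, and the triangle inequality adds D.\<close>

lemma quasi_optimality:
  assumes Uh0: "Uh \<noteq> {0}" and u: "is_solution \<Omega> A \<T> f u" and uh: "is_discrete_solution \<Omega> A \<T> Uh Vh f uh"
  shows "\<exists>w. is_arg_min (\<lambda>w. unorm (u - w)) (\<lambda>w. w \<in> Uh) w \<and>
    unorm (u - uh) \<le> (1 + C_stab * (K + 4)) * C_F * unorm (u - w)"
proof -
  have uU: "u \<in> UU" and bu: "\<And>v. v \<in> VV \<Longrightarrow> b u v = F_form f v" using u by (simp_all add: is_solution_def)
  have uhU: "uh \<in> Uh" and buh: "\<And>w. w \<in> Uh \<Longrightarrow> b uh (\<Theta> w) = F_form f (\<Theta> w)" using uh by (simp_all add: is_discrete_solution_def)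
  obtain B where B: "finite B" "Uh = span B" using Uh by (auto simp: fin_dim_subspace_of_def)
  have BU: "B \<subseteq> UU" using B(2) span_superset subspaces(3) by blast
  obtain w where w: "w \<in> Uh" "\<And>z. z \<in> Uh \<Longrightarrow> unorm (u - w) \<le> unorm (u - z)"
    using best_approximation_seminorm[OF U_space_subspace U_norm_add U_norm_scale B(1) BU uU] B(2) by blast
  note wU = subspaces(3)[OF w(1)]
  define e where "e = w - uh"
  have e: "e \<in> Uh" unfolding e_def by (rule subspace_diff[OF subspaces(1) w(1) uhU])
  note eT = subspaces(4)[OF trial_to_test(1)[OF e]]
  have d: "u - w \<in> UU" by (rule subspace_diff[OF U_space_subspace uU wU])
  define D where "D = unorm (u - w)"
  have D: "0 \<le> D" by (simp add: D_def U_norm_eq)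
  define n where "n = vnorm (\<Theta> e)"
  have diff: "b (x - y) v = b x v - b y v" if "x \<in> UU" "y \<in> UU" "v \<in> VV" for x y v
    using b_form_linear_left(1)[OF subspace_diff[OF U_space_subspace that(1,2)] that(3) that(2)] by simp
  have "n\<^sup>2 = b e (\<Theta> e)"
    using V_inner_bilinear(5)[OF eT eT] discrete_form[OF e e] by (simp add: n_def)
  also have "\<dots> = - b (u - w) (\<Theta> e)"
    \<comment> \<open>Unfolds \<open>e\<close> in the first argument of the form only, leaving
      \<open>\<Theta> e\<close> intact.\<close>
    unfolding e_def[of, THEN arg_cong[where f="\<lambda>x. b x (\<Theta> e)"]] diff[OF wU subspaces(3)[OF uhU] eT] diff[OF uU wU eT]
    using bu[OF eT] buh[OF e] by simp
  also have "\<dots> \<le> (K + 4) * D * n" using b_form_continuous[OF d eT] by (simp add: D_def n_def)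
  finally have n2: "n * n \<le> ((K + 4) * D) * n" by (simp add: power2_eq_square)
  have n0: "0 \<le> n" unfolding n_def by (rule V_inner_bilinear(7)[OF eT eT])
  have n: "n \<le> (K + 4) * D"
    using n2 n0 K(1) D by (cases "n = 0") simp_all
  have s: "u - uh = (u - w) + e" by (simp add: e_def)
  have "unorm (u - uh) \<le> D + unorm e"
    unfolding s D_def by (rule U_norm_add[OF d subspaces(3)[OF e]])
  also have "\<dots> \<le> C_F * D + C_stab * (C_F * ((K + 4) * D))"
  proof (rule add_mono)
    show "D \<le> C_F * D" using mult_right_mono[OF fortin_constant_ge_1[OF Uh0] D] by simp
    have "C_stab * (C_F * n) \<le> C_stab * (C_F * ((K + 4) * D))"
      by (intro mult_left_mono n C_stab_nonneg) (use C_F in simp)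
    then show "unorm e \<le> C_stab * (C_F * ((K + 4) * D))"
      using trial_to_test_stable[OF e] by (simp add: n_def)
  qed
  finally have "unorm (u - uh) \<le> (1 + C_stab * (K + 4)) * C_F * unorm (u - w)"
    by (simp add: D_def algebra_simps)
  moreover have "is_arg_min (\<lambda>w. unorm (u - w)) (\<lambda>w. w \<in> Uh) w"
    using w by (auto simp: is_arg_min_def not_less)
  ultimately show ?thesis by blast
qed

end

end

theorem theorem7:
  fixes \<Omega> :: "(real^'n) set" and A :: "real^'n \<Rightarrow> real^'n^'n"
  assumes "CARD('n) \<in> {2, 3}"
    and "convex_polytopal_domain \<Omega>"
    and "elliptic_coefficient \<Omega> A"
    and "cordes \<Omega> A"
  shows "\<exists>C_qopt>0. \<forall>\<T>. lipschitz_partition \<Omega> \<T> \<longrightarrow>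
    (\<forall>f\<in>L2 \<Omega>. \<forall>Uh Vh PiF C_F.
       fin_dim_subspace_of Uh (U_space \<Omega> \<T>) \<and> fin_dim_subspace_of Vh (V_space \<Omega> \<T>) \<and>
       0 < C_F \<and> is_fortin \<Omega> A \<T> Uh Vh PiF C_F \<longrightarrow>
         (\<exists>!uh. is_discrete_solution \<Omega> A \<T> Uh Vh f uh) \<and>
         (Uh \<noteq> {0} \<longrightarrow>
            (\<forall>u uh. is_solution \<Omega> A \<T> f u \<and> is_discrete_solution \<Omega> A \<T> Uh Vh f uh \<longrightarrow>
               (\<exists>w. is_arg_min (\<lambda>w. U_norm \<Omega> \<T> (u - w)) (\<lambda>w. w \<in> Uh) w \<and>
                    U_norm \<Omega> \<T> (u - uh) \<le> C_qopt * C_F * U_norm \<Omega> \<T> (u - w)))))"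
proof -
  have \<Omega>: "open \<Omega>" "bounded \<Omega>" "convex \<Omega>" "\<Omega> \<noteq> {}" using assms(2) by (simp_all add: convex_polytopal_domain_def)
  have A: "A \<in> borel_measurable (lebesgue_on \<Omega>)" using assms(3) by (simp add: elliptic_coefficient_def)
  obtain K C where K: "0 < K" "0 < C" "AE x in lebesgue. x \<in> \<Omega> \<longrightarrow> norm (A x) \<le> K"
    and C: "\<And>w. w \<in> X_space \<Omega> \<Longrightarrow> H2_norm \<Omega> w \<le> C * norm (pop (\<lambda>x D. contract \<Omega> K A x \<bullet> D) (weak_hess \<Omega> w))"
    using Hessian_estimate[OF assms(2-4)] by blast
  \<comment> \<open>This is \<open>1 + C_stab * (K + 4)\<close> written out: \<open>C_stab\<close>
    belongs to a locale that presupposes a mesh, whereas the constant must be chosen before one is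
    given.\<close>
  define C_qopt where "C_qopt = 1 + (3 * (C * (1 + K)) + 2) * (K + 4)"
  have pos: "0 < C_qopt" using K unfolding C_qopt_def by (intro add_pos_nonneg mult_nonneg_nonneg add_nonneg_nonneg) simp_all
  have cm: "cordes_mesh \<Omega> \<T> A K C" if "lipschitz_partition \<Omega> \<T>" for \<T>
    unfolding cordes_mesh_def cordes_mesh_axioms_def
    using lipschitz_partition_mesh[OF \<Omega>(1,2) that] \<Omega>(3,4) A K C by simp
  show ?thesis
  proof (rule exI[of _ C_qopt], intro conjI pos allI impI ballI)
    fix \<T> f Uh Vh PiF C_F
    assume p: "lipschitz_partition \<Omega> \<T>" and h: "fin_dim_subspace_of Uh (U_space \<Omega> \<T>) \<and> fin_dim_subspace_of Vh (V_space \<Omega> \<T>) \<and>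
       0 < C_F \<and> is_fortin \<Omega> A \<T> Uh Vh PiF C_F"
    interpret cordes_mesh \<Omega> \<T> A K C by (rule cm[OF p])
    note d = h[THEN conjunct1] h[THEN conjunct2, THEN conjunct1] h[THEN conjunct2, THEN conjunct2, THEN conjunct1] h[THEN conjunct2, THEN conjunct2, THEN conjunct2]
    show "\<exists>!uh. is_discrete_solution \<Omega> A \<T> Uh Vh f uh" by (rule discrete_solution_unique_exists[OF d])
    fix u uh
    assume "Uh \<noteq> {0}" and s: "is_solution \<Omega> A \<T> f u \<and> is_discrete_solution \<Omega> A \<T> Uh Vh f uh"
    from quasi_optimality[OF d this(1) s[THEN conjunct1] s[THEN conjunct2]]
    show "\<exists>w. is_arg_min (\<lambda>w. U_norm \<Omega> \<T> (u - w)) (\<lambda>w. w \<in> Uh) w \<and>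
       U_norm \<Omega> \<T> (u - uh) \<le> C_qopt * C_F * U_norm \<Omega> \<T> (u - w)"
      unfolding C_qopt_def C_stab_def .
  qed
qed

end
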